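(* Let $m\ge2$, let $t\mapsto x_1(t),\dots,x_m(t)$ be differentiable functions on an open interval $I$ with the $x_k(t)$ pairwise distinct, and let $\alpha_1,\dots,\alpha_m$ be fixed (independent of $t$) non-integer complex numbers. Let $W(z)=\prod_{k=1}^m(z-x_k)$, $V(z)=\frac12W(z)\sum_{k=1}^m\frac{\alpha_k}{z-x_k}$, and $w(x)=\prod_{k=1}^m (x-x_k)^{\alpha_k}$ on a $t$-dependent finite union $S=S(t)$ of arcs with endpoints among the $x_k$, such that the moments $\mu_j(t)=\int_S x^jw(x)\,dx$ exist, all Hankel determinants are nonzero for $t\in I$, the recurrence coefficients $a_n(t),b_n(t)$ are differentiable, and the deformation is isomonodromic in the sense that the constants $C_j$ in the local representations $f=f_j+C_jw$ (see context) do not depend on $t$. Then for every $n\ge1$, with $\dot{}=d/dt$, $$\frac{\dot a_n}{a_n}=\frac12\sum_{k=1}^m\frac{\big(\Theta_n(x_k)-\Theta_{n-1}(x_k)\big)\,\dot x_k}{W'(x_k)},\qquad \dot b_n=\sum_{k=1}^m\frac{\big(\Omega_{n+1}(x_k)-\Omega_n(x_k)\big)\,\dot x_k}{W'(x_k)}.$$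
   Context: For each fixed $t$: $p_n(z)=\gamma_nz^n+\cdots$ are the orthonormal polynomials for $\mathcal L(\varphi)=\int_S\varphi(x)w(x)\,dx$, with recurrence $a_{n+1}p_{n+1}(z)=(z-b_n)p_n(z)-a_np_{n-1}(z)$, $a_n=\gamma_{n-1}/\gamma_n$. $f(z)=\int_S\frac{w(x)}{z-x}dx$, and near each $x_j$ (in a slit neighbourhood) $f=f_j+C_jw$ where $f_j$ is holomorphic at $x_j$ and $C_j$ is a constant. $\varepsilon_n(z)=\int_S\frac{p_n(x)w(x)}{z-x}dx$. $\Theta_n = W(\varepsilon_n p_n' - \varepsilon_n' p_n) + 2V\varepsilon_n p_n$ and $\Omega_n = a_n W(\varepsilon_{n-1}p_n' - \varepsilon_n' p_{n-1}) + a_n V(\varepsilon_{n-1}p_n + \varepsilon_n p_{n-1})$ (primes are $d/dz$); these are polynomials in $z$ of degrees $m-2$ and $m-1$ respectively. *)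

theory Defs
  imports "HOL-Complex_Analysis.Complex_Analysis" "HOL-Computational_Algebra.Polynomial"
    "HOL-Combinatorics.Permutations"
begin

text \<open>Configuration at a fixed time: the points are given as xt :: nat => complex
  (indices k < m), S is a finite list of arcs (paths), the weight on S is w.\<close>

definition Wpoly :: "nat \<Rightarrow> (nat \<Rightarrow> complex) \<Rightarrow> complex poly" where
  "Wpoly m xt = (\<Prod>k<m. [:- xt k, 1:])"

text \<open>V(z) = 1/2 W(z) sum_k alpha_k/(z - x_k), written as the polynomial it is.\<close>
definition Vpoly :: "nat \<Rightarrow> (nat \<Rightarrow> complex) \<Rightarrow> (nat \<Rightarrow> complex) \<Rightarrow> complex poly" where
  "Vpoly m \<alpha> xt = smult (1/2) (\<Sum>k<m. smult (\<alpha> k) (\<Prod>i\<in>{..<m}-{k}. [:- xt i, 1:]))"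

definition Sset :: "(real \<Rightarrow> complex) list \<Rightarrow> complex set" where
  "Sset arcs = (\<Union>\<gamma>\<in>set arcs. path_image \<gamma>)"

definition Lfun :: "(real \<Rightarrow> complex) list \<Rightarrow> (complex \<Rightarrow> complex) \<Rightarrow> (complex \<Rightarrow> complex) \<Rightarrow> complex" where
  "Lfun arcs w \<phi> = (\<Sum>\<gamma>\<leftarrow>arcs. contour_integral \<gamma> (\<lambda>x. \<phi> x * w x))"

text \<open>Cauchy transform int_S phi(x) w(x)/(z-x) dx; f = cauchy_tr (%_. 1), eps_n = cauchy_tr p_n.\<close>
definition cauchy_tr :: "(real \<Rightarrow> complex) list \<Rightarrow> (complex \<Rightarrow> complex) \<Rightarrow> (complex \<Rightarrow> complex) \<Rightarrow> complex \<Rightarrow> complex" where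
  "cauchy_tr arcs w \<phi> z = (\<Sum>\<gamma>\<leftarrow>arcs. contour_integral \<gamma> (\<lambda>x. \<phi> x * w x / (z - x)))"

definition moment :: "(real \<Rightarrow> complex) list \<Rightarrow> (complex \<Rightarrow> complex) \<Rightarrow> nat \<Rightarrow> complex" where
  "moment arcs w j = Lfun arcs w (\<lambda>x. x ^ j)"

definition hankel_det :: "(nat \<Rightarrow> complex) \<Rightarrow> nat \<Rightarrow> complex" where
  "hankel_det \<mu> n = (\<Sum>\<pi> | \<pi> permutes {..<n}. of_int (sign \<pi>) * (\<Prod>i<n. \<mu> (i + \<pi> i)))"

definition orthonormal_family :: "(real \<Rightarrow> complex) list \<Rightarrow> (complex \<Rightarrow> complex) \<Rightarrow> (nat \<Rightarrow> complex poly) \<Rightarrow> bool" where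
  "orthonormal_family arcs w P \<longleftrightarrow>
     (\<forall>n. degree (P n) = n \<and> P n \<noteq> 0) \<and>
     (\<forall>n k. Lfun arcs w (\<lambda>x. poly (P n) x * poly (P k) x) = (if n = k then 1 else 0))"

definition acoef :: "(nat \<Rightarrow> complex poly) \<Rightarrow> nat \<Rightarrow> complex" where
  "acoef P n = lead_coeff (P (n - 1)) / lead_coeff (P n)"

definition bcoef :: "(nat \<Rightarrow> complex poly) \<Rightarrow> nat \<Rightarrow> complex" where
  "bcoef P n = (THE b. \<forall>z. acoef P (Suc n) * poly (P (Suc n)) z =
       (z - b) * poly (P n) z - (if n = 0 then 0 else acoef P n * poly (P (n - 1)) z))"

definition Theta :: "nat \<Rightarrow> (nat \<Rightarrow> complex) \<Rightarrow> (nat \<Rightarrow> complex) \<Rightarrow> (real \<Rightarrow> complex) list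
    \<Rightarrow> (complex \<Rightarrow> complex) \<Rightarrow> (nat \<Rightarrow> complex poly) \<Rightarrow> nat \<Rightarrow> complex poly" where
  "Theta m \<alpha> xt arcs w P n = (THE Q. \<forall>z. z \<notin> Sset arcs \<longrightarrow> poly Q z =
      poly (Wpoly m xt) z * (cauchy_tr arcs w (poly (P n)) z * poly (pderiv (P n)) z
                              - deriv (cauchy_tr arcs w (poly (P n))) z * poly (P n) z)
      + 2 * poly (Vpoly m \<alpha> xt) z * cauchy_tr arcs w (poly (P n)) z * poly (P n) z)"

definition Omega :: "nat \<Rightarrow> (nat \<Rightarrow> complex) \<Rightarrow> (nat \<Rightarrow> complex) \<Rightarrow> (real \<Rightarrow> complex) list
    \<Rightarrow> (complex \<Rightarrow> complex) \<Rightarrow> (nat \<Rightarrow> complex poly) \<Rightarrow> nat \<Rightarrow> complex poly" where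
  "Omega m \<alpha> xt arcs w P n = (THE Q. \<forall>z. z \<notin> Sset arcs \<longrightarrow> poly Q z =
      acoef P n * poly (Wpoly m xt) z *
         (cauchy_tr arcs w (poly (P (n - 1))) z * poly (pderiv (P n)) z
          - deriv (cauchy_tr arcs w (poly (P n))) z * poly (P (n - 1)) z)
      + acoef P n * poly (Vpoly m \<alpha> xt) z *
         (cauchy_tr arcs w (poly (P (n - 1))) z * poly (P n) z
          + cauchy_tr arcs w (poly (P n)) z * poly (P (n - 1)) z))"

text \<open>h is a branch of prod_k (z - x_k)^(alpha_k) on the set D: there are continuous
  logarithms L_k of z - x_k on D with h = prod_k exp (alpha_k L_k).\<close>
definition is_branch :: "nat \<Rightarrow> (nat \<Rightarrow> complex) \<Rightarrow> (nat \<Rightarrow> complex) \<Rightarrow> complex set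
    \<Rightarrow> (complex \<Rightarrow> complex) \<Rightarrow> bool" where
  "is_branch m \<alpha> xt D h \<longleftrightarrow> (\<exists>L :: nat \<Rightarrow> complex \<Rightarrow> complex.
      (\<forall>k<m. continuous_on D (L k) \<and> (\<forall>z\<in>D. exp (L k z) = z - xt k)) \<and>
      (\<forall>z\<in>D. h z = (\<Prod>k<m. exp (\<alpha> k * L k z))))"

definition slit_nbhd :: "complex \<Rightarrow> real \<Rightarrow> real \<Rightarrow> complex set \<Rightarrow> complex set" where
  "slit_nbhd c r \<theta> S = ball c r - S - {c + of_real s * cis \<theta> | s. s \<ge> 0}"

end

theory Submission
  imports Defs
begin

text \<open>Let \<open>L\<close> be the functional divided by its value at 1, and \<open>v\<^sub>k\<close> the velocity of \<open>x\<^sub>k\<close>. Everything follows from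
  the formula for the derivative \<open>L'\<close> of \<open>L\<close> with respect to the parameter,
  \<open>L' \<phi> = \<lambda> L \<phi> - \<Sum> \<alpha>\<^sub>k v\<^sub>k L((\<phi> - \<phi>(x\<^sub>k)) / (z - x\<^sub>k)) + \<Sum> \<phi>(x\<^sub>k) v\<^sub>k u\<^sub>k / W'(x\<^sub>k)\<close>,
  applied to products of orthogonal polynomials.
  Differentiating the Pearson relation \<open>L((W \<phi>)' + 2V \<phi>) = 0\<close> gives this formula for those \<open>\<phi>\<close>; because the
  exponents are not integers, it remains to know it on the multiples of a high power of \<open>W\<close>. There the weight
  \<open>W\<^sup>N w\<close> vanishes at the end points, and deforming the arcs to the segments from a generic base point \<open>b\<close> to
  the \<open>x\<^sub>k\<close> gives \<open>L(W\<^sup>N p) = \<sigma> \<Sum> A\<^sub>k I\<^sub>k(p)\<close> with base integrals \<open>I\<^sub>k\<close> that are linearly independent and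
  differentiable in the points. The coefficients \<open>A\<^sub>k\<close> lie in a countable set of sums of phases, whereas their
  ratios are continuous in the parameter, so the ratios are locally constant; differentiating under the
  integral sign finishes the proof.\<close>

subsection \<open>Linear functionals on polynomials\<close>

text \<open>The lists \<open>arcs t\<close> and the weights \<open>w t\<close> are given separately
  for each parameter, and no continuity in t is assumed for them, so their integrals cannot be
  differentiated directly. Regularity in t enters through the points and the recurrence
  coefficients. The latter determine the functional only up to a constant factor; this is why it is
  divided by its value at 1 and why an undetermined multiplier \<open>lam\<close> travels through
  the proof until it cancels in a quotient of two norms. A second obstacle is convergence: a valid
  path may have unbounded speed near finitely many parameters and may spiral into its end point, so
  the moments are gauge integrals that need not converge absolutely. Estimates along the arcs are
  therefore made on explicit primitives, of the form (z - p)^(1+beta) times a holomorphic function,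
  and not on the modulus of the integrand. Positive real parts of the raised exponents alpha_k + N
  make the base integrals converge, and the one extra factor W in \<open>Wpoly m x ^ Suc N\<close>
  clears the poles 1/(z - x_l) that differentiating the weight creates.\<close>

definition plin :: "(complex poly \<Rightarrow> complex) \<Rightarrow> bool" where
  "plin F \<longleftrightarrow> (\<forall>p q. F (p + q) = F p + F q) \<and> (\<forall>c p. F (smult c p) = c * F p)"

lemma plin_add: "plin F \<Longrightarrow> F (p + q) = F p + F q"
  and plin_smult: "plin F \<Longrightarrow> F (smult c p) = c * F p"
  by (auto simp: plin_def)

lemma plin_0: "plin F \<Longrightarrow> F 0 = 0"
  using plin_smult[of F 0 0] by simp

lemma plin_minus: "plin F \<Longrightarrow> F (- p) = - F p"
  using plin_smult[of F "-1" p] by simp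

lemma plin_diff: "plin F \<Longrightarrow> F (p - q) = F p - F q"
  using plin_add[of F p "- q"] plin_minus[of F q] by simp

lemma plin_sum: "plin F \<Longrightarrow> F (\<Sum>i\<in>A. f i) = (\<Sum>i\<in>A. F (f i))"
  by (induction A rule: infinite_finite_induct) (auto simp: plin_0 plin_add)

lemmas plin_simps = plin_add plin_smult plin_0 plin_minus plin_diff plin_sum

lemma plinI:
  assumes "\<And>p q. F (p + q) = F p + F q" and "\<And>c p. F (smult c p) = c * F p"
  shows "plin F"
  using assms by (auto simp: plin_def)

lemma plin_monom_expand:
  assumes "plin F" "degree p \<le> d"
  shows "F p = (\<Sum>j\<le>d. coeff p j * F (monom 1 j))"
proof -
  have "p = (\<Sum>j\<le>d. monom (coeff p j) j)"
    by (rule poly_as_sum_of_monoms'[OF assms(2), symmetric])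
  also have "\<dots> = (\<Sum>j\<le>d. smult (coeff p j) (monom 1 j))"
    by (simp add: smult_monom)
  finally have "F p = F (\<Sum>j\<le>d. smult (coeff p j) (monom 1 j))" by simp
  thus ?thesis using assms(1) by (simp add: plin_simps)
qed

section \<open>Difference quotients (p - p(c)) / (z - c) of polynomials\<close>

lemma synthetic_div_eqI:
  fixes p :: "'a::comm_ring_1 poly"
  assumes "p = [:- c, 1:] * q + [:r:]"
  shows "synthetic_div p c = q"
proof -
  have "p + smult c q = pCons r q" using assms by (simp add: algebra_simps)
  thus ?thesis using synthetic_div_unique by metis
qed

lemma synthetic_div_add: "synthetic_div (p + q) c = synthetic_div p c + synthetic_div q (c::'a::comm_ring_1)"
proof (rule synthetic_div_eqI[where r = "poly p c + poly q c"])
  have "p + q = ([:-c, 1:] * synthetic_div p c + [:poly p c:]) + ([:-c, 1:] * synthetic_div q c + [:poly q c:])"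
    by (simp only: synthetic_div_correct')
  thus "p + q = [:-c, 1:] * (synthetic_div p c + synthetic_div q c) + [:poly p c + poly q c:]"
    by (simp add: algebra_simps)
qed

lemma synthetic_div_smult: "synthetic_div (smult a p) c = smult a (synthetic_div p (c::'a::comm_ring_1))"
proof (rule synthetic_div_eqI[where r = "a * poly p c"])
  have "smult a p = smult a ([:-c, 1:] * synthetic_div p c + [:poly p c:])"
    by (simp only: synthetic_div_correct')
  also have "\<dots> = [:-c, 1:] * smult a (synthetic_div p c) + [:a * poly p c:]"
    by (simp add: smult_add_right del: mult_pCons_left)
  finally show "smult a p = [:-c, 1:] * smult a (synthetic_div p c) + [:a * poly p c:]" .
qed

text \<open>Leibniz rule for difference quotients. Only one factor is frozen at c; choosing which
  one decides later which orthogonality relation removes the other term.\<close>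

lemma synthetic_div_mult:
  "synthetic_div (p * q) c = synthetic_div p c * q + smult (poly p c) (synthetic_div q (c::'a::comm_ring_1))"
proof (rule synthetic_div_eqI[where r = "poly p c * poly q c"])
  have q: "[:poly p c:] * q = [:poly p c:] * ([:-c, 1:] * synthetic_div q c + [:poly q c:])"
    by (simp only: synthetic_div_correct')
  have "p * q = ([:-c, 1:] * synthetic_div p c + [:poly p c:]) * q"
    by (simp only: synthetic_div_correct')
  also have "\<dots> = [:-c, 1:] * synthetic_div p c * q + [:poly p c:] * q" by (simp only: distrib_right)
  also have "\<dots> = [:-c, 1:] * synthetic_div p c * q + [:poly p c:] * ([:-c, 1:] * synthetic_div q c + [:poly q c:])"
    by (simp only: q)
  also have "\<dots> = [:-c, 1:] * (synthetic_div p c * q + [:poly p c:] * (synthetic_div q c)) + [:poly p c:] * [:poly q c:]"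
    by (simp only: algebra_simps)
  finally show "p * q = [:-c, 1:] * (synthetic_div p c * q + smult (poly p c) (synthetic_div q c)) + [:poly p c * poly q c:]"
    by simp
qed

lemma synthetic_div_linear_mult [simp]:
  "synthetic_div ([:- c, 1:] * p) (c::'a::comm_ring_1) = p"
  by (rule synthetic_div_eqI[where r = 0]) simp

lemma synthetic_div_diff: "synthetic_div (p - q) c = synthetic_div p c - synthetic_div q (c::'a::comm_ring_1)"
  using synthetic_div_add[of "p - q" q c] by simp

lemma synthetic_div_sum: "synthetic_div (\<Sum>i\<in>A. f i) c = (\<Sum>i\<in>A. synthetic_div (f i) (c::'a::comm_ring_1))"
  by (induction A rule: infinite_finite_induct) (auto simp: synthetic_div_add)

lemmas sdiv_simps = synthetic_div_add synthetic_div_smult synthetic_div_diff synthetic_div_sum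

section \<open>The polynomials W and 2V, and interpolation at the points\<close>

definition Wdel :: "nat \<Rightarrow> (nat \<Rightarrow> complex) \<Rightarrow> nat \<Rightarrow> complex poly" where
  "Wdel m x k = (\<Prod>i\<in>{..<m}-{k}. [:- x i, 1:])"

text \<open>This is 2V, so that w'/w = 2V/W. The factor 1/2 of \<open>Vpoly\<close> is dropped
  because the Pearson relation involves 2V.\<close>

definition V2poly :: "nat \<Rightarrow> (nat \<Rightarrow> complex) \<Rightarrow> (nat \<Rightarrow> complex) \<Rightarrow> complex poly" where
  "V2poly m \<alpha> x = (\<Sum>k<m. smult (\<alpha> k) (Wdel m x k))"

lemma Vpoly_V2poly: "2 * poly (Vpoly m \<alpha> x) z = poly (V2poly m \<alpha> x) z"
  by (simp add: Vpoly_def V2poly_def Wdel_def)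

lemma Wpoly_Wdel: "k < m \<Longrightarrow> Wpoly m x = [:- x k, 1:] * Wdel m x k"
  unfolding Wpoly_def Wdel_def by (subst prod.remove[of _ k]) auto

lemma pderiv_Wpoly: "pderiv (Wpoly m x) = (\<Sum>k<m. Wdel m x k)"
  unfolding Wpoly_def Wdel_def pderiv_prod by (simp add: pderiv_pCons)

lemma poly_Wdel: "poly (Wdel m x k) z = (\<Prod>i\<in>{..<m}-{k}. z - x i)"
  by (simp add: Wdel_def poly_prod)

lemma poly_Wpoly: "poly (Wpoly m x) z = (\<Prod>i<m. z - x i)"
  by (simp add: Wpoly_def poly_prod)

lemma poly_Wpoly_root: "k < m \<Longrightarrow> poly (Wpoly m x) (x k) = 0"
  by (simp add: Wpoly_Wdel)

lemma poly_Wdel_other: "l < m \<Longrightarrow> l \<noteq> k \<Longrightarrow> poly (Wdel m x k) (x l) = 0"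
  unfolding poly_Wdel by (rule prod_zero) auto

lemma poly_Wdel_self:
  "inj_on x {..<m} \<Longrightarrow> k < m \<Longrightarrow> poly (Wdel m x k) (x k) \<noteq> 0"
  unfolding poly_Wdel by (auto simp: inj_on_def)

lemma sum_Wdel_at:
  assumes "k < m" shows "(\<Sum>l<m. c l * poly (Wdel m x l) (x k)) = c k * poly (Wdel m x k) (x k)"
proof -
  have "(\<Sum>l<m. c l * poly (Wdel m x l) (x k)) = (\<Sum>l\<in>{k}. c l * poly (Wdel m x l) (x k))"
    by (rule sum.mono_neutral_right) (use assms poly_Wdel_other in auto)
  thus ?thesis by simp
qed

lemma poly_V2poly_at: "k < m \<Longrightarrow> poly (V2poly m \<alpha> x) (x k) = \<alpha> k * poly (Wdel m x k) (x k)"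
  using sum_Wdel_at[of k m \<alpha> x] by (simp add: V2poly_def poly_sum)

lemma poly_pderiv_Wpoly_at: "k < m \<Longrightarrow> poly (pderiv (Wpoly m x)) (x k) = poly (Wdel m x k) (x k)"
  using sum_Wdel_at[of k m "\<lambda>_. 1" x] by (simp add: pderiv_Wpoly poly_sum)

lemma Wpoly_Suc: "Wpoly (Suc m) x = Wpoly m x * [:- x m, 1:]"
  by (simp add: Wpoly_def mult.commute)

lemma Wpoly_dvd:
  assumes "inj_on x {..<m}" "\<And>k. k < m \<Longrightarrow> poly p (x k) = 0"
  shows "Wpoly m x dvd p"
  using assms
proof (induction m)
  case 0
  then show ?case by (simp add: Wpoly_def)
next
  case (Suc m)
  have "inj_on x {..<m}" using Suc.prems(1) by (rule inj_on_subset) auto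
  then obtain q where q: "p = Wpoly m x * q" using Suc by (auto elim: dvdE)
  have "poly (Wpoly m x) (x m) \<noteq> 0"
    using inj_onD[OF Suc.prems(1)] by (force simp: poly_Wpoly)
  moreover have "poly p (x m) = 0" using Suc.prems(2) by simp
  ultimately have "poly q (x m) = 0" using q by simp
  hence "[:- x m, 1:] dvd q" by (simp add: poly_eq_0_iff_dvd)
  then show ?case unfolding Wpoly_Suc q by (rule mult_dvd_mono[OF dvd_refl])
qed

text \<open>Q is invertible modulo W because it has no zero among the simple roots of W;
  \<open>q\<close> is the Lagrange interpolation polynomial of the quotient of values.\<close>

lemma interpolate_mod_Wpoly:
  assumes x: "inj_on x {..<m}" and Q: "\<And>k. k < m \<Longrightarrow> poly Q (x k) \<noteq> 0"
  obtains q r where "\<psi> = Q * q + Wpoly m x * r"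
proof -
  define q where "q = (\<Sum>k<m. smult (poly \<psi> (x k) / (poly Q (x k) * poly (Wdel m x k) (x k))) (Wdel m x k))"
  have "poly q (x k) = poly \<psi> (x k) / poly Q (x k)" if "k < m" for k
    using sum_Wdel_at[OF that, of "\<lambda>k. poly \<psi> (x k) / (poly Q (x k) * poly (Wdel m x k) (x k))" x]
      poly_Wdel_self[OF x that] Q[OF that] by (simp add: q_def poly_sum)
  hence "poly (\<psi> - Q * q) (x k) = 0" if "k < m" for k using that Q by simp
  hence "Wpoly m x dvd \<psi> - Q * q" by (intro Wpoly_dvd x)
  then obtain r where "\<psi> - Q * q = Wpoly m x * r" by (elim dvdE)
  hence "\<psi> = Q * q + Wpoly m x * r" by (simp add: algebra_simps)
  thus ?thesis by (rule that)
qed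

text \<open>Equals (W phi w)' / w, because w'/w = 2V/W. Integrated against w it gives the boundary
  values of W phi w, which is the source of the Pearson relation.\<close>

definition Dstar :: "nat \<Rightarrow> (nat \<Rightarrow> complex) \<Rightarrow> (nat \<Rightarrow> complex) \<Rightarrow> complex poly \<Rightarrow> complex poly" where
  "Dstar m \<alpha> x \<phi> = pderiv (Wpoly m x * \<phi>) + V2poly m \<alpha> x * \<phi>"

lemma pderiv_linear_mult: "pderiv ([:- c, 1:] * p) = p + [:- c, 1:] * pderiv (p::'a::idom poly)"
proof -
  have "pderiv [:- c, 1:] = 1" by (simp add: pderiv_pCons)
  thus ?thesis by (simp add: pderiv_mult del: mult_pCons_left)
qed

lemma poly_pderiv_Wpoly_mult_at:
  "k < m \<Longrightarrow> poly (pderiv (Wpoly m x * \<phi>)) (x k) = poly (Wdel m x k) (x k) * poly \<phi> (x k)"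
  unfolding pderiv_mult by (simp add: poly_pderiv_Wpoly_at poly_Wpoly_root)

lemma poly_Dstar_at:
  "k < m \<Longrightarrow> poly (Dstar m \<alpha> x \<phi>) (x k) = (1 + \<alpha> k) * poly (Wdel m x k) (x k) * poly \<phi> (x k)"
  by (simp only: Dstar_def poly_add poly_mult poly_pderiv_Wpoly_mult_at poly_V2poly_at) (simp add: algebra_simps)

lemma Dstar_power_mult:
  "Dstar m \<alpha> x (Wpoly m x ^ i * \<psi>) =
     Wpoly m x ^ Suc i * pderiv \<psi> + Wpoly m x ^ i * ((smult (of_nat (Suc i)) (pderiv (Wpoly m x)) + V2poly m \<alpha> x) * \<psi>)"
proof -
  have "Wpoly m x * (Wpoly m x ^ i * \<psi>) = Wpoly m x ^ Suc i * \<psi>" by simp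
  thus ?thesis unfolding Dstar_def
    by (simp only: pderiv_mult pderiv_power_Suc) (simp add: algebra_simps)
qed

text \<open>Descent on the power of W. Since Dstar (W^i q) = W^(i+1) q' + W^i Q q with Q = (i+1) W'
  + 2V, a functional that vanishes on multiples of W^(i+1) also vanishes on W^i Q q. At x_k the
  value of Q is (i+1+alpha_k) W'(x_k), nonzero because alpha_k is not an integer, so modulo W every
  polynomial is a multiple of Q.\<close>

lemma functional_zero_descent:
  assumes E: "plin E" and x: "inj_on x {..<m}" and \<alpha>: "\<And>k. k < m \<Longrightarrow> \<alpha> k \<notin> \<int>"
    and D: "\<And>\<phi>. E (Dstar m \<alpha> x \<phi>) = 0"
    and N: "\<And>\<psi>. E (Wpoly m x ^ N * \<psi>) = 0"
  shows "E \<phi> = 0"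
proof -
  have "\<forall>\<psi>. E (Wpoly m x ^ N * \<psi>) = 0 \<Longrightarrow> \<forall>\<psi>. E (Wpoly m x ^ 0 * \<psi>) = 0" for N
  proof (induction N)
    case (Suc i)
    define Q where "Q = smult (of_nat (Suc i)) (pderiv (Wpoly m x)) + V2poly m \<alpha> x"
    have Q0: "poly Q (x k) \<noteq> 0" if "k < m" for k
    proof -
      have "poly Q (x k) = (of_nat (Suc i) + \<alpha> k) * poly (Wdel m x k) (x k)"
        using that by (simp add: Q_def poly_pderiv_Wpoly_at poly_V2poly_at algebra_simps)
      moreover have "of_nat (Suc i) + \<alpha> k \<noteq> 0"
      proof
        assume "of_nat (Suc i) + \<alpha> k = 0"
        hence "\<alpha> k = - of_nat (Suc i)" by (metis add_eq_0_iff)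
        hence "\<alpha> k \<in> \<int>" by simp
        thus False using \<alpha>[OF that] by simp
      qed
      ultimately show ?thesis using poly_Wdel_self[OF x that] by simp
    qed
    have "E (Wpoly m x ^ i * \<psi>) = 0" for \<psi>
    proof -
      obtain q r where qr: "\<psi> = Q * q + Wpoly m x * r"
        using interpolate_mod_Wpoly[OF x Q0] by blast
      have "E (Wpoly m x ^ Suc i * pderiv q) + E (Wpoly m x ^ i * (Q * q)) = 0"
        using D[of "Wpoly m x ^ i * q"] E unfolding Dstar_power_mult Q_def by (simp only: plin_add)
      hence "E (Wpoly m x ^ i * (Q * q)) = 0" using Suc.prems by simp
      moreover have "E (Wpoly m x ^ i * (Wpoly m x * r)) = 0"
      proof -
        have "Wpoly m x ^ i * (Wpoly m x * r) = Wpoly m x ^ Suc i * r" by (simp add: algebra_simps)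
        thus ?thesis using Suc.prems by metis
      qed
      ultimately show ?thesis unfolding qr distrib_left plin_add[OF E] by simp
    qed
    thus ?case using Suc.IH by blast
  qed simp
  from this[of N] N show ?thesis by simp
qed

text \<open>The value at x_k of the polynomial 2V f - W f', where f is the Cauchy transform of the
  weight. This form refers only to the functional and so makes sense before any integral
  appears.\<close>

definition ucoef :: "nat \<Rightarrow> (nat \<Rightarrow> complex) \<Rightarrow> (nat \<Rightarrow> complex) \<Rightarrow> (complex poly \<Rightarrow> complex) \<Rightarrow> nat \<Rightarrow> complex" where
  "ucoef m \<alpha> x L k = L (synthetic_div (V2poly m \<alpha> x) (x k) + pderiv (Wdel m x k))"

text \<open>The first two terms are minus the derivative of \<open>Dstar m \<alpha> x \<phi>\<close>
  with respect to x_k. Correcting them by alpha_k times a difference quotient gives an element of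
  the image of Dstar plus phi(x_k) times one fixed polynomial. A functional obeying the Pearson
  relation sees only the latter, which is where \<open>ucoef\<close> comes from.\<close>

lemma Dstar_synthetic:
  fixes \<alpha> x :: "nat \<Rightarrow> complex"
  assumes k: "k < m"
  defines "a \<equiv> \<alpha> k" and "Wk \<equiv> Wdel m x k" and "c \<equiv> x k"
  shows "pderiv (Wk * \<phi>) + synthetic_div (V2poly m \<alpha> x - smult a Wk) c * \<phi>
           + smult a (synthetic_div (Dstar m \<alpha> x \<phi>) c)
       = smult (1 + a) (Dstar m \<alpha> x (synthetic_div \<phi> c)
           + smult (poly \<phi> c) (synthetic_div (V2poly m \<alpha> x) c + pderiv Wk))"
proof -
  define g where "g = synthetic_div \<phi> c"
  define f where "f = poly \<phi> c"
  define W where "W = Wpoly m x"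
  define V where "V = V2poly m \<alpha> x"
  have W: "W = [:-c, 1:] * Wk" using Wpoly_Wdel[OF k, of x] by (simp add: W_def c_def Wk_def)
  have \<phi>: "\<phi> = [:-c, 1:] * g + [:f:]" by (simp add: g_def f_def synthetic_div_correct' del: mult_pCons_left)
  have V: "poly V c = a * poly Wk c" using poly_V2poly_at[OF k] by (simp add: V_def a_def Wk_def c_def)
  have Vd: "[:-c, 1:] * synthetic_div V c = V - [:poly V c:]"
    using synthetic_div_correct'[of c V] by (simp add: algebra_simps del: mult_pCons_left)
  have Wkd: "[:-c, 1:] * synthetic_div Wk c = Wk - [:poly Wk c:]"
    using synthetic_div_correct'[of c Wk] by (simp add: algebra_simps del: mult_pCons_left)
  have Wg: "Wk * \<phi> = W * g + smult f Wk" unfolding W \<phi> by (simp add: algebra_simps)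
  have 1: "pderiv (Wk * \<phi>) = pderiv (W * g) + smult f (pderiv Wk)"
    unfolding Wg by (simp only: pderiv_add pderiv_smult)
  have 2: "synthetic_div (Wk * \<phi>) c = Wk * g + smult f (synthetic_div Wk c)"
  proof -
    have "synthetic_div (Wk * \<phi>) c = synthetic_div (\<phi> * Wk) c" by (simp only: mult.commute)
    also have "\<dots> = g * Wk + smult f (synthetic_div Wk c)" by (simp only: synthetic_div_mult g_def f_def)
    finally show ?thesis by (simp only: mult.commute)
  qed
  have 3: "synthetic_div (V * \<phi>) c = V * g + smult f (synthetic_div V c)"
  proof -
    have "synthetic_div (V * \<phi>) c = synthetic_div (\<phi> * V) c" by (simp only: mult.commute)
    also have "\<dots> = g * V + smult f (synthetic_div V c)" by (simp only: synthetic_div_mult g_def f_def)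
    finally show ?thesis by (simp only: mult.commute)
  qed
  have 4: "synthetic_div (pderiv (W * \<phi>)) c = synthetic_div (Wk * \<phi>) c + pderiv (Wk * \<phi>)"
  proof -
    have "W * \<phi> = [:-c, 1:] * (Wk * \<phi>)" unfolding W by (simp only: mult.assoc)
    hence "pderiv (W * \<phi>) = Wk * \<phi> + [:-c, 1:] * pderiv (Wk * \<phi>)" by (simp only: pderiv_linear_mult)
    thus ?thesis by (simp only: synthetic_div_add synthetic_div_linear_mult)
  qed
  \<comment> \<open>Each division by z - c leaves a constant, V(c) and a Wk(c). These are equal, so
    they cancel and only V g - a Wk g remains.\<close>
  have 5: "synthetic_div (V - smult a Wk) c * \<phi> = smult f (synthetic_div V c - smult a (synthetic_div Wk c)) + V * g - smult a (Wk * g)"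
  proof -
    define X where "X = [:-c, 1:]"
    have "synthetic_div (V - smult a Wk) c * \<phi> = (synthetic_div V c - smult a (synthetic_div Wk c)) * (X * g + [:f:])"
      using \<phi> unfolding X_def by (simp only: sdiv_simps)
    also have "\<dots> = (X * synthetic_div V c) * g - smult a ((X * synthetic_div Wk c) * g)
        + smult f (synthetic_div V c - smult a (synthetic_div Wk c))"
      by (simp add: algebra_simps smult_diff_right)
    also have "\<dots> = smult f (synthetic_div V c - smult a (synthetic_div Wk c)) + V * g - smult a (Wk * g)"
      unfolding X_def Vd Wkd by (simp add: V algebra_simps smult_diff_right)
    finally show ?thesis .
  qed
  have "?thesis \<longleftrightarrow> pderiv (Wk * \<phi>) + synthetic_div (V - smult a Wk) c * \<phi>
           + smult a (synthetic_div (pderiv (W * \<phi>) + V * \<phi>) c)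
       = smult (1 + a) (pderiv (W * g) + V * g
           + smult f (synthetic_div V c + pderiv Wk))"
    by (simp add: Dstar_def W_def V_def g_def f_def)
  moreover have "\<dots>" unfolding 5 synthetic_div_add 4 2 3 1
    by (simp add: algebra_simps smult_add_right smult_add_left smult_diff_right)
  ultimately show ?thesis by blast
qed

text \<open>The difference of the two sides annihilates the image of \<open>Dstar\<close> and all multiples of \<open>W\<^bsup>N+1\<^esup>\<close>,
  so it vanishes by the descent above.\<close>

lemma deformation_functional:
  assumes L: "plin L" and Ld: "plin Ld" and x: "inj_on x {..<m}" and \<alpha>: "\<And>k. k < m \<Longrightarrow> \<alpha> k \<notin> \<int>"
    and D: "\<And>\<phi>. L (Dstar m \<alpha> x \<phi>) = 0"
    and Dd: "\<And>\<phi>. Ld (Dstar m \<alpha> x \<phi>) =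
        (\<Sum>k<m. v k * L (pderiv (Wdel m x k * \<phi>) + synthetic_div (V2poly m \<alpha> x - smult (\<alpha> k) (Wdel m x k)) (x k) * \<phi>))"
    and N: "\<And>\<psi>. Ld (Wpoly m x ^ Suc N * \<psi>) =
        lam * L (Wpoly m x ^ Suc N * \<psi>) - L (Wpoly m x ^ N * \<psi> * (\<Sum>k<m. smult (\<alpha> k * v k) (Wdel m x k)))"
  shows "Ld \<phi> = lam * L \<phi> - (\<Sum>k<m. \<alpha> k * v k * L (synthetic_div \<phi> (x k)))
     + (\<Sum>k<m. poly \<phi> (x k) * (v k * ucoef m \<alpha> x L k / poly (Wdel m x k) (x k)))"
proof -
  define E where "E \<phi> = Ld \<phi> - lam * L \<phi> + (\<Sum>k<m. \<alpha> k * v k * L (synthetic_div \<phi> (x k)))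
     - (\<Sum>k<m. poly \<phi> (x k) * (v k * ucoef m \<alpha> x L k / poly (Wdel m x k) (x k)))" for \<phi>
  have E: "plin E"
  proof (rule plinI)
    show "E (p + q) = E p + E q" for p q
      by (simp add: E_def plin_simps[OF L] plin_simps[OF Ld] sdiv_simps sum.distrib add_divide_distrib algebra_simps)
    show "E (smult c p) = c * E p" for c p
      by (simp add: E_def plin_simps[OF L] plin_simps[OF Ld] sdiv_simps sum_distrib_left algebra_simps)
  qed
  have ED: "E (Dstar m \<alpha> x \<phi>) = 0" for \<phi>
  proof -
    have "v k * L (pderiv (Wdel m x k * \<phi>) + synthetic_div (V2poly m \<alpha> x - smult (\<alpha> k) (Wdel m x k)) (x k) * \<phi>)
          + \<alpha> k * v k * L (synthetic_div (Dstar m \<alpha> x \<phi>) (x k))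
        = poly (Dstar m \<alpha> x \<phi>) (x k) * (v k * ucoef m \<alpha> x L k / poly (Wdel m x k) (x k))"
      (is "?lhs = ?rhs") if k: "k < m" for k
    proof -
      have "?lhs = v k * L (pderiv (Wdel m x k * \<phi>) + synthetic_div (V2poly m \<alpha> x - smult (\<alpha> k) (Wdel m x k)) (x k) * \<phi>
           + smult (\<alpha> k) (synthetic_div (Dstar m \<alpha> x \<phi>) (x k)))"
        by (simp add: plin_simps[OF L] algebra_simps)
      also have "\<dots> = v k * ((1 + \<alpha> k) * (poly \<phi> (x k) * ucoef m \<alpha> x L k))"
        unfolding Dstar_synthetic[OF k] ucoef_def
        by (simp only: plin_smult[OF L] plin_add[OF L, of "Dstar m \<alpha> x (synthetic_div \<phi> (x k))"] D add_0)
      also have "\<dots> = ?rhs" using poly_Wdel_self[OF x k] by (simp add: poly_Dstar_at[OF k])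
      finally show ?thesis .
    qed
    hence "(\<Sum>k<m. v k * L (pderiv (Wdel m x k * \<phi>) + synthetic_div (V2poly m \<alpha> x - smult (\<alpha> k) (Wdel m x k)) (x k) * \<phi>))
          + (\<Sum>k<m. \<alpha> k * v k * L (synthetic_div (Dstar m \<alpha> x \<phi>) (x k)))
        = (\<Sum>k<m. poly (Dstar m \<alpha> x \<phi>) (x k) * (v k * ucoef m \<alpha> x L k / poly (Wdel m x k) (x k)))"
      unfolding sum.distrib[symmetric] by (intro sum.cong) auto
    thus ?thesis unfolding E_def D Dd by simp
  qed
  \<comment> \<open>On multiples of W^(N+1) the terms phi(x_k) vanish, and the difference quotient
    at x_k simply replaces one factor W by W/(z - x_k).\<close>
  have EN: "E (Wpoly m x ^ Suc N * \<psi>) = 0" for \<psi>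
  proof -
    have "synthetic_div (Wpoly m x ^ Suc N * \<psi>) (x k) = Wpoly m x ^ N * \<psi> * Wdel m x k" if k: "k < m" for k
    proof -
      have "Wpoly m x ^ Suc N * \<psi> = [:- x k, 1:] * (Wpoly m x ^ N * \<psi> * Wdel m x k)"
        by (subst power_Suc, subst Wpoly_Wdel[OF k]) (simp only: ac_simps)
      thus ?thesis by (simp only: synthetic_div_linear_mult)
    qed
    hence "(\<Sum>k<m. \<alpha> k * v k * L (synthetic_div (Wpoly m x ^ Suc N * \<psi>) (x k)))
        = L (Wpoly m x ^ N * \<psi> * (\<Sum>k<m. smult (\<alpha> k * v k) (Wdel m x k)))"
      by (simp add: sum_distrib_left plin_simps[OF L])
    thus ?thesis unfolding E_def N by (simp add: poly_Wpoly_root)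
  qed
  have "E \<phi> = 0" by (rule functional_zero_descent[OF E x \<alpha> ED EN])
  thus ?thesis by (simp add: E_def algebra_simps)
qed

subsection \<open>Orthonormal polynomials and the recurrence coefficients\<close>

text \<open>Orthonormality for an abstract linear functional. The arcs enter only when the
  functional is instantiated, so the recurrence and Toda equations are proved without
  integrals.\<close>

definition ofam :: "(complex poly \<Rightarrow> complex) \<Rightarrow> (nat \<Rightarrow> complex poly) \<Rightarrow> bool" where
  "ofam L P \<longleftrightarrow> plin L \<and> (\<forall>n. degree (P n) = n \<and> P n \<noteq> 0) \<and> (\<forall>n k. L (P n * P k) = (if n = k then 1 else 0))"

lemma ofamD:
  assumes "ofam L P"
  shows "plin L" "degree (P n) = n" "P n \<noteq> 0" "L (P n * P n) = 1" "n \<noteq> k \<Longrightarrow> L (P n * P k) = 0"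
    "coeff (P n) n \<noteq> 0"
  using assms leading_coeff_0_iff[of "P n"] by (auto simp: ofam_def)

lemma poly_top_split:
  fixes P :: "'a::field poly"
  assumes "degree P = n" "P \<noteq> 0" "degree q \<le> n"
  obtains r where "q = smult (coeff q n / coeff P n) P + r" "\<And>j. n \<le> j \<Longrightarrow> coeff r j = 0"
proof
  let ?r = "q - smult (coeff q n / coeff P n) P"
  show "q = smult (coeff q n / coeff P n) P + ?r" by simp
  have "coeff P n \<noteq> 0" using assms by auto
  thus "coeff ?r j = 0" if "n \<le> j" for j
    using that assms by (cases "j = n") (auto simp: coeff_eq_0)
qed

text \<open>Induction on the degree of q, splitting off a multiple of the P of that degree. The
  hypothesis on the coefficients expresses degree below n in a form that also covers n = 0, where q
  must be zero.\<close>

lemma ofam_orth: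
  assumes P: "ofam L P" and q: "\<And>j. n \<le> j \<Longrightarrow> coeff q j = 0"
  shows "L (P n * q) = 0"
  using q
proof (induction "degree q" arbitrary: q rule: less_induct)
  case less
  note PD = ofamD[OF P]
  show ?case
  proof (cases "q = 0")
    case True thus ?thesis using plin_0[OF PD(1)] by simp
  next
    case False
    let ?d = "degree q"
    have dn: "?d < n" using less.prems False by (meson leading_coeff_0_iff not_le)
    obtain r where r: "q = smult (coeff q ?d / coeff (P ?d) ?d) (P ?d) + r" "\<And>j. ?d \<le> j \<Longrightarrow> coeff r j = 0"
      using poly_top_split[OF PD(2,3), of q ?d] by blast
    have "L (P n * r) = 0"
    proof (cases "r = 0")
      case True thus ?thesis using plin_0[OF PD(1)] by simp
    next
      case False
      hence "degree r < ?d" using r(2) by (meson leading_coeff_0_iff not_le)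
      thus ?thesis using less.hyps r(2) dn by (meson le_trans less_imp_le_nat)
    qed
    thus ?thesis
      by (subst r(1)) (use PD(5)[of n ?d] dn in \<open>simp add: distrib_left plin_simps[OF PD(1)]\<close>)
  qed
qed

lemma ofam_top:
  assumes P: "ofam L P" and q: "degree q \<le> n"
  shows "L (P n * q) = coeff q n / coeff (P n) n"
proof -
  note PD = ofamD[OF P]
  obtain r where r: "q = smult (coeff q n / coeff (P n) n) (P n) + r" "\<And>j. n \<le> j \<Longrightarrow> coeff r j = 0"
    using poly_top_split[OF PD(2,3) q] by blast
  show ?thesis
    by (subst r(1)) (simp add: distrib_left plin_simps[OF PD(1)] PD(4) ofam_orth[OF P r(2)])
qed

text \<open>Pairing q with the P of exactly its degree reads off its leading coefficient.\<close>

lemma ofam_eq_0: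
  assumes P: "ofam L P" and q: "degree q \<le> n" and "\<And>k. k \<le> n \<Longrightarrow> L (P k * q) = 0"
  shows "q = 0"
proof (rule ccontr)
  assume "q \<noteq> 0"
  have "L (P (degree q) * q) = coeff q (degree q) / coeff (P (degree q)) (degree q)"
    by (rule ofam_top[OF P]) simp
  thus False using assms(3)[OF q] ofamD(6)[OF P, of "degree q"] \<open>q \<noteq> 0\<close> by simp
qed

definition bfun :: "(complex poly \<Rightarrow> complex) \<Rightarrow> (nat \<Rightarrow> complex poly) \<Rightarrow> nat \<Rightarrow> complex" where
  "bfun L P n = L (P n * ([:0, 1:] * P n))"

lemma acoef_nz: "ofam L P \<Longrightarrow> acoef P n \<noteq> 0"
  using ofamD(2,6)[of L P] by (simp add: acoef_def)

lemma acoef_Suc: "ofam L P \<Longrightarrow> acoef P (Suc n) = coeff (P n) n / coeff (P (Suc n)) (Suc n)"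
  using ofamD(2)[of L P] by (simp add: acoef_def)

text \<open>The residual \<open>q\<close> has degree at most n, since the leading coefficients
  cancel, and it is orthogonal to P k for all k up to n, since multiplication by X can be moved to
  the other factor. The case n = 0 is separate because truncated subtraction would turn P (n - 1)
  into P 0.\<close>

lemma three_term:
  assumes P: "ofam L P"
  shows "smult (acoef P (Suc n)) (P (Suc n)) = [:- bfun L P n, 1:] * P n
           - (if n = 0 then 0 else smult (acoef P n) (P (n - 1)))"
proof -
  note PD = ofamD[OF P] and lin = plin_simps[OF ofamD(1)[OF P]]
  define X where "X = [:0, 1::complex:]"
  define q where "q = X * P n - smult (acoef P (Suc n)) (P (Suc n)) - smult (bfun L P n) (P n)
     - (if n = 0 then 0 else smult (acoef P n) (P (n - 1)))"
  have dX: "degree (X * p) \<le> Suc (degree p)" for p by (simp add: X_def)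
  have cX: "coeff (X * p) (Suc j) = coeff p j" for p j by (simp add: X_def)
  have qS: "coeff q (Suc n) = 0"
    using PD(2,6) by (auto simp: q_def cX acoef_Suc[OF P] coeff_eq_0)
  have "degree q \<le> Suc n" unfolding q_def
    using PD(2) dX[of "P n"]
    by (intro degree_diff_le) (auto simp: le_SucI)
  hence dq: "degree q \<le> n" using qS by (metis le_SucE leading_coeff_0_iff degree_0 zero_le)
  have "L (P k * q) = 0" if kn: "k \<le> n" for k
  proof -
    have e: "L (P k * q) = L (P k * (X * P n)) - acoef P (Suc n) * L (P k * P (Suc n)) - bfun L P n * L (P k * P n)
       - (if n = 0 then 0 else acoef P n * L (P k * P (n - 1)))"
      by (simp add: q_def right_diff_distrib lin)
    consider "k = n" | "k < n" "Suc k = n" | "Suc k < n" using kn by (metis Suc_leI le_eq_less_or_eq)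
    thus ?thesis
    proof cases
      case 1
      thus ?thesis unfolding e using PD(4,5)[of n] PD(5)[of n "n-1"] PD(5)[of n "Suc n"] by (simp add: bfun_def X_def)
    next
      case 2
      have "L (P k * (X * P n)) = L (P n * (X * P k))" by (simp add: algebra_simps)
      also have "\<dots> = coeff (X * P k) n / coeff (P n) n"
        using dX[of "P k"] PD(2)[of k] 2 by (intro ofam_top[OF P]) simp
      also have "\<dots> = acoef P n" using acoef_Suc[OF P, of k] 2(2) cX[of "P k" k] by simp
      finally show ?thesis unfolding e using 2 PD(4,5) by auto
    next
      case 3
      have "L (P k * (X * P n)) = L (P n * (X * P k))" by (simp add: algebra_simps)
      also have "\<dots> = 0"
        using dX[of "P k"] PD(2)[of k] 3 by (intro ofam_orth[OF P] coeff_eq_0) auto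
      finally show ?thesis unfolding e using 3 PD(5)[of k n] PD(5)[of k "Suc n"] PD(5)[of k "n-1"] by simp
    qed
  qed
  hence "q = 0" using ofam_eq_0[OF P dq] by blast
  thus ?thesis by (auto simp: q_def X_def algebra_simps)
qed

text \<open>Resolves the definite description: L(x p_n^2) satisfies the recurrence, and the
  coefficient is unique since P n is nonzero at some point.\<close>

lemma bcoef_eq:
  assumes P: "ofam L P" shows "bcoef P n = bfun L P n"
  unfolding bcoef_def
proof (rule the_equality)
  have tt: "acoef P (Suc n) * poly (P (Suc n)) z =
       (z - bfun L P n) * poly (P n) z - (if n = 0 then 0 else acoef P n * poly (P (n - 1)) z)" for z
  proof -
    have "poly (smult (acoef P (Suc n)) (P (Suc n))) z = poly ([:- bfun L P n, 1:] * P n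
           - (if n = 0 then 0 else smult (acoef P n) (P (n - 1)))) z"
      by (simp only: three_term[OF P])
    thus ?thesis by (auto simp: algebra_simps)
  qed
  thus "\<forall>z. acoef P (Suc n) * poly (P (Suc n)) z =
       (z - bfun L P n) * poly (P n) z - (if n = 0 then 0 else acoef P n * poly (P (n - 1)) z)" by blast
  fix b assume b: "\<forall>z. acoef P (Suc n) * poly (P (Suc n)) z =
       (z - b) * poly (P n) z - (if n = 0 then 0 else acoef P n * poly (P (n - 1)) z)"
  obtain z where "poly (P n) z \<noteq> 0" using ofamD(3)[OF P, of n] poly_all_0_iff_0 by blast
  moreover have "(z - b) * poly (P n) z = (z - bfun L P n) * poly (P n) z"
    using b tt[of z] by (metis diff_add_cancel)
  ultimately show "b = bfun L P n" by simp
qed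

section \<open>Monic orthogonal polynomials in terms of the recurrence coefficients\<close>

definition monic_of :: "(nat \<Rightarrow> complex poly) \<Rightarrow> nat \<Rightarrow> complex poly" where
  "monic_of P n = smult (1 / coeff (P n) n) (P n)"

text \<open>Only a_n^2 and b_n enter the monic recurrence, so differentiability in t passes from
  them to the monic polynomials. The leading coefficients gamma_n, whose dependence on t is not
  given, are avoided.\<close>

fun mono_rec :: "(nat \<Rightarrow> complex) \<Rightarrow> (nat \<Rightarrow> complex) \<Rightarrow> nat \<Rightarrow> complex poly" where
  "mono_rec a b 0 = 1"
| "mono_rec a b (Suc 0) = [:- b 0, 1:]"
| "mono_rec a b (Suc (Suc n)) = [:- b (Suc n), 1:] * mono_rec a b (Suc n) - smult ((a (Suc n))\<^sup>2) (mono_rec a b n)"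

lemma monic_of_rec:
  assumes P: "ofam L P" shows "monic_of P n = mono_rec (acoef P) (bcoef P) n"
proof -
  note PD = ofamD[OF P]
  have S: "monic_of P (Suc n) = smult (1 / coeff (P n) n) (smult (acoef P (Suc n)) (P (Suc n)))" for n
    using PD(6)[of n] by (simp add: monic_of_def acoef_Suc[OF P])
  have "monic_of P n = mono_rec (acoef P) (bcoef P) n \<and> monic_of P (Suc n) = mono_rec (acoef P) (bcoef P) (Suc n)"
  proof (induction n)
    case 0
    have "degree (P 0) = 0" using PD(2) by simp
    then obtain c where c: "P 0 = [:c:]" using degree_eq_zeroE by blast
    hence "c \<noteq> 0" using PD(3)[of 0] by auto
    moreover have "monic_of P (Suc 0) = smult (1 / coeff (P 0) 0) ([:- bfun L P 0, 1:] * P 0)"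
      unfolding S three_term[OF P] by simp
    ultimately show ?case using c by (simp add: monic_of_def one_pCons bcoef_eq[OF P])
  next
    case (Suc n)
    have "monic_of P (Suc (Suc n)) = smult (1 / coeff (P (Suc n)) (Suc n)) ([:- bfun L P (Suc n), 1:] * P (Suc n)
        - smult (acoef P (Suc n)) (P n))"
      unfolding S three_term[OF P] by simp
    also have "\<dots> = [:- bfun L P (Suc n), 1:] * monic_of P (Suc n) - smult (acoef P (Suc n) / coeff (P (Suc n)) (Suc n)) (P n)"
      by (simp add: monic_of_def smult_diff_right del: mult_pCons_left)
    also have "smult (acoef P (Suc n) / coeff (P (Suc n)) (Suc n)) (P n) = smult ((acoef P (Suc n))\<^sup>2) (monic_of P n)"
      using PD(6)[of n] by (simp add: monic_of_def acoef_Suc[OF P] power2_eq_square)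
    finally show ?case using Suc by (simp add: bcoef_eq[OF P])
  qed
  thus ?thesis by blast
qed

lemma degree_mono_rec: "degree (mono_rec a b n) = n \<and> coeff (mono_rec a b n) n = 1"
proof (induction a b n rule: mono_rec.induct)
  case (3 a b n)
  let ?q = "[:- b (Suc n), 1:] * mono_rec a b (Suc n)" and ?r = "smult ((a (Suc n))\<^sup>2) (mono_rec a b n)"
  have nz: "mono_rec a b (Suc n) \<noteq> 0" using 3 by (metis coeff_0 zero_neq_one)
  have "degree ?q = Suc (Suc n)" using 3 nz by (subst degree_mult_eq) auto
  moreover have "degree ?r < Suc (Suc n)" using 3 by (auto intro: le_less_trans[OF degree_smult_le])
  ultimately have "degree (?q - ?r) = Suc (Suc n)"
    by (metis degree_add_eq_left degree_minus diff_conv_add_uminus)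
  moreover have "coeff (?q - ?r) (Suc (Suc n)) = 1" using 3 by (simp add: coeff_eq_0)
  ultimately show ?case by simp
qed auto

text \<open>Derivative of a family of polynomials, coefficient by coefficient. The common degree
  bound makes a functional applied to the family a sum with a fixed number of terms.\<close>

definition has_pd :: "(real \<Rightarrow> complex poly) \<Rightarrow> complex poly \<Rightarrow> real \<Rightarrow> bool" where
  "has_pd F F' t \<longleftrightarrow> (\<exists>d. degree F' \<le> d \<and> (\<forall>s. degree (F s) \<le> d)) \<and>
     (\<forall>j. ((\<lambda>s. coeff (F s) j) has_vector_derivative coeff F' j) (at t))"

lemma has_pd_const: "has_pd (\<lambda>s. p) 0 t"
  by (auto simp: has_pd_def)

lemma has_pd_add: "has_pd F F' t \<Longrightarrow> has_pd G G' t \<Longrightarrow> has_pd (\<lambda>s. F s + G s) (F' + G') t"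
proof -
  assume F: "has_pd F F' t" and G: "has_pd G G' t"
  obtain d e where "degree F' \<le> d \<and> (\<forall>s. degree (F s) \<le> d)" "degree G' \<le> e \<and> (\<forall>s. degree (G s) \<le> e)"
    using F G by (auto simp: has_pd_def)
  hence "degree (F' + G') \<le> max d e \<and> (\<forall>s. degree (F s + G s) \<le> max d e)"
    by (meson degree_add_le le_max_iff_disj)
  thus ?thesis using F G unfolding has_pd_def coeff_add
    by (auto intro!: has_vector_derivative_add)
qed

lemma has_pd_mult:
  assumes F: "has_pd F F' t" and G: "has_pd G G' t"
  shows "has_pd (\<lambda>s. F s * G s) (F' * G t + F t * G') t"
proof -
  obtain d e where d: "degree F' \<le> d \<and> (\<forall>s. degree (F s) \<le> d)" "degree G' \<le> e \<and> (\<forall>s. degree (G s) \<le> e)"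
    using F G by (auto simp: has_pd_def)
  have "degree (F' * G t + F t * G') \<le> d + e"
    using d by (intro degree_add_le) (auto intro!: order.trans[OF degree_mult_le] add_mono)
  moreover have "\<forall>s. degree (F s * G s) \<le> d + e"
    using d by (auto intro!: order.trans[OF degree_mult_le] add_mono)
  moreover have "((\<lambda>s. coeff (F s * G s) j) has_vector_derivative coeff (F' * G t + F t * G') j) (at t)" for j
    unfolding coeff_mult coeff_add sum.distrib[symmetric]
  proof (rule has_vector_derivative_sum)
    fix i
    have "((\<lambda>s. coeff (F s) i * coeff (G s) (j - i)) has_vector_derivative
        coeff (F t) i * coeff G' (j - i) + coeff F' i * coeff (G t) (j - i)) (at t)"
      using F G by (intro has_vector_derivative_mult) (auto simp: has_pd_def)
    thus "((\<lambda>s. coeff (F s) i * coeff (G s) (j - i)) has_vector_derivative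
        coeff F' i * coeff (G t) (j - i) + coeff (F t) i * coeff G' (j - i)) (at t)"
      by (simp add: add.commute)
  qed
  ultimately show ?thesis unfolding has_pd_def by blast
qed

lemma has_pd_Const:
  assumes "(f has_vector_derivative f') (at t)" shows "has_pd (\<lambda>s. [:f s:]) [:f':] t"
  using assms by (auto simp: has_pd_def coeff_pCons split: nat.splits intro!: exI[of _ 0])

lemma has_pd_smult:
  assumes "(f has_vector_derivative f') (at t)" "has_pd F F' t"
  shows "has_pd (\<lambda>s. smult (f s) (F s)) (smult f' (F t) + smult (f t) F') t"
  using has_pd_mult[OF has_pd_Const[OF assms(1)] assms(2)] by simp

lemma has_pd_linear:
  assumes "(f has_vector_derivative f') (at t)" shows "has_pd (\<lambda>s. [:f s, 1:]) [:f':] t"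
proof -
  have "has_pd (\<lambda>s. [:f s:] + [:0, 1:]) ([:f':] + 0) t"
    by (intro has_pd_add has_pd_Const assms has_pd_const)
  thus ?thesis by simp
qed

lemma has_pd_uminus: "has_pd F F' t \<Longrightarrow> has_pd (\<lambda>s. - F s) (- F') t"
  using has_pd_mult[OF has_pd_const[of "[:-1:]"], of F F' t] by simp

lemma has_pd_diff: "has_pd F F' t \<Longrightarrow> has_pd G G' t \<Longrightarrow> has_pd (\<lambda>s. F s - G s) (F' - G') t"
  using has_pd_add[of F F' t "\<lambda>s. - G s" "- G'"] has_pd_uminus[of G G' t] by simp

lemma has_pd_sum: "(\<And>i. i \<in> A \<Longrightarrow> has_pd (F i) (F' i) t) \<Longrightarrow> has_pd (\<lambda>s. \<Sum>i\<in>A. F i s) (\<Sum>i\<in>A. F' i) t"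
  by (induction A rule: infinite_finite_induct) (auto intro: has_pd_const has_pd_add)

lemma has_pd_pderiv:
  assumes "has_pd F F' t" shows "has_pd (\<lambda>s. pderiv (F s)) (pderiv F') t"
proof -
  obtain d where "degree F' \<le> d \<and> (\<forall>s. degree (F s) \<le> d)" using assms by (auto simp: has_pd_def)
  hence "degree (pderiv F') \<le> d \<and> (\<forall>s. degree (pderiv (F s)) \<le> d)"
    by (auto simp: degree_pderiv intro: le_trans[OF diff_le_self])
  moreover have "((\<lambda>s. coeff (pderiv (F s)) j) has_vector_derivative coeff (pderiv F') j) (at t)" for j
    unfolding coeff_pderiv using assms
    by (intro has_vector_derivative_mult_right) (auto simp: has_pd_def)
  ultimately show ?thesis unfolding has_pd_def by blast
qed

lemma has_pd_mono_rec:
  assumes a: "\<And>n. n \<ge> 1 \<Longrightarrow> (\<lambda>s. a s n) differentiable (at t)" and b: "\<And>n. (\<lambda>s. b s n) differentiable (at t)"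
  obtains F' where "has_pd (\<lambda>s. mono_rec (a s) (b s) n) F' t"
proof -
  have "(\<exists>F'. has_pd (\<lambda>s. mono_rec (a s) (b s) n) F' t) \<and> (\<exists>F'. has_pd (\<lambda>s. mono_rec (a s) (b s) (Suc n)) F' t)"
  proof (induction n)
    case 0
    have "((\<lambda>s. - b s 0) has_vector_derivative - vector_derivative (\<lambda>s. b s 0) (at t)) (at t)"
      by (rule has_vector_derivative_minus) (use b[of 0] vector_derivative_works in blast)
    hence "has_pd (\<lambda>s. [:- b s 0, 1:]) [:- vector_derivative (\<lambda>s. b s 0) (at t):] t"
      by (rule has_pd_linear)
    thus ?case using has_pd_const[of 1 t] by auto
  next
    case (Suc n)
    then obtain F1 F2 where F: "has_pd (\<lambda>s. mono_rec (a s) (b s) n) F1 t" "has_pd (\<lambda>s. mono_rec (a s) (b s) (Suc n)) F2 t"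
      by blast
    have B: "((\<lambda>s. - b s (Suc n)) has_vector_derivative - vector_derivative (\<lambda>s. b s (Suc n)) (at t)) (at t)"
      by (rule has_vector_derivative_minus) (use b[of "Suc n"] vector_derivative_works in blast)
    have A: "((\<lambda>s. a s (Suc n)) has_vector_derivative vector_derivative (\<lambda>s. a s (Suc n)) (at t)) (at t)"
      using a[of "Suc n"] vector_derivative_works by auto
    have A2: "((\<lambda>s. (a s (Suc n))\<^sup>2) has_vector_derivative
        (a t (Suc n) * vector_derivative (\<lambda>s. a s (Suc n)) (at t) + vector_derivative (\<lambda>s. a s (Suc n)) (at t) * a t (Suc n))) (at t)"
      unfolding power2_eq_square by (rule has_vector_derivative_mult[OF A A])
    have "\<exists>F'. has_pd (\<lambda>s. [:- b s (Suc n), 1:] * mono_rec (a s) (b s) (Suc n) - smult ((a s (Suc n))\<^sup>2) (mono_rec (a s) (b s) n)) F' t"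
      by (rule exI, rule has_pd_diff[OF has_pd_mult[OF has_pd_linear[OF B] F(2)] has_pd_smult[OF A2 F(1)]])
    thus ?case using F(2) by auto
  qed
  thus ?thesis using that by blast
qed

text \<open>Product rule for the pairing, from the expansion in monomials. Linearity is required
  only near t because the functionals are meaningful only for parameters in the interval I.\<close>

lemma has_vector_derivative_functional:
  assumes F: "has_pd F F' t" and ev: "eventually (\<lambda>s. plin (L s)) (nhds t)" and Ld: "plin Ld"
    and m: "\<And>j. ((\<lambda>s. L s (monom 1 j)) has_vector_derivative Ld (monom 1 j)) (at t)"
  shows "((\<lambda>s. L s (F s)) has_vector_derivative (L t F' + Ld (F t))) (at t)"
proof -
  obtain d where d: "degree F' \<le> d" "\<And>s. degree (F s) \<le> d" using F by (auto simp: has_pd_def)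
  have Lt: "plin (L t)" using ev by (rule eventually_nhds_x_imp_x)
  have "((\<lambda>s. \<Sum>j\<le>d. coeff (F s) j * L s (monom 1 j)) has_vector_derivative
     (\<Sum>j\<le>d. coeff (F t) j * Ld (monom 1 j) + coeff F' j * L t (monom 1 j))) (at t)"
    using F m by (intro has_vector_derivative_sum has_vector_derivative_mult) (auto simp: has_pd_def)
  moreover have "(\<Sum>j\<le>d. coeff (F t) j * Ld (monom 1 j) + coeff F' j * L t (monom 1 j)) = L t F' + Ld (F t)"
    by (simp add: sum.distrib plin_monom_expand[OF Lt d(1)] plin_monom_expand[OF Ld d(2)])
  moreover have "eventually (\<lambda>s. (\<Sum>j\<le>d. coeff (F s) j * L s (monom 1 j)) = L s (F s)) (nhds t)"
    using ev by eventually_elim (simp add: plin_monom_expand[OF _ d(2)])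
  ultimately show ?thesis
    using has_vector_derivative_cong_ev[of UNIV "\<lambda>s. \<Sum>j\<le>d. coeff (F s) j * L s (monom 1 j)" "\<lambda>s. L s (F s)" t]
    by (simp add: plin_monom_expand[OF Lt d(2)])
qed

text \<open>Supplies the derivative of the functional once all moments are known to be
  differentiable.\<close>

lemma plin_of_moments:
  obtains F where "plin F" "\<And>j. F (monom 1 j) = l j"
proof -
  define F where "F p = (\<Sum>j\<le>degree p. coeff p j * l j)" for p :: "complex poly"
  have F: "F p = (\<Sum>j\<le>d. coeff p j * l j)" if "degree p \<le> d" for p d
    unfolding F_def by (rule sum.mono_neutral_left) (use that in \<open>auto simp: coeff_eq_0\<close>)
  have "plin F"
  proof (rule plinI)
    fix p q :: "complex poly"
    let ?d = "max (degree p) (degree q)"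
    have "degree (p + q) \<le> ?d" by (rule degree_add_le_max)
    thus "F (p + q) = F p + F q"
      using F[of "p + q" ?d] F[of p ?d] F[of q ?d] by (simp add: sum.distrib algebra_simps)
  next
    fix c and p :: "complex poly"
    show "F (smult c p) = c * F p"
      using F[of "smult c p" "degree p"] F[of p "degree p"] by (simp add: sum_distrib_left algebra_simps degree_smult_le)
  qed
  moreover have "F (monom 1 j) = l j" for j
  proof -
    have "F (monom 1 j) = (\<Sum>i\<le>j. coeff (monom 1 j) i * l i)" by (rule F) (rule degree_monom_le)
    also have "\<dots> = (\<Sum>i\<in>{j}. coeff (monom 1 j) i * l i)" by (rule sum.mono_neutral_right) auto
    finally show ?thesis by simp
  qed
  ultimately show ?thesis using that by blast
qed

text \<open>The recurrence coefficients determine a functional up to a factor; dividing by the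
  zeroth moment fixes that factor, so that differentiability of the coefficients can be transferred
  to the moments.\<close>

definition normL :: "(complex poly \<Rightarrow> complex) \<Rightarrow> complex poly \<Rightarrow> complex" where
  "normL L p = L p / L 1"

lemma ofam_L1: assumes P: "ofam L P" shows "L 1 \<noteq> 0"
proof
  assume "L 1 = 0"
  obtain c where c: "P 0 = [:c:]" using ofamD(2)[OF P, of 0] degree_eq_zeroE by blast
  have "P 0 * P 0 = smult (c * c) 1" unfolding c by simp
  hence "L (P 0 * P 0) = 0" using plin_smult[OF ofamD(1)[OF P], of "c * c" 1] \<open>L 1 = 0\<close> by simp
  thus False using ofamD(4)[OF P] by simp
qed

lemma plin_normL: "plin L \<Longrightarrow> plin (normL L)"
  by (rule plinI) (auto simp: normL_def plin_simps add_divide_distrib)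

lemma normL_monic:
  assumes P: "ofam L P"
  shows "normL L (monic_of P n) = (if n = 0 then 1 else 0)"
proof (cases "n = 0")
  case True
  obtain c where c: "P 0 = [:c:]" using ofamD(2)[OF P, of 0] degree_eq_zeroE by blast
  have "monic_of P 0 = 1" using c ofamD(3)[OF P, of 0] by (auto simp: monic_of_def one_pCons)
  thus ?thesis using True ofam_L1[OF P] by (simp add: normL_def)
next
  case False
  have "L (P n * 1) = 0" by (rule ofam_orth[OF P]) (use False in auto)
  thus ?thesis using False plin_smult[OF ofamD(1)[OF P]] by (simp add: normL_def monic_of_def)
qed

text \<open>The normalised functional maps the monic polynomial of degree n to 0 for n > 0 and to 1
  for n = 0. Solving this equation for the n-th moment expresses it by lower moments and by
  coefficients that are differentiable.\<close>

lemma normalized_moments_differentiable: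
  fixes L :: "real \<Rightarrow> complex poly \<Rightarrow> complex" and P :: "real \<Rightarrow> nat \<Rightarrow> complex poly"
  assumes I: "open I" "t \<in> I" and P: "\<And>s. s \<in> I \<Longrightarrow> ofam (L s) (P s)"
    and a: "\<And>n. n \<ge> 1 \<Longrightarrow> (\<lambda>s. acoef (P s) n) differentiable (at t)" and b: "\<And>n. (\<lambda>s. bcoef (P s) n) differentiable (at t)"
  shows "(\<lambda>s. normL (L s) (monom 1 n)) differentiable (at t)"
proof (induction n rule: less_induct)
  case (less n)
  define F where "F s = mono_rec (acoef (P s)) (bcoef (P s)) n" for s
  obtain F' where F': "has_pd F F' t"
    using has_pd_mono_rec[of "\<lambda>s. acoef (P s)" t "\<lambda>s. bcoef (P s)" n] a b unfolding F_def by blast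
  define g where "g s = (if n = 0 then 1 else 0) - (\<Sum>j<n. coeff (F s) j * normL (L s) (monom 1 j))" for s
  have Fj: "(\<lambda>s. coeff (F s) j) differentiable at t" for j
    using F' unfolding has_pd_def by (meson differentiableI_vector)
  have gd: "g differentiable (at t)" unfolding g_def
    by (intro differentiable_diff differentiable_sum ballI differentiable_mult[OF Fj less.IH]) auto
  have eq: "normL (L s) (monom 1 n) = g s" if s: "s \<in> I" for s
  proof -
    have lin: "plin (normL (L s))" using plin_normL[OF ofamD(1)[OF P[OF s]]] .
    have "normL (L s) (F s) = (\<Sum>j\<le>n. coeff (F s) j * normL (L s) (monom 1 j))"
      using plin_monom_expand[OF lin] degree_mono_rec by (simp add: F_def)
    also have "\<dots> = (\<Sum>j<n. coeff (F s) j * normL (L s) (monom 1 j)) + normL (L s) (monom 1 n)"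
      using degree_mono_rec[of "acoef (P s)" "bcoef (P s)" n] by (simp add: lessThan_Suc_atMost[symmetric] F_def)
    finally show ?thesis using normL_monic[OF P[OF s], of n] monic_of_rec[OF P[OF s], of n]
      by (auto simp: g_def F_def algebra_simps)
  qed
  show ?case
    using gd I eq has_vector_derivative_transform_within_open
    by (metis (no_types, lifting) differentiableI_vector vector_derivative_works)
qed

section \<open>The equations for a_n and b_n, derived from the deformation formula\<close>

definition qval :: "(complex poly \<Rightarrow> complex) \<Rightarrow> (nat \<Rightarrow> complex poly) \<Rightarrow> nat \<Rightarrow> complex \<Rightarrow> complex" where
  "qval L P n y = L (synthetic_div (P n) y)"

text \<open>What Theta_n becomes at x_k after inserting eps_n = p_n f - q_n, where q_n(y) is
  \<open>qval\<close>. The terms with f combine to p_n^2 (2V f - W f'), those with a factor W vanish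
  at x_k, and 2V(x_k) = alpha_k W'(x_k). \<open>Omega_at\<close> arises in the same way.\<close>

definition Theta_at where
  "Theta_at m \<alpha> x L P n k = (poly (P n) (x k))\<^sup>2 * ucoef m \<alpha> x L k
     - \<alpha> k * poly (Wdel m x k) (x k) * qval L P n (x k) * poly (P n) (x k)"

definition Omega_at where
  "Omega_at m \<alpha> x L P n k = acoef P n * (poly (P n) (x k) * poly (P (n - 1)) (x k) * ucoef m \<alpha> x L k
     - \<alpha> k * poly (Wdel m x k) (x k) / 2 *
        (qval L P (n - 1) (x k) * poly (P n) (x k) + qval L P n (x k) * poly (P (n - 1)) (x k)))"

text \<open>In the Leibniz rule the term with the unfrozen P n is orthogonal to a polynomial of
  degree n - 1.\<close>

lemma qval_square:
  assumes P: "ofam L P"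
  shows "L (synthetic_div (P n * P n) y) = qval L P n y * poly (P n) y"
proof -
  have "L (P n * synthetic_div (P n) y) = 0"
    using ofamD(2)[OF P, of n]
    by (cases n) (auto intro!: ofam_orth[OF P] coeff_eq_0 simp: degree_synthetic_div synthetic_div_eq_0_iff[THEN iffD2] plin_0[OF ofamD(1)[OF P]])
  thus ?thesis
    by (simp add: synthetic_div_mult plin_simps[OF ofamD(1)[OF P]] qval_def mult.commute)
qed

text \<open>The Leibniz rule in its two orders. In one order the remaining product is orthogonal to
  P n; in the other P (n - 1) meets a polynomial of degree n - 1 with leading coefficient gamma_n,
  which yields gamma_n / gamma_(n-1) = 1/a_n. The difference of the two is the Casorati
  identity.\<close>

lemma qval_product:
  assumes P: "ofam L P" and n: "n \<ge> 1"
  shows "L (synthetic_div (P n * P (n - 1)) y) = qval L P n y * poly (P (n - 1)) y"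
    and "L (synthetic_div (P n * P (n - 1)) y) = qval L P (n - 1) y * poly (P n) y + 1 / acoef P n"
proof -
  note PD = ofamD[OF P]
  note lin = plin_simps[OF PD(1)]
  have 0: "L (P n * synthetic_div (P (n - 1)) y) = 0"
    using PD(2)[of "n - 1"] n by (intro ofam_orth[OF P] coeff_eq_0) (simp add: degree_synthetic_div)
  have "L (synthetic_div (P n * P (n - 1)) y) = L (synthetic_div (P (n - 1) * P n) y)"
    by (simp only: mult.commute)
  also have "\<dots> = L (P n * synthetic_div (P (n - 1)) y) + poly (P (n - 1)) y * L (synthetic_div (P n) y)"
    unfolding synthetic_div_mult lin by (simp only: mult.commute)
  finally show "L (synthetic_div (P n * P (n - 1)) y) = qval L P n y * poly (P (n - 1)) y"
    unfolding 0 by (simp add: qval_def)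
  have "coeff (synthetic_div (P n) y) (n - 1) = coeff (P n) n"
    using arg_cong[OF synthetic_div_correct[of "P n" y], of "\<lambda>p. coeff p n"] PD(2)[of n] n
      degree_synthetic_div[of "P n" y] coeff_eq_0[of "synthetic_div (P n) y" n]
    by (cases n) auto
  hence "L (P (n - 1) * synthetic_div (P n) y) = 1 / acoef P n"
    using ofam_top[OF P, of "synthetic_div (P n) y" "n - 1"] PD(2)[of n] n acoef_Suc[OF P, of "n - 1"]
    by (simp add: degree_synthetic_div)
  thus "L (synthetic_div (P n * P (n - 1)) y) = qval L P (n - 1) y * poly (P n) y + 1 / acoef P n"
    by (simp add: synthetic_div_mult lin qval_def mult.commute)
qed

text \<open>With h_n the normalised squared norm of the monic polynomial M n, the formula for
  \<open>Ld\<close> gives h_n' = (lam + R_n) h_n, and a_n^2 = h_n / h_(n-1), so lam cancels. For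
  b_n, which is a difference of subleading coefficients of M n and M (n+1), the relation L0(M (j+1)
  M j) = 0 is differentiated.\<close>

lemma toda_equations:
  fixes L :: "real \<Rightarrow> complex poly \<Rightarrow> complex" and P :: "real \<Rightarrow> nat \<Rightarrow> complex poly"
  assumes I: "open I" "t \<in> I" and P: "\<And>s. s \<in> I \<Longrightarrow> ofam (L s) (P s)"
    and a: "\<And>n. n \<ge> 1 \<Longrightarrow> (\<lambda>s. acoef (P s) n) differentiable (at t)" and b: "\<And>n. (\<lambda>s. bcoef (P s) n) differentiable (at t)"
    and x: "inj_on x {..<m}" and Ld: "plin Ld"
    and mom: "\<And>j. ((\<lambda>s. normL (L s) (monom 1 j)) has_vector_derivative Ld (monom 1 j)) (at t)"
    and main: "\<And>\<phi>. Ld \<phi> = lam * normL (L t) \<phi> - (\<Sum>k<m. \<alpha> k * v k * normL (L t) (synthetic_div \<phi> (x k)))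
       + (\<Sum>k<m. poly \<phi> (x k) * (v k * ucoef m \<alpha> x (normL (L t)) k / poly (Wdel m x k) (x k)))"
    and n: "n \<ge> 1"
  shows "vector_derivative (\<lambda>s. acoef (P s) n) (at t) / acoef (P t) n =
      1/2 * (\<Sum>k<m. (Theta_at m \<alpha> x (L t) (P t) n k - Theta_at m \<alpha> x (L t) (P t) (n - 1) k) * v k / poly (Wdel m x k) (x k))"
    and "vector_derivative (\<lambda>s. bcoef (P s) n) (at t) =
      (\<Sum>k<m. (Omega_at m \<alpha> x (L t) (P t) (Suc n) k - Omega_at m \<alpha> x (L t) (P t) n k) * v k / poly (Wdel m x k) (x k))"
proof -
  define M where "M n s = mono_rec (acoef (P s)) (bcoef (P s)) n" for n s
  have M: "M n s = monic_of (P s) n" if "s \<in> I" for n s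
    using monic_of_rec[OF P[OF that]] by (simp add: M_def)
  have "\<exists>F'. has_pd (M n) F' t" for n
    using has_pd_mono_rec[of "\<lambda>s. acoef (P s)" t "\<lambda>s. bcoef (P s)" n] a b unfolding M_def by blast
  then obtain M' where M': "\<And>n. has_pd (M n) (M' n) t" by metis
  have cM: "((\<lambda>s. coeff (M n s) j) has_vector_derivative coeff (M' n) j) (at t)" for n j
    using M'[of n] by (simp add: has_pd_def)
  \<comment> \<open>The leading coefficient of M n is constantly 1, so the derivative has degree
    below n and is orthogonal to the monic polynomials of degree n and higher.\<close>
  have M'0: "coeff (M' n) j = 0" if "n \<le> j" for n j
  proof -
    have "coeff (M n s) j = (if j = n then 1 else 0)" for s
      using degree_mono_rec[of "acoef (P s)" "bcoef (P s)" n] that by (auto simp: M_def coeff_eq_0)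
    hence "((\<lambda>s. if j = n then 1 else 0) has_vector_derivative coeff (M' n) j) (at t)"
      using cM[of n j] by simp
    thus ?thesis using has_vector_derivative_const vector_derivative_unique_at by blast
  qed
  define L0 where "L0 s = normL (L s)" for s
  have lin0: "plin (L0 s)" if "s \<in> I" for s using plin_normL[OF ofamD(1)[OF P[OF that]]] by (simp add: L0_def)
  note lint = plin_simps[OF lin0[OF I(2)]] and PD = ofamD[OF P[OF I(2)]] and lind = plin_simps[OF Ld]
  have ev: "eventually (\<lambda>s. plin (L0 s)) (nhds t)"
    using eventually_nhds_in_open[OF I] by eventually_elim (rule lin0)
  have dL: "((\<lambda>s. L0 s (M n s * M k s)) has_vector_derivative (L0 t (M' n * M k t + M n t * M' k) + Ld (M n t * M k t))) (at t)" for n k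
    by (rule has_vector_derivative_functional[OF has_pd_mult[OF M' M'] ev Ld]) (use mom in \<open>simp add: L0_def\<close>)
  define \<gamma> where "\<gamma> s n = coeff (P s n) n" for s n
  define \<mu> where "\<mu> s = L s 1" for s
  have \<gamma>0: "\<gamma> s n \<noteq> 0" if "s \<in> I" for s n using ofamD(6)[OF P[OF that]] by (simp add: \<gamma>_def)
  have \<mu>0: "\<mu> s \<noteq> 0" if "s \<in> I" for s using ofam_L1[OF P[OF that]] by (simp add: \<mu>_def)
  have acf: "acoef (P s) (Suc j) = \<gamma> s j / \<gamma> s (Suc j)" if "s \<in> I" for s j
    using acoef_Suc[OF P[OF that]] by (simp add: \<gamma>_def)
  have LM: "L0 s (M n s * q) = L s (P s n * q) / (\<mu> s * \<gamma> s n)" if "s \<in> I" for s n q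
    using plin_smult[OF ofamD(1)[OF P[OF that]]] by (simp add: M[OF that] L0_def normL_def monic_of_def \<mu>_def \<gamma>_def)
  have MP: "M k s = smult (1 / \<gamma> s k) (P s k)" if "s \<in> I" for s k
    by (simp add: M[OF that] monic_of_def \<gamma>_def)
  have LMM: "L0 s (M n s * M k s) = L s (P s n * P s k) / (\<mu> s * \<gamma> s n * \<gamma> s k)" if "s \<in> I" for s n k
    unfolding LM[OF that] using plin_smult[OF ofamD(1)[OF P[OF that]]] by (simp add: MP[OF that])
  have LMM': "L0 t (M n t * M' k) = 0" if "k \<le> n" for n k
    unfolding LM[OF I(2)] using ofam_orth[OF P[OF I(2)], of n "M' k"] M'0 that by simp
  define w where "w k = v k / poly (Wdel m x k) (x k)" for k
  have wW: "w k * poly (Wdel m x k) (x k) = v k" if "k < m" for k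
    using poly_Wdel_self[OF x that] by (simp add: w_def)
  have u0: "ucoef m \<alpha> x (normL (L t)) k = ucoef m \<alpha> x (L t) k / \<mu> t" for k
    by (simp add: ucoef_def normL_def \<mu>_def)
  have mainP: "\<mu> t * Ld (P t n * P t k) = lam * L t (P t n * P t k)
      - (\<Sum>j<m. \<alpha> j * v j * L t (synthetic_div (P t n * P t k) (x j)))
      + (\<Sum>j<m. poly (P t n) (x j) * poly (P t k) (x j) * ucoef m \<alpha> x (L t) j * w j)" for n k
    unfolding main u0 normL_def \<mu>_def[symmetric] using \<mu>0[OF I(2)]
    by (simp add: field_simps sum_distrib_left w_def sum_divide_distrib[symmetric])
  define R where "R n = (\<Sum>k<m. Theta_at m \<alpha> x (L t) (P t) n k * w k)" for n
  \<comment> \<open>The summand lam does not depend on n, hence its cancellation in the quotient of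
    consecutive norms; the Theta values come from \<open>qval_square\<close>.\<close>
  have LdPP: "\<mu> t * Ld (P t n * P t n) = lam + R n" for n
  proof -
    have "R n = (\<Sum>k<m. poly (P t n) (x k) * poly (P t n) (x k) * ucoef m \<alpha> x (L t) k * w k
         - \<alpha> k * (w k * poly (Wdel m x k) (x k)) * (qval (L t) (P t) n (x k) * poly (P t n) (x k)))"
      unfolding R_def Theta_at_def by (intro sum.cong refl) (simp add: power2_eq_square algebra_simps)
    also have "\<dots> = (\<Sum>k<m. poly (P t n) (x k) * poly (P t n) (x k) * ucoef m \<alpha> x (L t) k * w k
         - \<alpha> k * v k * (qval (L t) (P t) n (x k) * poly (P t n) (x k)))"
      by (intro sum.cong refl) (simp add: wW)
    finally show ?thesis unfolding mainP qval_square[OF P[OF I(2)]] by (simp add: PD(4) sum_subtractf)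
  qed
  define h where "h n s = L0 s (M n s * M n s)" for n s
  have h_eq: "h n s = 1 / (\<mu> s * (\<gamma> s n)\<^sup>2)" if "s \<in> I" for n s
    unfolding h_def LMM[OF that] using ofamD(4)[OF P[OF that]] by (simp add: power2_eq_square)
  have hd: "(h n has_vector_derivative (lam + R n) * h n t) (at t)" for n
  proof -
    have "L0 t (M' n * M n t + M n t * M' n) = 0"
      using LMM'[of n n] unfolding plin_add[OF lin0[OF I(2)]] mult.commute[of "M' n"] by simp
    hence "L0 t (M' n * M n t + M n t * M' n) + Ld (M n t * M n t) = Ld (P t n * P t n) / (\<gamma> t n)\<^sup>2"
      by (simp add: MP[OF I(2)] lind power2_eq_square)
    also have "\<dots> = (lam + R n) * h n t"
      unfolding h_eq[OF I(2)] LdPP[symmetric] using \<mu>0[OF I(2)] by simp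
    finally show ?thesis using dL[of n n] by (simp add: h_def[abs_def])
  qed
  obtain n' where n': "n = Suc n'" using n by (cases n) auto
  show "vector_derivative (\<lambda>s. acoef (P s) n) (at t) / acoef (P t) n =
      1/2 * (\<Sum>k<m. (Theta_at m \<alpha> x (L t) (P t) n k - Theta_at m \<alpha> x (L t) (P t) (n - 1) k) * v k / poly (Wdel m x k) (x k))"
  proof -
    define A where "A s = acoef (P s) n" for s
    have "(A has_vector_derivative vector_derivative A (at t)) (at t)"
      using a[OF n] unfolding A_def by (rule vector_derivative_works[THEN iffD1])
    note Ad = this
    have "((\<lambda>s. (A s * A s) * h n' s) has_vector_derivative
       (A t * A t) * ((lam + R n') * h n' t) + (A t * vector_derivative A (at t) + vector_derivative A (at t) * A t) * h n' t) (at t)"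
      by (intro has_vector_derivative_mult Ad hd)
    moreover have "(A s * A s) * h n' s = h n s" if "s \<in> I" for s
      unfolding A_def n' acf[OF that] h_eq[OF that] using \<gamma>0[OF that] by (simp add: power2_eq_square)
    ultimately have "(h n has_vector_derivative
       (A t * A t) * ((lam + R n') * h n' t) + (A t * vector_derivative A (at t) + vector_derivative A (at t) * A t) * h n' t) (at t)"
      using I has_vector_derivative_transform_within_open by blast
    hence "(A t * A t) * ((lam + R n') * h n' t) + (A t * vector_derivative A (at t) + vector_derivative A (at t) * A t) * h n' t
        = (lam + R n) * h n t"
      using hd[of n] vector_derivative_unique_at by blast
    also have "h n t = (A t * A t) * h n' t"
      unfolding A_def n' acf[OF I(2)] h_eq[OF I(2)] using \<gamma>0[OF I(2)] by (simp add: power2_eq_square)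
    finally have "(2 * (A t * vector_derivative A (at t))) * h n' t = ((R n - R n') * (A t * A t)) * h n' t"
      by (simp add: algebra_simps)
    moreover have "h n' t \<noteq> 0" unfolding h_eq[OF I(2)] using \<gamma>0[OF I(2)] \<mu>0[OF I(2)] by simp
    ultimately have "2 * (A t * vector_derivative A (at t)) = (R n - R n') * (A t * A t)" by simp
    moreover have "A t \<noteq> 0" using acoef_nz[OF P[OF I(2)]] by (simp add: A_def)
    ultimately have "2 * vector_derivative A (at t) = (R n - R n') * A t" by simp
    with \<open>A t \<noteq> 0\<close> have "vector_derivative A (at t) / A t = 1/2 * (R n - R n')"
      by (simp add: field_simps)
    thus ?thesis unfolding A_def R_def n' sum_subtractf[symmetric] w_def by (simp add: algebra_simps diff_divide_distrib)
  qed
  define S where "S n = (\<Sum>k<m. Omega_at m \<alpha> x (L t) (P t) n k * w k)" for n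
  \<comment> \<open>In the derivative of L0(M (j+1) M j) = 0 the term with M' j vanishes, and M'
    (j+1) paired with M j contributes exactly its coefficient of degree j.\<close>
  have S: "coeff (M' (Suc j)) j = 1/2 * (\<Sum>k<m. \<alpha> k * v k) - S (Suc j)" for j
  proof -
    define cc where "cc = acoef (P t) (Suc j)"
    have cc: "cc \<noteq> 0" using acoef_nz[OF P[OF I(2)]] by (simp add: cc_def)
    have "L0 s (M (Suc j) s * M j s) = 0" if "s \<in> I" for s
      unfolding LMM[OF that] using ofamD(5)[OF P[OF that], of "Suc j" j] by simp
    hence "((\<lambda>s. 0) has_vector_derivative (L0 t (M' (Suc j) * M j t + M (Suc j) t * M' j) + Ld (M (Suc j) t * M j t))) (at t)"
      using dL[of "Suc j" j] I has_vector_derivative_transform_within_open by (metis (no_types, lifting))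
    hence "L0 t (M' (Suc j) * M j t + M (Suc j) t * M' j) + Ld (M (Suc j) t * M j t) = 0"
      using has_vector_derivative_const vector_derivative_unique_at by blast
    hence c1: "L0 t (M j t * M' (Suc j)) = - Ld (M (Suc j) t * M j t)"
      using LMM'[of j "Suc j"] by (simp add: lint mult.commute add_eq_0_iff)
    have c2: "L0 t (M j t * M' (Suc j)) = coeff (M' (Suc j)) j / (\<mu> t * (\<gamma> t j)\<^sup>2)"
    proof -
      have "degree (M' (Suc j)) \<le> j"
        using M'0[of "Suc j"] by (intro degree_le) auto
      thus ?thesis unfolding LM[OF I(2)]
        using ofam_top[OF P[OF I(2)]] by (simp add: \<gamma>_def power2_eq_square)
    qed
    have c3: "Ld (M (Suc j) t * M j t) = Ld (P t (Suc j) * P t j) / (\<gamma> t (Suc j) * \<gamma> t j)"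
      by (simp add: MP[OF I(2)] lind)
    have "coeff (M' (Suc j)) j = - (Ld (P t (Suc j) * P t j) / (\<gamma> t (Suc j) * \<gamma> t j)) * (\<mu> t * (\<gamma> t j)\<^sup>2)"
      using c1[unfolded c2 c3] \<gamma>0[OF I(2)] \<mu>0[OF I(2)] by (simp add: divide_eq_eq)
    also have "\<dots> = - (cc * (\<mu> t * Ld (P t (Suc j) * P t j)))"
      using \<gamma>0[OF I(2)] by (simp add: cc_def acf[OF I(2)] power2_eq_square)
    also have "cc * (\<mu> t * Ld (P t (Suc j) * P t j)) = S (Suc j) - 1/2 * (\<Sum>k<m. \<alpha> k * v k)"
    proof -
      \<comment> \<open>\<open>Omega_at\<close> is symmetric in j and j + 1, while the derivative
        produces only q_(j+1) p_j. The defect 1/a_(j+1) of the symmetrisation is the origin of the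
        constant 1/2 times the sum of alpha_k v_k, which drops out of b_n.\<close>
      have q: "qval (L t) (P t) j (x k) * poly (P t (Suc j)) (x k) = qval (L t) (P t) (Suc j) (x k) * poly (P t j) (x k) - 1 / cc" for k
        using qval_product[OF P[OF I(2)], of "Suc j" "x k"] by (simp add: cc_def)
      have "S (Suc j) = (\<Sum>k<m. cc * (poly (P t (Suc j)) (x k) * poly (P t j) (x k) * ucoef m \<alpha> x (L t) k * w k)
          - cc * (\<alpha> k * (w k * poly (Wdel m x k) (x k)) * (qval (L t) (P t) (Suc j) (x k) * poly (P t j) (x k)))
          + 1/2 * (\<alpha> k * (w k * poly (Wdel m x k) (x k))))"
        unfolding S_def Omega_at_def cc_def[symmetric] diff_Suc_1 q using cc
        by (intro sum.cong refl) (simp add: field_simps)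
      also have "\<dots> = (\<Sum>k<m. cc * (poly (P t (Suc j)) (x k) * poly (P t j) (x k) * ucoef m \<alpha> x (L t) k * w k)
          - cc * (\<alpha> k * v k * (qval (L t) (P t) (Suc j) (x k) * poly (P t j) (x k))) + 1/2 * (\<alpha> k * v k))"
        by (intro sum.cong refl) (simp add: wW)
      finally show ?thesis
        unfolding mainP using qval_product(1)[OF P[OF I(2)], of "Suc j"] PD(5)[of "Suc j" j]
        by (simp add: sum.distrib sum_subtractf sum_distrib_left algebra_simps)
    qed
    finally show ?thesis by simp
  qed
  \<comment> \<open>Comparison of the coefficients of z^n in the recurrence for M (n+1).\<close>
  have beq: "bcoef (P s) n = coeff (M n s) n' - coeff (M (Suc n) s) n" for s
    using degree_mono_rec[of "acoef (P s)" "bcoef (P s)" n'] degree_mono_rec[of "acoef (P s)" "bcoef (P s)" "Suc n'"]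
    by (simp add: M_def n' coeff_eq_0)
  have "((\<lambda>s. bcoef (P s) n) has_vector_derivative (coeff (M' n) n' - coeff (M' (Suc n)) n)) (at t)"
    unfolding beq by (intro has_vector_derivative_diff cM)
  hence "vector_derivative (\<lambda>s. bcoef (P s) n) (at t) = coeff (M' n) n' - coeff (M' (Suc n)) n"
    by (rule vector_derivative_at)
  also have "\<dots> = S (Suc n) - S n" using S[of n'] S[of n] by (simp add: n')
  finally show "vector_derivative (\<lambda>s. bcoef (P s) n) (at t) =
      (\<Sum>k<m. (Omega_at m \<alpha> x (L t) (P t) (Suc n) k - Omega_at m \<alpha> x (L t) (P t) n k) * v k / poly (Wdel m x k) (x k))"
    unfolding S_def sum_subtractf[symmetric] w_def by (simp add: algebra_simps diff_divide_distrib)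
qed

subsection \<open>A weighted arc\<close>

lemma has_vector_derivative_const_field_comp:
  fixes f :: "complex \<Rightarrow> complex"
  assumes "(g has_vector_derivative g') (at s)" "(f has_field_derivative f') (at (g s))"
  shows "((\<lambda>s. f (g s)) has_vector_derivative f' * g') (at s)"
  using field_vector_diff_chain_at[OF assms] by (simp add: o_def mult.commute)

text \<open>Near s the logarithm stays within pi of its value at s, so it coincides there with l s +
  Ln (y / y s) for the principal branch and inherits its derivative.\<close>

lemma continuous_log_has_derivative:
  fixes l y :: "real \<Rightarrow> complex"
  assumes T: "open T" "s \<in> T" and l: "continuous_on T l" and ey: "\<And>s. s \<in> T \<Longrightarrow> exp (l s) = y s"
    and y: "(y has_vector_derivative y') (at s)"
  shows "(l has_vector_derivative y' / y s) (at s)"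
proof -
  have ys: "y s \<noteq> 0" using ey[OF T(2)] by (metis exp_not_eq_zero)
  have "isCont l s" using l T by (simp add: continuous_on_eq_continuous_at)
  hence "eventually (\<lambda>s'. dist (l s') (l s) < pi) (at s)"
    unfolding isCont_def tendsto_iff using pi_gt_zero by blast
  then obtain d where d: "d > 0" "\<And>s'. s' \<noteq> s \<Longrightarrow> dist s' s < d \<Longrightarrow> dist (l s') (l s) < pi"
    unfolding eventually_at by auto
  let ?U = "ball s d \<inter> T"
  have eq: "l s + Ln (y s' / y s) = l s'" if "s' \<in> ?U" for s'
  proof -
    have "dist (l s') (l s) < pi" using d(2)[of s'] that pi_gt_zero by (cases "s' = s") (auto simp: dist_commute)
    hence "\<bar>Im (l s' - l s)\<bar> < pi" using abs_Im_le_cmod[of "l s' - l s"] by (simp add: dist_norm)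
    moreover have "y s' / y s = exp (l s' - l s)" using ey that T(2) by (simp add: exp_diff)
    ultimately show ?thesis by simp
  qed
  have "((\<lambda>z. l s + Ln (z / y s)) has_field_derivative 1 / y s) (at (y s))"
    using ys by (auto intro!: derivative_eq_intros)
  hence "((\<lambda>s'. l s + Ln (y s' / y s)) has_vector_derivative 1 / y s * y') (at s)"
    by (rule has_vector_derivative_const_field_comp[OF y])
  hence "(l has_vector_derivative 1 / y s * y') (at s)"
    by (rule has_vector_derivative_transform_within_open[where S = ?U]) (use T d eq in auto)
  thus ?thesis by simp
qed

text \<open>The values lie in 2 pi i Z, whose points are at mutual distance at least 2 pi; a
  continuous function on a connected set cannot jump between them.\<close>

lemma exp_continuous_eq_const:
  fixes h :: "'a::topological_space \<Rightarrow> complex"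
  assumes "connected T" "continuous_on T h" "\<And>s. s \<in> T \<Longrightarrow> exp (h s) = 1" "a \<in> T" "b \<in> T"
  shows "h a = h b"
proof -
  have "h constant_on T"
  proof (rule continuous_discrete_range_constant[OF assms(1,2)])
    fix s assume s: "s \<in> T"
    show "\<exists>e>0. \<forall>y. y \<in> T \<and> h y \<noteq> h s \<longrightarrow> e \<le> norm (h y - h s)"
    proof (intro exI[of _ "2 * pi"] conjI allI impI)
      fix y assume y: "y \<in> T \<and> h y \<noteq> h s"
      obtain n m where n: "Im (h y) = of_int (2 * n) * pi" "Re (h y) = 0"
        and m: "Im (h s) = of_int (2 * m) * pi" "Re (h s) = 0"
        using assms(3)[OF s, unfolded exp_eq_1] assms(3)[of y, unfolded exp_eq_1] y by blast
      have nm: "h y = of_int (2 * n) * pi * \<i>" "h s = of_int (2 * m) * pi * \<i>"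
        using n m by (auto simp: complex_eq_iff)
      have "h y - h s = of_real (2 * pi * of_int (n - m)) * \<i>" by (simp add: nm algebra_simps)
      hence "norm (h y - h s) = 2 * pi * \<bar>real_of_int (n - m)\<bar>"
        by (simp only: norm_mult norm_of_real norm_ii) (simp add: abs_mult)
      moreover have "n \<noteq> m" using y nm by auto
      hence "\<bar>real_of_int (n - m)\<bar> \<ge> 1" by linarith
      ultimately show "2 * pi \<le> norm (h y - h s)" by simp
    qed simp
  qed
  thus ?thesis using assms(4,5) by (auto simp: constant_on_def)
qed

text \<open>For \<open>\<kappa> s = s\<^sup>\<beta>\<close> the function \<open>(z - p)\<^bsup>1+\<beta>\<^esup> Hf \<kappa> p g z\<close> is a primitive of \<open>(z - p)\<^sup>\<beta> g z\<close>.\<close>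

definition Hf :: "(real \<Rightarrow> complex) \<Rightarrow> complex \<Rightarrow> (complex \<Rightarrow> complex) \<Rightarrow> complex \<Rightarrow> complex" where
  "Hf \<kappa> p g z = integral {0..1} (\<lambda>s. \<kappa> s * g (p + of_real s * (z - p)))"

text \<open>Captures s^beta by its differential equation, so that the regular case (beta = 0,
  constant kernel 1) and the singular case share all proofs. The expression \<open>powr\<close>
  alone would not do, because \<open>0 powr 0\<close> is 0 and continuity at 0 would fail for beta =
  0.\<close>

definition is_kernel :: "(real \<Rightarrow> complex) \<Rightarrow> complex \<Rightarrow> bool" where
  "is_kernel \<kappa> \<beta> \<longleftrightarrow> continuous_on {0..1} \<kappa> \<and> \<kappa> 1 = 1 \<and>
     (\<forall>s\<in>{0<..<1}. ((\<lambda>s. of_real s * \<kappa> s) has_vector_derivative (1 + \<beta>) * \<kappa> s) (at s))"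

lemma is_kernel_1: "is_kernel (\<lambda>_. 1) 0"
  unfolding is_kernel_def by (auto intro!: has_vector_derivative_real_field derivative_eq_intros)

lemma is_kernel_powr:
  assumes "Re \<beta> > 0" shows "is_kernel (\<lambda>s. of_real s powr \<beta>) \<beta>"
  unfolding is_kernel_def
proof (intro conjI ballI)
  show "continuous_on {0..1} (\<lambda>s. complex_of_real s powr \<beta>)"
    using assms by (intro continuous_on_powr_complex continuous_intros) auto
  fix s :: real assume s: "s \<in> {0<..<1}"
  have "((\<lambda>z. z powr \<beta>) has_field_derivative \<beta> * of_real s powr (\<beta> - 1)) (at (complex_of_real s))"
    using s by (intro has_field_derivative_powr) (auto simp: complex_nonpos_Reals_iff)
  from DERIV_mult[OF DERIV_ident this]
  have "((\<lambda>z. z * z powr \<beta>) has_field_derivative 1 * of_real s powr \<beta> + (\<beta> * of_real s powr (\<beta> - 1)) * of_real s) (at (of_real s))" .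
  moreover have "of_real s powr (\<beta> - 1) * complex_of_real s = of_real s powr \<beta>"
    using s by (simp add: powr_def left_diff_distrib exp_diff)
  ultimately have "((\<lambda>z. z * z powr \<beta>) has_field_derivative (1 + \<beta>) * of_real s powr \<beta>) (at (of_real s))"
    by (simp add: algebra_simps)
  thus "((\<lambda>s. of_real s * of_real s powr \<beta>) has_vector_derivative (1 + \<beta>) * of_real s powr \<beta>) (at s)"
    by (rule has_vector_derivative_real_field)
qed simp

text \<open>Differentiation under the integral gives the derivative. The equation (1 + beta) H + (z
  - p) H' = g follows by integrating the derivative of s kappa(s) g(p + s (z - p)) over [0, 1]: the
  boundary value is g z at 1 and 0 at 0.\<close>

lemma
  assumes S: "open S" "\<forall>z\<in>S. closed_segment p z \<subseteq> S" and g: "g holomorphic_on S" and \<kappa>: "is_kernel \<kappa> \<beta>"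
  shows Hf_has_derivative: "z \<in> S \<Longrightarrow> (Hf \<kappa> p g has_field_derivative integral {0..1} (\<lambda>s. \<kappa> s * (of_real s * deriv g (p + of_real s * (z - p))))) (at z)"
    and Hf_ode: "z \<in> S \<Longrightarrow> (1 + \<beta>) * Hf \<kappa> p g z + (z - p) * deriv (Hf \<kappa> p g) z = g z"
proof -
  have seg: "p + of_real s * (z - p) \<in> S" if "z \<in> S" "s \<in> {0..1}" for z s
  proof -
    have "p + of_real s * (z - p) = (1 - s) *\<^sub>R p + s *\<^sub>R z" by (simp add: scaleR_conv_of_real algebra_simps)
    thus ?thesis using S(2) that by (auto simp: closed_segment_def)
  qed
  have ck: "continuous_on {0..1} \<kappa>" using \<kappa> by (simp add: is_kernel_def)
  have cg: "continuous_on S g" "continuous_on S (deriv g)"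
    using g S(1) holomorphic_deriv holomorphic_on_imp_continuous_on by blast+
  have dg: "(g has_field_derivative deriv g y) (at y)" if "y \<in> S" for y
    using g S(1) that holomorphic_derivI by blast
  show D: "(Hf \<kappa> p g has_field_derivative integral {0..1} (\<lambda>s. \<kappa> s * (of_real s * deriv g (p + of_real s * (z - p))))) (at z)"
    if z: "z \<in> S" for z
  proof -
    obtain r where r: "r > 0" "ball z r \<subseteq> S" using S(1) z openE by blast
    have "((\<lambda>z. integral (cbox 0 1) (\<lambda>s. \<kappa> s * g (p + of_real s * (z - p)))) has_field_derivative
        integral (cbox 0 1) (\<lambda>s. \<kappa> s * (of_real s * deriv g (p + of_real s * (z - p))))) (at z within ball z r)"
    proof (rule leibniz_rule_field_derivative)
      fix y :: complex and s :: real assume y: "y \<in> ball z r" and s: "s \<in> cbox 0 1"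
      have "((\<lambda>y. g (p + of_real s * (y - p))) has_field_derivative deriv g (p + of_real s * (y - p)) * of_real s) (at y)"
        using r y s by (intro DERIV_chain2[OF dg]) (auto intro!: seg derivative_eq_intros)
      from DERIV_cmult[OF this, of "\<kappa> s"]
      show "((\<lambda>y. \<kappa> s * g (p + of_real s * (y - p))) has_field_derivative \<kappa> s * (of_real s * deriv g (p + of_real s * (y - p)))) (at y within ball z r)"
        by (simp add: mult.commute has_field_derivative_at_within)
    next
      fix y assume "y \<in> ball z r"
      thus "(\<lambda>s. \<kappa> s * g (p + of_real s * (y - p))) integrable_on cbox 0 1"
        using r seg by (intro integrable_continuous continuous_intros) (auto intro!: ck continuous_on_compose2[OF cg(1)] continuous_intros)
    next
      show "continuous_on (ball z r \<times> cbox 0 1) (\<lambda>(y, s). \<kappa> s * (of_real s * deriv g (p + of_real s * (y - p))))"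
        unfolding case_prod_unfold using r seg
        by (intro continuous_intros continuous_on_compose2[OF cg(2)] continuous_on_compose2[OF ck]) auto
    qed (use r in auto)
    thus ?thesis unfolding Hf_def[abs_def] using r at_within_open[of z "ball z r"] by simp
  qed
  show "(1 + \<beta>) * Hf \<kappa> p g z + (z - p) * deriv (Hf \<kappa> p g) z = g z" if z: "z \<in> S"
  proof -
    let ?y = "\<lambda>s. p + complex_of_real s * (z - p)"
    have "((\<lambda>s. (of_real s * \<kappa> s) * (deriv g (?y s) * (z - p)) + (1 + \<beta>) * \<kappa> s * g (?y s)) has_integral
        ((of_real 1 * \<kappa> 1) * g (?y 1) - (of_real 0 * \<kappa> 0) * g (?y 0))) {0..1}"
    proof (rule fundamental_theorem_of_calculus_interior)
      show "continuous_on {0..1} (\<lambda>s. of_real s * \<kappa> s * g (?y s))"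
        using seg z by (intro continuous_intros ck continuous_on_compose2[OF cg(1)]) auto
      fix s :: real assume s: "s \<in> {0<..<1}"
      have y: "(?y has_vector_derivative (z - p)) (at s)"
        by (auto intro!: has_vector_derivative_real_field derivative_eq_intros)
      show "((\<lambda>s. of_real s * \<kappa> s * g (?y s)) has_vector_derivative
          (of_real s * \<kappa> s) * (deriv g (?y s) * (z - p)) + (1 + \<beta>) * \<kappa> s * g (?y s)) (at s)"
        using s \<kappa> z seg
        by (intro has_vector_derivative_mult has_vector_derivative_const_field_comp[OF y] dg) (auto simp: is_kernel_def)
    qed simp
    hence 1: "((\<lambda>s. (of_real s * \<kappa> s) * (deriv g (?y s) * (z - p)) + (1 + \<beta>) * \<kappa> s * g (?y s)) has_integral g z) {0..1}"
      using \<kappa> by (simp add: is_kernel_def)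
    have i1: "((\<lambda>s. \<kappa> s * g (?y s)) has_integral Hf \<kappa> p g z) {0..1}"
      unfolding Hf_def using seg z
      by (intro integrable_integral integrable_continuous_real continuous_intros ck continuous_on_compose2[OF cg(1)]) auto
    have i2: "((\<lambda>s. \<kappa> s * (of_real s * deriv g (?y s))) has_integral deriv (Hf \<kappa> p g) z) {0..1}"
      unfolding DERIV_imp_deriv[OF D[OF z]] using seg z
      by (intro integrable_integral integrable_continuous_real continuous_intros ck continuous_on_compose2[OF cg(2)]) auto
    have "((\<lambda>s. (1 + \<beta>) * (\<kappa> s * g (?y s)) + (z - p) * (\<kappa> s * (of_real s * deriv g (?y s)))) has_integral
       ((1 + \<beta>) * Hf \<kappa> p g z + (z - p) * deriv (Hf \<kappa> p g) z)) {0..1}"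
      by (intro has_integral_add has_integral_mult_right i1 i2)
    note A = this
    have "(\<lambda>s. (1 + \<beta>) * (\<kappa> s * g (?y s)) + (z - p) * (\<kappa> s * (of_real s * deriv g (?y s))))
       = (\<lambda>s. (of_real s * \<kappa> s) * (deriv g (?y s) * (z - p)) + (1 + \<beta>) * \<kappa> s * g (?y s))"
      by (rule ext) (simp add: algebra_simps)
    from has_integral_unique[OF A[unfolded this] 1] show ?thesis .
  qed
qed

text \<open>The constant bounds the kernel alone and does not depend on g. This uniformity is what
  later estimates for varying test functions rest on.\<close>

lemma Hf_bound:
  assumes S: "\<forall>z\<in>S. closed_segment p z \<subseteq> S" and \<kappa>: "is_kernel \<kappa> \<beta>"
  obtains C where "C \<ge> 0" "\<And>g M z. continuous_on S g \<Longrightarrow> (\<And>z. z \<in> S \<Longrightarrow> norm (g z) \<le> M) \<Longrightarrow> z \<in> S \<Longrightarrow> norm (Hf \<kappa> p g z) \<le> C * M"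
proof -
  have ck: "continuous_on {0..1} \<kappa>" using \<kappa> by (simp add: is_kernel_def)
  hence "compact (\<kappa> ` {0..1})" using compact_continuous_image by blast
  then obtain C where C: "\<And>s. s \<in> {0..1} \<Longrightarrow> norm (\<kappa> s) \<le> C" "C > 0"
    using compact_imp_bounded bounded_pos by (metis (no_types, lifting) image_eqI)
  have "norm (Hf \<kappa> p g z) \<le> C * M" if g: "continuous_on S g" and M: "\<And>z. z \<in> S \<Longrightarrow> norm (g z) \<le> M" and z: "z \<in> S" for g M z
  proof -
    have seg: "p + of_real s * (z - p) \<in> S" if "s \<in> {0..1}" for s
    proof -
      have "p + of_real s * (z - p) = (1 - s) *\<^sub>R p + s *\<^sub>R z" by (simp add: scaleR_conv_of_real algebra_simps)
      thus ?thesis using S z that by (auto simp: closed_segment_def)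
    qed
    have "norm (\<kappa> s * g (p + of_real s * (z - p))) \<le> C * M" if "s \<in> {0..1}" for s
      unfolding norm_mult using C M[OF seg[OF that]] that by (intro mult_mono) (auto intro: order_less_imp_le)
    moreover have "(\<lambda>s. \<kappa> s * g (p + of_real s * (z - p))) integrable_on {0..1}"
      using seg by (intro integrable_continuous_real continuous_intros ck continuous_on_compose2[OF g]) auto
    ultimately show ?thesis unfolding Hf_def
      using has_integral_bound[of "C * M" "\<lambda>s. \<kappa> s * g (p + of_real s * (z - p))" _ 0 1] C(2) M[OF z] norm_ge_zero[of "g z"]
      by (auto simp: has_integral_integral)
  qed
  thus ?thesis using that C(2) by (meson less_imp_le)
qed

text \<open>The logarithms of z - x_k are lifted to the open parameter interval, since at the end
  points the arc reaches one of the x_k. The finite set \<open>brk\<close> holds the parameters at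
  which the path may fail to be differentiable.\<close>

locale weighted_arc =
  fixes m :: nat and x \<alpha> :: "nat \<Rightarrow> complex" and \<gamma> :: "real \<Rightarrow> complex" and w :: "complex \<Rightarrow> complex"
    and brk :: "real set" and ell :: "nat \<Rightarrow> real \<Rightarrow> complex"
  assumes x_inj: "inj_on x {..<m}" and nonint: "\<And>k. k < m \<Longrightarrow> \<alpha> k \<notin> \<int>"
    and path: "path \<gamma>" and fin_brk: "finite brk"
    and dgam: "\<And>s. s \<in> {0<..<1} - brk \<Longrightarrow> (\<gamma> has_vector_derivative vector_derivative \<gamma> (at s)) (at s)"
    and ends: "\<And>a. a \<in> {0, 1} \<Longrightarrow> \<gamma> a \<in> x ` {..<m}"
    and ell_cont: "\<And>k. k < m \<Longrightarrow> continuous_on {0<..<1} (ell k)"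
    and exp_ell: "\<And>k s. k < m \<Longrightarrow> s \<in> {0<..<1} \<Longrightarrow> exp (ell k s) = \<gamma> s - x k"
    and w_ell: "\<And>s. s \<in> {0<..<1} \<Longrightarrow> w (\<gamma> s) = (\<Prod>k<m. exp (\<alpha> k * ell k s))"
    and moments: "\<And>j. (\<lambda>z. z ^ j * w z) contour_integrable_on \<gamma>"
begin

abbreviation dg where "dg s \<equiv> vector_derivative \<gamma> (at s)"

text \<open>The weight with raised exponents along the arc. Separate exponents N k serve three uses:
  all 1 for W w, all N for W^N w, and exponents raised only at the ends of the arc, which keeps
  \<open>EN\<close> free of zeros off the arc.\<close>

definition wN :: "(nat \<Rightarrow> nat) \<Rightarrow> real \<Rightarrow> complex" where
  "wN N s = (\<Prod>k<m. exp ((\<alpha> k + of_nat (N k)) * ell k s))"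

definition EN :: "(nat \<Rightarrow> nat) \<Rightarrow> complex poly" where
  "EN N = (\<Prod>k<m. [:- x k, 1:] ^ N k)"

lemma poly_EN: "poly (EN N) z = (\<Prod>k<m. (z - x k) ^ N k)"
  by (simp add: EN_def poly_prod)

lemma wN_eq:
  assumes s: "s \<in> {0<..<1}" shows "poly (EN N) (\<gamma> s) * w (\<gamma> s) = wN N s"
proof -
  have "(\<gamma> s - x k) ^ N k * exp (\<alpha> k * ell k s) = exp ((\<alpha> k + of_nat (N k)) * ell k s)" if "k < m" for k
    unfolding exp_ell[OF that s, symmetric] exp_of_nat_mult[symmetric] exp_add[symmetric]
    by (simp add: algebra_simps)
  thus ?thesis unfolding wN_def poly_EN w_ell[OF s] prod.distrib[symmetric] by (intro prod.cong) auto
qed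

lemma avoid: "k < m \<Longrightarrow> s \<in> {0<..<1} \<Longrightarrow> \<gamma> s \<noteq> x k"
  using exp_ell exp_not_eq_zero by (metis right_minus_eq)

lemma gam_cont: "continuous_on {0..1} \<gamma>"
  using path by (simp add: path_def)

lemma dell:
  assumes "k < m" "s \<in> {0<..<1} - brk"
  shows "(ell k has_vector_derivative dg s / (\<gamma> s - x k)) (at s)"
proof -
  have "((\<lambda>s. \<gamma> s - x k) has_vector_derivative dg s) (at s)"
    using has_vector_derivative_diff[OF dgam[OF assms(2)] has_vector_derivative_const[of "x k"]] by simp
  from continuous_log_has_derivative[OF _ _ ell_cont exp_ell this] assms show ?thesis by auto
qed

lemma dexp_ell:
  assumes "A \<subseteq> {..<m}" "s \<in> {0<..<1} - brk"
  shows "((\<lambda>s. \<Prod>k\<in>A. exp (c k * ell k s)) has_vector_derivative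
     (\<Prod>k\<in>A. exp (c k * ell k s)) * ((\<Sum>k\<in>A. c k / (\<gamma> s - x k)) * dg s)) (at s)"
proof -
  have f: "finite A" using assms(1) finite_subset by blast
  have "((\<lambda>s. \<Sum>k\<in>A. c k * ell k s) has_vector_derivative (\<Sum>k\<in>A. c k * (dg s / (\<gamma> s - x k)))) (at s)"
    using assms by (intro has_vector_derivative_sum has_vector_derivative_mult_right dell) auto
  from has_vector_derivative_const_field_comp[OF this DERIV_exp]
  have "((\<lambda>s. exp (\<Sum>k\<in>A. c k * ell k s)) has_vector_derivative
     exp (\<Sum>k\<in>A. c k * ell k s) * (\<Sum>k\<in>A. c k * (dg s / (\<gamma> s - x k)))) (at s)" .
  moreover have "(\<Sum>k\<in>A. c k * (dg s / (\<gamma> s - x k))) = (\<Sum>k\<in>A. c k / (\<gamma> s - x k)) * dg s"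
    by (simp add: sum_distrib_right)
  ultimately show ?thesis by (simp add: exp_sum[OF f])
qed

lemma exp_ell_cont: "A \<subseteq> {..<m} \<Longrightarrow> continuous_on {0<..<1} (\<lambda>s. \<Prod>k\<in>A. exp (c k * ell k s))"
  using ell_cont by (intro continuous_intros) auto

lemma contour_integral_iff:
  "((\<lambda>u. \<phi> u * (poly (EN N) u * w u)) has_contour_integral v) \<gamma> \<longleftrightarrow>
     ((\<lambda>s. \<phi> (\<gamma> s) * wN N s * dg s) has_integral v) {0..1}"
  unfolding has_contour_integral
  by (rule has_integral_spike_finite_eq[of "{0,1}"]) (auto simp: wN_eq)

lemma poly_integrable: "(\<lambda>u. poly p u * w u) contour_integrable_on \<gamma>"
proof -
  have "(\<lambda>u. (\<Sum>j\<le>degree p. coeff p j * (u ^ j * w u))) contour_integrable_on \<gamma>"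
    by (intro contour_integrable_sum contour_integrable_lmul moments) auto
  thus ?thesis by (simp add: poly_altdef sum_distrib_right mult.assoc)
qed

definition Lg :: "complex poly \<Rightarrow> complex" where
  "Lg p = contour_integral \<gamma> (\<lambda>u. poly p u * w u)"

lemma plin_Lg: "plin Lg"
proof (rule plinI)
  show "Lg (p + q) = Lg p + Lg q" for p q
    unfolding Lg_def by (simp add: distrib_right contour_integral_add poly_integrable)
  show "Lg (smult c p) = c * Lg p" for c p
    unfolding Lg_def using contour_integral_lmul[OF poly_integrable, of c p] by (simp add: mult.assoc)
qed

lemma ftc_local:
  fixes F f :: "real \<Rightarrow> complex"
  assumes T: "is_interval T" "T \<subseteq> {0..1}" and F: "continuous_on T F"
    and dF: "\<And>s. s \<in> T \<inter> {0<..<1} - brk \<Longrightarrow> (F has_vector_derivative f s) (at s)"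
    and s: "s \<in> T" "s' \<in> T" "s \<le> s'"
  shows "(f has_integral F s' - F s) {s..s'}"
proof (rule fundamental_theorem_of_calculus_interior_strong[OF fin_brk s(3)])
  have sub: "{s..s'} \<subseteq> T" using mem_is_interval_1_I[OF T(1) s(1,2)] by auto
  show "continuous_on {s..s'} F" using F sub continuous_on_subset by blast
  show "(F has_vector_derivative f u) (at u)" if "u \<in> {s<..<s'} - brk" for u
    using that sub T(2) s by (intro dF) auto
qed

text \<open>F is extended to the closed interval by its limits; the primitives in use are products
  of powers of logarithms that exist only for parameters inside the interval.\<close>

lemma ftc_ends:
  fixes F f :: "real \<Rightarrow> complex"
  assumes F: "continuous_on {0<..<1} F"
    and dF: "\<And>s. s \<in> {0<..<1} - brk \<Longrightarrow> (F has_vector_derivative f s) (at s)"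
    and lim: "(F \<longlongrightarrow> A) (at 0 within {0<..<1})" "(F \<longlongrightarrow> B) (at 1 within {0<..<1})"
  shows "(f has_integral B - A) {0..1}"
proof -
  define G where "G s = (if s = 0 then A else if s = 1 then B else F s)" for s
  have G: "continuous_on {0..1} G"
    unfolding continuous_on_def
  proof
    fix s :: real assume s: "s \<in> {0..1}"
    have ins: "{0..1::real} - {0,1} = {0<..<1}" by auto
    consider "s = 0" | "s = 1" | "s \<in> {0<..<1}" using s by fastforce
    thus "(G \<longlongrightarrow> G s) (at s within {0..1})"
    proof cases
      case 1
      have "(G \<longlongrightarrow> A) (at 0 within {0<..<1})"
        using lim(1) by (rule Lim_transform_within[of _ _ _ _ 1]) (auto simp: G_def)
      moreover have "at (0::real) within {0..1} = at 0 within {0<..<1}"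
        by (rule at_within_nhd[of _ "{..<1}"]) auto
      ultimately show ?thesis using 1 by (simp add: G_def)
    next
      case 2
      have "(G \<longlongrightarrow> B) (at 1 within {0<..<1})"
        using lim(2) by (rule Lim_transform_within[of _ _ _ _ 1]) (auto simp: G_def)
      moreover have "at (1::real) within {0..1} = at 1 within {0<..<1}"
        by (rule at_within_nhd[of _ "{0<..}"]) auto
      ultimately show ?thesis using 2 by (simp add: G_def)
    next
      case 3
      have "(F \<longlongrightarrow> F s) (at s within {0<..<1})" using F 3 by (simp add: continuous_on_def)
      hence "(G \<longlongrightarrow> F s) (at s within {0<..<1})"
        by (rule Lim_transform_within[of _ _ _ _ 1]) (auto simp: G_def)
      moreover have "at s within {0..1} = at s within {0<..<1}"
        by (rule at_within_nhd[of _ "{0<..<1}"]) (use 3 in auto)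
      ultimately show ?thesis using 3 by (auto simp: G_def)
    qed
  qed
  have "(f has_integral G 1 - G 0) {0..1}"
  proof (rule ftc_local[OF _ _ G])
    fix s assume s: "s \<in> {0..1} \<inter> {0<..<1} - brk"
    show "(G has_vector_derivative f s) (at s)"
      by (rule has_vector_derivative_transform_within_open[OF dF, of s "{0<..<1}"]) (use s in \<open>auto simp: G_def\<close>)
  qed auto
  thus ?thesis by (simp add: G_def)
qed

text \<open>A neighbourhood, star-shaped about p, on which the weight is (z - p)^beta times a
  zero-free holomorphic function: J is the index of the singular point at the centre, if there is
  one, and all other z - x_l have holomorphic logarithms. The function \<open>cg\<close> is the
  zero-free factor.\<close>

definition chart :: "complex set \<Rightarrow> complex \<Rightarrow> nat set \<Rightarrow> (nat \<Rightarrow> complex \<Rightarrow> complex) \<Rightarrow> bool" where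
  "chart D p J lam \<longleftrightarrow> open D \<and> p \<in> D \<and> (\<forall>z\<in>D. closed_segment p z \<subseteq> D) \<and> J \<subseteq> {..<m}
     \<and> (J = {} \<or> (\<exists>k. J = {k} \<and> p = x k))
     \<and> (\<forall>l\<in>{..<m}-J. lam l holomorphic_on D \<and> (\<forall>z\<in>D. exp (lam l z) = z - x l))"

definition cg :: "(nat \<Rightarrow> nat) \<Rightarrow> nat set \<Rightarrow> (nat \<Rightarrow> complex \<Rightarrow> complex) \<Rightarrow> complex \<Rightarrow> complex" where
  "cg N J lam z = (\<Prod>l\<in>{..<m}-J. exp ((\<alpha> l + of_nat (N l)) * lam l z))"

lemma cg_holomorphic: "chart D p J lam \<Longrightarrow> cg N J lam holomorphic_on D"
  unfolding cg_def[abs_def] by (intro holomorphic_intros) (auto simp: chart_def)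

lemma cg_nz: "cg N J lam z \<noteq> 0" by (simp add: cg_def)

text \<open>On a connected parameter set the carried logarithms \<open>ell\<close> and those of the
  chart differ by constants from 2 pi i Z; C collects the resulting constant factor.\<close>

lemma chart_factor:
  assumes ch: "chart D p J lam" and T: "T \<subseteq> {0<..<1}" "connected T" "T \<noteq> {}" "\<gamma> ` T \<subseteq> D"
  obtains C where "C \<noteq> 0" "\<And>s. s \<in> T \<Longrightarrow> wN N s = (C * (\<Prod>l\<in>J. exp ((\<alpha> l + of_nat (N l)) * ell l s))) * cg N J lam (\<gamma> s)"
proof -
  obtain s0 where s0: "s0 \<in> T" using T(3) by blast
  define c where "c l = ell l s0 - lam l (\<gamma> s0)" for l
  have c: "ell l s = c l + lam l (\<gamma> s)" if l: "l \<in> {..<m} - J" and s: "s \<in> T" for l s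
  proof -
    have "ell l s - lam l (\<gamma> s) = ell l s0 - lam l (\<gamma> s0)"
    proof (rule exp_continuous_eq_const[OF T(2), of "\<lambda>s. ell l s - lam l (\<gamma> s)"])
      have "continuous_on D (lam l)" using ch l by (auto simp: chart_def intro: holomorphic_on_imp_continuous_on)
      moreover have "continuous_on T \<gamma>" using T(1) by (intro continuous_on_subset[OF gam_cont]) auto
      ultimately show "continuous_on T (\<lambda>s. ell l s - lam l (\<gamma> s))"
        using T l by (intro continuous_intros continuous_on_compose2[of D "lam l" T \<gamma>] continuous_on_subset[OF ell_cont]) auto
      fix s assume s: "s \<in> T"
      have "\<forall>l\<in>{..<m}-J. \<forall>z\<in>D. exp (lam l z) = z - x l" using ch by (simp add: chart_def)
      hence "exp (lam l (\<gamma> s)) = \<gamma> s - x l" using l s T(4) by blast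
      moreover have "exp (ell l s) = \<gamma> s - x l" using exp_ell l s T(1) by auto
      moreover have "\<gamma> s \<noteq> x l" using avoid l s T(1) by auto
      ultimately show "exp (ell l s - lam l (\<gamma> s)) = 1" by (simp add: exp_diff)
    qed (use s s0 in auto)
    thus ?thesis by (simp add: c_def algebra_simps)
  qed
  define C where "C = (\<Prod>l\<in>{..<m}-J. exp ((\<alpha> l + of_nat (N l)) * c l))"
  have J: "J \<subseteq> {..<m}" using ch by (simp add: chart_def)
  have "wN N s = (C * (\<Prod>l\<in>J. exp ((\<alpha> l + of_nat (N l)) * ell l s))) * cg N J lam (\<gamma> s)" if s: "s \<in> T" for s
  proof -
    have "wN N s = (\<Prod>l\<in>{..<m}-J. exp ((\<alpha> l + of_nat (N l)) * ell l s)) * (\<Prod>l\<in>J. exp ((\<alpha> l + of_nat (N l)) * ell l s))"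
      unfolding wN_def by (rule prod.subset_diff[OF J]) simp
    also have "(\<Prod>l\<in>{..<m}-J. exp ((\<alpha> l + of_nat (N l)) * ell l s)) = C * cg N J lam (\<gamma> s)"
      unfolding C_def cg_def prod.distrib[symmetric] using c s
      by (intro prod.cong) (auto simp: exp_add[symmetric] algebra_simps)
    finally show ?thesis by simp
  qed
  thus ?thesis using that[of C] by (simp add: C_def)
qed

text \<open>Realises the primitive (z - p)^(1+beta) Hf along the arc, with the carried branch
  \<open>e\<close> in place of (z - p)^beta. The equation \<open>Hf_ode\<close> turns the product
  rule into the integrand.\<close>

lemma chart_primitive:
  assumes ch: "chart D p J lam" and T: "T \<subseteq> {0<..<1}"  "\<gamma> ` T \<subseteq> D"
    and e: "e = (\<lambda>s. C * (\<Prod>l\<in>J. exp ((\<alpha> l + of_nat (N l)) * ell l s)))"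
    and wN: "\<And>s. s \<in> T \<Longrightarrow> wN N s = e s * cg N J lam (\<gamma> s)"
    and \<kappa>: "is_kernel \<kappa> (\<Sum>l\<in>J. \<alpha> l + of_nat (N l))" and \<phi>: "\<phi> holomorphic_on D"
  defines "F \<equiv> \<lambda>s. e s * (\<gamma> s - p) * Hf \<kappa> p (\<lambda>z. \<phi> z * cg N J lam z) (\<gamma> s)"
  shows "continuous_on T F" and "s \<in> T - brk \<Longrightarrow> (F has_vector_derivative \<phi> (\<gamma> s) * wN N s * dg s) (at s)"
proof -
  let ?g = "\<lambda>z. \<phi> z * cg N J lam z"
  have gh: "?g holomorphic_on D" by (intro holomorphic_intros \<phi> cg_holomorphic[OF ch])
  have D: "open D" "\<forall>z\<in>D. closed_segment p z \<subseteq> D" and J: "J \<subseteq> {..<m}"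
    using ch by (auto simp: chart_def)
  note Hd = Hf_has_derivative[OF D gh \<kappa>] and ode = Hf_ode[OF D gh \<kappa>]
  have gT: "continuous_on T \<gamma>" using T(1) by (intro continuous_on_subset[OF gam_cont]) auto
  have "continuous_on D (Hf \<kappa> p ?g)" using Hd DERIV_isCont by (meson continuous_at_imp_continuous_on)
  hence "continuous_on T (\<lambda>s. Hf \<kappa> p ?g (\<gamma> s))" using gT T(2) continuous_on_compose2 by blast
  moreover have "continuous_on T e" unfolding e
    using exp_ell_cont[OF J] T(1) by (intro continuous_intros continuous_on_subset[OF exp_ell_cont[OF J]]) auto
  ultimately show "continuous_on T F" unfolding F_def by (intro continuous_intros gT)
  assume s: "s \<in> T - brk"
  define b where "b = (\<Sum>l\<in>J. \<alpha> l + of_nat (N l))"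
  define H where "H = Hf \<kappa> p ?g (\<gamma> s)"
  define H' where "H' = deriv (Hf \<kappa> p ?g) (\<gamma> s)"
  define q where "q = (\<Sum>l\<in>J. (\<alpha> l + of_nat (N l)) / (\<gamma> s - x l))"
  have sT: "s \<in> {0<..<1} - brk" "\<gamma> s \<in> D" using s T by auto
  \<comment> \<open>J has at most one index, and then p = x k, so the logarithmic derivative of
    \<open>e\<close> has its only pole at the centre of the chart.\<close>
  have q: "q * (\<gamma> s - p) = b"
  proof -
    consider "J = {}" | k where "J = {k}" "p = x k" using ch by (auto simp: chart_def)
    thus ?thesis
    proof cases
      case 2
      thus ?thesis using avoid[of k s] sT J by (simp add: q_def b_def)
    qed (simp add: q_def b_def)
  qed
  have de: "(e has_vector_derivative e s * (q * dg s)) (at s)"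
    unfolding e q_def using has_vector_derivative_mult_right[OF dexp_ell[OF J sT(1), of "\<lambda>l. \<alpha> l + of_nat (N l)"], of C]
    by (simp add: mult.assoc)
  have dgp: "((\<lambda>s. \<gamma> s - p) has_vector_derivative dg s) (at s)"
    using has_vector_derivative_diff[OF dgam[OF sT(1)] has_vector_derivative_const[of p]] by simp
  have dH: "((\<lambda>s. Hf \<kappa> p ?g (\<gamma> s)) has_vector_derivative H' * dg s) (at s)"
    unfolding H'_def using Hd[OF sT(2)] DERIV_imp_deriv[OF Hd[OF sT(2)]] by (intro has_vector_derivative_const_field_comp dgam sT) auto
  have "(F has_vector_derivative (e s * (\<gamma> s - p)) * (H' * dg s) + (e s * dg s + e s * (q * dg s) * (\<gamma> s - p)) * H) (at s)"
    unfolding F_def H_def by (intro has_vector_derivative_mult de dgp dH)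
  moreover have "(e s * (\<gamma> s - p)) * (H' * dg s) + (e s * dg s + e s * (q * dg s) * (\<gamma> s - p)) * H
      = e s * dg s * ((1 + q * (\<gamma> s - p)) * H + (\<gamma> s - p) * H')" by (simp add: algebra_simps)
  moreover have "\<dots> = e s * dg s * ?g (\<gamma> s)"
    unfolding q using ode[OF sT(2)] by (simp add: H_def H'_def b_def)
  moreover have "\<dots> = \<phi> (\<gamma> s) * wN N s * dg s" using wN s by simp
  ultimately show "(F has_vector_derivative \<phi> (\<gamma> s) * wN N s * dg s) (at s)" by simp
qed

text \<open>In a ball about p that contains no further x_l, the quotient (z - x_l) / (p - x_l) has
  positive real part, so the principal logarithm is available for it.\<close>

lemma chart_at:
  assumes U: "open U" "p \<in> U"
  obtains r lam where "r > 0" "ball p r \<subseteq> U" "\<And>r'. 0 < r' \<Longrightarrow> r' \<le> r \<Longrightarrow> chart (ball p r') p {k. k < m \<and> x k = p} lam"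
proof -
  define J where "J = {k. k < m \<and> x k = p}"
  have "open (U - x ` ({..<m} - J))" using U by (intro open_Diff finite_imp_closed) auto
  moreover have "p \<in> U - x ` ({..<m} - J)" using U by (auto simp: J_def)
  ultimately obtain r where r: "r > 0" "ball p r \<subseteq> U - x ` ({..<m} - J)" using openE by blast
  define lam where "lam l z = Ln (p - x l) + Ln ((z - x l) / (p - x l))" for l z
  have chart: "chart (ball p r') p J lam" if r': "0 < r'" "r' \<le> r" for r'
    unfolding chart_def
  proof (intro conjI ballI)
    show "J = {} \<or> (\<exists>k. J = {k} \<and> p = x k)"
    proof (cases "J = {}")
      case False
      then obtain k where k: "k \<in> J" by blast
      hence "p = x k" "k < m" by (simp_all add: J_def)
      moreover have "J = {k}" using k inj_onD[OF x_inj] unfolding J_def by blast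
      ultimately show ?thesis by blast
    qed simp
    fix z assume z: "z \<in> ball p r'"
    show "closed_segment p z \<subseteq> ball p r'" using z r'(1) by (intro closed_segment_subset convex_ball) auto
  next
    fix l assume l: "l \<in> {..<m} - J"
    have pl: "p \<noteq> x l" using l by (auto simp: J_def)
    have rl: "r \<le> norm (p - x l)" using r(2) l by (auto simp: dist_norm subset_iff not_less)
    have *: "(z - x l) / (p - x l) \<notin> \<real>\<^sub>\<le>\<^sub>0" if "z \<in> ball p r'" for z
    proof -
      have eq: "(z - x l) / (p - x l) = 1 - (p - z) / (p - x l)" using pl by (simp add: field_simps)
      have "norm (p - z) < norm (p - x l)" using that r' rl by (simp add: dist_norm)
      hence "norm ((p - z) / (p - x l)) < 1" using pl by (simp add: norm_divide)
      hence "Re ((p - z) / (p - x l)) < 1" by (meson complex_Re_le_cmod le_less_trans)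
      thus ?thesis unfolding eq by (simp add: complex_nonpos_Reals_iff)
    qed
    have "(\<lambda>z. (z - x l) / (p - x l)) holomorphic_on ball p r'" using pl by (intro holomorphic_intros) auto
    thus "lam l holomorphic_on ball p r'" unfolding lam_def[abs_def]
      using * by (intro holomorphic_on_add holomorphic_on_const holomorphic_on_Ln')
    show "exp (lam l z) = z - x l" if "z \<in> ball p r'" for z
    proof -
      have "(z - x l) / (p - x l) \<noteq> 0" using *[OF that] by (auto simp del: divide_eq_0_iff)
      thus ?thesis using pl by (simp add: lam_def exp_add)
    qed
  qed (use r' in \<open>auto simp: J_def\<close>)
  show ?thesis
    by (rule that[of r lam]) (use r chart in \<open>auto simp: J_def\<close>)
qed

section \<open>Behaviour at the ends of an arc and the Pearson relation along it\<close>

lemma near_end: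
  assumes a: "a \<in> {0, 1}" and d: "d > 0"
  shows "{0<..<1} \<inter> ball a d \<noteq> {}" "is_interval ({0<..<1} \<inter> ball (a::real) d)" "connected ({0<..<1} \<inter> ball (a::real) d)"
    "at a within {0<..<1} \<noteq> bot" "eventually (\<lambda>s. s \<in> {0<..<1} \<inter> ball a d) (at a within {0<..<1})"
proof -
  have "a + (if a = 0 then 1 else -1) * min (d/2) (1/2) \<in> {0<..<1} \<inter> ball a d"
    using a d by (auto simp: dist_real_def)
  thus "{0<..<1} \<inter> ball a d \<noteq> {}" by blast
  show i: "is_interval ({0<..<1} \<inter> ball (a::real) d)"
    by (intro is_interval_Int) (auto simp: is_interval_convex_1)
  show "connected ({0<..<1} \<inter> ball (a::real) d)" using i is_interval_connected by blast
  show "at a within {0<..<1} \<noteq> bot"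
    using a by (auto simp: at_within_eq_bot_iff closure_greaterThanLessThan)
  show "eventually (\<lambda>s. s \<in> {0<..<1} \<inter> ball a d) (at a within {0<..<1})"
    using d by (auto simp: eventually_at dist_commute)
qed

lemma gam_end: "a \<in> {0,1} \<Longrightarrow> (\<gamma> \<longlongrightarrow> \<gamma> a) (at a within {0<..<1})"
proof -
  assume "a \<in> {0,1}"
  hence "(\<gamma> \<longlongrightarrow> \<gamma> a) (at a within {0..1})" using gam_cont by (auto simp: continuous_on_def)
  thus ?thesis by (rule tendsto_within_subset) auto
qed

abbreviation "Wp \<equiv> poly (Wpoly m x)"
abbreviation "Qp \<equiv> pderiv (Wpoly m x) + V2poly m \<alpha> x"

lemma EN_1: "EN (\<lambda>_. 1) = Wpoly m x" by (simp add: EN_def Wpoly_def)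

lemma wN1: "s \<in> {0<..<1} \<Longrightarrow> wN (\<lambda>_. 1) s = Wp (\<gamma> s) * w (\<gamma> s)"
  using wN_eq[of s "\<lambda>_. 1"] unfolding EN_1 by simp

lemma Wp_sum_inverse:
  assumes "\<And>k. k < m \<Longrightarrow> z \<noteq> x k"
  shows "Wp z * (\<Sum>k<m. c k / (z - x k)) = (\<Sum>k<m. c k * poly (Wdel m x k) z)"
  unfolding sum_distrib_left
proof (rule sum.cong)
  fix k assume "k \<in> {..<m}"
  hence "Wp z = (z - x k) * poly (Wdel m x k) z" "z \<noteq> x k" using assms by (auto simp: Wpoly_Wdel algebra_simps)
  thus "Wp z * (c k / (z - x k)) = c k * poly (Wdel m x k) z" by simp
qed simp

text \<open>The logarithmic derivative of W w is the sum of (alpha_k + 1)/(z - x_k); multiplication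
  by W clears the denominators and leaves W' + 2V.\<close>

lemma dW:
  assumes s: "s \<in> {0<..<1} - brk"
  shows "(wN (\<lambda>_. 1) has_vector_derivative poly Qp (\<gamma> s) * w (\<gamma> s) * dg s) (at s)"
proof -
  have d: "(wN (\<lambda>_. 1) has_vector_derivative wN (\<lambda>_. 1) s * ((\<Sum>k<m. (\<alpha> k + 1) / (\<gamma> s - x k)) * dg s)) (at s)"
    using dexp_ell[OF subset_refl s, of "\<lambda>k. \<alpha> k + 1"] by (simp add: wN_def[abs_def])
  have e1: "wN (\<lambda>_. 1) s * ((\<Sum>k<m. (\<alpha> k + 1) / (\<gamma> s - x k)) * dg s)
     = (Wp (\<gamma> s) * (\<Sum>k<m. (\<alpha> k + 1) / (\<gamma> s - x k))) * w (\<gamma> s) * dg s"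
  proof -
    have "wN (\<lambda>_. 1) s = Wp (\<gamma> s) * w (\<gamma> s)" by (rule wN1) (use s in auto)
    thus ?thesis by (simp only: ac_simps)
  qed
  have e2: "Wp (\<gamma> s) * (\<Sum>k<m. (\<alpha> k + 1) / (\<gamma> s - x k)) = poly Qp (\<gamma> s)"
    using avoid s by (subst Wp_sum_inverse) (auto simp: pderiv_Wpoly V2poly_def poly_sum sum.distrib algebra_simps)
  show ?thesis using d unfolding e1 e2 .
qed

lemma wN_cont: "continuous_on {0<..<1} (wN N)"
  unfolding wN_def[abs_def] by (rule exp_ell_cont) simp

lemma gam_near:
  assumes a: "a \<in> {0..1}" and r: "r > 0"
  obtains d where "d > 0" "\<And>s. s \<in> {0..1} \<inter> ball a d \<Longrightarrow> \<gamma> s \<in> ball (\<gamma> a) r"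
proof -
  obtain d where "d > 0" "\<forall>s\<in>{0..1}. dist s a < d \<longrightarrow> dist (\<gamma> s) (\<gamma> a) < r"
    using gam_cont a r unfolding continuous_on_iff by blast
  thus ?thesis using that[of d] by (auto simp: dist_commute)
qed

lemma end_index:
  assumes "a \<in> {0, 1}" obtains k where "k < m" "x k = \<gamma> a" "{j. j < m \<and> x j = \<gamma> a} = {k}"
proof -
  obtain k where k: "k < m" "x k = \<gamma> a" using ends[OF assms] by auto
  have "{j. j < m \<and> x j = \<gamma> a} = {k}" using k inj_onD[OF x_inj] by fastforce
  thus ?thesis using that k by blast
qed

text \<open>The derivative of W w along the arc is a polynomial times w times the speed, integrable
  because the moments exist. Indefinite gauge integrals are continuous up to the end point.\<close>

lemma W_w_has_limit:
  assumes a: "a \<in> {0, 1}"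
  obtains l where "(wN (\<lambda>_. 1) \<longlongrightarrow> l) (at a within {0<..<1})"
proof -
  define f where "f s = poly Qp (\<gamma> s) * w (\<gamma> s) * dg s" for s
  have int: "f integrable_on {0..1}"
    using poly_integrable[of Qp] unfolding contour_integrable_on f_def .
  define H where "H s = integral {0..s} f" for s
  have H: "continuous_on {0..1} H" unfolding H_def by (rule indefinite_integral_continuous_1[OF int])
  have diff: "wN (\<lambda>_. 1) s' - wN (\<lambda>_. 1) s = H s' - H s" if "s \<in> {0<..<1}" "s' \<in> {0<..<1}" "s \<le> s'" for s s'
  proof -
    have "(f has_integral wN (\<lambda>_. 1) s' - wN (\<lambda>_. 1) s) {s..s'}"
      by (rule ftc_local[OF _ _ wN_cont]) (use that dW in \<open>auto simp: f_def is_interval_convex_1\<close>)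
    moreover have "f integrable_on {0..s'}" by (rule integrable_subinterval_real[OF int]) (use that in auto)
    ultimately show ?thesis
      using that Henstock_Kurzweil_Integration.integral_combine[of 0 s s' f] by (auto simp: H_def integral_unique algebra_simps)
  qed
  have eq: "H s + (wN (\<lambda>_. 1) (1/2) - H (1/2)) = wN (\<lambda>_. 1) s" if "s \<in> {0<..<1}" for s
    using diff[of s "1/2"] diff[of "1/2" s] that by (cases "s \<le> 1/2") (auto simp: algebra_simps)
  have "(H \<longlongrightarrow> H a) (at a within {0..1})" using H a by (auto simp: continuous_on_def)
  hence "(H \<longlongrightarrow> H a) (at a within {0<..<1})" by (rule tendsto_within_subset) auto
  hence "((\<lambda>s. H s + (wN (\<lambda>_. 1) (1/2) - H (1/2))) \<longlongrightarrow> H a + (wN (\<lambda>_. 1) (1/2) - H (1/2))) (at a within {0<..<1})"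
    by (intro tendsto_intros)
  hence "(wN (\<lambda>_. 1) \<longlongrightarrow> H a + (wN (\<lambda>_. 1) (1/2) - H (1/2))) (at a within {0<..<1})"
    by (rule Lim_transform_within[of _ _ _ _ 1]) (use eq in auto)
  thus ?thesis by (rule that)
qed

text \<open>The moments force the boundary term W w to converge at an end point; a nonzero limit would make
  the exponent plus one times the logarithm converge, although the logarithm is unbounded.\<close>

lemma W_w_tendsto_0:
  assumes a: "a \<in> {0, 1}"
  shows "(wN (\<lambda>_. 1) \<longlongrightarrow> 0) (at a within {0<..<1})"
proof -
  obtain l where l: "(wN (\<lambda>_. 1) \<longlongrightarrow> l) (at a within {0<..<1})" using W_w_has_limit[OF a] .
  have "l = 0"
  proof (rule ccontr)
    assume l0: "l \<noteq> 0"
    obtain k where k: "k < m" "x k = \<gamma> a" "{j. j < m \<and> x j = \<gamma> a} = {k}" using end_index[OF a] .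
    obtain r lam where r: "r > 0" and ch: "chart (ball (\<gamma> a) r) (\<gamma> a) {k} lam"
      using chart_at[of UNIV "\<gamma> a"] k(3) by (metis UNIV_I open_UNIV order_refl)
    obtain d where d: "d > 0" "\<And>s. s \<in> {0..1} \<inter> ball a d \<Longrightarrow> \<gamma> s \<in> ball (\<gamma> a) r"
      using gam_near[of a r] a r by (metis atLeastAtMost_iff insert_iff order_refl singletonD zero_le_one)
    have imT: "\<gamma> ` ({0<..<1} \<inter> ball a d) \<subseteq> ball (\<gamma> a) r" using d(2) by fastforce
    obtain C where C: "C \<noteq> 0" "\<And>s. s \<in> {0<..<1} \<inter> ball a d \<Longrightarrow>
        wN (\<lambda>_. 1) s = (C * (\<Prod>l\<in>{k}. exp ((\<alpha> l + of_nat 1) * ell l s))) * cg (\<lambda>_. 1) {k} lam (\<gamma> s)"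
      using chart_factor[OF ch Int_lower1 near_end(3,1)[OF a d(1)] imT, of "\<lambda>_. 1"] by blast
    define G where "G = cg (\<lambda>_. 1) {k} lam"
    have Gc: "isCont G (\<gamma> a)"
      using cg_holomorphic[OF ch, of "\<lambda>_. 1"] r holomorphic_on_imp_continuous_on
      by (metis G_def centre_in_ball continuous_on_interior interior_ball)
    define u where "u s = (\<alpha> k + 1) * ell k s" for s
    define l' where "l' = l / (C * G (\<gamma> a))"
    have l'0: "l' \<noteq> 0" using l0 C(1) cg_nz by (simp add: l'_def G_def)
    have "((\<lambda>s. wN (\<lambda>_. 1) s / (C * G (\<gamma> s))) \<longlongrightarrow> l') (at a within {0<..<1})"
      unfolding l'_def using C(1) cg_nz
      by (intro tendsto_intros l isCont_tendsto_compose[OF Gc] gam_end[OF a]) (auto simp: G_def)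
    moreover have "eventually (\<lambda>s. wN (\<lambda>_. 1) s / (C * G (\<gamma> s)) = exp (u s)) (at a within {0<..<1})"
      using near_end(5)[OF a d(1)] by eventually_elim (use C cg_nz in \<open>auto simp: G_def u_def\<close>)
    ultimately have "((\<lambda>s. exp (u s)) \<longlongrightarrow> l') (at a within {0<..<1})"
      by (rule Lim_transform_eventually)
    hence lim1: "((\<lambda>s. exp (u s) / l') \<longlongrightarrow> 1) (at a within {0<..<1})"
      using tendsto_divide[OF _ tendsto_const, of "\<lambda>s. exp (u s)" l' _ l'] l'0 by simp
    then obtain e where e: "e > 0" "\<And>s. s \<in> {0<..<1} \<inter> ball a e \<Longrightarrow> s \<noteq> a \<Longrightarrow> dist (exp (u s) / l') 1 < 1"
      unfolding tendsto_iff eventually_at by (metis IntE dist_commute mem_ball zero_less_one)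
    let ?T = "{0<..<1} \<inter> ball a e"
    have np: "exp (u s) / l' \<notin> \<real>\<^sub>\<le>\<^sub>0" if "s \<in> ?T" for s
    proof -
      have "s \<noteq> a" using that a by auto
      hence "norm (exp (u s) / l' - 1) < 1" using e(2)[OF that] by (simp add: dist_norm)
      hence "Re (1 - exp (u s) / l') < 1" by (metis complex_Re_le_cmod le_less_trans norm_minus_commute)
      thus ?thesis by (simp add: complex_nonpos_Reals_iff)
    qed
    have uc: "continuous_on ?T u" unfolding u_def
      by (intro continuous_intros continuous_on_subset[OF ell_cont[OF k(1)]]) auto
    \<comment> \<open>Near the end exp(u)/l' lies within distance 1 of 1, where the principal
      logarithm is continuous, so \<open>h\<close> is constant there. Hence u converges, and with it
      \<open>ell k\<close>, although exp of it tends to 0.\<close>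
    define h where "h s = u s - Ln (exp (u s) / l') - Ln l'" for s
    have hc: "h s = h s'" if "s \<in> ?T" "s' \<in> ?T" for s s'
    proof (rule exp_continuous_eq_const[OF near_end(3)[OF a e(1)], of h])
      show "continuous_on ?T h" unfolding h_def
        by (intro continuous_intros uc continuous_on_Ln) (use np l'0 in auto)
      show "exp (h s) = 1" if "s \<in> ?T" for s using l'0 by (simp add: h_def exp_diff)
    qed (use that in auto)
    obtain s0 where s0: "s0 \<in> ?T" using near_end(1)[OF a e(1)] by blast
    have "((\<lambda>s. (Ln (exp (u s) / l') + Ln l' + h s0) / (\<alpha> k + 1)) \<longlongrightarrow> (Ln 1 + Ln l' + h s0) / (\<alpha> k + 1)) (at a within {0<..<1})"
      (is "(_ \<longlongrightarrow> ?L) _")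
    proof -
      have "\<alpha> k + 1 \<noteq> 0"
      proof
        assume "\<alpha> k + 1 = 0" hence "\<alpha> k = -1" by (simp only: eq_neg_iff_add_eq_0)
        thus False using nonint[OF k(1)] by simp
      qed
      thus ?thesis by (intro tendsto_intros lim1) auto
    qed
    moreover have "eventually (\<lambda>s. (Ln (exp (u s) / l') + Ln l' + h s0) / (\<alpha> k + 1) = ell k s) (at a within {0<..<1})"
      using near_end(5)[OF a e(1)]
    proof eventually_elim
      case (elim s)
      have "\<alpha> k + 1 \<noteq> 0"
      proof
        assume "\<alpha> k + 1 = 0" hence "\<alpha> k = -1" by (simp only: eq_neg_iff_add_eq_0)
        thus False using nonint[OF k(1)] by simp
      qed
      moreover have "Ln (exp (u s) / l') + Ln l' + h s0 = u s" using hc[OF elim s0] by (simp add: h_def algebra_simps)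
      ultimately show ?case by (simp add: u_def)
    qed
    ultimately have "(ell k \<longlongrightarrow> ?L) (at a within {0<..<1})" by (rule Lim_transform_eventually)
    hence "((\<lambda>s. exp (ell k s)) \<longlongrightarrow> exp ?L) (at a within {0<..<1})" by (intro tendsto_intros)
    moreover have "((\<lambda>s. exp (ell k s)) \<longlongrightarrow> 0) (at a within {0<..<1})"
    proof -
      have "((\<lambda>s. \<gamma> s - x k) \<longlongrightarrow> \<gamma> a - x k) (at a within {0<..<1})" by (intro tendsto_intros gam_end a)
      thus ?thesis unfolding k(2) using exp_ell[OF k(1)] k(2)
        by (auto intro: Lim_transform_within[of _ _ _ _ 1])
    qed
    ultimately have "exp ?L = 0" using near_end(4)[OF a zero_less_one] tendsto_unique by blast
    thus False by simp
  qed
  thus ?thesis using l by simp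
qed

text \<open>One factor z - x_k suffices: near x_k it differs from W only by the factor
  \<open>Wdel m x k\<close>, which does not vanish there.\<close>

lemma wN_tendsto_0:
  assumes a: "a \<in> {0, 1}" and k: "k < m" "x k = \<gamma> a" "N k \<ge> 1"
  shows "(wN N \<longlongrightarrow> 0) (at a within {0<..<1})"
proof -
  define R where "R = (\<Prod>l\<in>{..<m}-{k}. [:- x l, 1:] ^ N l) * [:- x k, 1:] ^ (N k - 1)"
  have EN: "EN N = [:- x k, 1:] * R"
  proof -
    have "EN N = [:- x k, 1:] ^ N k * (\<Prod>l\<in>{..<m}-{k}. [:- x l, 1:] ^ N l)"
      unfolding EN_def by (rule prod.remove) (use k in auto)
    also have "[:- x k, 1:] ^ N k = [:- x k, 1:] * [:- x k, 1:] ^ (N k - 1)"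
      using k(3) by (metis Suc_pred' less_eq_Suc_le One_nat_def power_Suc)
    finally show ?thesis by (simp only: R_def mult.assoc mult.commute mult.left_commute)
  qed
  have nz: "poly (Wdel m x k) (\<gamma> a) \<noteq> 0" using poly_Wdel_self[OF x_inj k(1)] k(2) by simp
  have pc: "((\<lambda>s. poly p (\<gamma> s)) \<longlongrightarrow> poly p (\<gamma> a)) (at a within {0<..<1})" for p
    by (intro isCont_tendsto_compose[OF poly_isCont] gam_end a)
  have "((\<lambda>s. wN (\<lambda>_. 1) s * poly R (\<gamma> s) / poly (Wdel m x k) (\<gamma> s)) \<longlongrightarrow> 0 * poly R (\<gamma> a) / poly (Wdel m x k) (\<gamma> a)) (at a within {0<..<1})"
    by (intro tendsto_intros W_w_tendsto_0 a pc nz)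
  moreover have "eventually (\<lambda>s. wN (\<lambda>_. 1) s * poly R (\<gamma> s) / poly (Wdel m x k) (\<gamma> s) = wN N s) (at a within {0<..<1})"
    using near_end(5)[OF a zero_less_one]
  proof eventually_elim
    case (elim s)
    hence s: "s \<in> {0<..<1}" by simp
    have "poly (Wdel m x k) (\<gamma> s) \<noteq> 0" using avoid s by (auto simp: poly_Wdel)
    moreover have "wN (\<lambda>_. 1) s = (\<gamma> s - x k) * poly (Wdel m x k) (\<gamma> s) * w (\<gamma> s)"
      unfolding wN1[OF s] Wpoly_Wdel[OF k(1)] by (simp add: algebra_simps)
    moreover have "wN N s = (\<gamma> s - x k) * poly R (\<gamma> s) * w (\<gamma> s)"
      unfolding wN_eq[OF s, symmetric] EN by (simp add: algebra_simps)
    ultimately show ?case by simp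
  qed
  ultimately have "(wN N \<longlongrightarrow> 0 * poly R (\<gamma> a) / poly (Wdel m x k) (\<gamma> a)) (at a within {0<..<1})"
    by (rule Lim_transform_eventually)
  thus ?thesis by simp
qed

lemma pearson:
  assumes U: "open U" "path_image \<gamma> \<subseteq> U" and \<phi>: "\<phi> holomorphic_on U"
  shows "((\<lambda>u. (deriv \<phi> u * Wp u + \<phi> u * poly Qp u) * w u) has_contour_integral 0) \<gamma>"
proof -
  have im: "\<gamma> s \<in> U" if "s \<in> {0..1}" for s using U(2) that by (auto simp: path_image_def)
  have d: "(\<phi> has_field_derivative deriv \<phi> z) (at z)" if "z \<in> U" for z using \<phi> U(1) that holomorphic_derivI by blast
  let ?F = "\<lambda>s. \<phi> (\<gamma> s) * wN (\<lambda>_. 1) s"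
  have "((\<lambda>s. (deriv \<phi> (\<gamma> s) * Wp (\<gamma> s) + \<phi> (\<gamma> s) * poly Qp (\<gamma> s)) * w (\<gamma> s) * dg s) has_integral 0 - 0) {0..1}"
  proof (rule ftc_ends[of ?F])
    have "continuous_on {0<..<1} (\<lambda>s. \<phi> (\<gamma> s))"
      using im by (intro continuous_on_compose2[OF holomorphic_on_imp_continuous_on[OF \<phi>]] continuous_on_subset[OF gam_cont]) auto
    thus "continuous_on {0<..<1} ?F" by (intro continuous_intros wN_cont)
    fix s assume s: "s \<in> {0<..<1} - brk"
    have "(?F has_vector_derivative \<phi> (\<gamma> s) * (poly Qp (\<gamma> s) * w (\<gamma> s) * dg s) + deriv \<phi> (\<gamma> s) * dg s * wN (\<lambda>_. 1) s) (at s)"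
      using s im by (intro has_vector_derivative_mult dW has_vector_derivative_const_field_comp[OF dgam d]) auto
    moreover have "\<phi> (\<gamma> s) * (poly Qp (\<gamma> s) * w (\<gamma> s) * dg s) + deriv \<phi> (\<gamma> s) * dg s * wN (\<lambda>_. 1) s
        = (deriv \<phi> (\<gamma> s) * Wp (\<gamma> s) + \<phi> (\<gamma> s) * poly Qp (\<gamma> s)) * w (\<gamma> s) * dg s"
      using s wN1 by (simp add: algebra_simps)
    ultimately show "(?F has_vector_derivative (deriv \<phi> (\<gamma> s) * Wp (\<gamma> s) + \<phi> (\<gamma> s) * poly Qp (\<gamma> s)) * w (\<gamma> s) * dg s) (at s)"
      by simp
  next
    have lim: "(?F \<longlongrightarrow> 0) (at a within {0<..<1})" if a: "a \<in> {0,1}" for a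
    proof -
      have "isCont \<phi> (\<gamma> a)"
      proof -
        have "a \<in> {0..1}" using a by auto
        from DERIV_isCont[OF d[OF im[OF this]]] show ?thesis .
      qed
      hence "(?F \<longlongrightarrow> \<phi> (\<gamma> a) * 0) (at a within {0<..<1})"
        by (intro tendsto_intros W_w_tendsto_0 a isCont_tendsto_compose[of _ \<phi>] gam_end)
      thus ?thesis by simp
    qed
    show "(?F \<longlongrightarrow> 0) (at 0 within {0<..<1})" "(?F \<longlongrightarrow> 0) (at 1 within {0<..<1})" using lim by auto
  qed
  thus ?thesis unfolding has_contour_integral by simp
qed

lemma Lg_Dstar: "Lg (Dstar m \<alpha> x \<phi>) = 0"
proof -
  have "((\<lambda>u. (deriv (poly \<phi>) u * Wp u + poly \<phi> u * poly Qp u) * w u) has_contour_integral 0) \<gamma>"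
    by (rule pearson[of UNIV]) (auto intro!: holomorphic_intros)
  moreover have "deriv (poly \<phi>) u * Wp u + poly \<phi> u * poly Qp u = poly (Dstar m \<alpha> x \<phi>) u" for u
    using DERIV_imp_deriv[OF poly_DERIV[of \<phi> u]] by (simp add: Dstar_def pderiv_mult algebra_simps)
  ultimately show ?thesis unfolding Lg_def by (simp add: contour_integral_unique)
qed

text \<open>Constrains the exponents only at the two ends of the arc; the other factors of
  \<open>EN\<close> may then be omitted, so that all its zeros lie on the arc.\<close>

definition good_exp :: "(nat \<Rightarrow> nat) \<Rightarrow> bool" where
  "good_exp N \<longleftrightarrow> (\<forall>k<m. x k \<in> {\<gamma> 0, \<gamma> 1} \<longrightarrow> N k \<ge> 1 \<and> Re (\<alpha> k + of_nat (N k)) > 0)"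

text \<open>The integral over a short piece is a difference of values of the chart primitive, the
  product of a bounded factor \<open>mm\<close> and \<open>Hf\<close>, and only the latter depends
  on phi. This gives a bound by the supremum of phi even where the arc spirals into its end and the
  integrand is not absolutely integrable.\<close>

lemma local_bound:
  assumes a: "a \<in> {0..1}" and U: "open U" "\<gamma> a \<in> U" and N: "good_exp N"
  obtains d C where "d > 0" "C \<ge> 0" "\<And>\<phi> M s s'. \<phi> holomorphic_on U \<Longrightarrow> (\<And>z. z \<in> U \<Longrightarrow> norm (\<phi> z) \<le> M) \<Longrightarrow>
      s \<in> {0..1} \<inter> ball a d \<Longrightarrow> s' \<in> {0..1} \<inter> ball a d \<Longrightarrow> s \<le> s' \<Longrightarrow>
      \<exists>v. ((\<lambda>s. \<phi> (\<gamma> s) * wN N s * dg s) has_integral v) {s..s'} \<and> norm v \<le> C * M"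
proof -
  define p where "p = \<gamma> a"
  define J where "J = {k. k < m \<and> x k = p}"
  obtain r lam where r: "r > 0" "ball p r \<subseteq> U" and ch: "\<And>r'. 0 < r' \<Longrightarrow> r' \<le> r \<Longrightarrow> chart (ball p r') p J lam"
    using chart_at[OF U] unfolding J_def p_def by metis
  define D where "D = ball p (r/2)"
  have chD: "chart D p J lam" using ch[of "r/2"] r by (simp add: D_def)
  have DU: "D \<subseteq> U" using r(1,2) by (auto simp: D_def)
  have Dst: "\<forall>z\<in>D. closed_segment p z \<subseteq> D" using chD by (simp add: chart_def)
  have J: "J \<subseteq> {..<m}" by (auto simp: J_def)
  define \<beta> where "\<beta> = (\<Sum>l\<in>J. \<alpha> l + of_nat (N l))"
  have Ja: "J = {} \<or> (\<exists>k. J = {k} \<and> x k = p \<and> k < m \<and> a \<in> {0,1})"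
  proof (cases "a \<in> {0<..<1}")
    case True
    hence "J = {}" using avoid by (fastforce simp: J_def p_def)
    thus ?thesis by blast
  next
    case False
    hence "a \<in> {0,1}" using a by auto
    from end_index[OF this] obtain k where "k < m" "x k = p" "J = {k}" unfolding J_def p_def by metis
    thus ?thesis using \<open>a \<in> {0,1}\<close> by blast
  qed
  obtain \<kappa> where \<kappa>: "is_kernel \<kappa> \<beta>"
  proof (cases "J = {}")
    case True thus ?thesis using that is_kernel_1 by (simp add: \<beta>_def)
  next
    case False
    then obtain k where k: "J = {k}" "x k = p" "k < m" "a \<in> {0,1}" using Ja by blast
    hence "x k \<in> {\<gamma> 0, \<gamma> 1}" by (auto simp: p_def)
    hence "Re (\<alpha> k + of_nat (N k)) > 0" using N k(3) unfolding good_exp_def by blast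
    hence "Re \<beta> > 0" using k(1) by (simp add: \<beta>_def)
    thus ?thesis using that is_kernel_powr by blast
  qed
  define g where "g = cg N J lam"
  have gh: "g holomorphic_on ball p r" unfolding g_def using ch[of r] r by (intro cg_holomorphic) auto
  have "compact (g ` cball p (r/2))"
    using r by (intro compact_continuous_image continuous_on_subset[OF holomorphic_on_imp_continuous_on[OF gh]]) auto
  then obtain Bg where Bg: "Bg > 0" "\<And>z. z \<in> cball p (r/2) \<Longrightarrow> norm (g z) \<le> Bg"
    using compact_imp_bounded bounded_pos by (metis (no_types, lifting) image_eqI)
  obtain CH where CH: "CH \<ge> 0" "\<And>g M z. continuous_on D g \<Longrightarrow> (\<And>z. z \<in> D \<Longrightarrow> norm (g z) \<le> M) \<Longrightarrow> z \<in> D \<Longrightarrow> norm (Hf \<kappa> p g z) \<le> CH * M"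
    using Hf_bound[OF Dst \<kappa>] by blast
  obtain d0 where d0: "d0 > 0" "\<And>s. s \<in> {0..1} \<inter> ball a d0 \<Longrightarrow> \<gamma> s \<in> D"
    using gam_near[OF a, of "r/2"] r unfolding D_def p_def by auto
  \<comment> \<open>Small enough that the only parameter among 0 and 1 that the ball can contain is
    a itself.\<close>
  define d1 where "d1 = min d0 (if a \<in> {0,1} then 1/2 else min a (1 - a))"
  have d1: "d1 > 0" using d0 a by (auto simp: d1_def)
  have only: "s = a" if "s \<in> {0,1}" "s \<in> ball a d1" for s
    using that a by (auto simp: d1_def dist_real_def split: if_splits)
  define X where "X = {0..1} \<inter> ball a d1"
  define T where "T = {0<..<1} \<inter> ball a d1"
  have XD: "\<gamma> s \<in> D" if "s \<in> X" for s using d0(2)[of s] that by (auto simp: X_def d1_def)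
  have Tne: "T \<noteq> {}"
  proof (cases "a \<in> {0,1}")
    case True thus ?thesis using near_end(1) d1 unfolding T_def by blast
  next
    case False
    hence "a \<in> T" using a d1 by (auto simp: T_def)
    thus ?thesis by blast
  qed
  have Ti: "is_interval T" "is_interval X" unfolding T_def X_def
    by (intro is_interval_Int; auto simp: is_interval_convex_1)+
  obtain C where C: "C \<noteq> 0" "\<And>s. s \<in> T \<Longrightarrow> wN N s = (C * (\<Prod>l\<in>J. exp ((\<alpha> l + of_nat (N l)) * ell l s))) * g (\<gamma> s)"
    unfolding g_def
  proof (rule chart_factor[OF chD, of T N])
    show "connected T" using Ti(1) is_interval_connected by blast
    show "\<gamma> ` T \<subseteq> D" using XD by (auto simp: T_def X_def)
  qed (use Tne that in \<open>auto simp: T_def\<close>)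
  define e where "e = (\<lambda>s. C * (\<Prod>l\<in>J. exp ((\<alpha> l + of_nat (N l)) * ell l s)))"
  have imTD: "\<gamma> ` T \<subseteq> D" using XD by (auto simp: T_def X_def)
  have wNT: "wN N s = e s * cg N J lam (\<gamma> s)" if "s \<in> T" for s using C(2)[OF that] by (simp add: e_def g_def)
  \<comment> \<open>The carried power times (z - p), extended by 0 to the end of the parameter
    interval. Continuity there holds because e (z - p) equals wN / g times (z - p), and wN tends to
    0.\<close>
  define mm where "mm s = (if s \<in> {0<..<1} then e s * (\<gamma> s - p) else 0)" for s
  have ec: "continuous_on {0<..<1} e" unfolding e_def by (intro continuous_intros exp_ell_cont J)
  have mmc: "continuous_on X mm"
    unfolding continuous_on_def
  proof
    fix s assume s: "s \<in> X"
    show "(mm \<longlongrightarrow> mm s) (at s within X)"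
    proof (cases "s \<in> {0<..<1}")
      case True
      have "isCont (\<lambda>s. e s * (\<gamma> s - p)) s"
        using True ec continuous_on_subset[OF gam_cont greaterThanLessThan_subseteq_atLeastAtMost_iff[THEN iffD2], of 0 1]
        by (intro continuous_intros) (auto simp: continuous_on_eq_continuous_at)
      hence "((\<lambda>s. e s * (\<gamma> s - p)) \<longlongrightarrow> mm s) (at s)" using True by (simp add: isCont_def mm_def)
      hence "(mm \<longlongrightarrow> mm s) (at s)"
        by (rule Lim_transform_within_open[of _ _ _ _ "{0<..<1}"]) (use True in \<open>auto simp: mm_def\<close>)
      thus ?thesis by (rule tendsto_within_subset) simp
    next
      case False
      hence sa: "s = a" "a \<in> {0,1}" using only[of s] s by (auto simp: X_def)
      have lim: "((\<lambda>s. e s * (\<gamma> s - p)) \<longlongrightarrow> 0) (at a within {0<..<1})"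
      proof -
        obtain k where k: "k < m" "x k = \<gamma> a" using end_index[OF sa(2)] by blast
        have "N k \<ge> 1" using N k sa(2) by (auto simp: good_exp_def)
        note w0 = wN_tendsto_0[of a k N, OF sa(2) k this]
        have "isCont g p" using gh r by (metis centre_in_ball continuous_on_interior holomorphic_on_imp_continuous_on interior_ball)
        hence "((\<lambda>s. wN N s / g (\<gamma> s) * (\<gamma> s - p)) \<longlongrightarrow> 0 / g p * (p - p)) (at a within {0<..<1})"
          using gam_end[OF sa(2)] cg_nz
          by (intro tendsto_intros w0 isCont_tendsto_compose[of p g]) (auto simp: g_def p_def)
        moreover have "eventually (\<lambda>s. wN N s / g (\<gamma> s) * (\<gamma> s - p) = e s * (\<gamma> s - p)) (at a within {0<..<1})"
          using near_end(5)[OF sa(2) d1] by eventually_elim (use C cg_nz in \<open>auto simp: T_def e_def g_def\<close>)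
        ultimately show ?thesis using Lim_transform_eventually[where l = 0] by simp
      qed
      have "((mm \<longlongrightarrow> 0) (at a within {0<..<1}))"
        using lim by (rule Lim_transform_within[of _ _ _ _ 1]) (auto simp: mm_def)
      moreover have "at a within X = at a within {0<..<1}"
      proof (rule at_within_nhd[of _ "ball a d1"])
        show "X \<inter> ball a d1 - {a} = {0<..<1} \<inter> ball a d1 - {a}"
        proof -
          have "u \<in> {0<..<1}" if "u \<in> {0..1}" "u \<in> ball a d1" "u \<noteq> a" for u
            using only[of u] that by (cases "u = 0 \<or> u = 1") auto
          thus ?thesis by (auto simp: X_def)
        qed
      qed (use d1 in auto)
      moreover have "mm s = 0" using False unfolding mm_def by (rule if_not_P)
      ultimately show ?thesis using sa by simp
    qed
  qed
  define d where "d = d1 / 2"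
  have "compact (mm ` ({0..1} \<inter> cball a d))"
    using d1 by (intro compact_continuous_image continuous_on_subset[OF mmc]) (auto simp: X_def d_def)
  then obtain B where B: "B > 0" "\<And>s. s \<in> {0..1} \<inter> cball a d \<Longrightarrow> norm (mm s) \<le> B"
    using compact_imp_bounded bounded_pos by (metis (no_types, lifting) image_eqI)
  show ?thesis
  proof (rule that[of d "2 * (B * (CH * Bg))"])
    fix \<phi> M s s' assume \<phi>: "\<phi> holomorphic_on U" and M: "\<And>z. z \<in> U \<Longrightarrow> norm (\<phi> z) \<le> M"
      and s: "s \<in> {0..1} \<inter> ball a d" "s' \<in> {0..1} \<inter> ball a d" "s \<le> s'"
    have M0: "M \<ge> 0" using M[OF U(2)] norm_ge_zero order_trans by blast
    have \<phi>D: "\<phi> holomorphic_on D" using \<phi> DU holomorphic_on_subset by blast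
    let ?g = "\<lambda>z. \<phi> z * g z"
    have gD: "?g holomorphic_on D" using r unfolding g_def
      by (intro holomorphic_intros \<phi>D cg_holomorphic[OF chD])
    define F where "F s = mm s * Hf \<kappa> p ?g (\<gamma> s)" for s
    have Hc: "continuous_on D (Hf \<kappa> p ?g)"
    proof -
      have "open D" by (simp add: D_def)
      from Hf_has_derivative[OF this Dst gD \<kappa>] show ?thesis
        using DERIV_isCont by (meson continuous_at_imp_continuous_on)
    qed
    have Fc: "continuous_on X F" unfolding F_def
      using XD by (intro continuous_intros mmc continuous_on_compose2[OF Hc] continuous_on_subset[OF gam_cont]) (auto simp: X_def)
    have dF: "(F has_vector_derivative \<phi> (\<gamma> s) * wN N s * dg s) (at s)" if "s \<in> T - brk" for s
    proof -
      have "((\<lambda>s. e s * (\<gamma> s - p) * Hf \<kappa> p ?g (\<gamma> s)) has_vector_derivative \<phi> (\<gamma> s) * wN N s * dg s) (at s)"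
        unfolding g_def by (rule chart_primitive(2)[OF chD _ imTD e_def wNT \<kappa>[unfolded \<beta>_def] \<phi>D that]) (auto simp: T_def)
      thus ?thesis
        by (rule has_vector_derivative_transform_within_open[of _ _ _ "{0<..<1}"]) (use that in \<open>auto simp: F_def mm_def T_def\<close>)
    qed
    have sX: "s \<in> X" "s' \<in> X" using s d1 by (auto simp: X_def d_def)
    have "((\<lambda>s. \<phi> (\<gamma> s) * wN N s * dg s) has_integral F s' - F s) {s..s'}"
      by (rule ftc_local[OF Ti(2) _ Fc]) (use sX s(3) dF in \<open>auto simp: X_def T_def\<close>)
    moreover have "norm (F s' - F s) \<le> 2 * (B * (CH * Bg)) * M"
    proof -
      have "norm (F u) \<le> B * (CH * (M * Bg))" if u: "u \<in> {0..1} \<inter> ball a d" for u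
      proof -
        have "u \<in> X" using u d1 by (auto simp: X_def d_def)
        hence "norm (Hf \<kappa> p ?g (\<gamma> u)) \<le> CH * (M * Bg)"
          using XD DU M Bg M0 by (intro CH(2) holomorphic_on_imp_continuous_on[OF gD]) (auto simp: norm_mult D_def intro!: mult_mono)
        moreover have "norm (mm u) \<le> B" using B(2)[of u] u by auto
        ultimately show ?thesis unfolding F_def norm_mult using B(1) by (intro mult_mono) auto
      qed
      from this[OF s(1)] this[OF s(2)] have "norm (F s' - F s) \<le> 2 * (B * (CH * (M * Bg)))"
        using norm_triangle_ineq4[of "F s'" "F s"] by linarith
      thus ?thesis by (simp add: algebra_simps)
    qed
    ultimately show "\<exists>v. ((\<lambda>s. \<phi> (\<gamma> s) * wN N s * dg s) has_integral v) {s..s'} \<and> norm v \<le> 2 * (B * (CH * Bg)) * M" by blast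
  qed (use d1 B CH Bg in \<open>auto simp: d_def\<close>)
qed

text \<open>The property of having a bound linear in the supremum of phi over [0, s] passes between
  neighbouring parameters in both directions, so it spreads from 0 to 1 by connectedness of the
  interval.\<close>

lemma global_bound:
  assumes U: "open U" "path_image \<gamma> \<subseteq> U" and N: "good_exp N"
  obtains C where "C \<ge> 0" "\<And>\<phi> M. \<phi> holomorphic_on U \<Longrightarrow> (\<And>z. z \<in> U \<Longrightarrow> norm (\<phi> z) \<le> M) \<Longrightarrow>
      \<exists>v. ((\<lambda>u. \<phi> u * (poly (EN N) u * w u)) has_contour_integral v) \<gamma> \<and> norm v \<le> C * M"
proof -
  define P where "P s \<longleftrightarrow> (\<exists>C\<ge>0. \<forall>\<phi> M. \<phi> holomorphic_on U \<and> (\<forall>z\<in>U. norm (\<phi> z) \<le> M) \<longrightarrow>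
      (\<exists>v. ((\<lambda>s. \<phi> (\<gamma> s) * wN N s * dg s) has_integral v) {0..s} \<and> norm v \<le> C * M))" for s
  have "P 0" unfolding P_def by (intro exI[of _ 0] conjI allI impI exI[of _ 0]) auto
  have "P 1"
  proof (rule connected_induction_simple[where S = "{0..1}" and P = P and a = 0 and b = 1])
    fix a :: real assume a: "a \<in> {0..1}"
    hence gU: "\<gamma> a \<in> U" using U(2) by (auto simp: path_image_def)
    obtain d C where d: "d > 0" and C: "C \<ge> 0" and
      loc: "\<And>\<phi> M s s'. \<phi> holomorphic_on U \<Longrightarrow> (\<And>z. z \<in> U \<Longrightarrow> norm (\<phi> z) \<le> M) \<Longrightarrow>
      s \<in> {0..1} \<inter> ball a d \<Longrightarrow> s' \<in> {0..1} \<inter> ball a d \<Longrightarrow> s \<le> s' \<Longrightarrow>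
      \<exists>v. ((\<lambda>s. \<phi> (\<gamma> s) * wN N s * dg s) has_integral v) {s..s'} \<and> norm v \<le> C * M"
      by (rule local_bound[OF a U(1) gU N], rule that, assumption, assumption) blast
    have "P s'" if s: "s \<in> {0..1} \<inter> ball a d" and s': "s' \<in> {0..1} \<inter> ball a d" and "P s" for s s'
    proof -
      obtain C0 where C0: "C0 \<ge> 0" "\<And>\<phi> M. \<phi> holomorphic_on U \<Longrightarrow> (\<And>z. z \<in> U \<Longrightarrow> norm (\<phi> z) \<le> M) \<Longrightarrow>
        \<exists>v. ((\<lambda>s. \<phi> (\<gamma> s) * wN N s * dg s) has_integral v) {0..s} \<and> norm v \<le> C0 * M"
        using \<open>P s\<close> unfolding P_def by blast
      show ?thesis unfolding P_def
      proof (intro exI[of _ "C0 + C"] conjI allI impI)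
        fix \<phi> M assume A: "\<phi> holomorphic_on U \<and> (\<forall>z\<in>U. norm (\<phi> z) \<le> M)"
        let ?f = "\<lambda>s. \<phi> (\<gamma> s) * wN N s * dg s"
        obtain v where v: "(?f has_integral v) {0..s}" "norm v \<le> C0 * M" using C0(2) A by blast
        show "\<exists>v. (?f has_integral v) {0..s'} \<and> norm v \<le> (C0 + C) * M"
        proof (cases "s \<le> s'")
          case True
          obtain v' where v': "(?f has_integral v') {s..s'}" "norm v' \<le> C * M" using loc[OF _ _ s s' True] A by blast
          have "(?f has_integral v + v') {0..s'}" using has_integral_combine[OF _ True v(1) v'(1)] s by auto
          moreover have "norm (v + v') \<le> (C0 + C) * M"
            using norm_triangle_ineq[of v v'] v v' by (simp add: algebra_simps)
          ultimately show ?thesis by blast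
        next
          case False
          hence le: "s' \<le> s" by simp
          obtain v' where v': "(?f has_integral v') {s'..s}" "norm v' \<le> C * M" using loc[OF _ _ s' s le] A by blast
          have "?f integrable_on {0..s'}"
            by (rule integrable_subinterval_real[of _ 0 s]) (use v le s' in auto)
          then obtain v'' where v'': "(?f has_integral v'') {0..s'}" by blast
          have "(?f has_integral v'' + v') {0..s}" using has_integral_combine[OF _ le v'' v'(1)] s' by auto
          hence "v'' + v' = v" using v(1) has_integral_unique by blast
          hence "v'' = v - v'" by (simp add: algebra_simps)
          hence "norm v'' \<le> norm v + norm v'" using norm_triangle_ineq4[of v v'] by simp
          thus ?thesis using v v' v'' by (intro exI[of _ v'']) (auto simp: algebra_simps)
        qed
      qed (use C C0 in auto)
    qed
    thus "\<exists>T. openin (top_of_set {0..1}) T \<and> a \<in> T \<and> (\<forall>x\<in>T. \<forall>y\<in>T. P x \<longrightarrow> P y)"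
      using a d openin_open_Int[OF open_ball, of "{0..1}" a d]
      by (intro exI[of _ "{0..1} \<inter> ball a d"] conjI ballI impI) (blast | simp)+
  qed (use \<open>P 0\<close> in auto)
  then obtain C where C: "C \<ge> 0" "\<forall>\<phi> M. \<phi> holomorphic_on U \<and> (\<forall>z\<in>U. norm (\<phi> z) \<le> M) \<longrightarrow>
      (\<exists>v. ((\<lambda>s. \<phi> (\<gamma> s) * wN N s * dg s) has_integral v) {0..1} \<and> norm v \<le> C * M)"
    unfolding P_def by (elim exE conjE)
  show ?thesis
  proof (rule that[OF C(1)])
    fix \<phi> M assume "\<phi> holomorphic_on U" "\<And>z. z \<in> U \<Longrightarrow> norm (\<phi> z) \<le> M"
    with C(2) have "\<exists>v. ((\<lambda>s. \<phi> (\<gamma> s) * wN N s * dg s) has_integral v) {0..1} \<and> norm v \<le> C * M" by blast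
    thus "\<exists>v. ((\<lambda>u. \<phi> u * (poly (EN N) u * w u)) has_contour_integral v) \<gamma> \<and> norm v \<le> C * M"
      by (simp only: contour_integral_iff)
  qed
qed

end

subsection \<open>Cauchy transforms along an arc\<close>

lemma poly_synthetic_div_self: "poly (synthetic_div p z) z = poly (pderiv p) (z::'a::idom)"
proof -
  have "pderiv p = pderiv ([:- z, 1:] * synthetic_div p z + [:poly p z:])" by (simp only: synthetic_div_correct')
  also have "\<dots> = synthetic_div p z + [:- z, 1:] * pderiv (synthetic_div p z)"
    by (simp only: pderiv_add pderiv_linear_mult) (simp add: pderiv_pCons)
  finally show ?thesis by simp
qed

text \<open>The numerator polynomials: the dependence on z is polynomial, and differentiation in z
  repeats the difference quotient. Induction on the coefficients of p, with L varying since it is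
  shifted by one degree.\<close>

lemma synthetic_functional_poly:
  assumes "plin L"
  obtains Q where "\<And>z. poly Q z = L (synthetic_div p z)" "\<And>z. poly (pderiv Q) z = L (synthetic_div (synthetic_div p z) z)"
proof -
  have "\<exists>Q. (\<forall>z. poly Q z = L (synthetic_div p z)) \<and> (\<forall>z. poly (pderiv Q) z = L (synthetic_div (synthetic_div p z) z))"
    using assms
  proof (induction p arbitrary: L)
    case 0
    thus ?case by (intro exI[of _ 0]) (simp add: plin_0)
  next
    case (pCons a p)
    define L' where "L' q = L (pCons 0 q)" for q
    have L': "plin L'" by (rule plinI) (auto simp: L'_def plin_simps[OF pCons.prems, symmetric])
    have LpC: "L (pCons c q) = c * L 1 + L' q" for c q
    proof -
      have "pCons c q = smult c 1 + pCons 0 q" by simp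
      thus ?thesis by (simp only: plin_simps[OF pCons.prems] L'_def)
    qed
    from pCons.IH[OF L'] obtain Q where Q: "\<forall>z. poly Q z = L' (synthetic_div p z)"
      "\<forall>z. poly (pderiv Q) z = L' (synthetic_div (synthetic_div p z) z)" by blast
    show ?case
      by (intro exI[of _ "smult (L 1) p + Q"])
         (simp add: LpC Q pderiv_add pderiv_smult poly_synthetic_div_self)
  qed
  thus ?thesis using that by blast
qed

lemma synthetic_div_quotient:
  fixes z :: "'a::field" assumes "z \<noteq> u"
  shows "poly p z / (z - u) = poly p u / (z - u) + poly (synthetic_div p z) u"
proof -
  have "poly p u = poly ([:- z, 1:] * synthetic_div p z + [:poly p z:]) u" by (simp only: synthetic_div_correct')
  hence "poly p u = (u - z) * poly (synthetic_div p z) u + poly p z" by (simp add: algebra_simps)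
  thus ?thesis using assms by (simp add: field_simps)
qed

text \<open>Taylor expansion of p at u to first order, with the remainder expressed by the
  derivative of the difference quotient.\<close>

lemma synthetic_div_second_quotient:
  fixes z :: "'a::field_char_0" assumes "z \<noteq> u"
  shows "poly p z / (z - u)\<^sup>2 = poly p u / (z - u)\<^sup>2 + poly (pderiv p) u / (z - u) + poly (pderiv (synthetic_div p z)) u"
proof -
  define s where "s = synthetic_div p z"
  have p: "p = [:- z, 1:] * s + [:poly p z:]" by (simp only: synthetic_div_correct' s_def)
  have p1: "poly p u = (u - z) * poly s u + poly p z"
    using arg_cong[OF p, of "\<lambda>p. poly p u"] by (simp add: algebra_simps)
  have pd: "pderiv p = s + [:- z, 1:] * pderiv s"
    by (subst p) (simp only: pderiv_add pderiv_linear_mult, simp add: pderiv_pCons)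
  have p2: "poly (pderiv p) u = poly s u + (u - z) * poly (pderiv s) u"
    using arg_cong[OF pd, of "\<lambda>p. poly p u"] by (simp add: algebra_simps)
  have zu: "z - u \<noteq> 0" using assms by simp
  have "poly p z = poly p u + poly (pderiv p) u * (z - u) + poly (pderiv s) u * (z - u)\<^sup>2"
    unfolding p1 p2 by (simp add: algebra_simps power2_eq_square)
  hence "poly p z / (z - u)\<^sup>2 = (poly p u + poly (pderiv p) u * (z - u) + poly (pderiv s) u * (z - u)\<^sup>2) / (z - u)\<^sup>2" by simp
  also have "\<dots> = poly p u / (z - u)\<^sup>2 + poly (pderiv p) u / (z - u) + poly (pderiv s) u"
    using zu by (simp add: add_divide_distrib power2_eq_square)
  finally show ?thesis by (simp add: s_def)
qed

context weighted_arc begin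

text \<open>The same large exponent at the ends of the arc and 0 elsewhere.\<close>

lemma ex_good_exp:
  obtains N where "good_exp N" "\<And>z. z \<notin> path_image \<gamma> \<Longrightarrow> poly (EN N) z \<noteq> 0"
proof -
  obtain K :: nat where K: "real K > (\<Sum>k<m. \<bar>Re (\<alpha> k)\<bar>)" using reals_Archimedean2 by blast
  define N where "N k = (if x k \<in> {\<gamma> 0, \<gamma> 1} then Suc K else 0)" for k
  have "Re (\<alpha> k) + real (Suc K) > 0" if "k < m" for k
  proof -
    have "\<bar>Re (\<alpha> k)\<bar> \<le> (\<Sum>k<m. \<bar>Re (\<alpha> k)\<bar>)" using that by (intro member_le_sum) auto
    thus ?thesis using K by simp
  qed
  hence "good_exp N" by (auto simp: good_exp_def N_def)
  moreover have "poly (EN N) z \<noteq> 0" if "z \<notin> path_image \<gamma>" for z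
    using that by (auto simp: poly_EN N_def path_image_def)
  ultimately show ?thesis using that by blast
qed

lemma far_set:
  assumes "z \<notin> path_image \<gamma>"
  obtains d where "d > 0" "path_image \<gamma> \<subseteq> {u. dist z u > 2 * d}"
proof -
  have "open (- path_image \<gamma>)" using closed_path_image[OF path] by (simp add: open_Compl)
  then obtain e where e: "e > 0" "ball z e \<subseteq> - path_image \<gamma>" using assms openE by (metis ComplI)
  have "dist z u > 2 * (e / 3)" if "u \<in> path_image \<gamma>" for u
    using e that by (force simp: subset_iff not_less)
  thus ?thesis using that[of "e/3"] e by auto
qed

text \<open>The integral against the regularised weight, defined for holomorphic test functions and
  controlled by \<open>global_bound\<close>.\<close>

definition TN :: "(nat \<Rightarrow> nat) \<Rightarrow> (complex \<Rightarrow> complex) \<Rightarrow> complex" where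
  "TN N \<phi> = contour_integral \<gamma> (\<lambda>u. \<phi> u * (poly (EN N) u * w u))"

lemma TN_integrable:
  assumes N: "good_exp N" and U: "open U" "path_image \<gamma> \<subseteq> U" "\<phi> holomorphic_on U" "\<And>z. z \<in> U \<Longrightarrow> norm (\<phi> z) \<le> M"
  shows "((\<lambda>u. \<phi> u * (poly (EN N) u * w u)) has_contour_integral TN N \<phi>) \<gamma>"
proof -
  obtain C where "\<And>\<phi> M. \<phi> holomorphic_on U \<Longrightarrow> (\<And>z. z \<in> U \<Longrightarrow> norm (\<phi> z) \<le> M) \<Longrightarrow>
      \<exists>v. ((\<lambda>u. \<phi> u * (poly (EN N) u * w u)) has_contour_integral v) \<gamma> \<and> norm v \<le> C * M"
    by (rule global_bound[OF U(1,2) N]) blast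
  from this[OF U(3,4)] obtain v where "((\<lambda>u. \<phi> u * (poly (EN N) u * w u)) has_contour_integral v) \<gamma>" by blast
  thus ?thesis unfolding TN_def using contour_integral_unique by blast
qed

lemma TN_pole_integrable:
  assumes N: "good_exp N" and z: "z \<notin> path_image \<gamma>"
  shows "((\<lambda>u. 1 / (z - u) ^ j * (poly (EN N) u * w u)) has_contour_integral TN N (\<lambda>u. 1 / (z - u) ^ j)) \<gamma>"
proof -
  obtain d where d: "d > 0" "path_image \<gamma> \<subseteq> {u. dist z u > 2 * d}" using far_set[OF z] .
  have U: "open {u. dist z u > d}" by (intro open_Collect_less continuous_intros)
  show ?thesis
  proof (rule TN_integrable[OF N U, of _ "1 / d ^ j"])
    show "path_image \<gamma> \<subseteq> {u. dist z u > d}" using d by fastforce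
    show "(\<lambda>u. 1 / (z - u) ^ j) holomorphic_on {u. dist z u > d}" using d by (intro holomorphic_intros) auto
    show "norm (1 / (z - u) ^ j) \<le> 1 / d ^ j" if "u \<in> {u. dist z u > d}" for u
      using that d by (auto simp: norm_divide norm_power dist_norm intro!: frac_le power_mono)
  qed
qed

text \<open>The error of the difference quotient is exactly h times the functional at 1/((z - u)^2
  (z + h - u)), a function bounded by d^(-3) near the arc. The uniform bound thus replaces
  differentiation under an integral that may not converge absolutely.\<close>

lemma TN_pole_has_derivative:
  assumes N: "good_exp N" and z: "z \<notin> path_image \<gamma>"
  shows "((\<lambda>z. TN N (\<lambda>u. 1 / (z - u))) has_field_derivative - TN N (\<lambda>u. 1 / (z - u)\<^sup>2)) (at z)"
proof -
  obtain d where d: "d > 0" "path_image \<gamma> \<subseteq> {u. dist z u > 2 * d}" using far_set[OF z] .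
  define U where "U = {u. dist z u > 2 * d}"
  have U: "open U" unfolding U_def by (intro open_Collect_less continuous_intros)
  obtain C where C: "C \<ge> 0" "\<And>\<phi> M. \<phi> holomorphic_on U \<Longrightarrow> (\<And>z. z \<in> U \<Longrightarrow> norm (\<phi> z) \<le> M) \<Longrightarrow>
      \<exists>v. ((\<lambda>u. \<phi> u * (poly (EN N) u * w u)) has_contour_integral v) \<gamma> \<and> norm v \<le> C * M"
    by (rule global_bound[OF U _ N]) (use d in \<open>auto simp: U_def\<close>)
  have key: "norm ((TN N (\<lambda>u. 1 / (z + h - u)) - TN N (\<lambda>u. 1 / (z - u))) / h - (- TN N (\<lambda>u. 1 / (z - u)\<^sup>2)))
      \<le> norm h * (C * (1 / d ^ 3))" if h: "h \<noteq> 0" "norm h < d" for h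
  proof -
    have far: "dist (z + h) u > d \<and> dist z u > d" if "u \<in> U" for u
      using that h d dist_triangle[of z u "z + h"] by (auto simp: U_def dist_norm)
    define \<psi> where "\<psi> u = 1 / ((z - u)\<^sup>2 * (z + h - u))" for u
    have "\<psi> holomorphic_on U" unfolding \<psi>_def using far d by (intro holomorphic_intros) (fastforce simp: dist_norm)
    moreover have "norm (\<psi> u) \<le> 1 / d ^ 3" if "u \<in> U" for u
    proof -
      have "d ^ 3 = d\<^sup>2 * d" by (simp add: power3_eq_cube power2_eq_square)
      also have "\<dots> \<le> (norm (z - u))\<^sup>2 * norm (z + h - u)"
        using far[OF that] d by (intro mult_mono power_mono) (auto simp: dist_norm)
      finally show ?thesis using d by (simp add: \<psi>_def norm_divide norm_mult norm_power frac_le)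
    qed
    ultimately obtain v where v: "((\<lambda>u. \<psi> u * (poly (EN N) u * w u)) has_contour_integral v) \<gamma>" "norm v \<le> C * (1 / d ^ 3)"
      using C(2) by blast
    have "dist z (z + h) < 2 * d" using h d by (simp add: dist_norm)
    hence zh: "z + h \<notin> path_image \<gamma>" using d(2) by force
    have "((\<lambda>u. (1 / (z + h - u) * (poly (EN N) u * w u) - 1 / (z - u) * (poly (EN N) u * w u)) / h
        - (- (1 / (z - u)\<^sup>2 * (poly (EN N) u * w u)))) has_contour_integral
       (TN N (\<lambda>u. 1 / (z + h - u)) - TN N (\<lambda>u. 1 / (z - u))) / h - (- TN N (\<lambda>u. 1 / (z - u)\<^sup>2))) \<gamma>"
      using TN_pole_integrable[OF N z, of 1] TN_pole_integrable[OF N z, of 2] TN_pole_integrable[OF N zh, of 1]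
      by (intro has_contour_integral_diff has_contour_integral_neg has_contour_integral_div) auto
    moreover have "((\<lambda>u. h * (\<psi> u * (poly (EN N) u * w u))) has_contour_integral h * v) \<gamma>"
      by (intro has_contour_integral_lmul v)
    moreover have "(1 / (z + h - u) * (poly (EN N) u * w u) - 1 / (z - u) * (poly (EN N) u * w u)) / h
        - (- (1 / (z - u)\<^sup>2 * (poly (EN N) u * w u))) = h * (\<psi> u * (poly (EN N) u * w u))" if "u \<in> path_image \<gamma>" for u
    proof -
      have "z - u \<noteq> 0" "z + h - u \<noteq> 0" using that z zh by auto
      hence "(1 / (z + h - u) - 1 / (z - u)) / h + 1 / (z - u)\<^sup>2 = h * \<psi> u"
        using h by (simp add: \<psi>_def divide_simps power2_eq_square)
      from arg_cong[OF this, of "\<lambda>y. y * (poly (EN N) u * w u)"] show ?thesis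
        by (simp add: diff_divide_distrib distrib_right left_diff_distrib)
    qed
    ultimately have "(TN N (\<lambda>u. 1 / (z + h - u)) - TN N (\<lambda>u. 1 / (z - u))) / h - (- TN N (\<lambda>u. 1 / (z - u)\<^sup>2)) = h * v"
      using has_contour_integral_unique has_contour_integral_eq by (metis (no_types, lifting))
    thus ?thesis using mult_left_mono[OF v(2) norm_ge_zero[of h]] by (simp add: norm_mult)
  qed
  have "((\<lambda>h. (TN N (\<lambda>u. 1 / (z + h - u)) - TN N (\<lambda>u. 1 / (z - u))) / h - (- TN N (\<lambda>u. 1 / (z - u)\<^sup>2))) \<longlongrightarrow> 0) (at 0)"
  proof (rule Lim_null_comparison)
    show "eventually (\<lambda>h. norm ((TN N (\<lambda>u. 1 / (z + h - u)) - TN N (\<lambda>u. 1 / (z - u))) / h - (- TN N (\<lambda>u. 1 / (z - u)\<^sup>2)))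
      \<le> norm h * (C * (1 / d ^ 3))) (at 0)"
      unfolding eventually_at using key d by (intro exI[of _ d]) auto
    show "((\<lambda>h::complex. norm h * (C * (1 / d ^ 3))) \<longlongrightarrow> 0) (at 0)"
      by (intro tendsto_eq_intros) auto
  qed
  thus ?thesis unfolding DERIV_def by (subst LIM_zero_iff[symmetric]) simp
qed

section \<open>The Cauchy transform of the weight and its differential equation\<close>

definition ct1 :: "complex \<Rightarrow> complex" where "ct1 z = contour_integral \<gamma> (\<lambda>u. w u / (z - u))"
definition ct2 :: "complex \<Rightarrow> complex" where "ct2 z = contour_integral \<gamma> (\<lambda>u. w u / (z - u)\<^sup>2)"

lemma Lg_integral: "((\<lambda>u. poly p u * w u) has_contour_integral Lg p) \<gamma>"
  unfolding Lg_def by (intro has_contour_integral_integral poly_integrable)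

text \<open>From EN(z)/(z - u) = EN(u)/(z - u) plus a polynomial in u: the transform of w exists and
  is expressed by the regularised transform and the moments, divided by EN(z).\<close>

lemma ct1_eq:
  assumes N: "good_exp N" and z: "z \<notin> path_image \<gamma>" and E: "poly (EN N) z \<noteq> 0"
  shows "((\<lambda>u. w u / (z - u)) has_contour_integral ct1 z) \<gamma>"
    and "ct1 z = (TN N (\<lambda>u. 1 / (z - u)) + Lg (synthetic_div (EN N) z)) / poly (EN N) z"
proof -
  let ?v = "(TN N (\<lambda>u. 1 / (z - u)) + Lg (synthetic_div (EN N) z)) / poly (EN N) z"
  have "((\<lambda>u. (1 / (z - u) * (poly (EN N) u * w u) + poly (synthetic_div (EN N) z) u * w u) / poly (EN N) z) has_contour_integral ?v) \<gamma>"
    using TN_pole_integrable[OF N z, of 1] by (intro has_contour_integral_div has_contour_integral_add Lg_integral) auto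
  hence "((\<lambda>u. w u / (z - u)) has_contour_integral ?v) \<gamma>"
  proof (rule has_contour_integral_eq)
    fix u assume "u \<in> path_image \<gamma>"
    hence "z \<noteq> u" using z by auto
    from synthetic_div_quotient[OF this, of "EN N"]
    have "(1 / (z - u) * (poly (EN N) u * w u) + poly (synthetic_div (EN N) z) u * w u) = poly (EN N) z / (z - u) * w u"
      by (simp add: algebra_simps)
    thus "(1 / (z - u) * (poly (EN N) u * w u) + poly (synthetic_div (EN N) z) u * w u) / poly (EN N) z = w u / (z - u)"
      using E by simp
  qed
  thus "ct1 z = ?v" "((\<lambda>u. w u / (z - u)) has_contour_integral ct1 z) \<gamma>"
    unfolding ct1_def using contour_integral_unique by auto
qed

lemma ct1_integral:
  assumes z: "z \<notin> path_image \<gamma>" shows "((\<lambda>u. w u / (z - u)) has_contour_integral ct1 z) \<gamma>"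
  using ex_good_exp ct1_eq(1)[OF _ z] z by metis

lemma ct_poly_integral:
  assumes z: "z \<notin> path_image \<gamma>"
  shows "((\<lambda>u. poly p u * w u / (z - u)) has_contour_integral poly p z * ct1 z - Lg (synthetic_div p z)) \<gamma>"
proof -
  have "((\<lambda>u. poly p z * (w u / (z - u)) - poly (synthetic_div p z) u * w u) has_contour_integral poly p z * ct1 z - Lg (synthetic_div p z)) \<gamma>"
    by (intro has_contour_integral_diff has_contour_integral_lmul ct1_integral z Lg_integral)
  thus ?thesis
  proof (rule has_contour_integral_eq)
    fix u assume "u \<in> path_image \<gamma>"
    hence "z \<noteq> u" using z by auto
    from synthetic_div_quotient[OF this, of p]
    have "poly p z / (z - u) * w u = (poly p u / (z - u) + poly (synthetic_div p z) u) * w u" by simp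
    thus "poly p z * (w u / (z - u)) - poly (synthetic_div p z) u * w u = poly p u * w u / (z - u)"
      by (simp add: algebra_simps)
  qed
qed

lemma ct2_integral:
  assumes N: "good_exp N" and z: "z \<notin> path_image \<gamma>" and E: "poly (EN N) z \<noteq> 0"
  shows "((\<lambda>u. w u / (z - u)\<^sup>2) has_contour_integral ct2 z) \<gamma>"
    and "poly (EN N) z * ct2 z = TN N (\<lambda>u. 1 / (z - u)\<^sup>2) + poly (pderiv (EN N)) z * ct1 z - Lg (synthetic_div (synthetic_div (EN N) z) z)"
proof -
  let ?s = "synthetic_div (EN N) z"
  let ?v = "(TN N (\<lambda>u. 1 / (z - u)\<^sup>2) + (poly ?s z * ct1 z - Lg (synthetic_div ?s z))) / poly (EN N) z"
  have "((\<lambda>u. (1 / (z - u)\<^sup>2 * (poly (EN N) u * w u) + poly ?s u * w u / (z - u)) / poly (EN N) z) has_contour_integral ?v) \<gamma>"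
    using TN_pole_integrable[OF N z, of 2] by (intro has_contour_integral_div has_contour_integral_add ct_poly_integral z)
  hence v: "((\<lambda>u. w u / (z - u)\<^sup>2) has_contour_integral ?v) \<gamma>"
  proof (rule has_contour_integral_eq)
    fix u assume "u \<in> path_image \<gamma>"
    hence zu: "z \<noteq> u" using z by auto
    have "1 / (z - u)\<^sup>2 * (poly (EN N) u * w u) + poly ?s u * w u / (z - u) = (poly (EN N) u / (z - u) + poly ?s u) * w u / (z - u)"
      by (simp add: power2_eq_square algebra_simps add_divide_distrib)
    also have "\<dots> = (poly (EN N) z / (z - u)) * w u / (z - u)" using synthetic_div_quotient[OF zu, of "EN N"] by simp
    finally show "(1 / (z - u)\<^sup>2 * (poly (EN N) u * w u) + poly ?s u * w u / (z - u)) / poly (EN N) z = w u / (z - u)\<^sup>2"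
      using E by (simp add: power2_eq_square)
  qed
  hence "ct2 z = ?v" unfolding ct2_def by (rule contour_integral_unique)
  thus "((\<lambda>u. w u / (z - u)\<^sup>2) has_contour_integral ct2 z) \<gamma>"
    "poly (EN N) z * ct2 z = TN N (\<lambda>u. 1 / (z - u)\<^sup>2) + poly (pderiv (EN N)) z * ct1 z - Lg (synthetic_div (synthetic_div (EN N) z) z)"
    using v E by (auto simp: poly_synthetic_div_self)
qed

text \<open>Quotient rule for the representation by the regularised transform; the identity for
  \<open>ct2\<close> shows that the result is again an integral against w.\<close>

lemma ct1_has_derivative:
  assumes z: "z \<notin> path_image \<gamma>" shows "(ct1 has_field_derivative - ct2 z) (at z)"
proof -
  obtain N where N: "good_exp N" and E: "\<And>z. z \<notin> path_image \<gamma> \<Longrightarrow> poly (EN N) z \<noteq> 0" using ex_good_exp by blast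
  obtain Q where Q: "\<And>z. poly Q z = Lg (synthetic_div (EN N) z)"
      "\<And>z. poly (pderiv Q) z = Lg (synthetic_div (synthetic_div (EN N) z) z)"
    using synthetic_functional_poly[OF plin_Lg] by metis
  have op: "open (- path_image \<gamma>)" using closed_path_image[OF path] by (simp add: open_Compl)
  let ?n = "\<lambda>z. TN N (\<lambda>u. 1 / (z - u)) + poly Q z"
  have n: "(?n has_field_derivative - TN N (\<lambda>u. 1 / (z - u)\<^sup>2) + poly (pderiv Q) z) (at z)"
    by (intro DERIV_add TN_pole_has_derivative N z poly_DERIV)
  have "((\<lambda>z. ?n z / poly (EN N) z) has_field_derivative
     ((- TN N (\<lambda>u. 1 / (z - u)\<^sup>2) + poly (pderiv Q) z) * poly (EN N) z - ?n z * poly (pderiv (EN N)) z) / (poly (EN N) z * poly (EN N) z)) (at z)"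
    by (rule DERIV_divide[OF n poly_DERIV E[OF z]])
  moreover have "((- TN N (\<lambda>u. 1 / (z - u)\<^sup>2) + poly (pderiv Q) z) * poly (EN N) z - ?n z * poly (pderiv (EN N)) z) / (poly (EN N) z * poly (EN N) z) = - ct2 z"
  proof -
    have n: "?n z = ct1 z * poly (EN N) z" using ct1_eq(2)[OF N z E[OF z]] E[OF z] by (simp add: Q)
    have "- TN N (\<lambda>u. 1 / (z - u)\<^sup>2) + poly (pderiv Q) z = poly (pderiv (EN N)) z * ct1 z - poly (EN N) z * ct2 z"
      using ct2_integral(2)[OF N z E[OF z]] by (simp add: Q)
    moreover have "(poly (pderiv (EN N)) z * ct1 z - poly (EN N) z * ct2 z) * poly (EN N) z - ct1 z * poly (EN N) z * poly (pderiv (EN N)) z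
        = - ct2 z * (poly (EN N) z * poly (EN N) z)" by (simp add: algebra_simps)
    ultimately show ?thesis unfolding n using E[OF z] by (simp only:) simp
  qed
  ultimately have "((\<lambda>z. ?n z / poly (EN N) z) has_field_derivative - ct2 z) (at z)" by simp
  thus ?thesis
    by (rule has_field_derivative_transform_within_open[OF _ op]) (use z ct1_eq(2)[OF N _ E] in \<open>auto simp: Q\<close>)
qed

text \<open>The Pearson relation for phi(u) = 1/(z - u). Moving the values of V and W from u to z
  leaves only polynomials in u, so 2V f - W f' is given by the functional alone.\<close>

lemma ct_ode:
  assumes z: "z \<notin> path_image \<gamma>"
  shows "poly (V2poly m \<alpha> x) z * ct1 z + Wp z * ct2 z = Lg (synthetic_div (V2poly m \<alpha> x) z + pderiv (synthetic_div (Wpoly m x) z))"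
proof -
  obtain N where N: "good_exp N" and E: "poly (EN N) z \<noteq> 0" using ex_good_exp z by metis
  let ?V = "V2poly m \<alpha> x" and ?W = "Wpoly m x"
  have op: "open (- {z})" "path_image \<gamma> \<subseteq> - {z}" using z by auto
  have d: "((\<lambda>u. 1 / (z - u)) has_field_derivative 1 / (z - u)\<^sup>2) (at u)" if "u \<noteq> z" for u
    using that by (auto intro!: derivative_eq_intros simp: power2_eq_square)
  have "((\<lambda>u. (deriv (\<lambda>u. 1 / (z - u)) u * Wp u + 1 / (z - u) * poly Qp u) * w u) has_contour_integral 0) \<gamma>"
    by (rule pearson[OF op]) (intro holomorphic_intros, auto)
  hence P: "((\<lambda>u. (1 / (z - u)\<^sup>2 * Wp u + 1 / (z - u) * poly Qp u) * w u) has_contour_integral 0) \<gamma>"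
  proof (rule has_contour_integral_eq)
    fix u assume "u \<in> path_image \<gamma>"
    hence "u \<noteq> z" using z by auto
    from DERIV_imp_deriv[OF d[OF this]]
    show "(deriv (\<lambda>u. 1 / (z - u)) u * Wp u + 1 / (z - u) * poly Qp u) * w u = (1 / (z - u)\<^sup>2 * Wp u + 1 / (z - u) * poly Qp u) * w u"
      by simp
  qed
  have "((\<lambda>u. poly ?V z * (w u / (z - u)) + Wp z * (w u / (z - u)\<^sup>2) - (1 / (z - u)\<^sup>2 * Wp u + 1 / (z - u) * poly Qp u) * w u)
      has_contour_integral poly ?V z * ct1 z + Wp z * ct2 z - 0) \<gamma>"
    by (intro has_contour_integral_diff has_contour_integral_add has_contour_integral_lmul ct1_integral ct2_integral(1)[OF N z E] z P)
  moreover have "poly ?V z * (w u / (z - u)) + Wp z * (w u / (z - u)\<^sup>2) - (1 / (z - u)\<^sup>2 * Wp u + 1 / (z - u) * poly Qp u) * w u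
     = poly (synthetic_div ?V z + pderiv (synthetic_div ?W z)) u * w u" if "u \<in> path_image \<gamma>" for u
  proof -
    have zu: "z \<noteq> u" using that z by auto
    have "poly ?V z / (z - u) + Wp z / (z - u)\<^sup>2 - (Wp u / (z - u)\<^sup>2 + (poly (pderiv ?W) u + poly ?V u) / (z - u))
      = poly (synthetic_div ?V z) u + poly (pderiv (synthetic_div ?W z)) u"
      unfolding synthetic_div_quotient[OF zu, of ?V] synthetic_div_second_quotient[OF zu, of ?W]
      by (simp add: add_divide_distrib)
    from arg_cong[OF this, of "\<lambda>y. y * w u"] show ?thesis
      by (simp add: algebra_simps add_divide_distrib)
  qed
  ultimately have "((\<lambda>u. poly (synthetic_div ?V z + pderiv (synthetic_div ?W z)) u * w u) has_contour_integral
      poly ?V z * ct1 z + Wp z * ct2 z - 0) \<gamma>" by (rule has_contour_integral_eq)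
  thus ?thesis unfolding Lg_def using contour_integral_unique by fastforce
qed

end

subsection \<open>Decomposition of an arc integral into base integrals\<close>

text \<open>The factors by which two branches of the product of (z - x_l)^(beta_l) can differ at a
  point.\<close>

definition phases :: "nat \<Rightarrow> (nat \<Rightarrow> complex) \<Rightarrow> complex set" where
  "phases m \<beta> = range (\<lambda>n :: nat \<Rightarrow> int. exp (\<Sum>l<m. \<beta> l * (of_int (2 * n l) * pi * \<i>)))"

text \<open>The additive group generated by the phases, since crossing a cut adds a difference of
  two phases to a coefficient. Sums of finite lists make its countability immediate.\<close>

definition phase_group :: "nat \<Rightarrow> (nat \<Rightarrow> complex) \<Rightarrow> complex set" where
  "phase_group m \<beta> = sum_list ` lists (phases m \<beta> \<union> uminus ` phases m \<beta>)"

text \<open>Only the entries n l with l < m matter. Restricting to them is essential, as the integer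
  sequences themselves are uncountable.\<close>

lemma countable_phase_group: "countable (phase_group m \<beta>)"
proof -
  have "phases m \<beta> \<subseteq> (\<lambda>n :: nat \<Rightarrow> int. exp (\<Sum>l<m. \<beta> l * (of_int (2 * n l) * pi * \<i>))) ` ({..<m} \<rightarrow>\<^sub>E UNIV)"
  proof
    fix y assume "y \<in> phases m \<beta>"
    then obtain n :: "nat \<Rightarrow> int" where y: "y = exp (\<Sum>l<m. \<beta> l * (of_int (2 * n l) * pi * \<i>))" by (auto simp: phases_def)
    have "y = exp (\<Sum>l<m. \<beta> l * (of_int (2 * (restrict n {..<m}) l) * pi * \<i>))"
      unfolding y by (intro arg_cong[of _ _ exp] sum.cong) auto
    thus "y \<in> (\<lambda>n :: nat \<Rightarrow> int. exp (\<Sum>l<m. \<beta> l * (of_int (2 * n l) * pi * \<i>))) ` ({..<m} \<rightarrow>\<^sub>E UNIV)"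
      by (rule image_eqI[where x = "restrict n {..<m}"]) auto
  qed
  moreover have "countable (({..<m} \<rightarrow>\<^sub>E UNIV) :: (nat \<Rightarrow> int) set)" by (intro countable_PiE) auto
  ultimately have "countable (phases m \<beta>)" by (meson countable_image countable_subset)
  thus ?thesis unfolding phase_group_def by (intro countable_image countable_lists) auto
qed

lemma phase_group_0: "0 \<in> phase_group m \<beta>"
  unfolding phase_group_def by (rule image_eqI[of _ _ "[]"]) auto

lemma phase_group_add: "a \<in> phase_group m \<beta> \<Longrightarrow> c \<in> phase_group m \<beta> \<Longrightarrow> a + c \<in> phase_group m \<beta>"
proof -
  assume "a \<in> phase_group m \<beta>" "c \<in> phase_group m \<beta>"
  then obtain p q where "p \<in> lists (phases m \<beta> \<union> uminus ` phases m \<beta>)" "q \<in> lists (phases m \<beta> \<union> uminus ` phases m \<beta>)"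
    "a = sum_list p" "c = sum_list q" by (auto simp: phase_group_def)
  thus ?thesis unfolding phase_group_def by (intro image_eqI[of _ _ "p @ q"]) auto
qed

lemma phase_group_phase: "a \<in> phases m \<beta> \<Longrightarrow> a \<in> phase_group m \<beta>"
  unfolding phase_group_def by (rule image_eqI[of _ _ "[a]"]) auto

lemma phase_group_minus: "a \<in> phase_group m \<beta> \<Longrightarrow> - a \<in> phase_group m \<beta>"
proof -
  have s: "sum_list (map uminus p) = - sum_list p" for p :: "complex list" by (induction p) auto
  assume "a \<in> phase_group m \<beta>"
  then obtain p where p: "p \<in> lists (phases m \<beta> \<union> uminus ` phases m \<beta>)" "a = sum_list p" by (auto simp: phase_group_def)
  hence "map uminus p \<in> lists (phases m \<beta> \<union> uminus ` phases m \<beta>)" by (force simp: lists_eq_set)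
  thus ?thesis unfolding phase_group_def p(2) s[symmetric] by (rule imageI)
qed

lemma phase_group_diff: "a \<in> phase_group m \<beta> \<Longrightarrow> c \<in> phase_group m \<beta> \<Longrightarrow> a - c \<in> phase_group m \<beta>"
  using phase_group_add[of a m \<beta> "- c"] phase_group_minus[of c m \<beta>] by simp

text \<open>A branch of the weight normalised to 1 at b. Only ratios occur, so near a generic
  configuration it varies holomorphically with the points.\<close>

definition wbase :: "nat \<Rightarrow> (nat \<Rightarrow> complex) \<Rightarrow> complex \<Rightarrow> (nat \<Rightarrow> complex) \<Rightarrow> complex \<Rightarrow> complex" where
  "wbase m x b \<beta> z = (\<Prod>l<m. ((z - x l) / (b - x l)) powr \<beta> l)"

definition Ibase :: "nat \<Rightarrow> (nat \<Rightarrow> complex) \<Rightarrow> complex \<Rightarrow> (nat \<Rightarrow> complex) \<Rightarrow> nat \<Rightarrow> complex poly \<Rightarrow> complex" where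
  "Ibase m x b \<beta> k p = contour_integral (linepath b (x k)) (\<lambda>u. poly p u * wbase m x b \<beta> u)"

text \<open>Restores the normalisation lost in \<open>wbase\<close>. Through the principal logarithm
  it can jump as the points move, but it is a common factor of all coefficients and cancels in their
  ratios.\<close>

definition omega :: "nat \<Rightarrow> (nat \<Rightarrow> complex) \<Rightarrow> complex \<Rightarrow> (nat \<Rightarrow> complex) \<Rightarrow> complex" where
  "omega m x b \<beta> = (\<Prod>l<m. exp (\<beta> l * Ln (b - x l)))"

text \<open>Off the ray from \<open>c\<close> away from \<open>b\<close> the principal branch of a power of \<open>(z - c) / (b - c)\<close> is holomorphic.\<close>

definition ray :: "complex \<Rightarrow> complex \<Rightarrow> complex set" where
  "ray b c = {z. (z - c) / (b - c) \<in> \<real>\<^sub>\<le>\<^sub>0}"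

text \<open>Geometrically, b is none of the points and lies on no line through two of them. Then the
  rays behind the points are disjoint, and the segment from b to x_k meets no ray before its
  end.\<close>

definition generic_base :: "nat \<Rightarrow> (nat \<Rightarrow> complex) \<Rightarrow> complex \<Rightarrow> bool" where
  "generic_base m x b \<longleftrightarrow> (\<forall>k<m. x k \<noteq> b) \<and> (\<forall>k<m. \<forall>l<m. k \<noteq> l \<longrightarrow> (x l - b) / (x k - b) \<notin> \<real>)"

lemma omega_nz: "omega m x b \<beta> \<noteq> 0" by (simp add: omega_def)

lemma closed_ray: "b \<noteq> c \<Longrightarrow> closed (ray b c)"
  unfolding ray_def using continuous_closed_vimage[OF closed_nonpos_Reals_complex, of "\<lambda>z. (z - c) / (b - c)"]
  by (auto simp: vimage_def intro!: continuous_intros)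

lemma ray_self: "c \<in> ray b c" by (simp add: ray_def)

lemma ray_iff: "b \<noteq> c \<Longrightarrow> z \<in> ray b c \<longleftrightarrow> (\<exists>s\<ge>0. z = b + of_real (1 + s) * (c - b))"
proof
  assume bc: "b \<noteq> c" and "z \<in> ray b c"
  then obtain r where r: "r \<le> 0" "(z - c) / (b - c) = of_real r" by (auto simp: ray_def elim!: nonpos_Reals_cases)
  hence "z - c = of_real r * (b - c)" using bc by (simp add: field_simps)
  hence "z = b + of_real (1 + - r) * (c - b)" by (simp add: algebra_simps)
  thus "\<exists>s\<ge>0. z = b + of_real (1 + s) * (c - b)" using r(1) by (intro exI[of _ "- r"]) simp
next
  assume bc: "b \<noteq> c" and "\<exists>s\<ge>0. z = b + of_real (1 + s) * (c - b)"
  then obtain s where s: "s \<ge> 0" "z = b + of_real (1 + s) * (c - b)" by blast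
  have "z - c = of_real (- s) * (b - c)" unfolding s by (simp add: algebra_simps)
  hence "(z - c) / (b - c) = of_real (- s)" using bc by simp
  moreover have "complex_of_real (- s) \<in> \<real>\<^sub>\<le>\<^sub>0" using s(1) by (simp only: nonpos_Reals_of_real_iff)
  ultimately show "z \<in> ray b c" unfolding ray_def by simp
qed

lemma rays_disjoint:
  assumes "generic_base m x b" "k < m" "l < m" "k \<noteq> l"
  shows "ray b (x k) \<inter> ray b (x l) = {}"
proof (rule ccontr)
  assume "\<not> ?thesis"
  then obtain z where z: "z \<in> ray b (x k)" "z \<in> ray b (x l)" by blast
  have nb: "b \<noteq> x k" "b \<noteq> x l" using assms by (auto simp: generic_base_def)
  obtain s s' where s: "s \<ge> 0" "s' \<ge> 0" "of_real (1 + s) * (x k - b) = of_real (1 + s') * (x l - b)"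
    using z by (auto simp: ray_iff[OF nb(1)] ray_iff[OF nb(2)])
  have "complex_of_real (1 + s') \<noteq> 0" using s(2) by (metis add_nonneg_eq_0_iff of_real_eq_0_iff zero_le_one zero_neq_one)
  hence "(x l - b) / (x k - b) = of_real ((1 + s) / (1 + s'))"
    using s(3) nb(1) by (simp add: field_simps)
  thus False using assms unfolding generic_base_def by (metis Reals_of_real)
qed

lemma segment_off_rays:
  assumes "generic_base m x b" "k < m" "l < m" "0 \<le> s" "s < 1"
  shows "b + of_real s * (x k - b) \<notin> ray b (x l)"
proof
  assume "b + of_real s * (x k - b) \<in> ray b (x l)"
  have nb: "b \<noteq> x k" "b \<noteq> x l" using assms by (auto simp: generic_base_def)
  then obtain s' where s': "s' \<ge> 0" "of_real s * (x k - b) = of_real (1 + s') * (x l - b)"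
    using \<open>_ \<in> ray b (x l)\<close> by (auto simp: ray_iff)
  have "complex_of_real (1 + s') \<noteq> 0" using s'(1) by (metis add_nonneg_eq_0_iff of_real_eq_0_iff zero_le_one zero_neq_one)
  hence "(x l - b) / (x k - b) = of_real (s / (1 + s'))"
    using s'(2) nb by (simp add: field_simps)
  hence "k = l" using assms unfolding generic_base_def by (metis Reals_of_real)
  hence "complex_of_real s = of_real (1 + s')" using s'(2) nb by simp
  hence "s = 1 + s'" by (simp only: of_real_eq_iff)
  thus False using s'(1) assms by simp
qed

lemma ray_off_base: "b \<noteq> c \<Longrightarrow> b \<notin> ray b c"
  by (auto simp: ray_def)

definition lamb :: "(nat \<Rightarrow> complex) \<Rightarrow> complex \<Rightarrow> nat \<Rightarrow> complex \<Rightarrow> complex" where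
  "lamb x b l z = Ln (b - x l) + Ln ((z - x l) / (b - x l))"

lemma lamb_has_derivative:
  assumes "b \<noteq> x l" "z \<notin> ray b (x l)"
  shows "(lamb x b l has_field_derivative 1 / (z - x l)) (at z)"
proof -
  have n: "(z - x l) / (b - x l) \<notin> \<real>\<^sub>\<le>\<^sub>0" using assms by (simp add: ray_def)
  hence "z \<noteq> x l" by auto
  have "((\<lambda>z. (z - x l) / (b - x l)) has_field_derivative 1 / (b - x l)) (at z)"
    using assms by (auto intro!: derivative_eq_intros)
  from DERIV_chain2[OF has_field_derivative_Ln[OF n] this]
  have "((\<lambda>z. Ln ((z - x l) / (b - x l))) has_field_derivative inverse ((z - x l) / (b - x l)) * (1 / (b - x l))) (at z)" .
  from DERIV_add[OF DERIV_const this] show ?thesis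
    unfolding lamb_def[abs_def] using assms \<open>z \<noteq> x l\<close> by (simp add: field_simps)
qed

lemma exp_lamb: "b \<noteq> x l \<Longrightarrow> z \<noteq> x l \<Longrightarrow> exp (lamb x b l z) = z - x l"
  by (simp add: lamb_def exp_add)

lemma omega_wbase:
  assumes "\<And>l. l < m \<Longrightarrow> b \<noteq> x l" "\<And>l. l < m \<Longrightarrow> z \<noteq> x l"
  shows "(\<Prod>l<m. exp (\<beta> l * lamb x b l z)) = omega m x b \<beta> * wbase m x b \<beta> z"
  unfolding omega_def wbase_def prod.distrib[symmetric]
  by (intro prod.cong) (use assms in \<open>auto simp: lamb_def powr_def exp_add[symmetric] algebra_simps\<close>)

section \<open>Charts adapted to the rays behind the points\<close>

context weighted_arc begin

context
  fixes b :: complex and N :: nat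
  assumes gen: "generic_base m x b" and N1: "N \<ge> 1" and NR: "\<And>k. k < m \<Longrightarrow> Re (\<alpha> k + of_nat N) > 0"
begin

abbreviation (input) "be \<equiv> \<lambda>k. \<alpha> k + complex_of_nat N"
abbreviation (input) "lm \<equiv> lamb x b"
abbreviation (input) "NN \<equiv> \<lambda>_::nat. N"
abbreviation (input) "om \<equiv> omega m x b be"
abbreviation (input) "Om \<equiv> - (\<Union>l<m. ray b (x l))"

lemma bx: "l < m \<Longrightarrow> b \<noteq> x l" using gen by (auto simp: generic_base_def)

lemma lm_hol: "l < m \<Longrightarrow> S \<inter> ray b (x l) = {} \<Longrightarrow> lm l holomorphic_on S"
  unfolding holomorphic_on_def using lamb_has_derivative bx
  by (meson disjoint_iff field_differentiable_at_within field_differentiable_def)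

lemma exp_lm: "l < m \<Longrightarrow> z \<notin> ray b (x l) \<Longrightarrow> exp (lm l z) = z - x l"
  using ray_self by (metis bx exp_lamb)

lemma Om_open: "open Om"
  by (intro open_Compl closed_UN) (auto intro!: closed_ray bx)

text \<open>The complement of the rays is star-shaped about b: a point of a ray, scaled away from b,
  stays on that ray, so a segment from b that meets a ray also ends on it.\<close>

lemma chart_Om: "chart Om b {} lm"
  unfolding chart_def
proof (intro conjI ballI)
  show "b \<in> Om" using ray_off_base bx by auto
  fix z assume z: "z \<in> Om"
  show "closed_segment b z \<subseteq> Om"
  proof
    fix y assume "y \<in> closed_segment b z"
    then obtain u where u: "0 \<le> u" "u \<le> 1" "y = (1 - u) *\<^sub>R b + u *\<^sub>R z" by (auto simp: closed_segment_def)
    have y: "y - b = of_real u * (z - b)" using u by (simp add: scaleR_conv_of_real algebra_simps)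
    have "y \<notin> ray b (x l)" if l: "l < m" for l
    proof
      assume "y \<in> ray b (x l)"
      then obtain s where s: "s \<ge> 0" "y = b + of_real (1 + s) * (x l - b)" using ray_iff[OF bx[OF l]] by blast
      have u0: "u \<noteq> 0"
      proof
        assume "u = 0" hence "complex_of_real (1 + s) * (x l - b) = 0" using s y by simp
        moreover have "complex_of_real (1 + s) \<noteq> 0" using s(1) by (metis add_nonneg_eq_0_iff of_real_eq_0_iff zero_le_one zero_neq_one)
        ultimately show False using bx[OF l] by simp
      qed
      have "of_real u * (z - b) = of_real (1 + s) * (x l - b)" using y s(2) by simp
      hence "z = b + of_real ((1 + s) / u) * (x l - b)" using u0 by (simp add: field_simps)
      also have "(1 + s) / u = 1 + ((1 + s) / u - 1)" by simp
      finally have "z \<in> ray b (x l)" unfolding ray_iff[OF bx[OF l]]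
        using u u0 s(1) by (intro exI[of _ "(1 + s) / u - 1"]) (auto simp: field_simps)
      thus False using z l by auto
    qed
    thus "y \<in> Om" by auto
  qed
next
  fix l assume "l \<in> {..<m} - {}"
  thus "lm l holomorphic_on Om" by (intro lm_hol) auto
  fix z assume "z \<in> Om" thus "exp (lm l z) = z - x l" using \<open>l \<in> _\<close> by (intro exp_lm) auto
qed (use Om_open in auto)

text \<open>D may cross the ray of x_k itself, since with J = {k} the logarithm of z - x_k is not
  part of the chart.\<close>

lemma chart_k:
  assumes "open D" "convex D" "x k \<in> D" "k < m" "\<And>l. l < m \<Longrightarrow> l \<noteq> k \<Longrightarrow> D \<inter> ray b (x l) = {}"
  shows "chart D (x k) {k} lm"
  unfolding chart_def
proof (intro conjI ballI)
  fix z assume "z \<in> D" thus "closed_segment (x k) z \<subseteq> D" using assms closed_segment_subset by blast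
next
  fix l assume l: "l \<in> {..<m} - {k}"
  show "lm l holomorphic_on D" using l assms(5) by (intro lm_hol) auto
  fix z assume "z \<in> D" thus "exp (lm l z) = z - x l" using l assms(5)[of l] by (intro exp_lm) auto
qed (use assms in auto)

lemma cg_Om: "z \<in> Om \<Longrightarrow> cg NN {} lm z = om * wbase m x b be z"
  unfolding cg_def using omega_wbase[of m b x z be] bx ray_self by auto

lemma cg_split: "k < m \<Longrightarrow> cg NN {} lm z = exp (be k * lm k z) * cg NN {k} lm z"
  unfolding cg_def by (simp add: prod.remove[of "{..<m}" k])

text \<open>The segment from x_k to z runs inside the ray, at positive distance from the other rays.
  Its Minkowski sum with a small ball is open and convex and still misses them.\<close>

lemma ex_convex_nbhd:
  assumes k: "k < m" and z: "z \<in> ray b (x k)"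
  obtains D where "open D" "convex D" "x k \<in> D" "z \<in> D" "\<And>l. l < m \<Longrightarrow> l \<noteq> k \<Longrightarrow> D \<inter> ray b (x l) = {}"
proof -
  define S where "S = closed_segment (x k) z"
  define R where "R = (\<Union>l\<in>{..<m}-{k}. ray b (x l))"
  have "S \<subseteq> ray b (x k)"
  proof
    fix y assume "y \<in> S"
    then obtain u where u: "0 \<le> u" "u \<le> 1" "y = (1 - u) *\<^sub>R x k + u *\<^sub>R z" by (auto simp: closed_segment_def S_def)
    obtain s where s: "s \<ge> 0" "z = b + of_real (1 + s) * (x k - b)" using z ray_iff[OF bx[OF k]] by blast
    have "y = b + of_real (1 + u * s) * (x k - b)" unfolding u(3) s(2) by (simp add: scaleR_conv_of_real algebra_simps)
    thus "y \<in> ray b (x k)" unfolding ray_iff[OF bx[OF k]] using u s by (intro exI[of _ "u * s"]) auto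
  qed
  hence disj: "S \<inter> R = {}" using rays_disjoint[OF gen k] unfolding R_def by fastforce
  have "compact S" "closed R" unfolding S_def R_def by (auto intro!: closed_UN closed_ray bx)
  from separate_compact_closed[OF this disj] obtain d where d: "d > 0" "\<And>u v. u \<in> S \<Longrightarrow> v \<in> R \<Longrightarrow> d \<le> dist u v" by blast
  define D where "D = (\<Union>u\<in>S. \<Union>v\<in>ball 0 d. {u + v})"
  show ?thesis
  proof (rule that[of D])
    have "D = (\<Union>u\<in>S. ball u d)"
    proof (intro equalityI subsetI)
      fix y assume "y \<in> D"
      then obtain u v where "u \<in> S" "norm v < d" "y = u + v" by (auto simp: D_def)
      thus "y \<in> (\<Union>u\<in>S. ball u d)" by (auto simp: dist_norm intro!: bexI[of _ u])
    next
      fix y assume "y \<in> (\<Union>u\<in>S. ball u d)"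
      then obtain u where "u \<in> S" "dist u y < d" by auto
      hence "y = u + (y - u)" "norm (y - u) < d" by (auto simp: dist_norm norm_minus_commute)
      thus "y \<in> D" unfolding D_def by (intro UN_I[OF \<open>u \<in> S\<close>] UN_I[of "y - u"]) auto
    qed
    thus "open D" by auto
    have "(\<Union>u\<in>S. \<Union>v\<in>ball 0 d. {u + v}) = {u + v | u v. u \<in> S \<and> v \<in> ball 0 d}" by blast
    thus "convex D" unfolding D_def
      using convex_sums[of S "ball 0 d"] by (simp add: S_def)
    have "u \<in> D" if "u \<in> S" for u using d(1) unfolding D_def by (intro UN_I[OF that] UN_I[of 0]) auto
    thus "x k \<in> D" "z \<in> D" by (auto simp: S_def)
    fix l assume l: "l < m" "l \<noteq> k"
    show "D \<inter> ray b (x l) = {}"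
    proof (rule ccontr)
      assume "D \<inter> ray b (x l) \<noteq> {}"
      then obtain u v where uv: "u \<in> S" "norm v < d" "u + v \<in> ray b (x l)" by (auto simp: D_def)
      hence "u + v \<in> R" using l by (auto simp: R_def)
      from d(2)[OF uv(1) this] uv(2) show False by (simp add: dist_norm)
    qed
  qed
qed

section \<open>Primitives in the charts and the relation between them\<close>

definition kap :: "nat \<Rightarrow> real \<Rightarrow> complex" where "kap k s = of_real s powr (be k)"

lemma kap_kernel: "k < m \<Longrightarrow> is_kernel (kap k) (\<Sum>l\<in>{k}. \<alpha> l + of_nat (NN l))"
  using is_kernel_powr[OF NR] by (simp add: kap_def[abs_def])

text \<open>The primitive of the reference branch on the complement of the rays that vanishes at b;
  the centre b is regular, hence the constant kernel.\<close>

definition prim0 :: "complex poly \<Rightarrow> complex \<Rightarrow> complex" where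
  "prim0 p z = (z - b) * Hf (\<lambda>_. 1) b (\<lambda>z. poly p z * cg NN {} lm z) z"

text \<open>The primitive that vanishes at x_k, without its factor exp (be k * lm k z). Omitting
  this factor makes it holomorphic across the ray of x_k.\<close>

definition primk :: "nat \<Rightarrow> complex poly \<Rightarrow> complex \<Rightarrow> complex" where
  "primk k p z = (z - x k) * Hf (kap k) (x k) (\<lambda>z. poly p z * cg NN {k} lm z) z"

lemma prim0_has_derivative:
  assumes z: "z \<in> Om" shows "(prim0 p has_field_derivative poly p z * cg NN {} lm z) (at z)"
proof -
  let ?g = "\<lambda>z. poly p z * cg NN {} lm z"
  have g: "?g holomorphic_on Om" by (intro holomorphic_intros cg_holomorphic[OF chart_Om])
  have st: "\<forall>z\<in>Om. closed_segment b z \<subseteq> Om" using chart_Om by (simp add: chart_def)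
  note d = Hf_has_derivative[OF Om_open st g is_kernel_1 z]
  have zb: "((\<lambda>z. z - b) has_field_derivative 1) (at z)" by (auto intro!: derivative_eq_intros)
  from DERIV_mult[OF zb d] show ?thesis
    unfolding prim0_def[abs_def] using Hf_ode[OF Om_open st g is_kernel_1 z] DERIV_imp_deriv[OF d]
    by (simp add: algebra_simps)
qed

text \<open>On D minus the ray both sides are primitives of the same function on a connected set, so
  they differ by a constant. One vanishes at b and the other at x_k, so the constant is the integral
  of the reference branch from b to x_k.\<close>

lemma chart_relation:
  assumes D: "open D" "convex D" "x k \<in> D" "k < m" "\<And>l. l < m \<Longrightarrow> l \<noteq> k \<Longrightarrow> D \<inter> ray b (x l) = {}"
    and z: "z \<in> D" "z \<notin> ray b (x k)"
  shows "prim0 p z = om * Ibase m x b be k p + exp (be k * lm k z) * primk k p z"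
proof -
  let ?g = "\<lambda>z. poly p z * cg NN {k} lm z"
  note ch = chart_k[OF D]
  have g: "?g holomorphic_on D" by (intro holomorphic_intros cg_holomorphic[OF ch])
  have st: "\<forall>z\<in>D. closed_segment (x k) z \<subseteq> D" using ch by (simp add: chart_def)
  have kk: "is_kernel (kap k) (be k)" using kap_kernel[OF D(4)] by simp
  note dH = Hf_has_derivative[OF D(1) st g kk] and ode = Hf_ode[OF D(1) st g kk]
  define X where "X = D - ray b (x k)"
  have Xo: "open X" unfolding X_def by (intro open_Diff D closed_ray bx)
  have XOm: "X \<subseteq> Om" using D(5) unfolding X_def by fastforce
  let ?f2 = "\<lambda>z. exp (be k * lm k z) * primk k p z"
  have d2: "(?f2 has_field_derivative poly p y * cg NN {} lm y) (at y)" if y: "y \<in> X" for y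
  proof -
    have yD: "y \<in> D" "y \<notin> ray b (x k)" using y by (auto simp: X_def)
    have yk: "y \<noteq> x k" using yD ray_self by blast
    have e: "((\<lambda>z. exp (be k * lm k z)) has_field_derivative exp (be k * lm k y) * (be k * (1 / (y - x k)))) (at y)"
      by (intro DERIV_chain2[OF DERIV_exp] DERIV_cmult lamb_has_derivative bx D yD)
    have "((\<lambda>z. z - x k) has_field_derivative 1) (at y)" by (auto intro!: derivative_eq_intros)
    from DERIV_mult[OF e DERIV_mult[OF this dH[OF yD(1)]]]
    have "(?f2 has_field_derivative exp (be k * lm k y) * (be k * (1 / (y - x k))) * ((y - x k) * Hf (kap k) (x k) ?g y)
       + (1 * Hf (kap k) (x k) ?g y + deriv (Hf (kap k) (x k) ?g) y * (y - x k)) * exp (be k * lm k y)) (at y)"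
      unfolding primk_def DERIV_imp_deriv[OF dH[OF yD(1)]] .
    moreover have "exp (be k * lm k y) * (be k * (1 / (y - x k))) * ((y - x k) * Hf (kap k) (x k) ?g y)
       + (1 * Hf (kap k) (x k) ?g y + deriv (Hf (kap k) (x k) ?g) y * (y - x k)) * exp (be k * lm k y)
      = exp (be k * lm k y) * ((1 + be k) * Hf (kap k) (x k) ?g y + (y - x k) * deriv (Hf (kap k) (x k) ?g) y)"
    proof -
      have alg: "e * (B * (1 / d)) * (d * H) + (1 * H + H' * d) * e = e * ((1 + B) * H + d * H')" if "d \<noteq> 0" for e B d H H' :: complex
        using that by (simp add: algebra_simps)
      show ?thesis by (rule alg) (use yk in simp)
    qed
    ultimately show ?thesis unfolding ode[OF yD(1)] cg_split[OF D(4), of y] by (simp add: mult.assoc mult.left_commute)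
  qed
  obtain r where r: "r > 0" "ball (x k) r \<subseteq> D" using D(1,3) openE by blast
  have kb: "norm (b - x k) > 0" using bx[OF D(4)] by simp
  define \<eta> where "\<eta> = min (1/2) (r / (2 * norm (b - x k)))"
  have \<eta>: "\<eta> > 0" "\<eta> < 1" "\<eta> * norm (b - x k) < r"
  proof -
    show "\<eta> > 0" "\<eta> < 1" using r kb by (auto simp: \<eta>_def)
    have "\<eta> * norm (b - x k) \<le> r / (2 * norm (b - x k)) * norm (b - x k)" using kb by (intro mult_right_mono) (auto simp: \<eta>_def)
    also have "\<dots> = r / 2" using kb by simp
    finally show "\<eta> * norm (b - x k) < r" using r by simp
  qed
  have nearD: "b + of_real s * (x k - b) \<in> D" if "1 - \<eta> \<le> s" "s \<le> 1" for s
  proof -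
    have "dist (x k) (b + of_real s * (x k - b)) = norm (of_real (1 - s) * (x k - b))" by (simp add: dist_norm algebra_simps)
    also have "\<dots> = (1 - s) * norm (b - x k)" using that by (simp add: norm_mult norm_minus_commute del: of_real_diff)
    also have "\<dots> \<le> \<eta> * norm (b - x k)" using that by (intro mult_right_mono) auto
    finally show ?thesis using \<eta>(3) r(2) by auto
  qed
  \<comment> \<open>A point of the segment from b just before x_k, about which D minus the ray is
    star-shaped.\<close>
  define a where "a = b + of_real (1 - \<eta>) * (x k - b)"
  have aX: "a \<in> X" using nearD[of "1 - \<eta>"] segment_off_rays[OF gen D(4) D(4), of "1 - \<eta>"] \<eta> by (auto simp: X_def a_def)
  \<comment> \<open>Since a lies on the line carrying the ray, on the side of b, a segment from a
    that meets the ray can do so only if y is on the ray too.\<close>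
  have seg: "closed_segment a y \<subseteq> X" if y: "y \<in> X" for y
  proof
    fix u assume u: "u \<in> closed_segment a y"
    have "u \<in> D" using u aX y D(2) closed_segment_subset[of a D y] unfolding X_def by blast
    moreover have "u \<notin> ray b (x k)"
    proof
      assume ur: "u \<in> ray b (x k)"
      obtain \<tau> where \<tau>: "0 \<le> \<tau>" "\<tau> \<le> 1" "u = (1 - \<tau>) *\<^sub>R a + \<tau> *\<^sub>R y" using u by (auto simp: closed_segment_def)
      obtain q where q: "q \<ge> 0" "u = b + of_real (1 + q) * (x k - b)" using ur ray_iff[OF bx[OF D(4)]] by blast
      have eq: "of_real \<tau> * (y - b) = of_real (1 + q - (1 - \<tau>) * (1 - \<eta>)) * (x k - b)"
        using \<tau>(3) q(2) unfolding a_def by (simp add: scaleR_conv_of_real algebra_simps)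
      have c1: "(1 - \<tau>) * (1 - \<eta>) \<le> 1 - \<tau>" using \<eta> \<tau> mult_left_mono[of "1 - \<eta>" 1 "1 - \<tau>"] by simp
      have \<tau>0: "\<tau> \<noteq> 0"
      proof
        assume "\<tau> = 0"
        hence "complex_of_real (q + \<eta>) * (x k - b) = 0" using eq by (simp add: algebra_simps)
        hence "q + \<eta> = 0" using bx[OF D(4)] by (metis mult_eq_0_iff of_real_eq_0_iff right_minus_eq)
        thus False using q \<eta> by simp
      qed
      define q' where "q' = (1 + q - (1 - \<tau>) * (1 - \<eta>)) / \<tau> - 1"
      have "q' \<ge> 0" using c1 q \<tau> \<tau>0 by (simp add: q'_def field_simps)
      moreover have "y = b + of_real (1 + q') * (x k - b)"
      proof -
        have "y - b = of_real (1 + q - (1 - \<tau>) * (1 - \<eta>)) * (x k - b) / of_real \<tau>" using eq \<tau>0 by (simp add: field_simps)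
        also have "\<dots> = of_real (1 + q') * (x k - b)" by (simp add: q'_def)
        finally show ?thesis by (simp add: algebra_simps)
      qed
      ultimately have "y \<in> ray b (x k)" unfolding ray_iff[OF bx[OF D(4)]] by blast
      thus False using y by (simp add: X_def)
    qed
    ultimately show "u \<in> X" by (simp add: X_def)
  qed
  have Xc: "connected X"
    by (rule starlike_imp_connected) (use aX seg in \<open>auto simp: starlike_def\<close>)
  have dd: "((\<lambda>z. prim0 p z - ?f2 z) has_field_derivative 0) (at y)" if "y \<in> X" for y
  proof -
    have "y \<in> Om" using that XOm by blast
    from DERIV_diff[OF prim0_has_derivative[OF this, of p] d2[OF that]] show ?thesis by simp
  qed
  have "continuous_on X (\<lambda>z. prim0 p z - ?f2 z)" using dd DERIV_isCont continuous_at_imp_continuous_on by blast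
  from DERIV_zero_connected_constant[OF Xc Xo finite.emptyI this] dd
  obtain c where c: "\<And>y. y \<in> X \<Longrightarrow> prim0 p y - ?f2 y = c" by auto
  \<comment> \<open>The primitive is followed along the segment from b; at its end it tends to c
    because the factor (1 - s)^beta of the other primitive tends to 0. Setting \<open>P\<close> to c
    at s = 1 therefore gives a continuous function.\<close>
  have "c = om * Ibase m x b be k p"
  proof -
    let ?y = "\<lambda>s. b + complex_of_real s * (x k - b)"
    define P where "P s = (if s < 1 then prim0 p (?y s) else c)" for s
    have yOm: "?y s \<in> Om" if "0 \<le> s" "s < 1" for s using segment_off_rays[OF gen D(4) _ that] by auto
    have yd: "(?y has_vector_derivative (x k - b)) (at s)" for s
      by (auto intro!: has_vector_derivative_real_field derivative_eq_intros)
    have Pd: "(P has_vector_derivative poly p (?y s) * cg NN {} lm (?y s) * (x k - b)) (at s)" if "0 \<le> s" "s < 1" for s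
      by (rule has_vector_derivative_transform_within_open[OF has_vector_derivative_const_field_comp[OF yd prim0_has_derivative[OF yOm[OF that]]], of "{..<1}"])
         (use that in \<open>auto simp: P_def\<close>)
    have Pc: "continuous_on {0..1} P"
      unfolding continuous_on_eq_continuous_within
    proof
      fix s :: real assume s: "s \<in> {0..1}"
      show "continuous (at s within {0..1}) P"
      proof (cases "s < 1")
        case True
        thus ?thesis using Pd[of s] s has_vector_derivative_continuous continuous_at_imp_continuous_at_within by fastforce
      next
        case False
        hence s1: "s = 1" using s by auto
        have Hc: "continuous_on {1-\<eta>..1} (\<lambda>s. primk k p (?y s))"
        proof -
          have "continuous_on D (Hf (kap k) (x k) ?g)" using dH DERIV_isCont continuous_at_imp_continuous_on by blast
          moreover have yc: "continuous_on {1-\<eta>..1} ?y" by (intro continuous_intros)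
          moreover have "?y ` {1-\<eta>..1} \<subseteq> D" by (intro image_subsetI nearD) auto
          ultimately have "continuous_on {1-\<eta>..1} (\<lambda>s. Hf (kap k) (x k) ?g (?y s))" by (rule continuous_on_compose2)
          thus ?thesis unfolding primk_def by (intro continuous_on_mult continuous_on_diff continuous_on_const yc)
        qed
        have pc: "continuous_on {1-\<eta>..1} (\<lambda>s. exp (be k * Ln (b - x k)) * (complex_of_real (1 - s) powr be k) * primk k p (?y s) + c)"
          using NR[OF D(4)] by (intro continuous_intros continuous_on_powr_complex Hc) auto
        have "P s = exp (be k * Ln (b - x k)) * (complex_of_real (1 - s) powr be k) * primk k p (?y s) + c" if "s \<in> {1-\<eta>..1}" for s
        proof (cases "s = 1")
          case False
          hence s: "s < 1" "0 \<le> s" using that \<eta> by auto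
          have yX: "?y s \<in> X" using nearD[of s] segment_off_rays[OF gen D(4) D(4) s(2,1)] that by (auto simp: X_def)
          have E: "(?y s - x k) / (b - x k) = of_real (1 - s)" using bx[OF D(4)] by (simp add: field_simps)
          have E0: "complex_of_real (1 - s) \<noteq> 0" using s by (simp only: of_real_eq_0_iff)
          have "exp (be k * lm k (?y s)) = exp (be k * Ln (b - x k)) * (complex_of_real (1 - s) powr be k)"
            by (simp only: lamb_def E powr_def if_not_P[OF E0] distrib_left exp_add)
          thus ?thesis using c[OF yX] s by (simp add: P_def algebra_simps)
        qed (simp add: P_def)
        hence "continuous_on {1-\<eta>..1} P" using continuous_on_eq[OF pc] by simp
        hence "continuous (at 1 within {1-\<eta>..1}) P" using \<eta> by (auto simp: continuous_on_eq_continuous_within)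
        moreover have "at (1::real) within {1-\<eta>..1} = at 1 within {0..1}"
          by (rule at_within_nhd[of _ "{1-\<eta><..}"]) (use \<eta> in auto)
        ultimately show ?thesis using s1 by (simp add: continuous_within)
      qed
    qed
    have "((\<lambda>s. poly p (?y s) * cg NN {} lm (?y s) * (x k - b)) has_integral P 1 - P 0) {0..1}"
      by (rule fundamental_theorem_of_calculus_interior[OF _ Pc Pd]) auto
    moreover have "P 1 - P 0 = c" by (simp add: P_def prim0_def)
    ultimately have "((\<lambda>s. poly p (?y s) * cg NN {} lm (?y s) * (x k - b)) has_integral c) {0..1}" by simp
    hence "((\<lambda>s. om * (poly p (linepath b (x k) s) * wbase m x b be (linepath b (x k) s)) * (x k - b)) has_integral c) {0..1}"
    proof (rule has_integral_spike_finite[of "{1}", rotated 2])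
      fix s :: real assume s: "s \<in> {0..1} - {1}"
      have "linepath b (x k) s = ?y s" by (simp add: linepath_def scaleR_conv_of_real algebra_simps)
      thus "om * (poly p (linepath b (x k) s) * wbase m x b be (linepath b (x k) s)) * (x k - b)
          = poly p (?y s) * cg NN {} lm (?y s) * (x k - b)" using s yOm[of s] by (simp add: cg_Om)
    qed simp
    hence "((\<lambda>u. om * (poly p u * wbase m x b be u)) has_contour_integral c) (linepath b (x k))"
      by (simp add: has_contour_integral_linepath)
    from has_contour_integral_div[OF this, of om]
    have "((\<lambda>u. poly p u * wbase m x b be u) has_contour_integral c / om) (linepath b (x k))"
      using omega_nz[of m x b be] by simp
    hence "Ibase m x b be k p = c / om" unfolding Ibase_def by (rule contour_integral_unique)
    thus ?thesis using omega_nz[of m x b be] by simp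
  qed
  moreover have "z \<in> X" using z by (simp add: X_def)
  ultimately show ?thesis using c[of z] by (simp add: algebra_simps)
qed

section \<open>Partial integrals along the arc and the bookkeeping of phases\<close>

definition Hint :: "complex poly \<Rightarrow> real \<Rightarrow> complex" where
  "Hint p s = integral {0..s} (\<lambda>s. poly p (\<gamma> s) * wN NN s * dg s)"

lemma EN_const: "EN NN = Wpoly m x ^ N"
  by (simp add: EN_def Wpoly_def prod_power_distrib)

lemma Hint_integral: "((\<lambda>s. poly p (\<gamma> s) * wN NN s * dg s) has_integral Lg (Wpoly m x ^ N * p)) {0..1}"
proof -
  have "((\<lambda>u. poly (EN NN * p) u * w u) has_contour_integral Lg (EN NN * p)) \<gamma>"
    unfolding Lg_def by (intro has_contour_integral_integral poly_integrable)
  hence "((\<lambda>u. poly p u * (poly (EN NN) u * w u)) has_contour_integral Lg (EN NN * p)) \<gamma>"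
    by (simp add: mult_ac)
  hence "((\<lambda>s. poly p (\<gamma> s) * wN NN s * dg s) has_integral Lg (EN NN * p)) {0..1}"
    by (simp only: contour_integral_iff)
  thus ?thesis by (simp only: EN_const)
qed

lemma Hint_0: "Hint p 0 = 0" and Hint_1: "Hint p 1 = Lg (Wpoly m x ^ N * p)"
  using Hint_integral[of p] by (auto simp: Hint_def integral_unique)

lemma Hint_cont: "continuous_on {0..1} (Hint p)"
  unfolding Hint_def[abs_def] using Hint_integral[of p] by (intro indefinite_integral_continuous_1) auto

lemma Hint_diff:
  assumes "s \<in> {0..1}" "s' \<in> {0..1}" "s \<le> s'" "((\<lambda>s. poly p (\<gamma> s) * wN NN s * dg s) has_integral v) {s..s'}"
  shows "Hint p s' - Hint p s = v"
proof -
  have "(\<lambda>s. poly p (\<gamma> s) * wN NN s * dg s) integrable_on {0..s'}"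
    by (rule integrable_subinterval_real[of _ 0 1]) (use Hint_integral[of p] assms in auto)
  from Henstock_Kurzweil_Integration.integral_combine[OF _ assms(3) this, symmetric] assms show ?thesis
    by (simp add: Hint_def integral_unique)
qed

text \<open>Within a chart \<open>wN\<close> / \<open>cg\<close> is, up to a constant, the carried
  power of z - q, so G is the chart primitive written without that unknown constant.\<close>

lemma chart_increment:
  fixes p :: "complex poly"
  assumes ch: "chart D q J lam" and T: "T \<subseteq> {0<..<1}" "is_interval T" "\<gamma> ` T \<subseteq> D"
    and \<kappa>: "is_kernel \<kappa> (\<Sum>l\<in>J. \<alpha> l + of_nat (NN l))" and s: "s \<in> T" "s' \<in> T"
  defines "G \<equiv> \<lambda>s. wN NN s / cg NN J lam (\<gamma> s) * ((\<gamma> s - q) * Hf \<kappa> q (\<lambda>z. poly p z * cg NN J lam z) (\<gamma> s))"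
  shows "Hint p s' - Hint p s = G s' - G s"
proof -
  have "connected T" "T \<noteq> {}" using T s is_interval_connected by auto
  then obtain C where C: "\<And>s. s \<in> T \<Longrightarrow> wN NN s = (C * (\<Prod>l\<in>J. exp ((\<alpha> l + of_nat (NN l)) * ell l s))) * cg NN J lam (\<gamma> s)"
    using chart_factor[OF ch T(1) _ _ T(3), of NN] by metis
  define e where "e = (\<lambda>s. C * (\<Prod>l\<in>J. exp ((\<alpha> l + of_nat (NN l)) * ell l s)))"
  have we: "wN NN s = e s * cg NN J lam (\<gamma> s)" if "s \<in> T" for s using C[OF that] by (simp add: e_def)
  have hp: "poly p holomorphic_on D" by (intro holomorphic_intros)
  let ?F = "\<lambda>s. e s * (\<gamma> s - q) * Hf \<kappa> q (\<lambda>z. poly p z * cg NN J lam z) (\<gamma> s)"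
  have FG: "?F s = G s" if "s \<in> T" for s using we[OF that] cg_nz by (simp add: G_def)
  have mono: "Hint p s' - Hint p s = ?F s' - ?F s" if s: "s \<in> T" "s' \<in> T" "s \<le> s'" for s s'
  proof (rule Hint_diff[OF _ _ s(3)])
    show "((\<lambda>s. poly p (\<gamma> s) * wN NN s * dg s) has_integral ?F s' - ?F s) {s..s'}"
    proof (rule ftc_local[OF T(2) _ chart_primitive(1)[OF ch T(1,3) e_def we \<kappa> hp] _ s])
      show "T \<subseteq> {0..1}" using T(1) by auto
      show "(?F has_vector_derivative poly p (\<gamma> s) * wN NN s * dg s) (at s)" if "s \<in> T \<inter> {0<..<1} - brk" for s
        by (rule chart_primitive(2)[OF ch T(1,3) e_def we \<kappa> hp]) (use that in auto)
    qed auto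
  qed (use s T(1) in auto)
  show ?thesis
  proof (cases "s \<le> s'")
    case True thus ?thesis using mono[OF s True] FG s by simp
  next
    case False
    hence "Hint p s - Hint p s' = ?F s - ?F s'" using s by (intro mono) auto
    thus ?thesis using FG s by (simp add: algebra_simps)
  qed
qed

text \<open>The primitive vanishing at x_k, for the branch carried by the arc. It stays meaningful
  when the arc crosses the ray of x_k.\<close>

definition Fk :: "complex poly \<Rightarrow> nat \<Rightarrow> real \<Rightarrow> complex" where
  "Fk p k s = wN NN s / cg NN {k} lm (\<gamma> s) * primk k p (\<gamma> s)"

definition F0 :: "complex poly \<Rightarrow> real \<Rightarrow> complex" where
  "F0 p s = wN NN s / cg NN {} lm (\<gamma> s) * prim0 p (\<gamma> s)"

definition Rloc :: "complex poly \<Rightarrow> real \<Rightarrow> complex" where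
  "Rloc p s = (if \<gamma> s \<in> Om then F0 p s else Fk p (SOME k. k < m \<and> \<gamma> s \<in> ray b (x k)) s)"

text \<open>The phase of the carried branch relative to the reference branch. The default value 0 on
  the rays makes \<open>Rloc_chart\<close> hold there too, where \<open>Rloc\<close> already is the
  chart primitive.\<close>

definition ct :: "real \<Rightarrow> complex" where
  "ct s = (if \<gamma> s \<in> Om then wN NN s / cg NN {} lm (\<gamma> s) else 0)"

text \<open>The carried and the reference logarithms differ by multiples of 2 pi i at every point
  off the rays.\<close>

lemma ct_phase:
  assumes s: "s \<in> {0<..<1}" shows "ct s \<in> phase_group m be"
proof (cases "\<gamma> s \<in> Om")
  case True
  have "\<exists>n::int. ell l s - lm l (\<gamma> s) = of_int (2 * n) * pi * \<i>" if l: "l < m" for l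
  proof -
    have "exp (ell l s - lm l (\<gamma> s)) = 1"
      using exp_ell[OF l s] exp_lm[OF l, of "\<gamma> s"] True l avoid[OF l s] by (auto simp: exp_diff)
    then obtain n :: int where "Re (ell l s - lm l (\<gamma> s)) = 0" "Im (ell l s - lm l (\<gamma> s)) = of_int (2 * n) * pi"
      unfolding exp_eq_1 by blast
    thus ?thesis by (intro exI[of _ n]) (simp add: complex_eq_iff)
  qed
  then obtain n :: "nat \<Rightarrow> int" where n: "\<And>l. l < m \<Longrightarrow> ell l s - lm l (\<gamma> s) = of_int (2 * n l) * pi * \<i>" by metis
  have "ct s = (\<Prod>l<m. exp (be l * ell l s) / exp (be l * lm l (\<gamma> s)))"
    using True by (simp add: ct_def wN_def cg_def prod_dividef)
  also have "\<dots> = (\<Prod>l<m. exp (be l * (of_int (2 * n l) * pi * \<i>)))"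
    by (intro prod.cong refl) (simp only: exp_diff[symmetric] right_diff_distrib[symmetric] n lessThan_iff)
  also have "\<dots> = exp (\<Sum>l<m. be l * (of_int (2 * n l) * pi * \<i>))" by (simp only: exp_sum[OF finite_lessThan])
  finally have "ct s \<in> phases m be" by (auto simp: phases_def)
  thus ?thesis by (rule phase_group_phase)
next
  case False
  have "ct s = 0" unfolding ct_def by (rule if_not_P[OF False])
  thus ?thesis by (simp only: phase_group_0)
qed

text \<open>Off the rays this is \<open>chart_relation\<close> multiplied by the phase.\<close>

lemma Rloc_chart:
  assumes D: "open D" "convex D" "x k \<in> D" "k < m" "\<And>l. l < m \<Longrightarrow> l \<noteq> k \<Longrightarrow> D \<inter> ray b (x l) = {}"
    and s: "\<gamma> s \<in> D"
  shows "Rloc p s = Fk p k s + ct s * (om * Ibase m x b be k p)"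
proof (cases "\<gamma> s \<in> Om")
  case True
  have "prim0 p (\<gamma> s) = om * Ibase m x b be k p + exp (be k * lm k (\<gamma> s)) * primk k p (\<gamma> s)"
    by (rule chart_relation[OF D s]) (use True D(4) in auto)
  thus ?thesis using True cg_nz[of NN "{k}" lm "\<gamma> s"]
    by (simp add: Rloc_def F0_def Fk_def ct_def cg_split[OF D(4), of "\<gamma> s"] field_simps)
next
  case False
  then obtain l where l: "l < m" "\<gamma> s \<in> ray b (x l)" by auto
  hence "(SOME k. k < m \<and> \<gamma> s \<in> ray b (x k)) = k"
    using D(4,5) s by (intro some_equality) (metis IntI empty_iff)+
  moreover have "Rloc p s = Fk p (SOME k. k < m \<and> \<gamma> s \<in> ray b (x k)) s" unfolding Rloc_def by (rule if_not_P[OF False])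
  moreover have "ct s = 0" unfolding ct_def by (rule if_not_P[OF False])
  ultimately show ?thesis by simp
qed

text \<open>The decomposition of the integral over \<open>[0, s]\<close> holds at the initial point and is propagated along the
  arc from chart to chart; the remainder \<open>Rloc\<close> vanishes at the final point.\<close>

definition good_at :: "real \<Rightarrow> bool" where
  "good_at s \<longleftrightarrow> (\<exists>A. (\<forall>k. A k \<in> phase_group m be) \<and> (\<forall>p. Hint p s = om * (\<Sum>k<m. A k * Ibase m x b be k p) + Rloc p s))"

lemma sum_update: "k < m \<Longrightarrow> (\<Sum>j<m. (A j + (if j = k then c else 0)) * f j) = (\<Sum>j<m. A j * f j) + c * (f k :: complex)"
proof -
  assume k: "k < m"
  have "(\<Sum>j<m. (A j + (if j = k then c else 0)) * f j) = (\<Sum>j<m. A j * f j + (if j = k then c * f j else 0))"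
    by (intro sum.cong) (auto simp: algebra_simps)
  thus ?thesis using k by (simp add: sum.distrib)
qed

text \<open>\<open>Fk\<close> is continuous across the ray of x_k and accounts for the whole
  increment; only the phase may change, and the coefficient of the k-th base integral absorbs the
  change ct s - ct s'.\<close>

lemma good_at_chart:
  assumes D: "open D" "convex D" "x k \<in> D" "k < m" "\<And>l. l < m \<Longrightarrow> l \<noteq> k \<Longrightarrow> D \<inter> ray b (x l) = {}"
    and T: "T \<subseteq> {0<..<1}" "is_interval T" "\<gamma> ` T \<subseteq> D" and s: "s \<in> T" "s' \<in> T" "good_at s"
  shows "good_at s'"
proof -
  obtain A where A: "\<And>k. A k \<in> phase_group m be" "\<And>p. Hint p s = om * (\<Sum>k<m. A k * Ibase m x b be k p) + Rloc p s"
    using s(3) by (auto simp: good_at_def)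
  define A' where "A' j = A j + (if j = k then ct s - ct s' else 0)" for j
  have "s \<in> {0<..<1}" "s' \<in> {0<..<1}" using s T(1) by auto
  hence "ct s - ct s' \<in> phase_group m be" by (intro phase_group_diff ct_phase)
  hence "A' j \<in> phase_group m be" for j unfolding A'_def
    using A(1) by (auto intro: phase_group_add phase_group_0)
  moreover have "Hint p s' = om * (\<Sum>k<m. A' k * Ibase m x b be k p) + Rloc p s'" for p
  proof -
    have h: "Hint p s' - Hint p s = Fk p k s' - Fk p k s"
      unfolding Fk_def primk_def by (rule chart_increment[OF chart_k[OF D] T kap_kernel[OF D(4)] s(1,2)])
    have r: "Rloc p s = Fk p k s + ct s * (om * Ibase m x b be k p)"
      "Rloc p s' = Fk p k s' + ct s' * (om * Ibase m x b be k p)"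
      using s T(3) by (auto intro!: Rloc_chart[OF D])
    have S: "(\<Sum>j<m. A' j * Ibase m x b be j p) = (\<Sum>j<m. A j * Ibase m x b be j p) + (ct s - ct s') * Ibase m x b be k p"
      unfolding A'_def by (rule sum_update[OF D(4)])
    show ?thesis using h A(2)[of p] unfolding r S by (simp add: algebra_simps)
  qed
  ultimately show ?thesis unfolding good_at_def by blast
qed

lemma good_at_Om:
  assumes T: "T \<subseteq> {0<..<1}" "is_interval T" "\<gamma> ` T \<subseteq> Om" and s: "s \<in> T" "s' \<in> T" "good_at s"
  shows "good_at s'"
proof -
  obtain A where A: "\<And>k. A k \<in> phase_group m be" "\<And>p. Hint p s = om * (\<Sum>k<m. A k * Ibase m x b be k p) + Rloc p s"
    using s(3) by (auto simp: good_at_def)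
  have H: "Hint p s' - Hint p s = F0 p s' - F0 p s" for p
    unfolding F0_def prim0_def by (rule chart_increment[OF chart_Om T _ s(1,2)]) (simp add: is_kernel_1)
  have Om: "\<gamma> s \<in> Om" "\<gamma> s' \<in> Om" using s T(3) by blast+
  have R: "Rloc p s = F0 p s" "Rloc p s' = F0 p s'" for p
    unfolding Rloc_def by (rule if_P[OF Om(1)], rule if_P[OF Om(2)])
  have "Hint p s' = om * (\<Sum>k<m. A k * Ibase m x b be k p) + Rloc p s'" for p
    using H[of p] unfolding A(2) R by (simp add: algebra_simps)
  thus ?thesis unfolding good_at_def using A(1) by blast
qed

lemma Fk_tendsto_0:
  assumes a: "a \<in> {0, 1}" and k: "k < m" "x k = \<gamma> a"
  shows "(Fk p k \<longlongrightarrow> 0) (at a within {0<..<1})"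
proof -
  obtain D where D: "open D" "convex D" "x k \<in> D" "\<And>l. l < m \<Longrightarrow> l \<noteq> k \<Longrightarrow> D \<inter> ray b (x l) = {}"
    using ex_convex_nbhd[OF k(1) ray_self] by metis
  note ch = chart_k[OF D(1-3) k(1) D(4)]
  have kk: "is_kernel (kap k) (be k)" using kap_kernel[OF k(1)] by simp
  have g: "cg NN {k} lm holomorphic_on D" by (rule cg_holomorphic[OF ch])
  have g1: "isCont (cg NN {k} lm) (x k)"
    using holomorphic_on_imp_continuous_on[OF g] D by (simp add: continuous_on_eq_continuous_at)
  have st: "\<forall>z\<in>D. closed_segment (x k) z \<subseteq> D" using ch by (simp add: chart_def)
  have "(\<lambda>z. poly p z * cg NN {k} lm z) holomorphic_on D" by (intro holomorphic_intros g)
  from DERIV_isCont[OF Hf_has_derivative[OF D(1) st this kk D(3)]]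
  have g2: "isCont (primk k p) (x k)" unfolding primk_def[abs_def] by (intro continuous_intros)
  have "((\<lambda>s. wN NN s / cg NN {k} lm (\<gamma> s) * primk k p (\<gamma> s)) \<longlongrightarrow> 0 / cg NN {k} lm (x k) * primk k p (x k)) (at a within {0<..<1})"
    using gam_end[OF a] wN_tendsto_0[of a k NN, OF a k] N1 cg_nz
    by (intro tendsto_intros isCont_tendsto_compose[OF g1] isCont_tendsto_compose[OF g2]) (auto simp: k(2))
  thus ?thesis by (simp add: Fk_def[abs_def])
qed

text \<open>Near an end \<open>Hint\<close> and \<open>Fk\<close> differ by a constant. Since
  \<open>Fk\<close> tends to 0 at the end, the constant is the value of \<open>Hint\<close>
  there.\<close>

lemma end_chart:
  assumes a: "a \<in> {0, 1}"
  obtains k T where "k < m" "T \<subseteq> {0<..<1}" "T \<noteq> {}" "\<forall>s\<in>T. \<forall>p. Hint p s - Hint p a = Fk p k s"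
    "\<forall>s\<in>T. \<forall>p. Rloc p s = Fk p k s + ct s * (om * Ibase m x b be k p)"
proof -
  obtain k where k: "k < m" "x k = \<gamma> a" using end_index[OF a] by blast
  obtain D where D: "open D" "convex D" "x k \<in> D" "\<And>l. l < m \<Longrightarrow> l \<noteq> k \<Longrightarrow> D \<inter> ray b (x l) = {}"
    using ex_convex_nbhd[OF k(1) ray_self] by metis
  obtain r where r: "r > 0" "ball (x k) r \<subseteq> D" using D(1,3) openE by blast
  have a01: "a \<in> {0..1}" using a by auto
  obtain d where d: "d > 0" "\<And>s. s \<in> {0..1} \<inter> ball a d \<Longrightarrow> \<gamma> s \<in> ball (\<gamma> a) r"
    using gam_near[OF a01 r(1)] by blast
  define T where "T = {0<..<1} \<inter> ball a d"
  have T: "T \<subseteq> {0<..<1}" "is_interval T" "T \<noteq> {}" using near_end[OF a d(1)] by (auto simp: T_def)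
  have im: "\<gamma> ` T \<subseteq> D"
  proof
    fix y assume "y \<in> \<gamma> ` T"
    then obtain s where s: "s \<in> T" "y = \<gamma> s" by blast
    have "s \<in> {0..1} \<inter> ball a d" using s(1) by (auto simp: T_def)
    from d(2)[OF this] show "y \<in> D" using r(2) k(2) s(2) by auto
  qed
  show ?thesis
  proof (rule that[OF k(1) T(1,3)]; intro ballI allI)
    fix s p assume s: "s \<in> T"
    show "Rloc p s = Fk p k s + ct s * (om * Ibase m x b be k p)"
      by (rule Rloc_chart[OF D(1-3) k(1) D(4)]) (use s im in auto)
    have inc: "Hint p s' - Hint p s = Fk p k s' - Fk p k s" if "s' \<in> T" for s'
      unfolding Fk_def primk_def by (rule chart_increment[OF chart_k[OF D(1-3) k(1) D(4)] T(1,2) im kap_kernel[OF k(1)] s that])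
    have "(Hint p \<longlongrightarrow> Hint p a) (at a within {0..1})" using Hint_cont a01 by (auto simp: continuous_on_def)
    hence l1: "(Hint p \<longlongrightarrow> Hint p a) (at a within {0<..<1})" by (rule tendsto_within_subset) auto
    have "((\<lambda>s'. Hint p s' - Fk p k s') \<longlongrightarrow> Hint p a - 0) (at a within {0<..<1})"
      by (intro tendsto_diff l1 Fk_tendsto_0 a k)
    moreover have "eventually (\<lambda>s'. Hint p s' - Fk p k s' = Hint p s - Fk p k s) (at a within {0<..<1})"
      using near_end(5)[OF a d(1)] by eventually_elim (use inc in \<open>auto simp: T_def algebra_simps\<close>)
    ultimately have "((\<lambda>s'. Hint p s - Fk p k s) \<longlongrightarrow> Hint p a) (at a within {0<..<1})"
      using Lim_transform_eventually by fastforce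
    hence "Hint p s - Fk p k s = Hint p a"
      using near_end(4)[OF a d(1)] tendsto_const tendsto_unique by blast
    thus "Hint p s - Hint p a = Fk p k s" by (simp add: algebra_simps)
  qed
qed

theorem arc_decomposition:
  obtains A where "\<And>k. A k \<in> phase_group m be"
    "\<And>p. Lg (Wpoly m x ^ N * p) = om * (\<Sum>k<m. A k * Ibase m x b be k p)"
proof -
  obtain k0 T0 where 0: "k0 < m" "T0 \<subseteq> {0<..<1}" "T0 \<noteq> {}" "\<forall>s\<in>T0. \<forall>p. Hint p s - Hint p 0 = Fk p k0 s"
    "\<forall>s\<in>T0. \<forall>p. Rloc p s = Fk p k0 s + ct s * (om * Ibase m x b be k0 p)"
    by (rule end_chart[of 0]) simp
  obtain k1 T1 where 1: "k1 < m" "T1 \<subseteq> {0<..<1}" "T1 \<noteq> {}" "\<forall>s\<in>T1. \<forall>p. Hint p s - Hint p 1 = Fk p k1 s"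
    "\<forall>s\<in>T1. \<forall>p. Rloc p s = Fk p k1 s + ct s * (om * Ibase m x b be k1 p)"
    by (rule end_chart[of 1]) simp
  obtain s0 s1 where s: "s0 \<in> T0" "s1 \<in> T1" using 0(3) 1(3) by blast
  have s01: "s0 \<in> {0<..<1}" "s1 \<in> {0<..<1}" using s 0(2) 1(2) by auto
  have g0: "good_at s0"
    unfolding good_at_def
  \<comment> \<open>Near the start Hint = Fk = Rloc - ct om I_k0, which dictates the single
    coefficient -ct s0.\<close>
  proof (intro exI[of _ "\<lambda>j. 0 + (if j = k0 then - ct s0 else 0)"] conjI allI)
    show "0 + (if j = k0 then - ct s0 else 0) \<in> phase_group m be" for j
      using ct_phase[OF s01(1)] by (auto intro: phase_group_minus phase_group_0)
    fix p
    show "Hint p s0 = om * (\<Sum>j<m. (0 + (if j = k0 then - ct s0 else 0)) * Ibase m x b be j p) + Rloc p s0"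
      unfolding sum_update[OF 0(1), of "\<lambda>_. 0"] using bspec[OF 0(4) s(1)] bspec[OF 0(5) s(1)] by (simp add: Hint_0)
  qed
  have "good_at s1"
  proof (rule connected_induction_simple[where S = "{0<..<1}" and P = good_at and a = s0 and b = s1])
    fix a :: real assume a: "a \<in> {0<..<1}"
    have a01: "a \<in> {0..1}" using a by auto
    show "\<exists>T. openin (top_of_set {0<..<1}) T \<and> a \<in> T \<and> (\<forall>u\<in>T. \<forall>v\<in>T. good_at u \<longrightarrow> good_at v)"
    proof (cases "\<gamma> a \<in> Om")
      case True
      then obtain r where r: "r > 0" "ball (\<gamma> a) r \<subseteq> Om" using Om_open openE by blast
      obtain d where d: "d > 0" "\<And>s. s \<in> {0..1} \<inter> ball a d \<Longrightarrow> \<gamma> s \<in> ball (\<gamma> a) r"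
        using gam_near[OF a01 r(1)] by blast
      define T where "T = {0<..<1} \<inter> ball a d"
      have im: "\<gamma> ` T \<subseteq> Om"
      proof
        fix y assume "y \<in> \<gamma> ` T"
        then obtain s where s: "s \<in> T" "y = \<gamma> s" by blast
        have "s \<in> {0..1} \<inter> ball a d" using s(1) by (auto simp: T_def)
        from d(2)[OF this] show "y \<in> Om" using r(2) s(2) by blast
      qed
      have "is_interval T" unfolding T_def by (intro is_interval_Int) (auto simp: is_interval_convex_1)
      moreover have "T \<subseteq> {0<..<1}" by (simp add: T_def)
      ultimately have "\<forall>u\<in>T. \<forall>v\<in>T. good_at u \<longrightarrow> good_at v"
        by (intro ballI impI) (rule good_at_Om[OF _ _ im])
      moreover have "openin (top_of_set {0<..<1}) T" unfolding T_def by (rule openin_open_Int[OF open_ball])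
      moreover have "a \<in> T" using a d by (auto simp: T_def)
      ultimately show ?thesis by blast
    next
      case False
      then obtain k where k: "k < m" "\<gamma> a \<in> ray b (x k)" by auto
      obtain D where D: "open D" "convex D" "x k \<in> D" "\<gamma> a \<in> D" "\<And>l. l < m \<Longrightarrow> l \<noteq> k \<Longrightarrow> D \<inter> ray b (x l) = {}"
        using ex_convex_nbhd[OF k] by metis
      obtain r where r: "r > 0" "ball (\<gamma> a) r \<subseteq> D" using D(1,4) openE by blast
      obtain d where d: "d > 0" "\<And>s. s \<in> {0..1} \<inter> ball a d \<Longrightarrow> \<gamma> s \<in> ball (\<gamma> a) r"
        using gam_near[OF a01 r(1)] by blast
      define T where "T = {0<..<1} \<inter> ball a d"
      have im: "\<gamma> ` T \<subseteq> D"
      proof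
        fix y assume "y \<in> \<gamma> ` T"
        then obtain s where s: "s \<in> T" "y = \<gamma> s" by blast
        have "s \<in> {0..1} \<inter> ball a d" using s(1) by (auto simp: T_def)
        from d(2)[OF this] show "y \<in> D" using r(2) s(2) by blast
      qed
      have Ti: "is_interval T" unfolding T_def by (intro is_interval_Int) (auto simp: is_interval_convex_1)
      have "T \<subseteq> {0<..<1}" by (simp add: T_def)
      hence "\<forall>u\<in>T. \<forall>v\<in>T. good_at u \<longrightarrow> good_at v"
        by (intro ballI impI) (rule good_at_chart[OF D(1-3) k(1) D(5) _ Ti im])
      moreover have "openin (top_of_set {0<..<1}) T" unfolding T_def by (rule openin_open_Int[OF open_ball])
      moreover have "a \<in> T" using a d by (auto simp: T_def)
      ultimately show ?thesis by blast
    qed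
  qed (use g0 s01 in auto)
  then obtain A where A: "\<And>k. A k \<in> phase_group m be" "\<And>p. Hint p s1 = om * (\<Sum>k<m. A k * Ibase m x b be k p) + Rloc p s1"
    by (auto simp: good_at_def)
  show ?thesis
  \<comment> \<open>The full integral is Hint at s1 minus Fk; replacing \<open>Rloc\<close> - Fk by
    its value adds ct s1 to the coefficient of k1.\<close>
  proof (rule that[of "\<lambda>j. A j + (if j = k1 then ct s1 else 0)"])
    show "A j + (if j = k1 then ct s1 else 0) \<in> phase_group m be" for j
      using A(1) ct_phase[OF s01(2)] by (auto intro: phase_group_add phase_group_0)
    show "Lg (Wpoly m x ^ N * p) = om * (\<Sum>j<m. (A j + (if j = k1 then ct s1 else 0)) * Ibase m x b be j p)" for p
      unfolding sum_update[OF 1(1)] Hint_1[symmetric] using A(2)[of p] bspec[OF 1(4) s(2), THEN spec, of p] bspec[OF 1(5) s(2), THEN spec, of p]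
      by (simp add: algebra_simps)
  qed
qed

end

end

subsection \<open>Independence of the base integrals\<close>

lemma cauchy_segment_has_derivative:
  assumes f: "continuous_on (closed_segment a c) f" and z: "z \<notin> closed_segment a c"
  shows "((\<lambda>z. contour_integral (linepath a c) (\<lambda>u. f u / (u - z))) has_field_derivative
      contour_integral (linepath a c) (\<lambda>u. f u / (u - z) ^ 2)) (at z)"
    and "(\<lambda>u. f u / (u - z)) contour_integrable_on (linepath a c)"
proof -
  have int: "(\<lambda>u. f u / (u - z)) contour_integrable_on (linepath a c)" if "z \<notin> closed_segment a c" for z
    using that by (intro contour_integrable_continuous_linepath continuous_intros f) auto
  thus "(\<lambda>u. f u / (u - z)) contour_integrable_on (linepath a c)" using z by blast
  have "((\<lambda>z. contour_integral (linepath a c) (\<lambda>u. f u / (u - z))) has_field_derivative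
      (of_nat 1 * contour_integral (linepath a c) (\<lambda>u. f u / (u - z) ^ Suc 1))) (at z)"
  proof (rule Cauchy_next_derivative(2)[where S = UNIV and B = "norm (c - a)"])
    show "((\<lambda>u. f u / (u - y) ^ 1) has_contour_integral contour_integral (linepath a c) (\<lambda>u. f u / (u - y))) (linepath a c)"
      if "y \<in> UNIV - path_image (linepath a c)" for y
      using has_contour_integral_integral[OF int[of y]] that by simp
  qed (use f z in auto)
  thus "((\<lambda>z. contour_integral (linepath a c) (\<lambda>u. f u / (u - z))) has_field_derivative
      contour_integral (linepath a c) (\<lambda>u. f u / (u - z) ^ 2)) (at z)" by (simp add: power2_eq_square)
qed

definition star :: "nat \<Rightarrow> (nat \<Rightarrow> complex) \<Rightarrow> complex \<Rightarrow> complex set" where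
  "star m x b = (\<Union>k<m. closed_segment b (x k))"

lemma compact_star: "compact (star m x b)"
  unfolding star_def by (intro compact_UN) auto

lemma star_scale:
  assumes "z \<notin> star m x b" "s \<ge> 1" shows "b + of_real s * (z - b) \<notin> star m x b"
proof
  assume "b + of_real s * (z - b) \<in> star m x b"
  then obtain k u where k: "k < m" and u: "0 \<le> u" "u \<le> 1" "b + of_real s * (z - b) = (1 - u) *\<^sub>R b + u *\<^sub>R x k"
    by (auto simp: star_def closed_segment_def)
  have "of_real s * (z - b) = of_real u * (x k - b)" using u(3) by (simp add: scaleR_conv_of_real algebra_simps)
  hence "z - b = of_real (u / s) * (x k - b)" using assms(2) by (simp add: field_simps)
  moreover have "b + of_real v * (x k - b) = (1 - v) *\<^sub>R b + v *\<^sub>R x k" for v by (simp add: scaleR_conv_of_real algebra_simps)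
  ultimately have "z = (1 - u / s) *\<^sub>R b + (u / s) *\<^sub>R x k" by (metis add.commute diff_add_cancel)
  moreover have "0 \<le> u / s" "u / s \<le> 1" using u assms(2) by auto
  ultimately have "z \<in> closed_segment b (x k)" unfolding closed_segment_def by blast
  thus False using assms(1) k by (auto simp: star_def)
qed

text \<open>Every point off the star escapes to infinity along the ray from b through it without
  meeting the star, and the outside of a large disc is connected.\<close>

lemma connected_compl_star: "connected (- star m x b)"
proof -
  obtain R where R: "R > 0" "star m x b \<subseteq> ball b R"
    using bounded_subset_ballD[OF compact_imp_bounded[OF compact_star]] by blast
  define V where "V = - cball b R"
  have V: "connected V" unfolding V_def by (rule connected_complement_bounded_convex) auto
  have VS: "V \<subseteq> - star m x b" using R by (auto simp: V_def)
  define B where "B z = (\<lambda>s. b + of_real s * (z - b)) ` {1..}" for z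
  have cB: "connected (B z \<union> V)" if z: "z \<notin> star m x b" and zb: "z \<noteq> b" for z
  proof (rule connected_Un)
    show "connected (B z)" unfolding B_def by (intro connected_continuous_image continuous_intros) auto
    define s where "s = max 1 ((R + 1) / norm (z - b))"
    have n: "norm (z - b) > 0" using zb by simp
    have "(R + 1) / norm (z - b) * norm (z - b) \<le> s * norm (z - b)" using n by (intro mult_right_mono) (auto simp: s_def)
    hence "R < s * norm (z - b)" using n by simp
    also have "s * norm (z - b) = dist b (b + of_real s * (z - b))" by (simp add: dist_norm norm_mult s_def)
    finally have "b + of_real s * (z - b) \<in> V" by (simp add: V_def)
    moreover have "b + of_real s * (z - b) \<in> B z" unfolding B_def by (rule imageI) (simp add: s_def)
    ultimately show "B z \<inter> V \<noteq> {}" by blast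
  qed (rule V)
  show ?thesis
  proof (cases "m = 0")
    case True thus ?thesis by (simp add: star_def connected_UNIV)
  next
    case False
    hence bS: "b \<in> star m x b" by (auto simp: star_def)
    have "- star m x b = \<Union> ((\<lambda>z. B z \<union> V) ` (- star m x b)) \<union> V"
    proof (intro equalityI subsetI)
      fix z assume z: "z \<in> - star m x b"
      have "b + of_real 1 * (z - b) \<in> B z" unfolding B_def by (rule imageI) simp
      thus "z \<in> \<Union> ((\<lambda>z. B z \<union> V) ` (- star m x b)) \<union> V" using z by auto
    next
      fix z assume "z \<in> \<Union> ((\<lambda>z. B z \<union> V) ` (- star m x b)) \<union> V"
      then consider "z \<in> V" | y where "y \<notin> star m x b" "z \<in> B y" by blast
      thus "z \<in> - star m x b" using VS star_scale by cases (auto simp: B_def)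
    qed
    also have "\<dots> = \<Union> (insert V ((\<lambda>z. B z \<union> V) ` (- star m x b)))" by blast
    also have "connected \<dots>"
    proof (rule connected_Union)
      fix S assume "S \<in> insert V ((\<lambda>z. B z \<union> V) ` (- star m x b))"
      thus "connected S" using V cB bS by auto
    next
      have "b + of_real (R + 1) \<in> V" using R by (simp add: V_def dist_norm norm_of_real del: of_real_add)
      thus "\<Inter> (insert V ((\<lambda>z. B z \<union> V) ` (- star m x b))) \<noteq> {}" by blast
    qed
    finally show ?thesis .
  qed
qed

text \<open>The finite expansion is preferred to the series: its polynomial part is annihilated
  exactly, and only the remainder needs an estimate.\<close>

lemma geometric_remainder:
  fixes u z :: complex
  assumes "z \<noteq> 0" "u \<noteq> z"
  shows "1 / (u - z) = - (\<Sum>j<n. u ^ j / z ^ Suc j) + u ^ n / (z ^ n * (u - z))"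
proof (induction n)
  case (Suc n)
  have "u ^ n / (z ^ n * (u - z)) = - (u ^ n / z ^ Suc n) + u ^ Suc n / (z ^ Suc n * (u - z))"
    using assms by (simp add: field_simps)
  thus ?case using Suc by simp
qed simp

context
  fixes m :: nat and x :: "nat \<Rightarrow> complex" and b :: complex and \<beta> :: "nat \<Rightarrow> complex"
  assumes gen: "generic_base m x b" and Re\<beta>: "\<And>k. k < m \<Longrightarrow> Re (\<beta> k) > 0"
begin

abbreviation (input) "wb \<equiv> wbase m x b \<beta>"

lemma bxne: "l < m \<Longrightarrow> b \<noteq> x l" using gen by (auto simp: generic_base_def)

text \<open>The segment meets a ray only at its end x_k, where the base of the k-th power is 0 and
  continuity follows from Re beta_k > 0.\<close>

lemma wbase_continuous_segment:
  assumes k: "k < m" shows "continuous_on (closed_segment b (x k)) wb"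
proof -
  have "continuous_on (closed_segment b (x k)) (\<lambda>z. ((z - x l) / (b - x l)) powr \<beta> l)" if l: "l < m" for l
  proof (intro continuous_on_powr_complex continuous_intros)
    show "closed_segment b (x k) \<subseteq> {z. 0 \<le> Re ((z - x l) / (b - x l)) \<or> Im ((z - x l) / (b - x l)) \<noteq> 0}"
    proof
      fix z assume "z \<in> closed_segment b (x k)"
      then obtain u where u: "0 \<le> u" "u \<le> 1" "z = (1 - u) *\<^sub>R b + u *\<^sub>R x k" by (auto simp: closed_segment_def)
      have z: "z = b + of_real u * (x k - b)" using u(3) by (simp add: scaleR_conv_of_real algebra_simps)
      have "z \<notin> ray b (x l) \<or> z = x l"
      proof (cases "u < 1")
        case True thus ?thesis using segment_off_rays[OF gen k l u(1)] z by simp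
      next
        case False
        hence "z = x k" using u z by simp
        thus ?thesis using rays_disjoint[OF gen k l] ray_self[of "x k" b] by auto
      qed
      thus "z \<in> {z. 0 \<le> Re ((z - x l) / (b - x l)) \<or> Im ((z - x l) / (b - x l)) \<noteq> 0}"
        by (auto simp: ray_def complex_nonpos_Reals_iff)
    qed
  qed (use Re\<beta> l bxne in auto)
  thus ?thesis unfolding wbase_def[abs_def] by (intro continuous_on_prod) auto
qed

lemma wbase_holomorphic:
  assumes "\<And>l. l < m \<Longrightarrow> S \<inter> ray b (x l) = {}" shows "wb holomorphic_on S"
proof -
  have "(\<lambda>z. ((z - x l) / (b - x l)) powr \<beta> l) holomorphic_on S" if l: "l < m" for l
    using assms[OF l] bxne[OF l] by (intro holomorphic_intros) (auto simp: ray_def)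
  thus ?thesis unfolding wbase_def[abs_def] by (intro holomorphic_on_prod) auto
qed

lemma wbase_nz: "(\<And>l. l < m \<Longrightarrow> z \<notin> ray b (x l)) \<Longrightarrow> wb z \<noteq> 0"
  using ray_self bxne by (fastforce simp: wbase_def)

lemma Ibase_integral:
  assumes "k < m"
  shows "((\<lambda>u. poly p u * wb u) has_contour_integral Ibase m x b \<beta> k p) (linepath b (x k))"
  unfolding Ibase_def using assms
  by (intro has_contour_integral_integral contour_integrable_continuous_linepath continuous_intros wbase_continuous_segment)

lemma plin_Ibase: assumes k: "k < m" shows "plin (Ibase m x b \<beta> k)"
proof (rule plinI)
  fix p q c
  have "((\<lambda>u. poly p u * wb u + poly q u * wb u) has_contour_integral Ibase m x b \<beta> k p + Ibase m x b \<beta> k q) (linepath b (x k))"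
    by (intro has_contour_integral_add Ibase_integral k)
  hence "((\<lambda>u. poly (p + q) u * wb u) has_contour_integral Ibase m x b \<beta> k p + Ibase m x b \<beta> k q) (linepath b (x k))"
    by (simp add: algebra_simps)
  thus "Ibase m x b \<beta> k (p + q) = Ibase m x b \<beta> k p + Ibase m x b \<beta> k q"
    using Ibase_integral[OF k] has_contour_integral_unique by blast
  have "((\<lambda>u. c * (poly p u * wb u)) has_contour_integral c * Ibase m x b \<beta> k p) (linepath b (x k))"
    by (intro has_contour_integral_lmul Ibase_integral k)
  hence "((\<lambda>u. poly (smult c p) u * wb u) has_contour_integral c * Ibase m x b \<beta> k p) (linepath b (x k))"
    by (simp add: algebra_simps)
  thus "Ibase m x b \<beta> k (smult c p) = c * Ibase m x b \<beta> k p"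
    using Ibase_integral[OF k] has_contour_integral_unique by blast
qed

text \<open>If a combination of the base integrals annihilates all polynomials, its Cauchy transform vanishes
  near infinity, hence off the star, and the jump of the transform across a segment is a multiple of
  the weight. The jump is computed by replacing a piece of the segment by the other two sides of a triangle.\<close>

lemma Ibase_independent:
  assumes A: "\<And>p. (\<Sum>k<m. A k * Ibase m x b \<beta> k p) = 0" and k: "k < m"
  shows "A k = 0"
proof -
  define cs where "cs j z = contour_integral (linepath b (x j)) (\<lambda>u. wb u / (u - z))" for j z
  define f where "f z = (\<Sum>j<m. A j * cs j z)" for z
  have fd: "f field_differentiable at z" if z: "z \<notin> star m x b" for z
  proof -
    have "(\<lambda>z. A j * cs j z) field_differentiable at z" if j: "j < m" for j
    proof -
      have "z \<notin> closed_segment b (x j)" using z j by (auto simp: star_def)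
      from cauchy_segment_has_derivative(1)[OF wbase_continuous_segment[OF j] this]
      show ?thesis unfolding cs_def field_differentiable_def using DERIV_cmult by blast
    qed
    thus ?thesis unfolding f_def[abs_def] by (intro field_differentiable_sum) auto
  qed
  obtain R where R: "R > 0" "star m x b \<subseteq> ball 0 R"
    using bounded_subset_ballD[OF compact_imp_bounded[OF compact_star]] by blast
  \<comment> \<open>Hypothesis A removes the polynomial part of 1/(u - z). Since |u| < R on the star
    and |z| > 2R, the remainder is at most K / 2^n for every n.\<close>
  have f_far: "f z = 0" if z: "norm z > 2 * R" for z
  proof -
    have z0: "z \<noteq> 0" using z R by auto
    have "\<exists>C. \<forall>u\<in>closed_segment b (x j). norm (wb u) \<le> C" if j: "j < m" for j
      using compact_imp_bounded[OF compact_continuous_image[OF wbase_continuous_segment[OF j] compact_segment]]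
      by (auto simp: bounded_iff)
    then obtain C where C: "\<And>j u. j < m \<Longrightarrow> u \<in> closed_segment b (x j) \<Longrightarrow> norm (wb u) \<le> C j" by metis
    have Cnn: "C j \<ge> 0" if "j < m" for j
      by (rule order_trans[OF norm_ge_zero C[OF that, of b]]) simp
    define K where "K = (\<Sum>j<m. norm (A j) * (C j / R * norm (x j - b)))"
    have bound: "norm (f z) \<le> K * (1/2) ^ n" for n
    proof -
      define r where "r j = contour_integral (linepath b (x j)) (\<lambda>u. wb u * (u ^ n / (z ^ n * (u - z))))" for j
      define p where "p = (\<Sum>i<n. monom (1 / z ^ Suc i) i)"
      have pp: "poly p u = (\<Sum>i<n. u ^ i / z ^ Suc i)" for u
        by (simp add: p_def poly_sum poly_monom field_simps)
      have seg: "norm u < R \<and> u \<noteq> z \<and> R \<le> norm (u - z)" if "u \<in> closed_segment b (x j)" "j < m" for u j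
      proof -
        have "u \<in> star m x b" using that by (auto simp: star_def)
        hence "norm u < R" using R by auto
        moreover have "norm z \<le> norm u + norm (u - z)" using norm_triangle_ineq4[of u "u - z"] by simp
        ultimately show ?thesis using z R by auto
      qed
      have cr: "(\<lambda>u. wb u * (u ^ n / (z ^ n * (u - z)))) contour_integrable_on linepath b (x j)" if j: "j < m" for j
        using seg[OF _ j] z0 by (intro contour_integrable_continuous_linepath continuous_intros wbase_continuous_segment j) auto
      have cs: "cs j z = - Ibase m x b \<beta> j p + r j" if j: "j < m" for j
      proof -
        have "((\<lambda>u. - (poly p u * wb u) + wb u * (u ^ n / (z ^ n * (u - z)))) has_contour_integral - Ibase m x b \<beta> j p + r j) (linepath b (x j))"
          unfolding r_def by (intro has_contour_integral_add has_contour_integral_neg Ibase_integral j has_contour_integral_integral cr)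
        hence "((\<lambda>u. wb u / (u - z)) has_contour_integral - Ibase m x b \<beta> j p + r j) (linepath b (x j))"
        proof (rule has_contour_integral_eq)
          fix u assume "u \<in> path_image (linepath b (x j))"
          hence uz: "u \<noteq> z" using seg[OF _ j] by auto
          have "wb u / (u - z) = wb u * (1 / (u - z))" by simp
          also have "\<dots> = wb u * (- poly p u + u ^ n / (z ^ n * (u - z)))"
            unfolding pp by (subst geometric_remainder[OF z0 uz, of n]) simp
          finally show "- (poly p u * wb u) + wb u * (u ^ n / (z ^ n * (u - z))) = wb u / (u - z)" by (simp add: algebra_simps)
        qed
        thus ?thesis unfolding cs_def by (rule contour_integral_unique)
      qed
      have "f z = (\<Sum>j<m. A j * (- Ibase m x b \<beta> j p + r j))" unfolding f_def by (intro sum.cong) (auto simp: cs)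
      also have "\<dots> = - (\<Sum>j<m. A j * Ibase m x b \<beta> j p) + (\<Sum>j<m. A j * r j)"
        by (simp add: algebra_simps sum.distrib sum_subtractf)
      finally have fz: "f z = (\<Sum>j<m. A j * r j)" by (simp add: A)
      have rb: "norm (r j) \<le> C j / R * (1/2)^n * norm (x j - b)" if j: "j < m" for j
        unfolding r_def
      proof (rule contour_integral_bound_linepath[OF cr[OF j]])
        show "0 \<le> C j / R * (1/2)^n" using Cnn[OF j] R by simp
        fix u assume u: "u \<in> closed_segment b (x j)"
        have "norm u * 2 \<le> norm z" "norm z > 0" using seg[OF u j] z R by auto
        hence "norm (u / z) \<le> 1/2" by (simp add: norm_divide divide_le_eq)
        hence "norm (u / z) ^ n \<le> (1/2)^n" by (intro power_mono) auto
        moreover have "1 / norm (u - z) \<le> 1 / R" using seg[OF u j] R by (simp add: frac_le)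
        ultimately have "norm (wb u) * (norm (u / z) ^ n * (1 / norm (u - z))) \<le> C j * ((1/2)^n * (1 / R))"
          using C[OF j u] Cnn[OF j] by (intro mult_mono) auto
        thus "norm (wb u * (u ^ n / (z ^ n * (u - z)))) \<le> C j / R * (1/2)^n"
          by (simp add: norm_mult norm_divide norm_power power_divide mult.commute[of R])
      qed
      have "norm (\<Sum>j<m. A j * r j) \<le> (\<Sum>j<m. norm (A j) * (C j / R * (1/2)^n * norm (x j - b)))"
      proof (intro sum_norm_le)
        fix j assume "j \<in> {..<m}"
        hence "norm (r j) \<le> C j / R * (1/2)^n * norm (x j - b)" using rb by blast
        thus "norm (A j * r j) \<le> norm (A j) * (C j / R * (1/2)^n * norm (x j - b))"
          unfolding norm_mult by (rule mult_left_mono) simp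
      qed
      also have "\<dots> = K * (1/2)^n" unfolding K_def sum_distrib_right by (intro sum.cong) auto
      finally show ?thesis using fz by simp
    qed
    have "(\<lambda>n. K * (1/2) ^ n) \<longlonglongrightarrow> K * 0" by (intro tendsto_intros LIMSEQ_power_zero) auto
    hence "norm (f z) \<le> 0" using LIMSEQ_le_const[of "\<lambda>n. K * (1/2)^n" 0 "norm (f z)"] bound by auto
    thus ?thesis by simp
  qed
  have f0: "f z = 0" if z: "z \<notin> star m x b" for z
  proof (rule analytic_continuation_open[of "- cball 0 (2 * R)" "- star m x b" f "\<lambda>_. 0"])
    show "open (- star m x b)" using compact_imp_closed[OF compact_star] by blast
    have "complex_of_real (2 * R + 1) \<in> - cball 0 (2 * R)" using R by (simp only: ComplD mem_cball Compl_iff dist_0_norm norm_of_real)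
    thus "- cball 0 (2 * R) \<noteq> ({} :: complex set)" by blast
    show "- cball 0 (2 * R) \<subseteq> - star m x b" using R by fastforce
    show "f holomorphic_on - star m x b"
      unfolding holomorphic_on_def using fd field_differentiable_at_within by blast
  qed (use z f_far connected_compl_star in auto)
  define d where "d = x k - b"
  have d0: "d \<noteq> 0" using bxne[OF k] by (simp add: d_def)
  \<comment> \<open>The midpoint of the k-th segment; genericity of b keeps it off all rays and all
    other segments.\<close>
  define u0 where "u0 = b + of_real (1/2) * d"
  have u0r: "u0 \<notin> ray b (x l)" if "l < m" for l
    using segment_off_rays[OF gen k that, of "1/2"] by (simp add: u0_def d_def)
  have u0s: "u0 \<notin> closed_segment b (x l)" if l: "l < m" "l \<noteq> k" for l
  proof
    assume "u0 \<in> closed_segment b (x l)"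
    then obtain u where u: "u0 = (1 - u) *\<^sub>R b + u *\<^sub>R x l" by (auto simp: closed_segment_def)
    have "of_real (1/2) * d = of_real u * (x l - b)" using u by (simp add: u0_def scaleR_conv_of_real algebra_simps)
    moreover from this have "u \<noteq> 0" using d0 by auto
    ultimately have "(x l - b) / (x k - b) = of_real (1 / (2 * u))" using d0 by (simp add: d_def field_simps)
    thus False using gen k l unfolding generic_base_def by (metis Reals_of_real)
  qed
  define Av where "Av = - ((\<Union>l<m. ray b (x l)) \<union> (\<Union>l\<in>{..<m}-{k}. closed_segment b (x l)))"
  have "open Av" unfolding Av_def by (intro open_Compl closed_Un closed_UN) (auto intro!: closed_ray bxne)
  moreover have "u0 \<in> Av" using u0r u0s by (auto simp: Av_def)
  ultimately obtain r where r: "r > 0" "ball u0 r \<subseteq> Av" using openE by blast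
  define \<eta> where "\<eta> = min (1/4) (r / (2 * norm d))"
  have \<eta>: "\<eta> > 0" "\<eta> < 1/2" "\<eta> * norm d < r"
  proof -
    show "\<eta> > 0" "\<eta> < 1/2" using r d0 by (auto simp: \<eta>_def)
    have "\<eta> * norm d \<le> r / (2 * norm d) * norm d" using d0 by (intro mult_right_mono) (auto simp: \<eta>_def)
    thus "\<eta> * norm d < r" using d0 r by simp
  qed
  define e where "e = of_real \<eta> * d"
  have e0: "e \<noteq> 0" using \<eta> d0 by (simp add: e_def)
  have inball: "u0 + y * e \<in> ball u0 r" if "norm y \<le> 1" for y
  proof -
    have "norm (y * e) \<le> 1 * (\<eta> * norm d)" unfolding norm_mult e_def using that \<eta> by (intro mult_mono) auto
    thus ?thesis using \<eta>(3) by (simp add: dist_norm)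
  qed
  \<comment> \<open>A triangle whose base lies on the k-th segment with centre u0 and whose apex is
    to its left; the size of e keeps it in a disc on which the weight is holomorphic.\<close>
  define p1 p2 q where "p1 = u0 - e" and "p2 = u0 + e" and "q = u0 + \<i> * e"
  have pb: "p1 \<in> ball u0 r" "p2 \<in> ball u0 r" "q \<in> ball u0 r"
    using inball[of "-1"] inball[of 1] inball[of \<i>] by (auto simp: p1_def p2_def q_def)
  have p1': "p1 = b + of_real (1/2 - \<eta>) * d" and p2': "p2 = b + of_real (1/2 + \<eta>) * d"
    by (simp_all add: p1_def p2_def u0_def e_def algebra_simps)
  have wbh: "wb holomorphic_on ball u0 r" by (rule wbase_holomorphic) (use r in \<open>auto simp: Av_def\<close>)
  have wbc: "continuous_on (closed_segment y y') wb" if "y \<in> ball u0 r" "y' \<in> ball u0 r" for y y'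
    using that by (intro continuous_on_subset[OF holomorphic_on_imp_continuous_on[OF wbh]] closed_segment_subset convex_ball)
  have sub1: "p1 \<in> closed_segment b (x k)" "p2 \<in> closed_segment b (x k)" "p2 \<in> closed_segment p1 (x k)"
  proof -
    have s: "b + of_real s * d \<in> closed_segment b (x k)" if "0 \<le> s" "s \<le> 1" for s
      using that unfolding closed_segment_def
      by (intro CollectI exI[of _ s]) (simp add: d_def scaleR_conv_of_real algebra_simps)
    show "p1 \<in> closed_segment b (x k)" unfolding p1' by (rule s) (use \<eta> in simp_all)
    show "p2 \<in> closed_segment b (x k)" unfolding p2' by (rule s) (use \<eta> in simp_all)
    define s where "s = 2 * \<eta> / (1/2 + \<eta>)"
    have s01: "0 \<le> s" "s \<le> 1" using \<eta> by (auto simp: s_def field_simps)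
    have "s * (1/2 + \<eta>) = 2 * \<eta>" using \<eta> by (simp add: s_def)
    hence "complex_of_real s * of_real (1/2 + \<eta>) = of_real (2 * \<eta>)" by (metis of_real_mult)
    moreover have "x k - p1 = of_real (1/2 + \<eta>) * d" "p2 - p1 = of_real (2 * \<eta>) * d"
      unfolding p1' p2' by (simp_all add: d_def field_simps)
    ultimately have "p2 - p1 = of_real s * (x k - p1)" by simp
    hence "p2 = (1 - s) *\<^sub>R p1 + s *\<^sub>R x k"
      by (simp add: scaleR_conv_of_real algebra_simps)
    thus "p2 \<in> closed_segment p1 (x k)" using s01 unfolding closed_segment_def by blast
  qed
  have c1: "continuous_on (closed_segment b p1) wb" "continuous_on (closed_segment p2 (x k)) wb"
  proof -
    have "closed_segment b p1 \<subseteq> closed_segment b (x k)" "closed_segment p2 (x k) \<subseteq> closed_segment b (x k)"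
      using sub1 by (auto simp: subset_closed_segment)
    thus "continuous_on (closed_segment b p1) wb" "continuous_on (closed_segment p2 (x k)) wb"
      using continuous_on_subset[OF wbase_continuous_segment[OF k]] by blast+
  qed
  define I where "I y y' z = contour_integral (linepath y y') (\<lambda>u. wb u / (u - z))" for y y' z
  \<comment> \<open>The transform f with the base of the triangle replaced by the other two sides.
    The contour now avoids u0, so g is continuous there, while f has a jump.\<close>
  define g where "g z = (\<Sum>j\<in>{..<m}-{k}. A j * cs j z) + A k * (I b p1 z + I p1 q z + I q p2 z + I p2 (x k) z)" for z
  have off: "u0 + y * e \<notin> closed_segment b (x k)" if "Im y \<noteq> 0" for y
  proof
    assume "u0 + y * e \<in> closed_segment b (x k)"
    then obtain s where "u0 + y * e = (1 - s) *\<^sub>R b + s *\<^sub>R x k" by (auto simp: closed_segment_def)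
    hence "(of_real (1/2) + y * of_real \<eta>) * d = of_real s * d" by (simp add: u0_def e_def d_def scaleR_conv_of_real algebra_simps)
    hence "of_real (1/2) + y * of_real \<eta> = of_real s" using d0 by simp
    hence "Im (of_real (1/2) + y * of_real \<eta>) = 0" by (simp only: Im_complex_of_real)
    thus False using that \<eta> by simp
  qed
  have ostar: "u0 + y * e \<notin> star m x b" if "Im y \<noteq> 0" "norm y \<le> 1" for y
  proof
    assume "u0 + y * e \<in> star m x b"
    then obtain j where j: "j < m" "u0 + y * e \<in> closed_segment b (x j)" by (auto simp: star_def)
    moreover have "u0 + y * e \<in> Av" using inball[OF that(2)] r by blast
    ultimately show False using off[OF that(1)] by (cases "j = k") (auto simp: Av_def)
  qed
  define tri where "tri = linepath p1 p2 +++ linepath p2 q +++ linepath q p1"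
  have tri: "valid_path tri" "pathfinish tri = pathstart tri" "path_image tri = closed_segment p1 p2 \<union> closed_segment p2 q \<union> closed_segment q p1"
    by (auto simp: tri_def path_image_join)
  have tri_ball: "path_image tri \<subseteq> ball u0 r" unfolding tri(3) using pb by (intro Un_least closed_segment_subset convex_ball)
  have tri_nz: "y = of_real s \<and> \<bar>s\<bar> \<le> 1 \<or> (\<exists>s\<in>{0..1}. y = of_real (1 - s) + of_real s * \<i>) \<or> (\<exists>s\<in>{0..1}. y = of_real (s - 1) + of_real s * \<i>)
      \<or> Im y = 0" if "u0 + y * e \<in> path_image tri" "s = Re y" for y s
  proof -
    from that(1) consider t where "t \<in> {0..1}" "u0 + y * e = (1 - t) *\<^sub>R p1 + t *\<^sub>R p2"
      | t where "t \<in> {0..1}" "u0 + y * e = (1 - t) *\<^sub>R p2 + t *\<^sub>R q"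
      | t where "t \<in> {0..1}" "u0 + y * e = (1 - t) *\<^sub>R q + t *\<^sub>R p1"
      unfolding tri(3) closed_segment_def by fastforce
    thus ?thesis
    proof cases
      case 1
      hence "y * e = of_real (2 * t - 1) * e" by (simp add: p1_def p2_def scaleR_conv_of_real algebra_simps)
      hence "y = of_real (2 * t - 1)" using e0 by simp
      hence "Im y = 0" by (simp only: Im_complex_of_real)
      thus ?thesis by blast
    next
      case 2
      hence "y * e = (of_real (1 - t) + of_real t * \<i>) * e" by (simp add: q_def p2_def scaleR_conv_of_real algebra_simps)
      hence "y = of_real (1 - t) + of_real t * \<i>" using e0 by simp
      thus ?thesis using 2(1) by blast
    next
      case 3
      hence "y * e = (of_real ((1 - t) - 1) + of_real (1 - t) * \<i>) * e" by (simp add: q_def p1_def scaleR_conv_of_real algebra_simps)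
      hence "y = of_real ((1 - t) - 1) + of_real (1 - t) * \<i>" using e0 by simp
      moreover have "1 - t \<in> {0..1}" using 3(1) by simp
      ultimately show ?thesis by blast
    qed
  qed
  have not_tri: "u0 + of_real \<tau> * \<i> * e \<notin> path_image tri" if "\<tau> \<noteq> 0" "\<tau> < 1" for \<tau>
    using tri_nz[of "of_real \<tau> * \<i>" 0] that by (auto simp: complex_eq_iff)
  have gf: "g z = f z - A k * (2 * of_real pi * \<i> * winding_number tri z * wb z)"
    if z: "z = u0 + of_real \<tau> * \<i> * e" and \<tau>: "\<tau> \<noteq> 0" "\<bar>\<tau>\<bar> < 1" for z \<tau>
  proof -
    have ny: "norm (of_real \<tau> * \<i>) \<le> 1" "Im (of_real \<tau> * \<i>) \<noteq> 0" using \<tau> by (auto simp: norm_mult)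
    have zb: "z \<in> ball u0 r" using inball[OF ny(1)] z by simp
    have zt: "z \<notin> path_image tri" unfolding z using not_tri \<tau> by simp
    have zs: "z \<notin> closed_segment b (x k)" using off[OF ny(2)] z by simp
    have "((\<lambda>u. wb u / (u - z)) has_contour_integral (2 * pi * \<i> * winding_number tri z * wb z)) tri"
      by (rule Cauchy_integral_formula_convex_simple[OF convex_ball wbh])
         (use zb tri tri_ball zt in \<open>auto simp: interior_open\<close>)
    hence "((\<lambda>u. wb u / (u - z)) has_contour_integral (2 * of_real pi * \<i> * winding_number tri z * wb z)) tri"
      by simp
    moreover have "((\<lambda>u. wb u / (u - z)) has_contour_integral (I p1 p2 z + (I p2 q z + I q p1 z))) tri"
      unfolding tri_def I_def using zt tri(3) pb
      by (intro has_contour_integral_join has_contour_integral_integral cauchy_segment_has_derivative(2) wbc) auto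
    ultimately have w: "I p1 p2 z + (I p2 q z + I q p1 z) = 2 * of_real pi * \<i> * winding_number tri z * wb z"
      using has_contour_integral_unique by blast
    have ci: "continuous_on (closed_segment y y') (\<lambda>u. wb u / (u - z))"
      if "continuous_on (closed_segment y y') wb" "z \<notin> closed_segment y y'" for y y'
      using that by (intro continuous_intros) auto
    have rev: "I p2 q z = - I q p2 z" "I q p1 z = - I p1 q z"
      unfolding I_def using zt tri(3) pb by (intro contour_integral_reverse_linepath ci wbc; blast)+
    have seg1: "closed_segment p1 (x k) \<subseteq> closed_segment b (x k)" using sub1(1) by (intro closed_segment_subset) auto
    have "cs k z = I b p1 z + I p1 (x k) z"
      unfolding cs_def I_def
      by (rule contour_integral_split_linepath[OF ci[OF wbase_continuous_segment[OF k] zs] sub1(1)])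
    also have "I p1 (x k) z = I p1 p2 z + I p2 (x k) z" unfolding I_def
      by (rule contour_integral_split_linepath[OF ci[OF continuous_on_subset[OF wbase_continuous_segment[OF k] seg1]] sub1(3)])
         (use zs seg1 in auto)
    finally have csk: "cs k z = I b p1 z + (I p1 p2 z + I p2 (x k) z)" .
    have "f z = A k * cs k z + (\<Sum>j\<in>{..<m}-{k}. A j * cs j z)"
      unfolding f_def by (rule sum.remove) (use k in auto)
    hence "f z - g z = A k * (I p1 p2 z + (I p2 q z + I q p1 z))"
      unfolding g_def csk rev by (simp add: algebra_simps)
    thus ?thesis unfolding w by (simp add: algebra_simps)
  qed
  have out: "g z = 0" if z: "z = u0 + of_real (- \<tau>) * \<i> * e" and \<tau>: "0 < \<tau>" "\<tau> < 1" for z \<tau>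
  proof -
    have imr: "Im (of_real s * y) = s * Im y" for s y by simp
    \<comment> \<open>The closed half plane on the side of q. It contains the triangle but not z, so
      the winding number is 0.\<close>
    define H where "H = {y. 0 \<le> Im ((y - u0) / e)}"
    have "convex H"
    proof (rule convexI)
      fix y y' and s t :: real assume h: "y \<in> H" "y' \<in> H" "0 \<le> s" "0 \<le> t" "s + t = 1"
      have "s *\<^sub>R y + t *\<^sub>R y' - u0 = of_real s * (y - u0) + of_real t * (y' - u0) + (of_real (s + t) - 1) * u0"
        by (simp add: scaleR_conv_of_real algebra_simps)
      hence "(s *\<^sub>R y + t *\<^sub>R y' - u0) / e = of_real s * ((y - u0) / e) + of_real t * ((y' - u0) / e)"
        using h(5) by (simp add: add_divide_distrib)
      hence "Im ((s *\<^sub>R y + t *\<^sub>R y' - u0) / e) = s * Im ((y - u0) / e) + t * Im ((y' - u0) / e)"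
        by (simp only: plus_complex.sel imr)
      thus "s *\<^sub>R y + t *\<^sub>R y' \<in> H" using h by (simp add: H_def)
    qed
    moreover have "p1 \<in> H" "p2 \<in> H" "q \<in> H" using e0 by (auto simp: H_def p1_def p2_def q_def)
    ultimately have "path_image tri \<subseteq> H" unfolding tri(3) by (intro Un_least closed_segment_subset)
    moreover have "z \<notin> H" using z \<tau> e0 by (simp add: H_def)
    ultimately have "winding_number tri z = 0"
      using tri valid_path_imp_path \<open>convex H\<close> by (intro winding_number_zero_outside[of _ H]) auto
    moreover have "f z = 0" unfolding z by (rule f0, rule ostar) (use \<tau> in \<open>auto simp: norm_mult\<close>)
    ultimately show ?thesis using gf[OF z] \<tau> by simp
  qed
  have inn: "g z = - A k * (2 * of_real pi * \<i> * wb z)" if z: "z = u0 + of_real \<tau> * \<i> * e" and \<tau>: "0 < \<tau>" "\<tau> < 1" for z \<tau>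
  proof -
    have "\<not> collinear {p1, p2, q}"
    proof
      assume "collinear {p1, p2, q}"
      hence "collinear {0, p1 - p2, q - p2}" using collinear_3[of p1 p2 q] by simp
      hence "(q - p2) / (p1 - p2) \<in> \<real>" by (simp only: collinear_iff_Reals)
      moreover have "(q - p2) / (p1 - p2) = (1 - \<i>) / 2"
        using e0 by (simp add: p1_def p2_def q_def field_simps)
      ultimately show False by (simp add: complex_is_Real_iff)
    qed
    \<comment> \<open>Barycentric coordinates of u0 + i tau e, all positive for 0 < tau < 1.\<close>
    moreover have "((1 - \<tau>) / 2) *\<^sub>R p1 + ((1 - \<tau>) / 2) *\<^sub>R p2 + \<tau> *\<^sub>R q = z"
      unfolding z p1_def p2_def q_def by (simp add: scaleR_conv_of_real field_simps)
    ultimately have zi: "z \<in> interior (convex hull {p1, p2, q})"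
      using \<tau>
      by (subst interior_convex_hull_3_minimal, simp, simp, intro CollectI, rule_tac exI[of _ "(1 - \<tau>) / 2"],
          rule_tac exI[of _ "(1 - \<tau>) / 2"], rule_tac exI[of _ \<tau>]) (auto simp: field_simps)
    \<comment> \<open>The positive imaginary part shows that the triangle is traversed
      counterclockwise, so the winding number is 1 and not -1.\<close>
    have "(p2 - p1) * cnj (p2 - z) = of_real (2 * (norm e)\<^sup>2) * (1 + of_real \<tau> * \<i>)"
    proof -
      have "p2 - p1 = 2 * e" "p2 - z = e * (1 - of_real \<tau> * \<i>)" by (auto simp: p1_def p2_def z algebra_simps)
      hence "(p2 - p1) * cnj (p2 - z) = 2 * (e * cnj e) * (1 + of_real \<tau> * \<i>)" by simp
      thus ?thesis by (simp add: complex_norm_square[symmetric])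
    qed
    hence "Im ((p2 - p1) * cnj (p2 - z)) = 2 * (norm e)\<^sup>2 * \<tau>" by simp
    hence "0 < Im ((p2 - p1) * cnj (p2 - z))" using e0 \<tau> by simp
    hence "winding_number tri z = 1" unfolding tri_def using winding_number_triangle[OF zi] by simp
    moreover have "f z = 0" unfolding z by (rule f0, rule ostar) (use \<tau> in \<open>auto simp: norm_mult\<close>)
    ultimately show ?thesis using gf[OF z] \<tau> by simp
  qed
  have u0n: "u0 \<notin> closed_segment b p1" "u0 \<notin> closed_segment p2 (x k)" "u0 \<notin> closed_segment p1 q" "u0 \<notin> closed_segment q p2"
  proof -
    have inj: "s = s'" if "b + of_real s * d = b + of_real s' * d" for s s' using that d0 by simp
    show "u0 \<notin> closed_segment b p1"
    proof
      assume "u0 \<in> closed_segment b p1"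
      then obtain t where t: "0 \<le> t" "t \<le> 1" "u0 = (1 - t) *\<^sub>R b + t *\<^sub>R p1" by (auto simp: closed_segment_def)
      have "u0 = b + of_real (t * (1/2 - \<eta>)) * d" unfolding t(3) p1' by (simp add: scaleR_conv_of_real algebra_simps)
      hence "1/2 = t * (1/2 - \<eta>)" unfolding u0_def by (rule inj)
      moreover have "t * (1/2 - \<eta>) \<le> 1 * (1/2 - \<eta>)" using t \<eta> by (intro mult_right_mono) auto
      ultimately have "1/2 \<le> 1 * (1/2 - \<eta>)" by (simp only:)
      thus False using \<eta> by simp
    qed
    show "u0 \<notin> closed_segment p2 (x k)"
    proof
      assume "u0 \<in> closed_segment p2 (x k)"
      then obtain t where t: "0 \<le> t" "t \<le> 1" "u0 = (1 - t) *\<^sub>R p2 + t *\<^sub>R x k" by (auto simp: closed_segment_def)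
      have "u0 = b + of_real ((1 - t) * (1/2 + \<eta>) + t) * d" unfolding t(3) p2' by (simp add: d_def scaleR_conv_of_real algebra_simps)
      hence "1/2 = (1 - t) * (1/2 + \<eta>) + t" unfolding u0_def by (rule inj)
      moreover have "(1 - t) * (1/2 + \<eta>) + t = 1/2 + (\<eta> + t * (1/2 - \<eta>))" by (simp add: field_simps)
      ultimately have "0 = \<eta> + t * (1/2 - \<eta>)" by simp
      moreover have "0 \<le> t * (1/2 - \<eta>)" using t \<eta> by simp
      ultimately show False using \<eta> by simp
    qed
    show "u0 \<notin> closed_segment p1 q"
    proof
      assume "u0 \<in> closed_segment p1 q"
      then obtain t where t: "u0 = (1 - t) *\<^sub>R p1 + t *\<^sub>R q" by (auto simp: closed_segment_def)
      have "(of_real (t - 1) + of_real t * \<i>) * e = 0" using t by (simp add: p1_def q_def scaleR_conv_of_real algebra_simps)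
      hence "of_real (t - 1) + of_real t * \<i> = 0" using e0 by simp
      thus False by (auto simp: complex_eq_iff)
    qed
    show "u0 \<notin> closed_segment q p2"
    proof
      assume "u0 \<in> closed_segment q p2"
      then obtain t where t: "u0 = (1 - t) *\<^sub>R q + t *\<^sub>R p2" by (auto simp: closed_segment_def)
      have "(of_real t + of_real (1 - t) * \<i>) * e = 0" using t by (simp add: p2_def q_def scaleR_conv_of_real algebra_simps)
      hence "of_real t + of_real (1 - t) * \<i> = 0" using e0 by simp
      thus False by (auto simp: complex_eq_iff)
    qed
  qed
  have gc: "isCont g u0"
  proof -
    have "isCont (cs j) u0" if "j \<in> {..<m} - {k}" for j
      unfolding cs_def using that u0s
      by (intro DERIV_isCont[OF cauchy_segment_has_derivative(1)] wbase_continuous_segment) auto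
    moreover have "isCont (I y y') u0" if "continuous_on (closed_segment y y') wb" "u0 \<notin> closed_segment y y'" for y y'
      unfolding I_def using that by (intro DERIV_isCont[OF cauchy_segment_has_derivative(1)])
    ultimately show ?thesis unfolding g_def[abs_def]
      by (intro continuous_intros) (use c1 u0n pb wbc in auto)
  qed
  have wc: "isCont wb u0"
    using holomorphic_on_imp_continuous_on[OF wbh] r by (metis centre_in_ball continuous_on_interior interior_ball)
  have lim: "((\<lambda>\<tau>. u0 + of_real (c * \<tau>) * \<i> * e) \<longlongrightarrow> u0) (at_right 0)" for c :: real
    by (rule tendsto_eq_intros refl | simp)+
  have ev: "eventually (\<lambda>\<tau>. 0 < \<tau> \<and> \<tau> < (1::real)) (at_right 0)"
    unfolding eventually_at_right_field by (intro exI[of _ 1]) auto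
  \<comment> \<open>Both one-sided limits of g at u0 are taken. As f vanishes on both sides, the
    limit from outside the triangle is 0 and the one from inside is -2 pi i A_k times the nonzero
    weight at u0.\<close>
  have "((\<lambda>\<tau>. g (u0 + of_real (-1 * \<tau>) * \<i> * e)) \<longlongrightarrow> g u0) (at_right 0)"
    by (rule isCont_tendsto_compose[OF gc lim])
  moreover have "eventually (\<lambda>\<tau>. g (u0 + of_real (-1 * \<tau>) * \<i> * e) = 0) (at_right 0)"
    using ev
  proof eventually_elim
    case (elim \<tau>)
    show ?case by (rule out[of _ \<tau>]) (use elim in simp_all)
  qed
  ultimately have "((\<lambda>\<tau>::real. 0) \<longlongrightarrow> g u0) (at_right 0)" by (rule Lim_transform_eventually)
  hence g1: "g u0 = 0" using tendsto_const tendsto_unique trivial_limit_at_right_real by blast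
  have "((\<lambda>\<tau>. g (u0 + of_real (1 * \<tau>) * \<i> * e)) \<longlongrightarrow> g u0) (at_right 0)"
    by (rule isCont_tendsto_compose[OF gc lim])
  moreover have "eventually (\<lambda>\<tau>. g (u0 + of_real (1 * \<tau>) * \<i> * e) = - A k * (2 * of_real pi * \<i> * wb (u0 + of_real (1 * \<tau>) * \<i> * e))) (at_right 0)"
    using ev
  proof eventually_elim
    case (elim \<tau>)
    show ?case by (rule inn[of _ \<tau>]) (use elim in simp_all)
  qed
  ultimately have "((\<lambda>\<tau>::real. - A k * (2 * of_real pi * \<i> * wb (u0 + of_real (1 * \<tau>) * \<i> * e))) \<longlongrightarrow> g u0) (at_right 0)"
    by (rule Lim_transform_eventually)
  moreover have "((\<lambda>\<tau>::real. - A k * (2 * of_real pi * \<i> * wb (u0 + of_real (1 * \<tau>) * \<i> * e))) \<longlongrightarrow> - A k * (2 * of_real pi * \<i> * wb u0)) (at_right 0)"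
    by (intro tendsto_intros isCont_tendsto_compose[OF wc lim])
  ultimately have "- A k * (2 * of_real pi * \<i> * wb u0) = g u0"
    using tendsto_unique trivial_limit_at_right_real by blast
  thus ?thesis using g1 wbase_nz[of u0] u0r by simp
qed

end

subsection \<open>Differentiability of the base integrals in the points\<close>

text \<open>Cauchy's inequality on discs of radius R/2, which stay in the ball because R is at least
  4. The gain 1/R turns a bound for g into a Lipschitz estimate.\<close>

lemma holomorphic_increment_bound:
  assumes g: "g holomorphic_on ball 0 R" and M: "\<And>z. z \<in> ball 0 R \<Longrightarrow> norm (g z) \<le> M" and R: "R \<ge> 4"
  shows "norm (g 1 - g (0::complex)) \<le> 2 * M / R"
proof -
  have d: "norm (deriv g z) \<le> 2 * M / R" if z: "z \<in> cball 0 1" for z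
  proof -
    have sub: "cball z (R/2) \<subseteq> ball 0 R"
    proof
      fix y assume "y \<in> cball z (R/2)"
      hence "norm y \<le> R/2 + 1" using z norm_triangle_ineq[of z "y - z"] by (simp add: dist_norm norm_minus_commute)
      thus "y \<in> ball 0 R" using R by simp
    qed
    have "norm ((deriv ^^ 1) g z) \<le> fact 1 * M / (R/2) ^ 1"
    proof (rule Cauchy_inequality)
      show "g holomorphic_on ball z (R/2)" using g sub holomorphic_on_subset by (meson ball_subset_cball subset_trans)
      show "continuous_on (cball z (R/2)) g" using holomorphic_on_imp_continuous_on[OF g] sub continuous_on_subset by blast
      show "norm (g y) \<le> M" if "norm (z - y) = R/2" for y
        using that sub by (intro M) (auto simp: dist_norm subset_iff)
    qed (use R in auto)
    thus ?thesis by (simp add: mult.commute)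
  qed
  have "norm (g 1 - g 0) \<le> 2 * M / R * norm (1 - 0 :: complex)"
  proof (rule field_differentiable_bound[of "cball 0 1" g "deriv g"])
    fix z :: complex assume z: "z \<in> cball 0 1"
    hence "z \<in> ball 0 R" using R by auto
    thus "(g has_field_derivative deriv g z) (at z within cball 0 1)"
      using g holomorphic_derivI[of g "ball 0 R" z] has_field_derivative_at_within by blast
  qed (use d in auto)
  thus ?thesis by simp
qed

text \<open>Boundedness and holomorphy along complex lines replace the theory of holomorphic functions of
  several variables: Cauchy's inequality on lines gives the Lipschitz bound needed for the chain rule.\<close>

lemma chain_rule_complex_lines:
  fixes J :: "(nat \<Rightarrow> complex) \<Rightarrow> complex" and x :: "nat \<Rightarrow> real \<Rightarrow> complex"
  assumes \<rho>: "\<rho> > 0" and bnd: "\<And>y. (\<forall>l<m. norm (y l - x l t) < \<rho>) \<Longrightarrow> norm (J y) \<le> M"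
    and hol: "\<And>u v z. (\<forall>l<m. norm (u l + z * v l - x l t) < \<rho>) \<Longrightarrow> (\<lambda>z. J (\<lambda>l. u l + z * v l)) field_differentiable at z"
    and D: "((\<lambda>z. J (\<lambda>l. x l t + z * v l)) has_field_derivative D) (at 0)"
    and x: "\<And>l. l < m \<Longrightarrow> (x l has_vector_derivative v l) (at t)"
    and cong: "\<And>y y'. (\<And>l. l < m \<Longrightarrow> y l = y' l) \<Longrightarrow> J y = J y'"
  shows "((\<lambda>s. J (\<lambda>l. x l s)) has_vector_derivative D) (at t)"
proof -
  define e where "e l h = x l (t + h) - x l t - of_real h * v l" for l h
  define \<delta> where "\<delta> h = (\<Sum>l<m. norm (e l h))" for h
  have elim: "((\<lambda>h. norm (e l h) / norm h) \<longlongrightarrow> 0) (at 0)" if "l < m" for l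
    using x[OF that] unfolding has_vector_derivative_def has_derivative_at e_def by (simp add: scaleR_conv_of_real)
  have \<delta>lim: "((\<lambda>h. \<delta> h / norm h) \<longlongrightarrow> 0) (at 0)"
    unfolding \<delta>_def sum_divide_distrib using tendsto_sum[of "{..<m}" "\<lambda>l h. norm (e l h) / norm h" "\<lambda>_. 0" "at 0"] elim by simp
  have e0: "((\<lambda>h. \<delta> h) \<longlongrightarrow> 0) (at 0)"
  proof -
    have "((\<lambda>h::real. \<delta> h / norm h * norm h) \<longlongrightarrow> 0 * 0) (at 0)"
      by (intro tendsto_mult \<delta>lim tendsto_norm_zero tendsto_ident_at)
    moreover have "eventually (\<lambda>h::real. \<delta> h / norm h * norm h = \<delta> h) (at 0)"
      by (auto simp: eventually_at intro: exI[of _ 1])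
    ultimately show ?thesis using Lim_transform_eventually by fastforce
  qed
  have el: "norm (e l h) \<le> \<delta> h" if "l < m" for l h unfolding \<delta>_def using that by (intro member_le_sum) auto
  define V where "V = 1 + (\<Sum>l<m. norm (v l))"
  have V: "V > 0" "\<And>l. l < m \<Longrightarrow> norm (v l) \<le> V"
  proof -
    show "V > 0" unfolding V_def by (intro add_pos_nonneg sum_nonneg) auto
    show "norm (v l) \<le> V" if "l < m" for l
      using member_le_sum[of l "{..<m}" "\<lambda>l. norm (v l)"] that by (simp add: V_def)
  qed
  \<comment> \<open>The linearised and the true positions are joined by the complex line in
    direction \<open>e\<close>. It may be followed up to radius R = rho / (2 delta) while moving
    each point by at most rho/2, so the increment over a unit step is of order 1/R, that is, of
    order delta.\<close>
  have key: "norm (J (\<lambda>l. x l (t + h)) - J (\<lambda>l. x l t + of_real h * v l)) \<le> 4 * M / \<rho> * \<delta> h"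
    if h: "\<delta> h < \<rho> / 8" "\<bar>h\<bar> * V < \<rho> / 4" for h
  proof (cases "\<delta> h = 0")
    case True
    have "e l h = 0" if "l < m" for l using el[OF that, of h] True by simp
    hence "J (\<lambda>l. x l (t + h)) = J (\<lambda>l. x l t + of_real h * v l)" by (intro cong) (simp add: e_def algebra_simps)
    thus ?thesis using True by simp
  next
    case False
    hence \<delta>0: "\<delta> h > 0" unfolding \<delta>_def using sum_nonneg[of "{..<m}" "\<lambda>l. norm (e l h)"] by (simp add: less_le)
    define R where "R = \<rho> / (2 * \<delta> h)"
    have R4: "R \<ge> 4" using h(1) \<delta>0 by (simp add: R_def field_simps)
    have near: "norm ((x l t + of_real h * v l) + z * e l h - x l t) < \<rho>" if "l < m" "z \<in> ball 0 R" for l z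
    proof -
      have "norm (of_real h * v l) \<le> \<bar>h\<bar> * V" unfolding norm_mult using V(2)[OF that(1)] by (simp add: mult_left_mono)
      moreover have "norm (z * e l h) \<le> R * \<delta> h" unfolding norm_mult using that el[OF that(1), of h] R4 by (intro mult_mono) auto
      moreover have "R * \<delta> h = \<rho> / 2" using \<delta>0 by (simp add: R_def)
      ultimately have "norm (of_real h * v l) + norm (z * e l h) < \<rho>" using h(2) \<rho> by linarith
      moreover have "(x l t + of_real h * v l) + z * e l h - x l t = of_real h * v l + z * e l h" by simp
      ultimately show ?thesis using le_less_trans[OF norm_triangle_ineq[of "of_real h * v l" "z * e l h"]] by simp
    qed
    define g where "g z = J (\<lambda>l. (x l t + of_real h * v l) + z * e l h)" for z
    have "g holomorphic_on ball 0 R" unfolding g_def holomorphic_on_def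
    proof
      fix z :: complex assume "z \<in> ball 0 R"
      hence "\<forall>l<m. norm ((x l t + of_real h * v l) + z * e l h - x l t) < \<rho>" using near by blast
      from hol[OF this] show "(\<lambda>z. J (\<lambda>l. x l t + of_real h * v l + z * e l h)) field_differentiable at z within ball 0 R"
        by (rule field_differentiable_at_within)
    qed
    from holomorphic_increment_bound[OF this _ R4, of M]
    have "norm (g 1 - g 0) \<le> 2 * M / R" using near bnd by (auto simp: g_def)
    moreover have "g 1 = J (\<lambda>l. x l (t + h))" unfolding g_def by (intro cong) (simp add: e_def)
    moreover have "2 * M / R = 4 * M / \<rho> * \<delta> h" using \<rho> \<delta>0 by (simp add: R_def)
    ultimately show ?thesis by (simp add: g_def)
  qed
  define j where "j z = J (\<lambda>l. x l t + z * v l)" for z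
  have jd: "((\<lambda>h. norm (j (of_real h) - j 0 - of_real h * D) / norm h) \<longlongrightarrow> 0) (at (0::real))"
  proof -
    have "((\<lambda>h. j (complex_of_real h)) has_vector_derivative D) (at 0)"
      using D unfolding j_def[symmetric] by (intro has_vector_derivative_real_field) simp
    thus ?thesis unfolding has_vector_derivative_def has_derivative_at by (simp add: scaleR_conv_of_real)
  qed
  have "((\<lambda>h. norm (J (\<lambda>l. x l (t + h)) - J (\<lambda>l. x l t) - h *\<^sub>R D) / norm h) \<longlongrightarrow> 0) (at 0)"
  proof (rule Lim_null_comparison)
    show "((\<lambda>h. 4 * M / \<rho> * (\<delta> h / norm h) + norm (j (of_real h) - j 0 - of_real h * D) / norm h) \<longlongrightarrow> 0) (at 0)"
    proof -
      have "((\<lambda>h. 4 * M / \<rho> * (\<delta> h / norm h) + norm (j (of_real h) - j 0 - of_real h * D) / norm h) \<longlongrightarrow> 4 * M / \<rho> * 0 + 0) (at 0)"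
        by (intro tendsto_add tendsto_mult tendsto_const \<delta>lim jd)
      thus ?thesis by (simp only: mult_zero_right add_0_right)
    qed
    have "((\<lambda>h::real. \<bar>h\<bar> * V) \<longlongrightarrow> 0 * V) (at 0)" by (intro tendsto_intros tendsto_rabs_zero)
    hence "eventually (\<lambda>h::real. \<bar>h\<bar> * V < \<rho> / 4) (at 0)" using order_tendstoD(2)[of _ 0 _ "\<rho>/4"] \<rho> by simp
    moreover have "eventually (\<lambda>h. \<delta> h < \<rho> / 8) (at 0)" by (rule order_tendstoD(2)[OF e0]) (use \<rho> in simp)
    ultimately show "eventually (\<lambda>h. norm (norm (J (\<lambda>l. x l (t + h)) - J (\<lambda>l. x l t) - h *\<^sub>R D) / norm h)
        \<le> 4 * M / \<rho> * (\<delta> h / norm h) + norm (j (of_real h) - j 0 - of_real h * D) / norm h) (at 0)"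
    proof eventually_elim
      case (elim h)
      have "J (\<lambda>l. x l (t + h)) - J (\<lambda>l. x l t) - h *\<^sub>R D
        = (J (\<lambda>l. x l (t + h)) - J (\<lambda>l. x l t + of_real h * v l)) + (j (of_real h) - j 0 - of_real h * D)"
        by (simp add: j_def scaleR_conv_of_real)
      hence "norm (J (\<lambda>l. x l (t + h)) - J (\<lambda>l. x l t) - h *\<^sub>R D)
        \<le> norm (J (\<lambda>l. x l (t + h)) - J (\<lambda>l. x l t + of_real h * v l)) + norm (j (of_real h) - j 0 - of_real h * D)"
        by (simp only: norm_triangle_ineq)
      with key[OF elim(2,1)]
      have "norm (J (\<lambda>l. x l (t + h)) - J (\<lambda>l. x l t) - h *\<^sub>R D) \<le> 4 * M / \<rho> * \<delta> h + norm (j (of_real h) - j 0 - of_real h * D)"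
        by linarith
      hence "norm (J (\<lambda>l. x l (t + h)) - J (\<lambda>l. x l t) - h *\<^sub>R D) / norm h \<le> (4 * M / \<rho> * \<delta> h + norm (j (of_real h) - j 0 - of_real h * D)) / norm h"
        by (intro divide_right_mono) auto
      thus ?case by (simp add: add_divide_distrib)
    qed
  qed
  thus ?thesis unfolding has_vector_derivative_def has_derivative_at by (auto intro: bounded_linear_scaleR_left)
qed

text \<open>Free of division, genericity becomes an open condition in the points and a polynomial
  one in the coordinates of b.\<close>

lemma generic_base_iff:
  "generic_base m x b \<longleftrightarrow> (\<forall>k<m. x k \<noteq> b) \<and> (\<forall>k<m. \<forall>l<m. k \<noteq> l \<longrightarrow> Im ((x l - b) * cnj (x k - b)) \<noteq> 0)"
proof -
  have "(c / d \<in> \<real>) \<longleftrightarrow> Im (c * cnj d) = 0" if "d \<noteq> 0" for c d :: complex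
  proof -
    have "Im (c / d) = Im (c * cnj d) / (norm d)\<^sup>2" by (simp add: complex_div_cnj[of c d] power2_eq_square del: complex_cnj_mult)?
    thus ?thesis using that by (simp add: complex_is_Real_iff)
  qed
  note iff = this
  have "(x l - b) / (x k - b) \<in> \<real> \<longleftrightarrow> Im ((x l - b) * cnj (x k - b)) = 0" if "x k \<noteq> b" for k l
    by (rule iff) (use that in simp)
  thus ?thesis unfolding generic_base_def by blast
qed

text \<open>Besides openness, two-sided bounds for |y_l - b| are recorded. They control the ratios
  in \<open>wbase\<close> uniformly and give the local boundedness of the base integrals.\<close>

lemma generic_base_nbhd:
  assumes gen: "generic_base m x b"
  obtains \<rho> where "\<rho> > 0" "\<And>y. (\<forall>l<m. norm (y l - x l) < \<rho>) \<Longrightarrow> generic_base m y b"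
    "\<And>y l. (\<forall>l<m. norm (y l - x l) < \<rho>) \<Longrightarrow> l < m \<Longrightarrow> norm (y l - b) \<ge> \<rho>"
    "\<And>y l. (\<forall>l<m. norm (y l - x l) < \<rho>) \<Longrightarrow> l < m \<Longrightarrow> norm (y l - b) \<le> 1 / \<rho>"
proof -
  have 1: "eventually (\<lambda>\<rho>. \<forall>y. norm (y - x l) < \<rho> \<longrightarrow> norm (y - b) \<ge> \<rho> \<and> norm (y - b) \<le> 1 / \<rho>) (at_right 0)" if l: "l < m" for l
  proof -
    define n where "n = norm (x l - b)"
    have n: "n > 0" using gen l by (auto simp: generic_base_def n_def)
    have "eventually (\<lambda>\<rho>::real. 0 < \<rho> \<and> \<rho> < min (n / 2) (1 / (n + 1)) \<and> \<rho> < 1) (at_right 0)"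
      unfolding eventually_at_right_field using n by (intro exI[of _ "min (min (n / 2) (1 / (n + 1))) 1"]) auto
    thus ?thesis
    proof eventually_elim
      case (elim \<rho>)
      show ?case
      proof (intro allI impI conjI)
        fix y assume y: "norm (y - x l) < \<rho>"
        have "n \<le> norm (y - b) + norm (y - x l)" unfolding n_def using norm_triangle_ineq4[of "y - b" "y - x l"] by simp
        thus "\<rho> \<le> norm (y - b)" using y elim by auto
        have "norm (y - b) \<le> norm (y - x l) + n" unfolding n_def using norm_triangle_ineq[of "y - x l" "x l - b"] by simp
        hence "norm (y - b) \<le> n + 1" using y elim by auto
        also have "n + 1 \<le> 1 / \<rho>" using elim n by (simp add: field_simps)
        finally show "norm (y - b) \<le> 1 / \<rho>" .
      qed
    qed
  qed
  have 2: "eventually (\<lambda>\<rho>. \<forall>y y'. norm (y - x l) < \<rho> \<longrightarrow> norm (y' - x k) < \<rho> \<longrightarrow> Im ((y - b) * cnj (y' - b)) \<noteq> 0) (at_right 0)"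
    if "k < m" "l < m" "k \<noteq> l" for k l
  proof -
    define S where "S = {z :: complex \<times> complex. Im ((fst z - b) * cnj (snd z - b)) \<noteq> 0}"
    have "open S" unfolding S_def by (intro open_Collect_neq continuous_intros)
    moreover have "(x l, x k) \<in> S" using gen that by (auto simp: S_def generic_base_iff)
    ultimately obtain r where r: "r > 0" "ball (x l, x k) r \<subseteq> S" using openE by blast
    have "eventually (\<lambda>\<rho>::real. 0 < \<rho> \<and> \<rho> < r / 2) (at_right 0)"
      unfolding eventually_at_right_field using r by (intro exI[of _ "r/2"]) auto
    thus ?thesis
    proof eventually_elim
      case (elim \<rho>)
      show ?case
      proof (intro allI impI)
        fix y y' assume "norm (y - x l) < \<rho>" "norm (y' - x k) < \<rho>"
        moreover have "dist (x l, x k) (y, y') \<le> dist (x l) y + dist (x k) y'"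
          unfolding dist_Pair_Pair by (rule sqrt_sum_squares_le_sum) auto
        ultimately have "dist (x l, x k) (y, y') < r" using elim by (simp add: dist_norm norm_minus_commute)
        hence "(y, y') \<in> S" using r by auto
        thus "Im ((y - b) * cnj (y' - b)) \<noteq> 0" by (simp add: S_def)
      qed
    qed
  qed
  have "eventually (\<lambda>\<rho>. \<forall>l\<in>{..<m}. \<forall>y. norm (y - x l) < \<rho> \<longrightarrow> norm (y - b) \<ge> \<rho> \<and> norm (y - b) \<le> 1 / \<rho>) (at_right 0)"
    using 1 by (intro eventually_ball_finite) auto
  moreover have "eventually (\<lambda>\<rho>. \<forall>q\<in>{q \<in> {..<m} \<times> {..<m}. fst q \<noteq> snd q}. \<forall>y y'. norm (y - x (snd q)) < \<rho> \<longrightarrow> norm (y' - x (fst q)) < \<rho> \<longrightarrow> Im ((y - b) * cnj (y' - b)) \<noteq> 0) (at_right 0)"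
    using 2 by (intro eventually_ball_finite) auto
  moreover have "eventually (\<lambda>\<rho>::real. 0 < \<rho>) (at_right 0)" by (rule eventually_at_right_less)
  ultimately have "eventually (\<lambda>\<rho>. (\<forall>l\<in>{..<m}. \<forall>y. norm (y - x l) < \<rho> \<longrightarrow> norm (y - b) \<ge> \<rho> \<and> norm (y - b) \<le> 1 / \<rho>)
     \<and> (\<forall>q\<in>{q \<in> {..<m} \<times> {..<m}. fst q \<noteq> snd q}. \<forall>y y'. norm (y - x (snd q)) < \<rho> \<longrightarrow> norm (y' - x (fst q)) < \<rho> \<longrightarrow> Im ((y - b) * cnj (y' - b)) \<noteq> 0)
     \<and> 0 < \<rho>) (at_right 0)" by eventually_elim blast
  from eventually_happens'[OF trivial_limit_at_right_real this] obtain \<rho>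
    where \<rho>: "\<forall>l\<in>{..<m}. \<forall>y. norm (y - x l) < \<rho> \<longrightarrow> norm (y - b) \<ge> \<rho> \<and> norm (y - b) \<le> 1 / \<rho>"
     "\<forall>q\<in>{q \<in> {..<m} \<times> {..<m}. fst q \<noteq> snd q}. \<forall>y y'. norm (y - x (snd q)) < \<rho> \<longrightarrow> norm (y' - x (fst q)) < \<rho> \<longrightarrow> Im ((y - b) * cnj (y' - b)) \<noteq> 0" "0 < \<rho>"
    by (elim exE conjE)
  show ?thesis
  proof (rule that[OF \<rho>(3)])
    fix y assume y: "\<forall>l<m. norm (y l - x l) < \<rho>"
    show lo: "norm (y l - b) \<ge> \<rho>" "norm (y l - b) \<le> 1 / \<rho>" if "l < m" for l using y that \<rho>(1) by auto
    have "y l \<noteq> b" if "l < m" for l using lo(1)[OF that] \<rho>(3) by auto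
    moreover have "Im ((y l - b) * cnj (y k - b)) \<noteq> 0" if "k < m" "l < m" "k \<noteq> l" for k l
      using bspec[OF \<rho>(2), of "(k, l)"] y that by auto
    ultimately show "generic_base m y b" unfolding generic_base_iff by blast
  qed
qed

text \<open>The principal argument is at most pi in modulus, so the imaginary part of the exponent
  costs at most exp(pi |Im a|).\<close>

lemma norm_powr_le:
  assumes "Re a > 0" "norm z \<le> C"
  shows "norm (z powr a) \<le> C powr Re a * exp (pi * \<bar>Im a\<bar>)"
proof (cases "z = 0")
  case False
  have "Re (a * Ln z) = Re a * ln (norm z) - Im a * Im (Ln z)" using False by simp
  also have "\<dots> \<le> Re a * ln C + pi * \<bar>Im a\<bar>"
  proof -
    have "0 < norm z" using False by simp
    hence "ln (norm z) \<le> ln C" using assms(2) by (simp add: ln_mono)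
    hence "Re a * ln (norm z) \<le> Re a * ln C" using assms(1) by (intro mult_left_mono) auto
    moreover have "- (Im a * Im (Ln z)) \<le> \<bar>Im a\<bar> * \<bar>Im (Ln z)\<bar>" by (metis abs_ge_minus_self abs_mult)
    moreover have "\<bar>Im (Ln z)\<bar> \<le> pi" using mpi_less_Im_Ln[OF False] Im_Ln_le_pi[OF False] by simp
    ultimately show ?thesis using mult_left_mono[of "\<bar>Im (Ln z)\<bar>" pi "\<bar>Im a\<bar>"] by (simp add: mult.commute)
  qed
  finally have "exp (Re (a * Ln z)) \<le> exp (Re a * ln C + pi * \<bar>Im a\<bar>)" by simp
  moreover have "C > 0" using assms(2) False by (meson less_le_trans zero_less_norm_iff)
  ultimately show ?thesis using False by (simp add: powr_def exp_add)
qed simp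

lemma Ibase_cong:
  assumes "\<And>l. l < m \<Longrightarrow> y l = y' l" "k < m" shows "Ibase m y b \<beta> k p = Ibase m y' b \<beta> k p"
proof -
  have "wbase m y b \<beta> = wbase m y' b \<beta>" unfolding wbase_def[abs_def] using assms by (auto intro!: prod.cong)
  thus ?thesis using assms by (simp add: Ibase_def)
qed

lemma Ibase_locally_bounded:
  assumes k: "k < m" and Re: "\<And>l. l < m \<Longrightarrow> Re (\<beta> l) > 0" and \<rho>: "\<rho> > 0"
  obtains M where "\<forall>y. generic_base m y b \<longrightarrow> (\<forall>l<m. norm (y l - b) \<ge> \<rho>) \<longrightarrow> (\<forall>l<m. norm (y l - b) \<le> 1 / \<rho>) \<longrightarrow>
    norm (Ibase m y b \<beta> k p) \<le> M"
proof -
  have "compact (poly p ` cball b (1 / \<rho>))" by (intro compact_continuous_image continuous_intros) auto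
  then obtain P where P: "P > 0" "\<And>z. z \<in> cball b (1 / \<rho>) \<Longrightarrow> norm (poly p z) \<le> P"
    using compact_imp_bounded bounded_pos by (metis (no_types, lifting) image_eqI)
  define C where "C = 2 / \<rho> / \<rho>"
  define W where "W = (\<Prod>l<m. C powr Re (\<beta> l) * exp (pi * \<bar>Im (\<beta> l)\<bar>))"
  have W0: "W \<ge> 0" unfolding W_def by (intro prod_nonneg) auto
  show ?thesis
  proof (rule that[of "P * W * (1 / \<rho>)"])
    show "\<forall>y. generic_base m y b \<longrightarrow> (\<forall>l<m. norm (y l - b) \<ge> \<rho>) \<longrightarrow> (\<forall>l<m. norm (y l - b) \<le> 1 / \<rho>) \<longrightarrow>
      norm (Ibase m y b \<beta> k p) \<le> P * W * (1 / \<rho>)"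
    proof (intro allI impI)
    fix y assume gen: "generic_base m y b" and "\<forall>l<m. norm (y l - b) \<ge> \<rho>" and "\<forall>l<m. norm (y l - b) \<le> 1 / \<rho>"
    hence lo: "norm (y l - b) \<ge> \<rho>" and hi: "norm (y l - b) \<le> 1 / \<rho>" if "l < m" for l using that by auto
    have "norm (Ibase m y b \<beta> k p) \<le> P * W * norm (y k - b)"
    proof (rule has_contour_integral_bound_linepath[OF Ibase_integral[OF gen Re k]])
      show "0 \<le> P * W" using P W0 by simp
      fix u assume "u \<in> closed_segment b (y k)"
      then obtain s where s: "0 \<le> s" "s \<le> 1" "u = (1 - s) *\<^sub>R b + s *\<^sub>R y k" by (auto simp: closed_segment_def)
      have "u - b = of_real s * (y k - b)" using s(3) by (simp add: scaleR_conv_of_real algebra_simps)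
      hence "norm (u - b) = s * norm (y k - b)" using s by (simp add: norm_mult)
      also have "\<dots> \<le> 1 * norm (y k - b)" using s by (intro mult_right_mono) auto
      finally have ub: "norm (u - b) \<le> 1 / \<rho>" using hi[OF k] by simp
      hence "norm (poly p u) \<le> P" by (intro P) (simp add: dist_norm norm_minus_commute)
      moreover have "norm (wbase m y b \<beta> u) \<le> W"
        unfolding wbase_def W_def prod_norm[symmetric]
      proof (intro prod_mono conjI norm_ge_zero)
        fix l assume "l \<in> {..<m}"
        hence l: "l < m" by simp
        have "norm (u - y l) \<le> norm (u - b) + norm (y l - b)" using norm_triangle_ineq4[of "u - b" "y l - b"] by simp
        hence "norm (u - y l) \<le> 2 / \<rho>" using ub hi[OF l] by simp
        hence "norm (u - y l) / norm (b - y l) \<le> 2 / \<rho> / \<rho>"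
          using lo[OF l] \<rho> by (intro frac_le) (auto simp: norm_minus_commute)
        thus "norm (((u - y l) / (b - y l)) powr \<beta> l) \<le> C powr Re (\<beta> l) * exp (pi * \<bar>Im (\<beta> l)\<bar>)"
          unfolding C_def by (intro norm_powr_le Re l) (simp add: norm_divide)
      qed
      ultimately show "norm (poly p u * wbase m y b \<beta> u) \<le> P * W"
        unfolding norm_mult using P by (intro mult_mono) auto
    qed
    also have "\<dots> \<le> P * W * (1 / \<rho>)" using hi[OF k] P W0 by (intro mult_left_mono) auto
    finally show "norm (Ibase m y b \<beta> k p) \<le> P * W * (1 / \<rho>)" .
    qed
  qed
qed

section \<open>The base integrals over the unit interval and their derivatives along complex
  lines\<close>

lemma generic_ratio:
  assumes "generic_base m y b" "k < m" "l < m" "l \<noteq> k" "0 \<le> s"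
  shows "1 - complex_of_real s * ((y k - b) / (y l - b)) \<notin> \<real>\<^sub>\<le>\<^sub>0"
proof
  let ?r = "(y k - b) / (y l - b)"
  assume "1 - complex_of_real s * ?r \<in> \<real>\<^sub>\<le>\<^sub>0"
  then obtain t where t: "t \<le> 0" "1 - complex_of_real s * ?r = of_real t" by (auto elim!: nonpos_Reals_cases)
  have "s \<noteq> 0" using t by (auto simp: complex_eq_iff)
  moreover have "of_real s * ?r = of_real (1 - t)" using t(2) by (simp add: algebra_simps)
  ultimately have "?r = of_real ((1 - t) / s)" by (simp add: field_simps)
  thus False using assms unfolding generic_base_def by (metis Reals_of_real)
qed

context
  fixes m k :: nat and \<beta> :: "nat \<Rightarrow> complex" and b :: complex
  assumes k: "k < m" and Re\<beta>: "\<And>l. l < m \<Longrightarrow> Re (\<beta> l) > 0"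
begin

text \<open>The part of the weight on the segment that stays regular. In the parameter s the
  singular factor is (1 - s)^(beta_k), which does not depend on the points; this is what permits
  differentiation under the integral.\<close>

definition Efac :: "(nat \<Rightarrow> complex) \<Rightarrow> real \<Rightarrow> complex" where
  "Efac y s = exp (\<Sum>l\<in>{..<m}-{k}. \<beta> l * Ln (1 - of_real s * ((y k - b) / (y l - b))))"

lemma wbase_segment:
  assumes gen: "generic_base m y b" and s: "0 \<le> s"
  shows "wbase m y b \<beta> (b + of_real s * (y k - b)) = of_real (1 - s) powr \<beta> k * Efac y s"
proof -
  have f: "(b + of_real s * (y k - b) - y l) / (b - y l) = 1 - of_real s * ((y k - b) / (y l - b))" if "l < m" for l
  proof -
    have "y l - b \<noteq> 0" "b - y l \<noteq> 0" using gen that by (auto simp: generic_base_def)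
    thus ?thesis by (simp add: field_simps)
  qed
  have yk: "y k - b \<noteq> 0" using gen k by (auto simp: generic_base_def)
  have "wbase m y b \<beta> (b + of_real s * (y k - b)) = (\<Prod>l<m. (1 - of_real s * ((y k - b) / (y l - b))) powr \<beta> l)"
    unfolding wbase_def by (intro prod.cong) (auto simp: f)
  also have "\<dots> = (1 - of_real s * ((y k - b) / (y k - b))) powr \<beta> k * (\<Prod>l\<in>{..<m}-{k}. (1 - of_real s * ((y k - b) / (y l - b))) powr \<beta> l)"
    by (rule prod.remove) (use k in auto)
  also have "(\<Prod>l\<in>{..<m}-{k}. (1 - of_real s * ((y k - b) / (y l - b))) powr \<beta> l) = Efac y s"
    unfolding Efac_def exp_sum[OF finite_Diff[OF finite_lessThan]]
  proof (intro prod.cong refl)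
    fix l assume "l \<in> {..<m} - {k}"
    hence "1 - complex_of_real s * ((y k - b) / (y l - b)) \<noteq> 0" using generic_ratio[OF gen k _ _ s, of l] by auto
    thus "(1 - of_real s * ((y k - b) / (y l - b))) powr \<beta> l = exp (\<beta> l * Ln (1 - of_real s * ((y k - b) / (y l - b))))"
      by (simp add: powr_def)
  qed
  finally show ?thesis using yk by simp
qed

lemma Ibase_param:
  assumes gen: "generic_base m y b"
  shows "Ibase m y b \<beta> k p = integral {0..1} (\<lambda>s. (y k - b) * (poly p (b + of_real s * (y k - b)) * (of_real (1 - s) powr \<beta> k * Efac y s)))"
proof -
  have "Ibase m y b \<beta> k p = integral {0..1} (\<lambda>s. poly p (linepath b (y k) s) * wbase m y b \<beta> (linepath b (y k) s) * (y k - b))"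
    unfolding Ibase_def contour_integral_integral by simp
  also have "\<dots> = integral {0..1} (\<lambda>s. (y k - b) * (poly p (b + of_real s * (y k - b)) * (of_real (1 - s) powr \<beta> k * Efac y s)))"
  proof (rule integral_cong)
    fix s :: real assume s: "s \<in> {0..1}"
    have "linepath b (y k) s = b + of_real s * (y k - b)" by (simp add: linepath_def scaleR_conv_of_real algebra_simps)
    thus "poly p (linepath b (y k) s) * wbase m y b \<beta> (linepath b (y k) s) * (y k - b)
       = (y k - b) * (poly p (b + of_real s * (y k - b)) * (of_real (1 - s) powr \<beta> k * Efac y s))"
      using wbase_segment[OF gen, of s] s by simp
  qed
  finally show ?thesis .
qed

text \<open>The derivative of the parametrised integrand when the points move with velocity v. The
  three summands come from the length factor y k - b, from the polynomial and from
  \<open>Efac\<close>.\<close>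

definition dIb :: "(nat \<Rightarrow> complex) \<Rightarrow> (nat \<Rightarrow> complex) \<Rightarrow> complex poly \<Rightarrow> real \<Rightarrow> complex" where
  "dIb y v p s = of_real (1 - s) powr \<beta> k * Efac y s * (v k * poly p (b + of_real s * (y k - b))
     + (y k - b) * (poly (pderiv p) (b + of_real s * (y k - b)) * (of_real s * v k))
     + (y k - b) * poly p (b + of_real s * (y k - b)) *
        (\<Sum>l\<in>{..<m}-{k}. \<beta> l * (- (of_real s * ((v k * (y l - b) - (y k - b) * v l) / ((y l - b) * (y l - b)))) / (1 - of_real s * ((y k - b) / (y l - b))))))"

lemma Ibase_line_derivative_0:
  assumes gen: "generic_base m u b"
  shows "((\<lambda>z. Ibase m (\<lambda>l. u l + z * v l) b \<beta> k p) has_field_derivative integral {0..1} (dIb u v p)) (at 0)"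
proof -
  obtain \<rho> where \<rho>: "\<rho> > 0" "\<And>y. (\<forall>l<m. norm (y l - u l) < \<rho>) \<Longrightarrow> generic_base m y b"
    using generic_base_nbhd[OF gen] by metis
  define V where "V = 1 + (\<Sum>l<m. norm (v l))"
  have V: "V > 0" "\<And>l. l < m \<Longrightarrow> norm (v l) \<le> V"
  proof -
    show "V > 0" unfolding V_def by (intro add_pos_nonneg sum_nonneg) auto
    show "norm (v l) \<le> V" if "l < m" for l
      using member_le_sum[of l "{..<m}" "\<lambda>l. norm (v l)"] that by (simp add: V_def)
  qed
  define U where "U = ball (0::complex) (\<rho> / V)"
  have genU: "generic_base m (\<lambda>l. u l + z * v l) b" if z: "z \<in> U" for z
  proof (rule \<rho>(2), intro allI impI)
    fix l assume l: "l < m"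
    have "norm (z * v l) \<le> norm z * V" unfolding norm_mult using V(2)[OF l] by (intro mult_left_mono) auto
    also have "\<dots> < \<rho>" using z V(1) by (simp add: U_def field_simps)
    finally show "norm (u l + z * v l - u l) < \<rho>" by simp
  qed
  have ne: "u l + z * v l - b \<noteq> 0" if "l < m" "z \<in> U" for l z using genU[OF that(2)] that(1) by (auto simp: generic_base_def)
  have np: "1 - complex_of_real s * ((u k + z * v k - b) / (u l + z * v l - b)) \<notin> \<real>\<^sub>\<le>\<^sub>0"
    if "l \<in> {..<m} - {k}" "z \<in> U" "0 \<le> s" for l z s
    using generic_ratio[OF genU[OF that(2)] k _ _ that(3), of l] that(1) by simp
  have np0: "1 - complex_of_real s * ((u k + z * v k - b) / (u l + z * v l - b)) \<noteq> 0"
    if "l \<in> {..<m} - {k}" "z \<in> U" "0 \<le> s" for l z s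
  proof
    assume "1 - complex_of_real s * ((u k + z * v k - b) / (u l + z * v l - b)) = 0"
    with np[OF that] show False by (metis nonpos_Reals_zero_I)
  qed
  let ?y = "\<lambda>z l. u l + z * v l"
  let ?f = "\<lambda>z s. (?y z k - b) * (poly p (b + of_real s * (?y z k - b)) * (of_real (1 - s) powr \<beta> k * Efac (?y z) s))"
  have dlin: "((\<lambda>z. ?y z l - b) has_field_derivative v l) (at z)" for l z
    by (auto intro!: derivative_eq_intros)
  have dE: "((\<lambda>z. Efac (?y z) s) has_field_derivative Efac (?y z) s *
     (\<Sum>l\<in>{..<m}-{k}. \<beta> l * (- (of_real s * ((v k * (?y z l - b) - (?y z k - b) * v l) / ((?y z l - b) * (?y z l - b)))) / (1 - of_real s * ((?y z k - b) / (?y z l - b)))))) (at z)"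
    if z: "z \<in> U" and s: "s \<in> {0..1}" for z s
    unfolding Efac_def
  proof (rule DERIV_chain2[OF DERIV_exp], rule DERIV_sum, rule DERIV_cmult)
    fix l assume l: "l \<in> {..<m} - {k}"
    have "((\<lambda>z. (?y z k - b) / (?y z l - b)) has_field_derivative (v k * (?y z l - b) - (?y z k - b) * v l) / ((?y z l - b) * (?y z l - b))) (at z)"
      by (rule DERIV_divide[OF dlin dlin]) (use ne[of l z] l z in auto)
    hence "((\<lambda>z. 1 - of_real s * ((?y z k - b) / (?y z l - b))) has_field_derivative
       0 - of_real s * ((v k * (?y z l - b) - (?y z k - b) * v l) / ((?y z l - b) * (?y z l - b)))) (at z)"
      by (intro DERIV_diff DERIV_const DERIV_cmult)
    from DERIV_chain2[OF has_field_derivative_Ln[OF np[OF l z]] this] s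
    show "((\<lambda>z. Ln (1 - of_real s * ((?y z k - b) / (?y z l - b)))) has_field_derivative
       - (of_real s * ((v k * (?y z l - b) - (?y z k - b) * v l) / ((?y z l - b) * (?y z l - b)))) / (1 - of_real s * ((?y z k - b) / (?y z l - b)))) (at z)"
      by (simp add: divide_inverse mult.commute)
  qed
  have cY: "continuous_on (U \<times> cbox 0 1) (\<lambda>q. b + complex_of_real (snd q) * (?y (fst q) k - b))"
    by (intro continuous_intros)
  have cE: "continuous_on (U \<times> cbox 0 1) (\<lambda>q. Efac (?y (fst q)) (snd q))"
    unfolding Efac_def using np ne by (intro continuous_intros continuous_on_Ln) auto
  have cP: "continuous_on (U \<times> cbox 0 1) (\<lambda>q. complex_of_real (1 - snd q) powr \<beta> k)"
    using Re\<beta>[OF k] by (intro continuous_intros continuous_on_powr_complex) auto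
  have "((\<lambda>z. integral (cbox 0 1) (?f z)) has_field_derivative integral (cbox 0 1) (dIb (?y 0) v p)) (at 0 within U)"
  proof (rule leibniz_rule_field_derivative[where fx = "\<lambda>z. dIb (?y z) v p"])
    have eq: "v * (P * (\<kappa> * E)) + (P' * sv * (\<kappa> * E) + (\<kappa> * (E * S)) * P) * Y = \<kappa> * E * (v * P + Y * (P' * sv) + Y * P * S)"
      for v P \<kappa> E P' sv S Y :: complex by (simp add: algebra_simps)
    fix z s assume z: "z \<in> U" and s: "s \<in> cbox (0::real) 1"
    have s01: "s \<in> {0..1}" using s by simp
    have dp: "((\<lambda>z. poly p (b + of_real s * (?y z k - b))) has_field_derivative poly (pderiv p) (b + of_real s * (?y z k - b)) * (of_real s * v k)) (at z)"
      by (rule DERIV_chain2[OF poly_DERIV]) (auto intro!: derivative_eq_intros)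

    have "((\<lambda>z. ?f z s) has_field_derivative
       (v k * (poly p (b + of_real s * (?y z k - b)) * (of_real (1 - s) powr \<beta> k * Efac (?y z) s)) +
        (poly (pderiv p) (b + of_real s * (?y z k - b)) * (of_real s * v k) * (of_real (1 - s) powr \<beta> k * Efac (?y z) s)
         + (of_real (1 - s) powr \<beta> k * (Efac (?y z) s *
     (\<Sum>l\<in>{..<m}-{k}. \<beta> l * (- (of_real s * ((v k * (?y z l - b) - (?y z k - b) * v l) / ((?y z l - b) * (?y z l - b)))) / (1 - of_real s * ((?y z k - b) / (?y z l - b)))))))
           * poly p (b + of_real s * (?y z k - b))) * (?y z k - b))) (at z)"
      by (intro DERIV_mult dlin dp DERIV_cmult dE z s01)
    thus "((\<lambda>z. ?f z s) has_field_derivative dIb (?y z) v p s) (at z within U)"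
      unfolding dIb_def by (rule has_field_derivative_at_within[OF DERIV_cong]) (rule eq)
  next
    fix z assume z: "z \<in> U"
    have c: "continuous_on (cbox 0 1) (\<lambda>s. (z, s))" by (intro continuous_intros)
    have "continuous_on (U \<times> cbox 0 1) (\<lambda>q. ?f (fst q) (snd q))"
      by (intro continuous_intros cE cP)
    from continuous_on_compose2[OF this c] z show "?f z integrable_on cbox 0 1"
      by (intro integrable_continuous) auto
  next
    show "continuous_on (U \<times> cbox 0 1) (\<lambda>(z, s). dIb (?y z) v p s)"
      unfolding dIb_def case_prod_unfold using ne np0
      by (intro continuous_intros cE cP) auto
  qed (use V \<rho> in \<open>auto simp: U_def\<close>)
  hence "((\<lambda>z. integral {0..1} (?f z)) has_field_derivative integral {0..1} (dIb (?y 0) v p)) (at 0)"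
    using at_within_open[of 0 U] V \<rho> by (simp add: U_def)
  hence "((\<lambda>z. Ibase m (?y z) b \<beta> k p) has_field_derivative integral {0..1} (dIb (?y 0) v p)) (at 0)"
  proof (rule has_field_derivative_transform_within_open[of _ _ _ U])
    show "integral {0..1} (?f z) = Ibase m (?y z) b \<beta> k p" if "z \<in> U" for z by (rule Ibase_param[OF genU[OF that], symmetric])
  qed (use V \<rho> in \<open>auto simp: U_def\<close>)
  thus ?thesis by simp
qed

text \<open>Differentiability at z is the case of 0 for the line with shifted starting
  point.\<close>

lemma Ibase_line_differentiable:
  assumes gen: "generic_base m (\<lambda>l. u l + z * v l) b"
  shows "(\<lambda>z. Ibase m (\<lambda>l. u l + z * v l) b \<beta> k p) field_differentiable at z"
proof -
  have "((\<lambda>h. Ibase m (\<lambda>l. (u l + z * v l) + h * v l) b \<beta> k p) has_field_derivative integral {0..1} (dIb (\<lambda>l. u l + z * v l) v p)) (at 0)"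
    by (rule Ibase_line_derivative_0[OF gen])
  moreover have "(u l + z * v l) + h * v l = u l + (h + z) * v l" for h l by (simp add: algebra_simps)
  ultimately have "((\<lambda>h. Ibase m (\<lambda>l. u l + (h + z) * v l) b \<beta> k p) has_field_derivative integral {0..1} (dIb (\<lambda>l. u l + z * v l) v p)) (at 0)"
    by simp
  hence "((\<lambda>h. Ibase m (\<lambda>l. u l + h * v l) b \<beta> k p) has_field_derivative integral {0..1} (dIb (\<lambda>l. u l + z * v l) v p)) (at (0 + z))"
    by (subst DERIV_shift) simp
  thus ?thesis by (auto simp: field_differentiable_def)
qed

lemma Ibase_has_vector_derivative:
  assumes gen: "generic_base m (\<lambda>l. x l t) b" and x: "\<And>l. l < m \<Longrightarrow> (x l has_vector_derivative v l) (at t)"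
  shows "((\<lambda>s. Ibase m (\<lambda>l. x l s) b \<beta> k p) has_vector_derivative integral {0..1} (dIb (\<lambda>l. x l t) v p)) (at t)"
proof -
  obtain \<rho> where \<rho>: "\<rho> > 0" "\<And>y. (\<forall>l<m. norm (y l - x l t) < \<rho>) \<Longrightarrow> generic_base m y b"
    "\<And>y l. (\<forall>l<m. norm (y l - x l t) < \<rho>) \<Longrightarrow> l < m \<Longrightarrow> norm (y l - b) \<ge> \<rho>"
    "\<And>y l. (\<forall>l<m. norm (y l - x l t) < \<rho>) \<Longrightarrow> l < m \<Longrightarrow> norm (y l - b) \<le> 1 / \<rho>"
    by (rule generic_base_nbhd[OF gen]) blast
  obtain M where M: "\<forall>y. generic_base m y b \<longrightarrow> (\<forall>l<m. norm (y l - b) \<ge> \<rho>) \<longrightarrow> (\<forall>l<m. norm (y l - b) \<le> 1 / \<rho>) \<longrightarrow>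
    norm (Ibase m y b \<beta> k p) \<le> M"
    by (rule Ibase_locally_bounded[OF k Re\<beta> \<rho>(1), where b = b and p = p])
  show ?thesis
  proof (rule chain_rule_complex_lines[where m = m and x = x and t = t and v = v and M = M and J = "\<lambda>y. Ibase m y b \<beta> k p", OF \<rho>(1)])
    show "norm (Ibase m y b \<beta> k p) \<le> M" if "\<forall>l<m. norm (y l - x l t) < \<rho>" for y
      using M \<rho>(2-4)[OF that] by blast
    show "(\<lambda>z. Ibase m (\<lambda>l. u l + z * v l) b \<beta> k p) field_differentiable at z"
      if "\<forall>l<m. norm (u l + z * v l - x l t) < \<rho>" for u v z
      by (rule Ibase_line_differentiable) (rule \<rho>(2), rule that)
    show "((\<lambda>z. Ibase m (\<lambda>l. x l t + z * v l) b \<beta> k p) has_field_derivative integral {0..1} (dIb (\<lambda>l. x l t) v p)) (at 0)"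
      by (rule Ibase_line_derivative_0[OF gen])
    show "(x l has_vector_derivative v l) (at t)" if "l < m" for l by (rule x[OF that])
    show "Ibase m y b \<beta> k p = Ibase m y' b \<beta> k p" if "\<And>l. l < m \<Longrightarrow> y l = y' l" for y y'
      by (rule Ibase_cong[OF that k])
  qed
qed

text \<open>The weight vanishes at the end point of the segment, so moving the end point contributes only the
  integral of a total derivative along the segment.\<close>

lemma dIb_integral:
  assumes gen: "generic_base m u b"
  shows "integral {0..1} (dIb u v (Wpoly m u * \<psi>)) =
     - Ibase m u b \<beta> k (\<psi> * (\<Sum>l<m. smult (\<beta> l * v l) (Wdel m u l)))
     - (\<Sum>l<m. \<beta> l * v l / (u l - b)) * Ibase m u b \<beta> k (Wpoly m u * \<psi>)"
proof -
  define p where "p = Wpoly m u * \<psi>"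
  define d where "d = u k - b"
  define Y where "Y s = b + complex_of_real s * d" for s
  define \<kappa> where "\<kappa> s = complex_of_real (1 - s) powr \<beta> k" for s
  define r where "r l = d / (u l - b)" for l
  have ub: "u l - b \<noteq> 0" if "l < m" for l using gen that by (auto simp: generic_base_def)
  have d0: "d \<noteq> 0" using ub[OF k] by (simp add: d_def)
  have np: "1 - complex_of_real s * r l \<notin> \<real>\<^sub>\<le>\<^sub>0" if "l \<in> {..<m} - {k}" "0 \<le> s" for l s
    using generic_ratio[OF gen k _ _ that(2), of l] that(1) by (simp add: r_def d_def)
  have np0: "1 - complex_of_real s * r l \<noteq> 0" if "l \<in> {..<m} - {k}" "0 \<le> s" for l s
  proof
    assume "1 - complex_of_real s * r l = 0"
    with np[OF that] show False by (metis nonpos_Reals_zero_I)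
  qed
  let ?E = "\<lambda>s. Efac u s"
  let ?f0 = "\<lambda>s. poly p (Y s) * (\<kappa> s * ?E s)"
  let ?S = "\<lambda>s. (\<Sum>l\<in>{..<m}-{k}. \<beta> l * (- r l / (1 - of_real s * r l)))"
  have dE: "(?E has_vector_derivative ?E s * ?S s) (at s)" if s: "0 \<le> s" for s
  proof -
    have "((\<lambda>z. exp (\<Sum>l\<in>{..<m}-{k}. \<beta> l * Ln (1 - z * r l))) has_field_derivative
        exp (\<Sum>l\<in>{..<m}-{k}. \<beta> l * Ln (1 - of_real s * r l)) * ?S s) (at (of_real s))"
    proof (rule DERIV_chain2[OF DERIV_exp], rule DERIV_sum, rule DERIV_cmult)
      fix l assume l: "l \<in> {..<m} - {k}"
      have "((\<lambda>z. 1 - z * r l) has_field_derivative - r l) (at (of_real s))" by (auto intro!: derivative_eq_intros)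
      from DERIV_chain2[OF has_field_derivative_Ln[OF np[OF l s]] this]
      show "((\<lambda>z. Ln (1 - z * r l)) has_field_derivative - r l / (1 - of_real s * r l)) (at (of_real s))"
        by (simp add: divide_inverse mult.commute)
    qed
    from has_vector_derivative_real_field[OF this] show ?thesis by (simp add: Efac_def[abs_def] r_def d_def)
  qed
  have d\<kappa>: "(\<kappa> has_vector_derivative - (\<beta> k * \<kappa> s / of_real (1 - s))) (at s)" if s: "0 < s" "s < 1" for s
  proof -
    have "((\<lambda>z. (1 - z) powr \<beta> k) has_field_derivative (\<beta> k * (1 - of_real s) powr (\<beta> k - 1)) * (0 - 1)) (at (of_real s))"
      using s by (intro DERIV_chain2[OF has_field_derivative_powr]) (auto intro!: derivative_eq_intros simp: complex_nonpos_Reals_iff)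
    moreover have "(1 - complex_of_real s) powr (\<beta> k - 1) = (1 - of_real s) powr \<beta> k / (1 - of_real s)"
      using s by (simp add: powr_def left_diff_distrib exp_diff)
    ultimately have "((\<lambda>z. (1 - z) powr \<beta> k) has_field_derivative - (\<beta> k * \<kappa> s / of_real (1 - s))) (at (of_real s))"
      by (simp add: \<kappa>_def)
    from has_vector_derivative_real_field[OF this] show ?thesis by (simp add: \<kappa>_def[abs_def])
  qed
  have dY: "(Y has_vector_derivative d) (at s)" for s
    unfolding Y_def by (auto intro!: has_vector_derivative_real_field derivative_eq_intros)
  \<comment> \<open>Moving x_k with velocity v_k moves Y s by s v_k, that is, by a multiple of s
    Y'(s). The effect of stretching the segment is therefore v_k times the derivative of s
    f0(s).\<close>
  have df0: "((\<lambda>s. of_real s * ?f0 s) has_vector_derivative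
      ?f0 s + of_real s * (poly p (Y s) * (\<kappa> s * (?E s * ?S s) + - (\<beta> k * \<kappa> s / of_real (1 - s)) * ?E s) + poly (pderiv p) (Y s) * d * (\<kappa> s * ?E s))) (at s)"
    if s: "0 < s" "s < 1" for s
  proof -
    have "((\<lambda>s. complex_of_real s) has_vector_derivative 1) (at s)" by (auto intro!: has_vector_derivative_real_field derivative_eq_intros)
    moreover have "(?f0 has_vector_derivative poly p (Y s) * (\<kappa> s * (?E s * ?S s) + - (\<beta> k * \<kappa> s / of_real (1 - s)) * ?E s) + poly (pderiv p) (Y s) * d * (\<kappa> s * ?E s)) (at s)"
      using s by (intro has_vector_derivative_mult dE d\<kappa> has_vector_derivative_const_field_comp[OF dY poly_DERIV]) auto
    ultimately show ?thesis by (rule has_vector_derivative_eq_rhs[OF has_vector_derivative_mult]) simp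
  qed
  have wY: "\<kappa> s * ?E s = wbase m u b \<beta> (Y s)" if "0 \<le> s" for s
    using wbase_segment[OF gen that] by (simp add: \<kappa>_def Y_def d_def)
  have f0c: "continuous_on {0..1} (\<lambda>s. of_real s * ?f0 s)"
  proof -
    have "Y s \<in> closed_segment b (u k)" if "s \<in> {0..1}" for s
      using that unfolding closed_segment_def
      by (intro CollectI exI[of _ s]) (simp add: Y_def d_def scaleR_conv_of_real algebra_simps)
    hence "continuous_on {0..1} (\<lambda>s. wbase m u b \<beta> (Y s))"
      by (intro continuous_on_compose2[OF wbase_continuous_segment[OF gen Re\<beta> k]])
         (auto simp: Y_def intro!: continuous_intros)
    hence "continuous_on {0..1} (\<lambda>s. of_real s * (poly p (Y s) * wbase m u b \<beta> (Y s)))"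
      by (intro continuous_intros) (auto simp: Y_def intro!: continuous_intros)
    thus ?thesis by (rule continuous_on_eq) (simp add: wY)
  qed
  have "((\<lambda>s. ?f0 s + of_real s * (poly p (Y s) * (\<kappa> s * (?E s * ?S s) + - (\<beta> k * \<kappa> s / of_real (1 - s)) * ?E s) + poly (pderiv p) (Y s) * d * (\<kappa> s * ?E s)))
     has_integral of_real 1 * ?f0 1 - of_real 0 * ?f0 0) {0..1}"
    by (rule fundamental_theorem_of_calculus_interior[OF _ f0c df0]) auto
  \<comment> \<open>Both boundary values vanish: at 0 through the factor s, at 1 because
    \<open>0 powr \<beta> k\<close> is 0.\<close>
  hence tot: "((\<lambda>s. ?f0 s + of_real s * (poly p (Y s) * (\<kappa> s * (?E s * ?S s) + - (\<beta> k * \<kappa> s / of_real (1 - s)) * ?E s) + poly (pderiv p) (Y s) * d * (\<kappa> s * ?E s)))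
     has_integral 0) {0..1}" by (simp add: \<kappa>_def)
  define Q where "Q = \<psi> * (\<Sum>l<m. smult (\<beta> l * v l) (Wdel m u l))"
  \<comment> \<open>Minus the logarithmic derivative of the factor by which \<open>wbase\<close> is
    normalised at b.\<close>
  define c where "c = (\<Sum>l<m. \<beta> l * v l / (u l - b))"
  have Ib: "((\<lambda>s. poly q (Y s) * wbase m u b \<beta> (Y s) * d) has_integral Ibase m u b \<beta> k q) {0..1}" for q
  proof -
    have "linepath b (u k) s = Y s" for s by (simp add: linepath_def Y_def d_def scaleR_conv_of_real algebra_simps)
    thus ?thesis using Ibase_integral[OF gen Re\<beta> k, where p = q] by (simp add: has_contour_integral_linepath d_def)
  qed
  have "((\<lambda>s. v k * (?f0 s + of_real s * (poly p (Y s) * (\<kappa> s * (?E s * ?S s) + - (\<beta> k * \<kappa> s / of_real (1 - s)) * ?E s) + poly (pderiv p) (Y s) * d * (\<kappa> s * ?E s)))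
     + (- (poly Q (Y s) * wbase m u b \<beta> (Y s) * d) - c * (poly p (Y s) * wbase m u b \<beta> (Y s) * d))) has_integral
     v k * 0 + (- Ibase m u b \<beta> k Q - c * Ibase m u b \<beta> k p)) {0..1}"
    by (intro has_integral_add has_integral_mult_right tot has_integral_diff has_integral_neg Ib)
  hence "(dIb u v p has_integral v k * 0 + (- Ibase m u b \<beta> k Q - c * Ibase m u b \<beta> k p)) {0..1}"
  proof (rule has_integral_spike_finite[of "{0, 1}", rotated 2])
    fix s :: real assume "s \<in> {0..1} - {0, 1}"
    hence s: "0 < s" "s < 1" by auto
    define L where "L = {..<m} - {k}"
    have s1: "1 - complex_of_real s \<noteq> 0" using s by (simp add: complex_eq_iff)
    have Yne: "Y s - u l \<noteq> 0" if l: "l < m" for l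
    proof -
      have "Y s \<notin> ray b (u l)" using segment_off_rays[OF gen k l] s by (simp add: Y_def d_def)
      thus ?thesis using ray_self by force
    qed
    have Qp: "poly Q (Y s) = poly p (Y s) * (\<Sum>l<m. \<beta> l * v l / (Y s - u l))"
    proof -
      have "poly p (Y s) * (\<beta> l * v l / (Y s - u l)) = poly \<psi> (Y s) * (\<beta> l * v l * poly (Wdel m u l) (Y s))" if l: "l < m" for l
      proof -
        have "poly p (Y s) = (Y s - u l) * (poly (Wdel m u l) (Y s) * poly \<psi> (Y s))" by (simp add: p_def Wpoly_Wdel[OF l] algebra_simps)
        moreover have "a * B * (c / a) = c * B" if "a \<noteq> 0" for a B c :: complex using that by simp
        ultimately show ?thesis using Yne[OF l] by simp
      qed
      hence "(\<Sum>l<m. poly \<psi> (Y s) * (\<beta> l * v l * poly (Wdel m u l) (Y s))) = (\<Sum>l<m. poly p (Y s) * (\<beta> l * v l / (Y s - u l)))"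
        by (intro sum.cong) auto
      thus ?thesis by (simp only: Q_def poly_mult poly_sum poly_smult sum_distrib_left)
    qed
    have t: "- (d * (1 / (Y s - u l) + 1 / (u l - b))) = r l * (of_real s * r l) / (1 - of_real s * r l)" if l: "l \<in> L" for l
    proof -
      have lm: "l < m" using l by (simp add: L_def)
      have e: "Y s - u l = - (u l - b) * (1 - of_real s * r l)" using ub[OF lm] by (simp add: Y_def r_def field_simps)
      define a where "a = u l - b"
      define q where "q = 1 - complex_of_real s * r l"
      have a: "a \<noteq> 0" "q \<noteq> 0" using ub[OF lm] np0[of l s] l s by (auto simp: a_def q_def L_def)
      have sr: "of_real s * r l = 1 - q" by (simp add: q_def)
      have "- (d * (1 / (- a * q) + 1 / a)) = (d / a) * (1 - q) / q" using a by (simp add: field_simps)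
      thus ?thesis unfolding e a_def[symmetric] q_def[symmetric] sr by (simp add: r_def a_def)
    qed
    have tk: "- (d * (1 / (Y s - u k) + 1 / (u k - b))) = of_real s / of_real (1 - s)"
    proof -
      define q where "q = 1 - complex_of_real s"
      have e: "Y s - u k = - d * q" "complex_of_real s = 1 - q" "of_real (1 - s) = q" by (auto simp: Y_def d_def q_def algebra_simps)
      have "- (d * (1 / (- d * q) + 1 / d)) = (1 - q) / q" using d0 s1 by (simp add: q_def[symmetric] field_simps)
      thus ?thesis unfolding e d_def[symmetric] .
    qed
    have "- (d * (\<Sum>l<m. \<beta> l * v l / (Y s - u l))) - d * c = (\<Sum>l<m. \<beta> l * v l * - (d * (1 / (Y s - u l) + 1 / (u l - b))))"
    proof -
      have "(\<Sum>l<m. \<beta> l * v l * - (d * (1 / (Y s - u l) + 1 / (u l - b))))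
        = (\<Sum>l<m. - (d * (\<beta> l * v l / (Y s - u l))) - d * (\<beta> l * v l / (u l - b)))"
        by (intro sum.cong) (auto simp: algebra_simps)
      thus ?thesis unfolding c_def by (simp only: sum_subtractf sum_negf sum_distrib_left)
    qed
    also have "\<dots> = \<beta> k * v k * - (d * (1 / (Y s - u k) + 1 / (u k - b))) + (\<Sum>l\<in>L. \<beta> l * v l * - (d * (1 / (Y s - u l) + 1 / (u l - b))))"
      unfolding L_def by (rule sum.remove) (use k in auto)
    also have "(\<Sum>l\<in>L. \<beta> l * v l * - (d * (1 / (Y s - u l) + 1 / (u l - b)))) = (\<Sum>l\<in>L. \<beta> l * v l * (r l * (of_real s * r l) / (1 - of_real s * r l)))"
      by (intro sum.cong refl) (simp only: t)
    finally have sums: "- (d * (\<Sum>l<m. \<beta> l * v l / (Y s - u l))) - d * c =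
       \<beta> k * v k * (of_real s / of_real (1 - s)) + (\<Sum>l\<in>L. \<beta> l * v l * (r l * (of_real s * r l) / (1 - of_real s * r l)))"
      unfolding tk .
    \<comment> \<open>The derivative of r_l = d / (u_l - b) has a part due to x_k, which belongs to
      the total derivative, and a part due to x_l, which is matched with the right side of
      \<open>sums\<close>.\<close>
    have dr: "d * (\<Sum>l\<in>L. \<beta> l * (- (of_real s * ((v k * (u l - b) - d * v l) / ((u l - b) * (u l - b)))) / (1 - of_real s * r l)))
       = v k * of_real s * ?S s + (\<Sum>l\<in>L. \<beta> l * v l * (r l * (of_real s * r l) / (1 - of_real s * r l)))"
      unfolding L_def[symmetric] sum_distrib_left sum.distrib[symmetric]
    proof (intro sum.cong refl)
      fix l assume l: "l \<in> L"
      hence lm: "l < m" by (simp add: L_def)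
      define q where "q = 1 - complex_of_real s * r l"
      have q: "q \<noteq> 0" using np0[of l s] l s by (auto simp: q_def L_def)
      have "d * ((v k * (u l - b) - d * v l) / ((u l - b) * (u l - b))) = v k * r l - r l * r l * v l"
      proof -
        define a where "a = u l - b"
        have "a \<noteq> 0" using ub[OF lm] by (simp add: a_def)
        thus ?thesis unfolding r_def a_def[symmetric] by (simp add: field_simps)
      qed
      moreover have "d * (\<beta> l * (- (of_real s * X) / q)) = \<beta> l * (- (of_real s * (d * X)) / q)" for X
        by simp
      ultimately have "d * (\<beta> l * (- (of_real s * ((v k * (u l - b) - d * v l) / ((u l - b) * (u l - b)))) / q))
         = \<beta> l * (- (of_real s * (v k * r l - r l * r l * v l)) / q)" by (simp only:)
      also have "\<dots> = v k * of_real s * (\<beta> l * (- r l / q)) + \<beta> l * v l * (r l * (of_real s * r l) / q)"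
        using q by (simp add: field_simps)
      finally show "d * (\<beta> l * (- (of_real s * ((v k * (u l - b) - d * v l) / ((u l - b) * (u l - b)))) / (1 - of_real s * r l)))
         = v k * of_real s * (\<beta> l * (- r l / (1 - of_real s * r l))) + \<beta> l * v l * (r l * (of_real s * r l) / (1 - of_real s * r l))"
        by (simp only: q_def)
    qed
    define w where "w = \<kappa> s * ?E s"
    have "dIb u v p s = w * (v k * poly p (Y s) + d * (poly (pderiv p) (Y s) * (of_real s * v k))
        + poly p (Y s) * (d * (\<Sum>l\<in>L. \<beta> l * (- (of_real s * ((v k * (u l - b) - d * v l) / ((u l - b) * (u l - b)))) / (1 - of_real s * r l)))))"
      unfolding dIb_def w_def \<kappa>_def Y_def d_def r_def L_def by (simp add: algebra_simps)
    also have "\<dots> = v k * (poly p (Y s) * w + of_real s * (poly p (Y s) * (w * ?S s + - (\<beta> k / of_real (1 - s)) * w) + poly (pderiv p) (Y s) * d * w))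
       + w * poly p (Y s) * (- (d * (\<Sum>l<m. \<beta> l * v l / (Y s - u l))) - d * c)"
      unfolding sums dr by (simp add: algebra_simps)
    also have "\<dots> = v k * (?f0 s + of_real s * (poly p (Y s) * (\<kappa> s * (?E s * ?S s) + - (\<beta> k * \<kappa> s / of_real (1 - s)) * ?E s) + poly (pderiv p) (Y s) * d * (\<kappa> s * ?E s)))
     + (- (poly Q (Y s) * w * d) - c * (poly p (Y s) * w * d))"
      unfolding Qp w_def by (simp add: algebra_simps)
    finally show "dIb u v p s = v k * (?f0 s + of_real s * (poly p (Y s) * (\<kappa> s * (?E s * ?S s) + - (\<beta> k * \<kappa> s / of_real (1 - s)) * ?E s) + poly (pderiv p) (Y s) * d * (\<kappa> s * ?E s)))
     + (- (poly Q (Y s) * wbase m u b \<beta> (Y s) * d) - c * (poly p (Y s) * wbase m u b \<beta> (Y s) * d))"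
      using wY[of s] s by (simp add: w_def)
  qed simp
  from integral_unique[OF this] show ?thesis unfolding p_def Q_def c_def by simp
qed

end

subsection \<open>The deformation formula\<close>

text \<open>b is sought on the parabola (s, s^2). Being on the line through two distinct points is
  then a nonzero polynomial equation in s of degree at most 2, so finitely many s are
  excluded.\<close>

lemma generic_base_exists:
  assumes "inj_on x {..<m}" obtains b where "generic_base m x b"
proof -
  define c where "c k l = [:Im (x l * cnj (x k)), - Im (x l - x k), Re (x l - x k):]" for k l
  define bad where "bad = Re ` x ` {..<m} \<union> (\<Union>q\<in>{q \<in> {..<m} \<times> {..<m}. fst q \<noteq> snd q}. {s. poly (c (fst q) (snd q)) s = 0})"
  have "finite {s. poly (c k l) s = 0}" if "k < m" "l < m" "k \<noteq> l" for k l
  proof -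
    have "x l - x k \<noteq> 0" using assms that by (auto simp: inj_on_def)
    hence "c k l \<noteq> 0" by (auto simp: c_def complex_eq_iff)
    thus ?thesis by (rule poly_roots_finite)
  qed
  hence "finite bad" unfolding bad_def by auto
  then obtain s where s: "s \<notin> bad" using ex_new_if_finite infinite_UNIV_char_0 by blast
  define b where "b = Complex s (s * s)"
  have "Im ((x l - b) * cnj (x k - b)) = poly (c k l) s" for k l
    by (simp add: c_def b_def algebra_simps)
  moreover have "poly (c k l) s \<noteq> 0" if "k < m" "l < m" "k \<noteq> l" for k l
  proof
    assume "poly (c k l) s = 0"
    hence "s \<in> bad" unfolding bad_def using that by (intro UnI2 UN_I[of "(k, l)"]) auto
    thus False using s by simp
  qed
  moreover have "x k \<noteq> b" if "k < m" for k
  proof -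
    have "Re (x k) \<noteq> s" using s that by (force simp: bad_def)
    thus ?thesis by (auto simp: b_def)
  qed
  ultimately have "generic_base m x b" unfolding generic_base_iff by simp
  thus thesis by (rule that)
qed

text \<open>A dual family, adjoining one functional at a time. Independence provides p on which F n
  differs from the combination predicted by the earlier functionals; subtracting the projection of p
  leaves a polynomial killed by these but not by F n.\<close>

lemma biorthogonal_polys:
  fixes n :: nat
  assumes F: "\<And>k. k < n \<Longrightarrow> plin (F k)"
    and ind: "\<And>A. (\<forall>p. (\<Sum>k<n. A k * F k p) = 0) \<Longrightarrow> (\<forall>k<n. A k = 0)"
  shows "\<exists>\<psi>. \<forall>j<n. \<forall>k<n. F k (\<psi> j) = (if j = k then 1 else 0)"
  using assms
proof (induction n)
  case (Suc n)
  have Fn: "plin (F n)" and Fk: "\<And>k. k < n \<Longrightarrow> plin (F k)" using Suc.prems(1) by auto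
  have "\<exists>\<psi>. \<forall>j<n. \<forall>k<n. F k (\<psi> j) = (if j = k then 1 else 0)"
  proof (rule Suc.IH[OF Fk])
    fix A assume A: "\<forall>p. (\<Sum>k<n. A k * F k p) = 0"
    have "(\<Sum>k<n. (A(n := 0)) k * F k p) = (\<Sum>k<n. A k * F k p)" for p by (intro sum.cong) auto
    hence "\<forall>p. (\<Sum>k<Suc n. (A(n := 0)) k * F k p) = 0" using A by simp
    from Suc.prems(2)[OF this] have h: "\<forall>k<Suc n. (A(n := 0)) k = 0" .
    show "\<forall>k<n. A k = 0"
    proof (intro allI impI)
      fix k assume "k < n"
      thus "A k = 0" using h[rule_format, of k] by simp
    qed
  qed
  then obtain \<psi> where \<psi>: "\<And>j k. j < n \<Longrightarrow> k < n \<Longrightarrow> F k (\<psi> j) = (if j = k then 1 else 0)" by blast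
  define A where "A = (\<lambda>k. if k = n then 1 else - F n (\<psi> k))"
  have "\<not> (\<forall>p. (\<Sum>k<Suc n. A k * F k p) = 0)"
  proof
    assume "\<forall>p. (\<Sum>k<Suc n. A k * F k p) = 0"
    from Suc.prems(2)[OF this] have "A n = 0" by simp
    thus False by (simp add: A_def)
  qed
  then obtain p where p: "(\<Sum>k<Suc n. A k * F k p) \<noteq> 0" by blast
  define q where "q = p - (\<Sum>j<n. smult (F j p) (\<psi> j))"
  have q0: "F k q = 0" if k: "k < n" for k
  proof -
    have "(\<Sum>j<n. F j p * F k (\<psi> j)) = (\<Sum>j<n. if j = k then F j p else 0)"
      using k by (intro sum.cong) (auto simp: \<psi>)
    thus ?thesis unfolding q_def plin_simps[OF Fk[OF k]] using k by simp
  qed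
  have "F n q = F n p + (\<Sum>k<n. A k * F k p)"
    unfolding q_def plin_simps[OF Fn] by (simp add: A_def sum_negf mult.commute)
  also have "\<dots> = (\<Sum>k<Suc n. A k * F k p)" by (simp add: A_def)
  finally have qn: "F n q \<noteq> 0" using p by simp
  define e where "e = smult (1 / F n q) q"
  have e: "F k e = 0" if "k < n" for k using q0[OF that] by (simp add: e_def plin_smult[OF Fk[OF that]])
  have en: "F n e = 1" using qn by (simp add: e_def plin_smult[OF Fn])
  define \<phi> where "\<phi> j = (if j = n then e else \<psi> j - smult (F n (\<psi> j)) e)" for j
  have "F k (\<phi> j) = (if j = k then 1 else 0)" if jk: "j < Suc n" "k < Suc n" for j k
  proof -
    have Fp: "plin (F k)" using Suc.prems(1)[OF jk(2)] .
    consider "j = n" "k = n" | "j = n" "k < n" | "j < n" "k = n" | "j < n" "k < n" using jk by linarith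
    thus ?thesis
      by cases (use e en \<psi> in \<open>simp_all add: \<phi>_def plin_simps[OF Fp] plin_simps[OF Fn]\<close>)
  qed
  thus ?case by blast
qed simp

text \<open>Stability of a linear system near the identity matrix. With S the total error of the
  coefficients, R the residual and E the deviation of the matrix, S is at most R + E S, hence at
  most 2R once E < 1/2.\<close>

lemma coefficients_tendsto:
  fixes a :: "nat \<Rightarrow> 'a \<Rightarrow> complex" and M :: "nat \<Rightarrow> nat \<Rightarrow> 'a \<Rightarrow> complex"
  assumes M: "\<And>j k. j < m \<Longrightarrow> k < m \<Longrightarrow> (M j k \<longlongrightarrow> (if j = k then 1 else 0)) F"
    and s: "\<And>j. j < m \<Longrightarrow> ((\<lambda>t. \<Sum>k<m. a k t * M j k t) \<longlongrightarrow> c j) F" and i: "i < m"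
  shows "(a i \<longlongrightarrow> c i) F"
proof -
  define \<delta> where "\<delta> j k = (if j = k then 1 else 0 :: complex)" for j k :: nat
  define r where "r j t = (\<Sum>k<m. a k t * M j k t) - (\<Sum>k<m. c k * M j k t)" for j t
  define E where "E t = (\<Sum>j<m. \<Sum>k<m. norm (M j k t - \<delta> j k))" for t
  define R where "R t = (\<Sum>j<m. norm (r j t))" for t
  define S where "S t = (\<Sum>j<m. norm (a j t - c j))" for t
  have r0: "(r j \<longlongrightarrow> 0) F" if j: "j < m" for j
  proof -
    have "(r j \<longlongrightarrow> c j - (\<Sum>k<m. c k * \<delta> j k)) F"
      unfolding r_def[abs_def] \<delta>_def by (intro tendsto_diff s tendsto_sum tendsto_mult tendsto_const M j) auto
    moreover have "(\<Sum>k<m. c k * \<delta> j k) = (\<Sum>k<m. if k = j then c k else 0)" by (intro sum.cong) (auto simp: \<delta>_def)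
    ultimately show ?thesis using j by simp
  qed
  have R0: "(R \<longlongrightarrow> 0) F" unfolding R_def[abs_def] by (rule tendsto_null_sum) (auto intro!: tendsto_norm_zero r0)
  have E0: "(E \<longlongrightarrow> 0) F" unfolding E_def[abs_def]
  proof (intro tendsto_null_sum tendsto_norm_zero)
    fix j k assume jk: "j \<in> {..<m}" "k \<in> {..<m}"
    hence "(M j k \<longlongrightarrow> \<delta> j k) F" using M by (simp add: \<delta>_def)
    thus "((\<lambda>t. M j k t - \<delta> j k) \<longlongrightarrow> 0) F" using LIM_zero by blast
  qed
  have SR: "S t \<le> 2 * R t" if Et: "E t < 1/2" for t
  proof -
    have "norm (a j t - c j) \<le> norm (r j t) + (\<Sum>k<m. norm (M j k t - \<delta> j k)) * S t" if j: "j < m" for j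
    proof -
      have "(\<Sum>k<m. (a k t - c k) * \<delta> j k) = (\<Sum>k<m. if k = j then a k t - c k else 0)" by (intro sum.cong) (auto simp: \<delta>_def)
      also have "\<dots> = a j t - c j" using j by simp
      finally have "a j t - c j = r j t - (\<Sum>k<m. (a k t - c k) * (M j k t - \<delta> j k))"
        unfolding r_def by (simp add: algebra_simps sum_subtractf sum.distrib)
      hence "norm (a j t - c j) \<le> norm (r j t) + norm (\<Sum>k<m. (a k t - c k) * (M j k t - \<delta> j k))" by (simp only: norm_triangle_ineq4)
      also have "norm (\<Sum>k<m. (a k t - c k) * (M j k t - \<delta> j k)) \<le> (\<Sum>k<m. norm (M j k t - \<delta> j k) * S t)"
      proof (rule sum_norm_le)
        fix k assume k: "k \<in> {..<m}"
        have "norm (a k t - c k) \<le> S t" unfolding S_def by (rule member_le_sum) (use k in auto)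
        thus "norm ((a k t - c k) * (M j k t - \<delta> j k)) \<le> norm (M j k t - \<delta> j k) * S t"
          unfolding norm_mult by (subst mult.commute) (intro mult_left_mono, auto)
      qed
      finally show ?thesis by (simp add: sum_distrib_right)
    qed
    hence "S t \<le> (\<Sum>j<m. norm (r j t) + (\<Sum>k<m. norm (M j k t - \<delta> j k)) * S t)" unfolding S_def[of t] by (intro sum_mono) simp
    also have "\<dots> = R t + E t * S t" by (simp add: R_def E_def sum.distrib sum_distrib_right)
    also have "E t * S t \<le> 1/2 * S t" using Et by (intro mult_right_mono) (auto simp: S_def sum_nonneg)
    finally show ?thesis by simp
  qed
  have "((\<lambda>t. a i t - c i) \<longlongrightarrow> 0) F"
  proof (rule Lim_null_comparison)
    have "((\<lambda>t. 2 * R t) \<longlongrightarrow> 2 * 0) F" by (intro tendsto_mult tendsto_const R0)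
    thus "((\<lambda>t. 2 * R t) \<longlongrightarrow> 0) F" by simp
    have "eventually (\<lambda>t. E t < 1/2) F" by (rule order_tendstoD(2)[OF E0]) simp
    thus "eventually (\<lambda>t. norm (a i t - c i) \<le> 2 * R t) F"
    proof eventually_elim
      case (elim t)
      have "norm (a i t - c i) \<le> S t" unfolding S_def by (rule member_le_sum) (use i in auto)
      thus ?case using SR[OF elim] by simp
    qed
  qed
  thus ?thesis by (rule LIM_zero_cancel)
qed

section \<open>Derivatives of W, 2V and the Pearson operator with respect to the points\<close>

lemma has_pd_prod_linear:
  assumes "finite A" "\<And>k. k \<in> A \<Longrightarrow> (x k has_vector_derivative v k) (at t)"
  shows "has_pd (\<lambda>s. \<Prod>i\<in>A. [:- x i s, 1:]) (- (\<Sum>k\<in>A. smult (v k) (\<Prod>i\<in>A-{k}. [:- x i t, 1:]))) t"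
  using assms
proof (induction A rule: finite_induct)
  case empty
  thus ?case using has_pd_const[of 1 t] by simp
next
  case (insert l A)
  have l: "has_pd (\<lambda>s. [:- x l s, 1:]) [:- v l:] t"
    by (intro has_pd_linear has_vector_derivative_minus insert.prems) simp
  have A: "has_pd (\<lambda>s. \<Prod>i\<in>A. [:- x i s, 1:]) (- (\<Sum>k\<in>A. smult (v k) (\<Prod>i\<in>A-{k}. [:- x i t, 1:]))) t"
    using insert by blast
  have e: "(\<Prod>i\<in>insert l A-{k}. [:- x i t, 1:]) = [:- x l t, 1:] * (\<Prod>i\<in>A-{k}. [:- x i t, 1:])" if "k \<in> A" for k
  proof -
    have "insert l A - {k} = insert l (A - {k})" using that insert.hyps by auto
    thus ?thesis using insert.hyps by simp
  qed
  have "(\<Sum>k\<in>insert l A. smult (v k) (\<Prod>i\<in>insert l A-{k}. [:- x i t, 1:]))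
     = smult (v l) (\<Prod>i\<in>A. [:- x i t, 1:]) + (\<Sum>k\<in>A. [:- x l t, 1:] * smult (v k) (\<Prod>i\<in>A-{k}. [:- x i t, 1:]))"
  proof -
    have "insert l A - {l} = A" using insert.hyps by auto
    moreover have "(\<Sum>k\<in>A. smult (v k) (\<Prod>i\<in>insert l A-{k}. [:- x i t, 1:])) = (\<Sum>k\<in>A. [:- x l t, 1:] * smult (v k) (\<Prod>i\<in>A-{k}. [:- x i t, 1:]))"
      by (intro sum.cong refl) (simp only: e mult_smult_right)
    ultimately show ?thesis by (simp only: sum.insert[OF insert.hyps])
  qed
  hence eq: "- (\<Sum>k\<in>insert l A. smult (v k) (\<Prod>i\<in>insert l A-{k}. [:- x i t, 1:]))
     = [:- v l:] * (\<Prod>i\<in>A. [:- x i t, 1:]) + [:- x l t, 1:] * - (\<Sum>k\<in>A. smult (v k) (\<Prod>i\<in>A-{k}. [:- x i t, 1:]))"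
    by (simp only: sum_distrib_left[symmetric]) simp
  have "(\<Prod>i\<in>insert l A. [:- x i s, 1:]) = [:- x l s, 1:] * (\<Prod>i\<in>A. [:- x i s, 1:])" for s
    using insert.hyps by simp
  thus ?case using has_pd_mult[OF l A] unfolding eq by simp
qed

lemma has_pd_power:
  assumes "has_pd F F' t" "n \<ge> 1"
  shows "has_pd (\<lambda>s. F s ^ n) (smult (of_nat n) (F t ^ (n - 1) * F')) t"
  using assms(2)
proof (induction n rule: nat_induct_at_least)
  case (Suc n)
  have "F' * F t ^ n + F t * smult (of_nat n) (F t ^ (n - 1) * F') = smult (of_nat (Suc n)) (F t ^ (Suc n - 1) * F')"
  proof -
    have "F t ^ n = F t * F t ^ (n - 1)" using Suc.hyps by (cases n) auto
    thus ?thesis by (simp add: algebra_simps smult_add_left)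
  qed
  thus ?case using has_pd_mult[OF assms(1) Suc.IH] by simp
qed (use assms in simp)

lemma has_pd_Wpoly:
  assumes "\<And>k. k < m \<Longrightarrow> (x k has_vector_derivative v k) (at t)"
  shows "has_pd (\<lambda>s. Wpoly m (\<lambda>k. x k s)) (- (\<Sum>k<m. smult (v k) (Wdel m (\<lambda>k. x k t) k))) t"
  unfolding Wpoly_def Wdel_def by (rule has_pd_prod_linear) (use assms in auto)

lemma smult_sum_distrib: "smult c (\<Sum>i\<in>A. f i) = (\<Sum>i\<in>A. smult c (f i))"
  by (induction A rule: infinite_finite_induct) (auto simp: smult_add_right)

text \<open>Moving x_l removes the factor z - x_l from every W_k with k other than l. Their
  combination is 2V - alpha_l W_l divided by z - x_l, an exact division; the rest is an exchange of
  summations.\<close>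

lemma has_pd_V2poly:
  assumes v: "\<And>k. k < m \<Longrightarrow> (x k has_vector_derivative v k) (at t)"
  defines "X \<equiv> \<lambda>k. x k t"
  shows "has_pd (\<lambda>s. V2poly m \<alpha> (\<lambda>k. x k s))
     (- (\<Sum>k<m. smult (v k) (synthetic_div (V2poly m \<alpha> X - smult (\<alpha> k) (Wdel m X k)) (X k)))) t"
proof -
  define D where "D k l = (\<Prod>i\<in>{..<m}-{k}-{l}. [:- X i, 1:])" for k l
  have "has_pd (\<lambda>s. V2poly m \<alpha> (\<lambda>k. x k s)) (\<Sum>k<m. smult (\<alpha> k) (- (\<Sum>l\<in>{..<m}-{k}. smult (v l) (D k l)))) t"
    unfolding V2poly_def
  proof (rule has_pd_sum)
    fix k assume "k \<in> {..<m}"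
    have "has_pd (\<lambda>s. Wdel m (\<lambda>k. x k s) k) (- (\<Sum>l\<in>{..<m}-{k}. smult (v l) (D k l))) t"
      unfolding Wdel_def D_def X_def by (rule has_pd_prod_linear) (use v in auto)
    from has_pd_smult[OF has_vector_derivative_const this, of "\<alpha> k"]
    show "has_pd (\<lambda>s. smult (\<alpha> k) (Wdel m (\<lambda>k. x k s) k)) (smult (\<alpha> k) (- (\<Sum>l\<in>{..<m}-{k}. smult (v l) (D k l)))) t"
      by simp
  qed
  moreover have "synthetic_div (V2poly m \<alpha> X - smult (\<alpha> l) (Wdel m X l)) (X l) = (\<Sum>k\<in>{..<m}-{l}. smult (\<alpha> k) (D k l))"
    if l: "l < m" for l
  proof -
    have "V2poly m \<alpha> X = smult (\<alpha> l) (Wdel m X l) + (\<Sum>k\<in>{..<m}-{l}. smult (\<alpha> k) (Wdel m X k))"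
      unfolding V2poly_def by (rule sum.remove) (use l in auto)
    moreover have "Wdel m X k = [:- X l, 1:] * D k l" if "k \<in> {..<m} - {l}" for k
      unfolding Wdel_def D_def by (rule prod.remove) (use l that in auto)
    moreover from calculation(2)
    have "(\<Sum>k\<in>{..<m}-{l}. smult (\<alpha> k) (Wdel m X k)) = (\<Sum>k\<in>{..<m}-{l}. [:- X l, 1:] * smult (\<alpha> k) (D k l))"
      by (intro sum.cong refl) (simp only: mult_smult_right)
    ultimately have "V2poly m \<alpha> X - smult (\<alpha> l) (Wdel m X l) = (\<Sum>k\<in>{..<m}-{l}. [:- X l, 1:] * smult (\<alpha> k) (D k l))"
      by simp
    also have "\<dots> = [:- X l, 1:] * (\<Sum>k\<in>{..<m}-{l}. smult (\<alpha> k) (D k l))" by (simp only: sum_distrib_left)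
    finally show ?thesis by (simp only: synthetic_div_linear_mult)
  qed
  moreover have "(\<Sum>k<m. smult (\<alpha> k) (- (\<Sum>l\<in>{..<m}-{k}. smult (v l) (D k l))))
     = - (\<Sum>l<m. smult (v l) (\<Sum>k\<in>{..<m}-{l}. smult (\<alpha> k) (D k l)))"
  proof -
    have "(\<Sum>k<m. \<Sum>l\<in>{..<m}-{k}. smult (\<alpha> k * v l) (D k l)) = (\<Sum>l<m. \<Sum>k\<in>{..<m}-{l}. smult (\<alpha> k * v l) (D k l))"
    proof -
      have "(\<Sum>k<m. \<Sum>l\<in>{..<m}-{k}. smult (\<alpha> k * v l) (D k l)) = (\<Sum>(k, l)\<in>Sigma {..<m} (\<lambda>k. {..<m}-{k}). smult (\<alpha> k * v l) (D k l))"
        by (rule sum.Sigma) auto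
      also have "\<dots> = (\<Sum>(l, k)\<in>Sigma {..<m} (\<lambda>l. {..<m}-{l}). smult (\<alpha> k * v l) (D k l))"
        by (rule sum.reindex_bij_witness[of _ prod.swap prod.swap]) auto
      also have "\<dots> = (\<Sum>l<m. \<Sum>k\<in>{..<m}-{l}. smult (\<alpha> k * v l) (D k l))"
        by (rule sum.Sigma[symmetric]) auto
      finally show ?thesis .
    qed
    thus ?thesis by (simp add: smult_sum_distrib sum_negf mult.commute cong: sum.cong)
  qed
  moreover from calculation(2) have "(\<Sum>l<m. smult (v l) (synthetic_div (V2poly m \<alpha> X - smult (\<alpha> l) (Wdel m X l)) (X l)))
      = (\<Sum>l<m. smult (v l) (\<Sum>k\<in>{..<m}-{l}. smult (\<alpha> k) (D k l)))"
    by (intro sum.cong) auto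
  ultimately show ?thesis by (simp only:)
qed

lemma pderiv_sum: "pderiv (\<Sum>i\<in>A. f i) = (\<Sum>i\<in>A. pderiv (f i))"
  by (induction A rule: infinite_finite_induct) (auto simp: pderiv_add)

lemma has_pd_Dstar:
  assumes v: "\<And>k. k < m \<Longrightarrow> (x k has_vector_derivative v k) (at t)"
  defines "X \<equiv> \<lambda>k. x k t"
  shows "has_pd (\<lambda>s. Dstar m \<alpha> (\<lambda>k. x k s) \<phi>)
     (- (\<Sum>k<m. smult (v k) (pderiv (Wdel m X k * \<phi>) + synthetic_div (V2poly m \<alpha> X - smult (\<alpha> k) (Wdel m X k)) (X k) * \<phi>))) t"
proof -
  have W: "has_pd (\<lambda>s. Wpoly m (\<lambda>k. x k s) * \<phi>) (- (\<Sum>k<m. smult (v k) (Wdel m X k)) * \<phi>) t"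
    using has_pd_mult[OF has_pd_Wpoly[OF v] has_pd_const[of \<phi>]] unfolding X_def by simp
  have V: "has_pd (\<lambda>s. V2poly m \<alpha> (\<lambda>k. x k s) * \<phi>)
     (- (\<Sum>k<m. smult (v k) (synthetic_div (V2poly m \<alpha> X - smult (\<alpha> k) (Wdel m X k)) (X k))) * \<phi>) t"
    using has_pd_mult[OF has_pd_V2poly[OF v] has_pd_const[of \<phi>]] unfolding X_def by simp
  have "pderiv (- (\<Sum>k<m. smult (v k) (Wdel m X k)) * \<phi>)
      + - (\<Sum>k<m. smult (v k) (synthetic_div (V2poly m \<alpha> X - smult (\<alpha> k) (Wdel m X k)) (X k))) * \<phi>
     = - (\<Sum>k<m. smult (v k) (pderiv (Wdel m X k * \<phi>) + synthetic_div (V2poly m \<alpha> X - smult (\<alpha> k) (Wdel m X k)) (X k) * \<phi>))"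
    by (simp add: sum_distrib_right pderiv_minus pderiv_sum pderiv_smult smult_add_right sum.distrib)
  thus ?thesis using has_pd_add[OF has_pd_pderiv[OF W] V] unfolding Dstar_def by simp
qed

text \<open>The complement of a compact set is infinite, so values there determine a polynomial and
  the definite descriptions of Theta and Omega can be resolved.\<close>

lemma the_poly_off_compact:
  fixes S :: "complex set"
  assumes S: "compact S" and T: "\<And>z. z \<notin> S \<Longrightarrow> poly T z = g z"
  shows "(THE Q. \<forall>z. z \<notin> S \<longrightarrow> poly Q z = g z) = T"
proof (rule the_equality)
  fix Q assume Q: "\<forall>z. z \<notin> S \<longrightarrow> poly Q z = g z"
  have "infinite (- S)"
    using compact_imp_bounded[OF S] by (metis Compl_partition finite_imp_bounded bounded_Un not_bounded_UNIV)
  moreover have "- S \<subseteq> {z. poly (Q - T) z = 0}" using Q T by auto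
  ultimately have "Q - T = 0" using poly_roots_finite infinite_super by blast
  thus "Q = T" by simp
qed (use T in auto)

text \<open>A connected set of complex numbers with more than one point is uncountable.\<close>

lemma connected_countable_image_constant:
  fixes f :: "real \<Rightarrow> complex"
  assumes "connected J" "continuous_on J f" "countable K" "f ` J \<subseteq> K" "s \<in> J" "t \<in> J"
  shows "f s = f t"
proof (rule ccontr)
  assume "f s \<noteq> f t"
  hence "uncountable (f ` J)"
    using connected_uncountable[OF connected_continuous_image[OF assms(2,1)]] assms(5,6) by blast
  thus False using countable_subset[OF assms(4,3)] by simp
qed

text \<open>Supplies the hypotheses of \<open>deformation_functional\<close>: the action on the
  image of \<open>Dstar\<close> by differentiating the Pearson relation, and the action on multiples
  of W^(N+1) from the decomposition into base integrals.\<close>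

lemma deformation_formula:
  fixes L :: "real \<Rightarrow> complex poly \<Rightarrow> complex" and P :: "real \<Rightarrow> nat \<Rightarrow> complex poly"
    and x v :: "nat \<Rightarrow> real \<Rightarrow> complex" and \<alpha> :: "nat \<Rightarrow> complex"
  defines "X \<equiv> \<lambda>s k. x k s"
  assumes I: "open I" "t0 \<in> I" and P: "\<And>s. s \<in> I \<Longrightarrow> ofam (L s) (P s)"
    and a: "\<And>n s. n \<ge> 1 \<Longrightarrow> s \<in> I \<Longrightarrow> (\<lambda>s. acoef (P s) n) differentiable (at s)"
    and b: "\<And>n s. s \<in> I \<Longrightarrow> (\<lambda>s. bcoef (P s) n) differentiable (at s)"
    and inj: "\<And>s. s \<in> I \<Longrightarrow> inj_on (X s) {..<m}"
    and v: "\<And>k s. k < m \<Longrightarrow> s \<in> I \<Longrightarrow> (x k has_vector_derivative v k s) (at s)"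
    and \<alpha>: "\<And>k. k < m \<Longrightarrow> \<alpha> k \<notin> \<int>"
    and pearson: "\<And>s \<phi>. s \<in> I \<Longrightarrow> L s (Dstar m \<alpha> (X s) \<phi>) = 0"
    and decomp: "\<And>s b N. s \<in> I \<Longrightarrow> generic_base m (X s) b \<Longrightarrow> N \<ge> 1 \<Longrightarrow> (\<forall>k<m. Re (\<alpha> k + of_nat N) > 0) \<Longrightarrow>
       \<exists>A. (\<forall>k. A k \<in> phase_group m (\<lambda>k. \<alpha> k + of_nat N)) \<and>
         (\<forall>p. L s (Wpoly m (X s) ^ N * p) = omega m (X s) b (\<lambda>k. \<alpha> k + of_nat N) *
            (\<Sum>k<m. A k * Ibase m (X s) b (\<lambda>k. \<alpha> k + of_nat N) k p))"
  obtains Ld lam where "plin Ld"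
    "\<forall>j. ((\<lambda>s. normL (L s) (monom 1 j)) has_vector_derivative Ld (monom 1 j)) (at t0)"
    "\<forall>\<phi>. Ld \<phi> = lam * normL (L t0) \<phi> - (\<Sum>k<m. \<alpha> k * v k t0 * normL (L t0) (synthetic_div \<phi> (X t0 k)))
       + (\<Sum>k<m. poly \<phi> (X t0 k) * (v k t0 * ucoef m \<alpha> (X t0) (normL (L t0)) k / poly (Wdel m (X t0) k) (X t0 k)))"
proof -
  define L0 where "L0 s = normL (L s)" for s
  define W where "W s = Wpoly m (X s)" for s
  define W' where "W' s = (\<Sum>k<m. smult (v k s) (Wdel m (X s) k))" for s
  have L1: "L s 1 \<noteq> 0" if "s \<in> I" for s by (rule ofam_L1[OF P[OF that]])
  have lin0: "plin (L0 s)" if "s \<in> I" for s unfolding L0_def by (rule plin_normL[OF ofamD(1)[OF P[OF that]]])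
  have "\<exists>F. plin F \<and> (\<forall>j. F (monom 1 j) = vector_derivative (\<lambda>s. L0 s (monom 1 j)) (at s))" for s
    by (rule plin_of_moments[of "\<lambda>j. vector_derivative (\<lambda>s. L0 s (monom 1 j)) (at s)"]) blast
  then obtain dL where dL: "\<And>s. plin (dL s)" "\<And>s j. dL s (monom 1 j) = vector_derivative (\<lambda>s. L0 s (monom 1 j)) (at s)"
    by metis
  have mom: "((\<lambda>s. L0 s (monom 1 j)) has_vector_derivative dL s (monom 1 j)) (at s)" if s: "s \<in> I" for s j
  proof -
    have "(\<lambda>s. L0 s (monom 1 j)) differentiable (at s)" unfolding L0_def
      by (rule normalized_moments_differentiable[OF I(1) s P a b]) (use s in auto)
    thus ?thesis unfolding dL(2) by (simp only: vector_derivative_works)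
  qed
  have dF: "((\<lambda>s. L0 s (F s)) has_vector_derivative (L0 s F' + dL s (F s))) (at s)" if "has_pd F F' s" "s \<in> I" for F F' s
  proof (rule has_vector_derivative_functional[OF that(1) _ dL(1) mom[OF that(2)]])
    show "eventually (\<lambda>s. plin (L0 s)) (nhds s)"
      using eventually_nhds_in_open[OF I(1) that(2)] by eventually_elim (rule lin0)
  qed
  have dW: "has_pd W (- W' s) s" if "s \<in> I" for s
    unfolding W_def[abs_def] W'_def X_def by (rule has_pd_Wpoly) (use v that in auto)
  have pearson0: "L0 s (Dstar m \<alpha> (X s) \<phi>) = 0" if "s \<in> I" for s \<phi>
    using pearson[OF that] by (simp add: L0_def normL_def)
  \<comment> \<open>Otherwise the descent would make the normalised functional vanish at 1.\<close>
  have nondeg: "\<exists>\<psi>. L0 s (W s ^ M * \<psi>) \<noteq> 0" if s: "s \<in> I" for s M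
  proof (rule ccontr)
    assume "\<not> (\<exists>\<psi>. L0 s (W s ^ M * \<psi>) \<noteq> 0)"
    hence "L0 s (Wpoly m (X s) ^ M * \<psi>) = 0" for \<psi> by (simp add: W_def)
    from functional_zero_descent[OF lin0[OF s] inj[OF s] \<alpha> pearson0[OF s] this] have "L0 s 1 = 0" by blast
    thus False using L1[OF s] by (simp add: L0_def normL_def)
  qed
  have "\<forall>k. \<exists>n::nat. - Re (\<alpha> k) < real n" using reals_Archimedean2 by blast
  then obtain n0 :: "nat \<Rightarrow> nat" where n0: "\<And>k. - Re (\<alpha> k) < real (n0 k)" by metis
  define N where "N = Suc (\<Sum>k<m. n0 k)"
  have N1: "N \<ge> 1" by (simp add: N_def)
  define \<beta> where "\<beta> = (\<lambda>k. \<alpha> k + complex_of_nat N)"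
  have Re\<beta>: "Re (\<beta> k) > 0" if k: "k < m" for k
  proof -
    have "n0 k \<le> N" using member_le_sum[of k "{..<m}" n0] k by (simp add: N_def)
    hence "real (n0 k) \<le> real N" by (simp only: of_nat_le_iff)
    thus ?thesis using n0[of k] by (simp add: \<beta>_def)
  qed
  obtain b where gen0: "generic_base m (X t0) b" by (rule generic_base_exists[OF inj[OF I(2)]])
  obtain \<rho> where \<rho>: "\<rho> > 0" "\<And>y. (\<forall>l<m. norm (y l - X t0 l) < \<rho>) \<Longrightarrow> generic_base m y b"
    by (rule generic_base_nbhd[OF gen0]) blast
  have "eventually (\<lambda>s. \<forall>l\<in>{..<m}. norm (X s l - X t0 l) < \<rho>) (nhds t0)"
  proof (intro eventually_ball_finite ballI finite_lessThan)
    fix l assume "l \<in> {..<m}"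
    hence "l < m" by simp
    hence "isCont (x l) t0" by (rule has_vector_derivative_continuous[OF v[OF _ I(2)]])
    hence "eventually (\<lambda>s. dist (x l s) (x l t0) < \<rho>) (nhds t0)"
      using \<rho>(1) unfolding isCont_def tendsto_at_iff_tendsto_nhds by (rule tendstoD)
    thus "eventually (\<lambda>s. norm (X s l - X t0 l) < \<rho>) (nhds t0)" by (simp add: X_def dist_norm)
  qed
  hence "eventually (\<lambda>s. generic_base m (X s) b \<and> s \<in> I) (nhds t0)"
    using eventually_nhds_in_open[OF I] by eventually_elim (use \<rho>(2) in auto)
  then obtain \<delta> where \<delta>: "\<delta> > 0" "\<And>s. dist s t0 < \<delta> \<Longrightarrow> generic_base m (X s) b \<and> s \<in> I"
    unfolding eventually_nhds_metric by blast
  define J where "J = ball t0 \<delta>"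
  have J: "open J" "t0 \<in> J" using \<delta>(1) by (auto simp: J_def)
  have gen: "generic_base m (X s) b" and JI: "s \<in> I" if "s \<in> J" for s
    using that \<delta>(2)[of s] by (auto simp: J_def dist_commute)
  define Ib where "Ib k p s = Ibase m (X s) b \<beta> k p" for k p s
  have dIb: "((\<lambda>s. Ib k p s) has_vector_derivative integral {0..1} (dIb m k \<beta> b (X s) (\<lambda>l. v l s) p)) (at s)"
    if "k < m" "s \<in> J" for k p s
    using Ibase_has_vector_derivative[of k m \<beta> x s b "\<lambda>l. v l s" p, OF that(1) Re\<beta>] gen[OF that(2)] v[OF _ JI[OF that(2)]]
    unfolding Ib_def X_def by blast
  have "\<forall>s\<in>J. \<exists>A. (\<forall>k. A k \<in> phase_group m \<beta>) \<and> (\<forall>p. L s (W s ^ N * p) = omega m (X s) b \<beta> * (\<Sum>k<m. A k * Ib k p s))"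
    using decomp[OF JI gen N1] Re\<beta> unfolding \<beta>_def W_def Ib_def by simp
  then obtain A where A: "\<And>s k. s \<in> J \<Longrightarrow> A s k \<in> phase_group m \<beta>"
    "\<And>s p. s \<in> J \<Longrightarrow> L s (W s ^ N * p) = omega m (X s) b \<beta> * (\<Sum>k<m. A s k * Ib k p s)" by metis
  define c where "c k s = omega m (X s) b \<beta> / L s 1 * A s k" for k s
  define \<nu> where "\<nu> p s = L0 s (W s ^ N * p)" for p s
  have \<nu>: "\<nu> p s = (\<Sum>k<m. c k s * Ib k p s)" if "s \<in> J" for p s
    unfolding \<nu>_def L0_def normL_def A(2)[OF that] by (simp add: c_def sum_distrib_left sum_divide_distrib mult.assoc)
  have d\<nu>: "(\<nu> p has_vector_derivative (L0 s (smult (of_nat N) (W s ^ (N - 1) * (- W' s)) * p) + dL s (W s ^ N * p))) (at s)" if "s \<in> I" for p s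
  proof -
    have "has_pd (\<lambda>s. W s ^ N * p) (smult (of_nat N) (W s ^ (N - 1) * (- W' s)) * p) s"
      using has_pd_mult[OF has_pd_power[OF dW[OF that] N1] has_pd_const[of p]] by simp
    from dF[OF this that] show ?thesis unfolding \<nu>_def .
  qed
  \<comment> \<open>The coefficients are chosen separately for each parameter. Continuity is forced:
    tested on polynomials dual to the base integrals at s, they satisfy a linear system that tends
    to the identity and has convergent right sides.\<close>
  have ccont: "isCont (c j) s" if s: "s \<in> J" and j: "j < m" for s j
  proof -
    have "\<exists>\<psi>. \<forall>j<m. \<forall>k<m. Ibase m (X s) b \<beta> k (\<psi> j) = (if j = k then 1 else 0)"
    proof (rule biorthogonal_polys)
      show "plin (Ibase m (X s) b \<beta> k)" if "k < m" for k by (rule plin_Ibase[OF gen[OF s] Re\<beta> that])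
      show "\<forall>k<m. B k = 0" if "\<forall>p. (\<Sum>k<m. B k * Ibase m (X s) b \<beta> k p) = 0" for B
        using Ibase_independent[where \<beta> = \<beta> and A = B, OF gen[OF s] Re\<beta>] that by blast
    qed
    then obtain \<psi> where \<psi>: "\<And>j k. j < m \<Longrightarrow> k < m \<Longrightarrow> Ib k (\<psi> j) s = (if j = k then 1 else 0)"
      unfolding Ib_def by blast
    have "(c j \<longlongrightarrow> c j s) (at s)"
    proof (rule coefficients_tendsto[where M = "\<lambda>j k. Ib k (\<psi> j)", OF _ _ j])
      fix j k assume jk: "j < m" "k < m"
      have "isCont (\<lambda>s. Ib k (\<psi> j) s) s" by (rule has_vector_derivative_continuous[OF dIb[OF jk(2) s]])
      thus "(Ib k (\<psi> j) \<longlongrightarrow> (if j = k then 1 else 0)) (at s)" unfolding isCont_def \<psi>[OF jk] .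
    next
      fix j assume j: "j < m"
      have "isCont (\<nu> (\<psi> j)) s" by (rule has_vector_derivative_continuous[OF d\<nu>[OF JI[OF s]]])
      hence "(\<nu> (\<psi> j) \<longlongrightarrow> \<nu> (\<psi> j) s) (at s)" by (simp add: isCont_def)
      moreover have "\<nu> (\<psi> j) s = (\<Sum>k<m. if k = j then c k s else 0)"
        unfolding \<nu>[OF s] using j by (intro sum.cong) (auto simp: \<psi>)
      moreover have "eventually (\<lambda>t. \<nu> (\<psi> j) t = (\<Sum>k<m. c k t * Ib k (\<psi> j) t)) (at s)"
        using eventually_nhds_in_open[OF J(1) s] unfolding eventually_at_filter by eventually_elim (simp add: \<nu>)
      ultimately show "((\<lambda>t. \<Sum>k<m. c k t * Ib k (\<psi> j) t) \<longlongrightarrow> c j s) (at s)"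
        using j Lim_transform_eventually by fastforce
    qed
    thus ?thesis by (simp add: isCont_def)
  qed
  \<comment> \<open>By \<open>nondeg\<close> some coefficient is nonzero at t0; it serves as the
    common denominator.\<close>
  obtain k0 where k0: "k0 < m" "c k0 t0 \<noteq> 0"
  proof -
    obtain \<psi> where "L0 t0 (W t0 ^ N * \<psi>) \<noteq> 0" using nondeg[OF I(2)] by blast
    hence "(\<Sum>k<m. c k t0 * Ib k \<psi> t0) \<noteq> 0" using \<nu>[OF J(2), of \<psi>] by (simp add: \<nu>_def)
    then obtain k where "k \<in> {..<m}" "c k t0 * Ib k \<psi> t0 \<noteq> 0" by (rule sum.not_neutral_contains_not_neutral)
    thus thesis using that by auto
  qed
  have "eventually (\<lambda>s. c k0 s \<noteq> 0) (nhds t0)"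
    using ccont[OF J(2) k0(1)] k0(2) unfolding isCont_def tendsto_at_iff_tendsto_nhds by (rule tendsto_imp_eventually_ne)
  hence "eventually (\<lambda>s. c k0 s \<noteq> 0 \<and> s \<in> J) (nhds t0)"
    using eventually_nhds_in_open[OF J] by (rule eventually_conj)
  then obtain \<delta>' where \<delta>': "\<delta>' > 0" "\<And>s. dist s t0 < \<delta>' \<Longrightarrow> c k0 s \<noteq> 0 \<and> s \<in> J"
    unfolding eventually_nhds_metric by blast
  define J' where "J' = ball t0 \<delta>'"
  have J': "open J'" "t0 \<in> J'" "connected J'" using \<delta>'(1) by (auto simp: J'_def)
  have JJ: "s \<in> J" and ck0: "c k0 s \<noteq> 0" if "s \<in> J'" for s
    using that \<delta>'(2)[of s] by (auto simp: J'_def dist_commute)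
  define r where "r k = c k t0 / c k0 t0" for k
  have ratio: "c k s = r k * c k0 s" if s: "s \<in> J'" and k: "k < m" for s k
  proof -
    \<comment> \<open>The factors \<open>omega\<close> and L s 1 cancel, so the ratio is a quotient
      of two elements of a countable group and, being continuous, is constant near t0.\<close>
    have "c k s / c k0 s = c k t0 / c k0 t0"
    proof (rule connected_countable_image_constant[OF J'(3) _ _ _ s J'(2)])
      show "continuous_on J' (\<lambda>s. c k s / c k0 s)"
      proof -
        have "continuous_on J' (c j)" if "j < m" for j
          using ccont[OF JJ that] by (intro continuous_at_imp_continuous_on) auto
        thus ?thesis using k k0 ck0 by (intro continuous_on_divide) auto
      qed
      show "countable ((\<lambda>(y, z). y / z) ` (phase_group m \<beta> \<times> phase_group m \<beta>))"
        by (intro countable_image countable_SIGMA countable_phase_group)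
      show "(\<lambda>s. c k s / c k0 s) ` J' \<subseteq> (\<lambda>(y, z). y / z) ` (phase_group m \<beta> \<times> phase_group m \<beta>)"
      proof
        fix y assume "y \<in> (\<lambda>s. c k s / c k0 s) ` J'"
        then obtain s where s: "s \<in> J'" "y = c k s / c k0 s" by blast
        have "y = A s k / A s k0" using s(2) L1[OF JI[OF JJ[OF s(1)]]] omega_nz[of m "X s" b \<beta>] by (simp add: c_def)
        thus "y \<in> (\<lambda>(y, z). y / z) ` (phase_group m \<beta> \<times> phase_group m \<beta>)" using A(1)[OF JJ[OF s(1)]] by force
      qed
    qed
    thus ?thesis using ck0[OF s] by (simp add: r_def field_simps)
  qed
  define \<sigma> where "\<sigma> = c k0"
  define G where "G p s = (\<Sum>k<m. r k * Ib k p s)" for p s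
  have \<nu>G: "\<nu> p s = \<sigma> s * G p s" if "s \<in> J'" for p s
    unfolding \<nu>[OF JJ[OF that]] G_def sum_distrib_left using ratio[OF that] by (intro sum.cong) (auto simp: \<sigma>_def)
  define G' where "G' p = (\<Sum>k<m. r k * integral {0..1} (dIb m k \<beta> b (X t0) (\<lambda>l. v l t0) p))" for p
  have dG: "(G p has_vector_derivative G' p) (at t0)" for p
    unfolding G_def[abs_def] G'_def
    by (intro has_vector_derivative_sum has_vector_derivative_mult_right dIb J(2)) auto
  define Q where "Q = (\<Sum>l<m. smult (\<beta> l * v l t0) (Wdel m (X t0) l))"
  define \<kappa> where "\<kappa> = (\<Sum>l<m. \<beta> l * v l t0 / (X t0 l - b))"
  have G'W: "G' (W t0 * \<psi>) = - G (\<psi> * Q) t0 - \<kappa> * G (W t0 * \<psi>) t0" for \<psi>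
  proof -
    have "G' (W t0 * \<psi>) = (\<Sum>k<m. r k * (- Ib k (\<psi> * Q) t0 - \<kappa> * Ib k (W t0 * \<psi>) t0))"
      unfolding G'_def W_def Ib_def Q_def \<kappa>_def using dIb_integral[OF _ Re\<beta> gen0] by (intro sum.cong) auto
    thus ?thesis unfolding G_def by (simp add: algebra_simps sum_subtractf sum_negf sum_distrib_left)
  qed
  have W_G: "L0 t0 (W t0 ^ N * p) = \<sigma> t0 * G p t0" for p using \<nu>G[OF J'(2), of p] by (simp add: \<nu>_def)
  have \<sigma>0: "\<sigma> t0 \<noteq> 0" using k0(2) by (simp add: \<sigma>_def)
  \<comment> \<open>Near t0 the factor is the quotient of \<open>\<nu> p\<close> and
    \<open>G p\<close> for a p with nonzero value; both are differentiable, the second because its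
    coefficients r are constants.\<close>
  obtain \<sigma>' where \<sigma>': "(\<sigma> has_vector_derivative \<sigma>') (at t0)"
  proof -
    obtain p where "L0 t0 (W t0 ^ N * p) \<noteq> 0" using nondeg[OF I(2)] by blast
    hence Gp: "G p t0 \<noteq> 0" unfolding W_G by simp
    have "(\<lambda>s. \<nu> p s / G p s) differentiable (at t0)"
      using d\<nu>[OF I(2), of p] dG[of p] Gp by (intro differentiable_divide) (auto intro: differentiableI_vector)
    then obtain D where D: "((\<lambda>s. \<nu> p s / G p s) has_vector_derivative D) (at t0)"
      using vector_derivative_works by blast
    have "isCont (G p) t0" by (rule has_vector_derivative_continuous[OF dG])
    hence "eventually (\<lambda>s. G p s \<noteq> 0) (nhds t0)"
      using Gp unfolding isCont_def tendsto_at_iff_tendsto_nhds by (rule tendsto_imp_eventually_ne)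
    hence "eventually (\<lambda>s. G p s \<noteq> 0 \<and> s \<in> J') (nhds t0)"
      using eventually_nhds_in_open[OF J'(1,2)] by (rule eventually_conj)
    then obtain S where S: "open S" "t0 \<in> S" "\<And>s. s \<in> S \<Longrightarrow> G p s \<noteq> 0 \<and> s \<in> J'" unfolding eventually_nhds by blast
    have "(\<sigma> has_vector_derivative D) (at t0)"
      by (rule has_vector_derivative_transform_within_open[OF D S(1,2)]) (use S(3) \<nu>G in auto)
    thus thesis by (rule that)
  qed
  define lam where "lam = \<sigma>' / \<sigma> t0 - \<kappa>"
  \<comment> \<open>The exponents alpha_k + N split Q in two. The part with N will cancel the
    derivative of the explicit power W^N in \<open>\<nu>\<close>, leaving only the original
    exponents.\<close>
  have Q: "Q = (\<Sum>k<m. smult (\<alpha> k * v k t0) (Wdel m (X t0) k)) + smult (of_nat N) (W' t0)"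
    unfolding Q_def W'_def \<beta>_def
    by (simp add: smult_sum_distrib sum.distrib[symmetric] smult_add_left[symmetric] distrib_right)
  note lt = plin_simps[OF lin0[OF I(2)]]
  have key: "dL t0 (Wpoly m (X t0) ^ Suc N * \<psi>) =
      lam * L0 t0 (Wpoly m (X t0) ^ Suc N * \<psi>) - L0 t0 (Wpoly m (X t0) ^ N * \<psi> * (\<Sum>k<m. smult (\<alpha> k * v k t0) (Wdel m (X t0) k)))" for \<psi>
  proof -
    define p where "p = W t0 * \<psi>"
    have "((\<lambda>s. \<sigma> s * G p s) has_vector_derivative (\<sigma> t0 * G' p + \<sigma>' * G p t0)) (at t0)"
      by (rule has_vector_derivative_mult[OF \<sigma>' dG])
    hence "(\<nu> p has_vector_derivative (\<sigma> t0 * G' p + \<sigma>' * G p t0)) (at t0)"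
      by (rule has_vector_derivative_transform_within_open[OF _ J'(1,2)]) (use \<nu>G in auto)
    from vector_derivative_unique_at[OF this d\<nu>[OF I(2)]]
    have "dL t0 (W t0 ^ N * p) = \<sigma> t0 * G' p + \<sigma>' * G p t0 - L0 t0 (smult (of_nat N) (W t0 ^ (N - 1) * (- W' t0)) * p)" by simp
    also have "\<sigma> t0 * G' p = - L0 t0 (W t0 ^ N * (\<psi> * Q)) - \<kappa> * L0 t0 (W t0 ^ N * p)"
      unfolding p_def G'W W_G by (simp add: algebra_simps)
    also have "\<sigma>' * G p t0 = \<sigma>' / \<sigma> t0 * L0 t0 (W t0 ^ N * p)" unfolding W_G using \<sigma>0 by simp
    also have "smult (of_nat N) (W t0 ^ (N - 1) * (- W' t0)) * p = - (W t0 ^ N * \<psi> * smult (of_nat N) (W' t0))"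
    proof -
      have "W t0 ^ N = W t0 ^ (N - 1) * W t0" using N1 by (cases N) auto
      thus ?thesis by (simp add: p_def algebra_simps)
    qed
    also have "W t0 ^ N * (\<psi> * Q) = W t0 ^ N * \<psi> * (\<Sum>k<m. smult (\<alpha> k * v k t0) (Wdel m (X t0) k)) + W t0 ^ N * \<psi> * smult (of_nat N) (W' t0)"
      unfolding Q by (simp only: distrib_left mult.assoc)
    also have "W t0 ^ N * p = W t0 ^ Suc N * \<psi>" by (simp add: p_def algebra_simps)
    finally show ?thesis unfolding lam_def W_def lt by (simp add: algebra_simps)
  qed
  have Dd: "dL t0 (Dstar m \<alpha> (X t0) \<phi>) =
        (\<Sum>k<m. v k t0 * L0 t0 (pderiv (Wdel m (X t0) k * \<phi>) + synthetic_div (V2poly m \<alpha> (X t0) - smult (\<alpha> k) (Wdel m (X t0) k)) (X t0 k) * \<phi>))"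
    (is "_ = ?R") for \<phi>
  proof -
    define D' where "D' = (\<Sum>k<m. smult (v k t0) (pderiv (Wdel m (X t0) k * \<phi>) + synthetic_div (V2poly m \<alpha> (X t0) - smult (\<alpha> k) (Wdel m (X t0) k)) (X t0 k) * \<phi>))"
    have "has_pd (\<lambda>s. Dstar m \<alpha> (X s) \<phi>) (- D') t0"
      unfolding X_def D'_def by (rule has_pd_Dstar) (use v I in auto)
    from dF[OF this I(2)]
    have "((\<lambda>s. L0 s (Dstar m \<alpha> (X s) \<phi>)) has_vector_derivative (L0 t0 (- D') + dL t0 (Dstar m \<alpha> (X t0) \<phi>))) (at t0)" .
    moreover have "((\<lambda>s. L0 s (Dstar m \<alpha> (X s) \<phi>)) has_vector_derivative 0) (at t0)"
      by (rule has_vector_derivative_transform_within_open[OF has_vector_derivative_const I]) (use pearson0 in auto)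
    ultimately have "L0 t0 (- D') + dL t0 (Dstar m \<alpha> (X t0) \<phi>) = 0" by (rule vector_derivative_unique_at)
    hence "dL t0 (Dstar m \<alpha> (X t0) \<phi>) = L0 t0 D'" by (simp add: lt)
    also have "\<dots> = ?R" unfolding D'_def by (simp only: lt)
    finally show ?thesis .
  qed
  show thesis
  proof (rule that[OF dL(1)[of t0]]; rule allI)
    fix j show "((\<lambda>s. normL (L s) (monom 1 j)) has_vector_derivative dL t0 (monom 1 j)) (at t0)"
      using mom[OF I(2)] unfolding L0_def .
  next
    fix \<phi> show "dL t0 \<phi> = lam * normL (L t0) \<phi> - (\<Sum>k<m. \<alpha> k * v k t0 * normL (L t0) (synthetic_div \<phi> (X t0 k)))
       + (\<Sum>k<m. poly \<phi> (X t0 k) * (v k t0 * ucoef m \<alpha> (X t0) (normL (L t0)) k / poly (Wdel m (X t0) k) (X t0 k)))"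
      unfolding L0_def[symmetric]
      by (rule deformation_functional[OF lin0[OF I(2)] dL(1) inj[OF I(2)] \<alpha> pearson0[OF I(2)] Dd key])
  qed
qed

subsection \<open>Finite unions of arcs\<close>

text \<open>Composing the logarithms of the branch with the arc gives the lifts, and the exceptional
  set of the piecewise C1 path becomes \<open>brk\<close>.\<close>

lemma weighted_arc_of_branch:
  assumes x: "inj_on x {..<m}" and \<alpha>: "\<And>k. k < m \<Longrightarrow> \<alpha> k \<notin> \<int>"
    and \<gamma>: "arc \<gamma> \<and> valid_path \<gamma> \<and> pathstart \<gamma> \<in> x ` {..<m} \<and> pathfinish \<gamma> \<in> x ` {..<m}"
    and br: "is_branch m \<alpha> x (\<gamma> ` {0<..<1}) w"
    and mom: "\<And>j. (\<lambda>z. z ^ j * w z) contour_integrable_on \<gamma>"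
  obtains brk ell where "weighted_arc m x \<alpha> \<gamma> w brk ell"
proof -
  obtain l where l: "\<And>k. k < m \<Longrightarrow> continuous_on (\<gamma> ` {0<..<1}) (l k)"
    "\<And>k z. k < m \<Longrightarrow> z \<in> \<gamma> ` {0<..<1} \<Longrightarrow> exp (l k z) = z - x k"
    "\<And>z. z \<in> \<gamma> ` {0<..<1} \<Longrightarrow> w z = (\<Prod>k<m. exp (\<alpha> k * l k z))"
    using br unfolding is_branch_def by blast
  have p: "path \<gamma>" using \<gamma> arc_imp_path by blast
  have c: "continuous_on {0<..<1} \<gamma>"
    by (rule continuous_on_subset[OF p[unfolded path_def]]) auto
  obtain S where S: "finite S" "\<gamma> C1_differentiable_on {0..1} - S"
    using \<gamma> unfolding valid_path_def piecewise_C1_differentiable_on_def by blast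
  have "weighted_arc m x \<alpha> \<gamma> w S (\<lambda>k s. l k (\<gamma> s))"
  proof
    show "(\<gamma> has_vector_derivative vector_derivative \<gamma> (at s)) (at s)" if "s \<in> {0<..<1} - S" for s
      using S(2) that unfolding C1_differentiable_on_eq by (auto simp: vector_derivative_works)
    show "\<gamma> a \<in> x ` {..<m}" if "a \<in> {0, 1}" for a using \<gamma> that by (auto simp: pathstart_def pathfinish_def)
    show "continuous_on {0<..<1} (\<lambda>s. l k (\<gamma> s))" if "k < m" for k
      by (rule continuous_on_compose2[OF l(1)[OF that] c]) auto
  qed (use x \<alpha> p S l mom in auto)
  thus thesis by (rule that)
qed

lemma phase_group_sum_list:
  "(\<And>y. y \<in> set ys \<Longrightarrow> f y \<in> phase_group m \<beta>) \<Longrightarrow> (\<Sum>y\<leftarrow>ys. f y) \<in> phase_group m \<beta>"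
  by (induction ys) (auto intro: phase_group_0 phase_group_add)

lemma sum_list_has_field_derivative:
  "(\<And>y. y \<in> set ys \<Longrightarrow> (f y has_field_derivative f' y) (at z)) \<Longrightarrow>
    ((\<lambda>z. \<Sum>y\<leftarrow>ys. f y z) has_field_derivative (\<Sum>y\<leftarrow>ys. f' y)) (at (z::complex))"
  by (induction ys) (auto intro!: DERIV_add)

section \<open>Sums over the arcs, and the values of Theta and Omega at the points\<close>

locale weighted_arcs =
  fixes m :: nat and x \<alpha> :: "nat \<Rightarrow> complex" and arcs :: "(real \<Rightarrow> complex) list" and w :: "complex \<Rightarrow> complex"
  assumes wa: "\<And>\<gamma>. \<gamma> \<in> set arcs \<Longrightarrow> \<exists>brk ell. weighted_arc m x \<alpha> \<gamma> w brk ell"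
begin

definition LS :: "complex poly \<Rightarrow> complex" where "LS p = Lfun arcs w (poly p)"
definition fS :: "complex \<Rightarrow> complex" where "fS z = (\<Sum>\<gamma>\<leftarrow>arcs. weighted_arc.ct1 \<gamma> w z)"
definition gS :: "complex \<Rightarrow> complex" where "gS z = (\<Sum>\<gamma>\<leftarrow>arcs. weighted_arc.ct2 \<gamma> w z)"

lemma LS_sum: "LS p = (\<Sum>\<gamma>\<leftarrow>arcs. weighted_arc.Lg \<gamma> w p)"
proof -
  have "contour_integral \<gamma> (\<lambda>x. poly p x * w x) = weighted_arc.Lg \<gamma> w p" if g: "\<gamma> \<in> set arcs" for \<gamma>
  proof -
    obtain brk ell where "weighted_arc m x \<alpha> \<gamma> w brk ell" using wa[OF g] by blast
    from weighted_arc.Lg_def[OF this] show ?thesis by simp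
  qed
  thus ?thesis unfolding LS_def Lfun_def by (intro arg_cong[of _ _ sum_list] map_cong) auto
qed

lemma plin_LS: "plin LS"
proof (rule plinI)
  have lin: "plin (weighted_arc.Lg \<gamma> w)" if g: "\<gamma> \<in> set arcs" for \<gamma>
  proof -
    obtain brk ell where "weighted_arc m x \<alpha> \<gamma> w brk ell" using wa[OF g] by blast
    thus ?thesis by (rule weighted_arc.plin_Lg)
  qed
  show "LS (p + q) = LS p + LS q" for p q
    unfolding LS_sum sum_list_addf[symmetric] using plin_add[OF lin]
    by (intro arg_cong[of _ _ sum_list] map_cong) auto
  show "LS (smult c p) = c * LS p" for c p
    unfolding LS_sum sum_list_const_mult[symmetric] using plin_smult[OF lin]
    by (intro arg_cong[of _ _ sum_list] map_cong) auto
qed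

lemma LS_Dstar: "LS (Dstar m \<alpha> x \<phi>) = 0"
proof -
  have "weighted_arc.Lg \<gamma> w (Dstar m \<alpha> x \<phi>) = 0" if g: "\<gamma> \<in> set arcs" for \<gamma>
  proof -
    obtain brk ell where "weighted_arc m x \<alpha> \<gamma> w brk ell" using wa[OF g] by blast
    thus ?thesis by (rule weighted_arc.Lg_Dstar)
  qed
  hence "(\<Sum>\<gamma>\<leftarrow>arcs. weighted_arc.Lg \<gamma> w (Dstar m \<alpha> x \<phi>)) = (\<Sum>\<gamma>\<leftarrow>arcs. 0)"
    by (intro arg_cong[of _ _ sum_list] map_cong) auto
  thus ?thesis unfolding LS_sum by simp
qed

lemma LS_decomposition:
  assumes gen: "generic_base m x b" and N: "N \<ge> 1" "\<forall>k<m. Re (\<alpha> k + of_nat N) > 0"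
  shows "\<exists>A. (\<forall>k. A k \<in> phase_group m (\<lambda>k. \<alpha> k + of_nat N)) \<and>
     (\<forall>p. LS (Wpoly m x ^ N * p) = omega m x b (\<lambda>k. \<alpha> k + of_nat N) *
        (\<Sum>k<m. A k * Ibase m x b (\<lambda>k. \<alpha> k + of_nat N) k p))"
proof -
  let ?\<beta> = "\<lambda>k. \<alpha> k + complex_of_nat N"
  have "\<exists>A. (\<forall>k. A k \<in> phase_group m ?\<beta>) \<and>
     (\<forall>p. weighted_arc.Lg \<gamma> w (Wpoly m x ^ N * p) = omega m x b ?\<beta> * (\<Sum>k<m. A k * Ibase m x b ?\<beta> k p))"
    if g: "\<gamma> \<in> set arcs" for \<gamma>
  proof -
    obtain brk ell where wg: "weighted_arc m x \<alpha> \<gamma> w brk ell" using wa[OF g] by blast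
    have NR: "Re (\<alpha> k + of_nat N) > 0" if "k < m" for k using N(2) that by blast
    show ?thesis
    proof (rule weighted_arc.arc_decomposition[OF wg gen N(1) NR])
      fix A
      assume A: "\<And>k. A k \<in> phase_group m ?\<beta>"
        "\<And>p. weighted_arc.Lg \<gamma> w (Wpoly m x ^ N * p) = omega m x b ?\<beta> * (\<Sum>k<m. A k * Ibase m x b ?\<beta> k p)"
      show ?thesis by (rule exI[of _ A], intro conjI allI, rule A(1), rule A(2))
    qed
  qed
  hence "\<forall>\<gamma>\<in>set arcs. \<exists>A. (\<forall>k. A k \<in> phase_group m ?\<beta>) \<and>
     (\<forall>p. weighted_arc.Lg \<gamma> w (Wpoly m x ^ N * p) = omega m x b ?\<beta> * (\<Sum>k<m. A k * Ibase m x b ?\<beta> k p))" by (rule ballI)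
  from bchoice[OF this] obtain A where A: "\<forall>\<gamma>\<in>set arcs. (\<forall>k. A \<gamma> k \<in> phase_group m ?\<beta>) \<and>
     (\<forall>p. weighted_arc.Lg \<gamma> w (Wpoly m x ^ N * p) = omega m x b ?\<beta> * (\<Sum>k<m. A \<gamma> k * Ibase m x b ?\<beta> k p))" by (rule exE)
  note A1 = conjunct1[OF bspec[OF A], rule_format] and A2 = conjunct2[OF bspec[OF A], rule_format]
  have "LS (Wpoly m x ^ N * p) = omega m x b ?\<beta> * (\<Sum>k<m. (\<Sum>\<gamma>\<leftarrow>arcs. A \<gamma> k) * Ibase m x b ?\<beta> k p)" for p
  proof -
    have "LS (Wpoly m x ^ N * p) = (\<Sum>\<gamma>\<leftarrow>arcs. omega m x b ?\<beta> * (\<Sum>k<m. A \<gamma> k * Ibase m x b ?\<beta> k p))"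
      unfolding LS_sum using A2 by (intro arg_cong[of _ _ sum_list] map_cong) auto
    also have "\<dots> = omega m x b ?\<beta> * (\<Sum>k<m. (\<Sum>\<gamma>\<leftarrow>arcs. A \<gamma> k) * Ibase m x b ?\<beta> k p)"
      by (induction arcs) (simp_all add: distrib_left distrib_right sum.distrib)
    finally show ?thesis .
  qed
  moreover have "(\<Sum>\<gamma>\<leftarrow>arcs. A \<gamma> k) \<in> phase_group m ?\<beta>" for k by (rule phase_group_sum_list, rule A1)
  ultimately show ?thesis by (intro exI[of _ "\<lambda>k. \<Sum>\<gamma>\<leftarrow>arcs. A \<gamma> k"]) blast
qed

lemma compact_Sset: "compact (Sset arcs)"
  unfolding Sset_def
proof (intro compact_UN finite_set)
  fix \<gamma> assume "\<gamma> \<in> set arcs"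
  then obtain brk ell where "weighted_arc m x \<alpha> \<gamma> w brk ell" using wa by blast
  thus "compact (path_image \<gamma>)" by (intro compact_path_image weighted_arc.path)
qed

text \<open>The familiar eps = p f - q: the difference quotient of p is a polynomial in the
  integration variable and contributes the numerator polynomial q.\<close>

lemma cauchy_tr_poly:
  assumes z: "z \<notin> Sset arcs"
  shows "cauchy_tr arcs w (poly p) z = poly p z * fS z - LS (synthetic_div p z)"
proof -
  have "contour_integral \<gamma> (\<lambda>u. poly p u * w u / (z - u)) = poly p z * weighted_arc.ct1 \<gamma> w z - weighted_arc.Lg \<gamma> w (synthetic_div p z)"
    if g: "\<gamma> \<in> set arcs" for \<gamma>
  proof -
    obtain brk ell where wg: "weighted_arc m x \<alpha> \<gamma> w brk ell" using wa[OF g] by blast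
    have "z \<notin> path_image \<gamma>" using z g by (auto simp: Sset_def)
    from weighted_arc.ct_poly_integral[OF wg this] show ?thesis by (rule contour_integral_unique)
  qed
  hence "cauchy_tr arcs w (poly p) z = (\<Sum>\<gamma>\<leftarrow>arcs. poly p z * weighted_arc.ct1 \<gamma> w z - weighted_arc.Lg \<gamma> w (synthetic_div p z))"
    unfolding cauchy_tr_def by (intro arg_cong[of _ _ sum_list] map_cong) auto
  thus ?thesis by (simp add: fS_def LS_sum sum_list_subtractf sum_list_const_mult)
qed

lemma fS_has_derivative:
  assumes z: "z \<notin> Sset arcs" shows "(fS has_field_derivative - gS z) (at z)"
proof -
  have "((\<lambda>z. \<Sum>\<gamma>\<leftarrow>arcs. weighted_arc.ct1 \<gamma> w z) has_field_derivative (\<Sum>\<gamma>\<leftarrow>arcs. - weighted_arc.ct2 \<gamma> w z)) (at z)"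
  proof (rule sum_list_has_field_derivative)
    fix \<gamma> assume g: "\<gamma> \<in> set arcs"
    obtain brk ell where wg: "weighted_arc m x \<alpha> \<gamma> w brk ell" using wa[OF g] by blast
    have "z \<notin> path_image \<gamma>" using z g by (auto simp: Sset_def)
    thus "(weighted_arc.ct1 \<gamma> w has_field_derivative - weighted_arc.ct2 \<gamma> w z) (at z)" by (rule weighted_arc.ct1_has_derivative[OF wg])
  qed
  thus ?thesis unfolding fS_def[abs_def] gS_def by (simp add: uminus_sum_list_map o_def)
qed

lemma fS_ode:
  assumes z: "z \<notin> Sset arcs"
  shows "poly (V2poly m \<alpha> x) z * fS z + poly (Wpoly m x) z * gS z =
     LS (synthetic_div (V2poly m \<alpha> x) z + pderiv (synthetic_div (Wpoly m x) z))"
proof -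
  have "poly (V2poly m \<alpha> x) z * weighted_arc.ct1 \<gamma> w z + poly (Wpoly m x) z * weighted_arc.ct2 \<gamma> w z =
     weighted_arc.Lg \<gamma> w (synthetic_div (V2poly m \<alpha> x) z + pderiv (synthetic_div (Wpoly m x) z))" if g: "\<gamma> \<in> set arcs" for \<gamma>
  proof -
    obtain brk ell where wg: "weighted_arc m x \<alpha> \<gamma> w brk ell" using wa[OF g] by blast
    have "z \<notin> path_image \<gamma>" using z g by (auto simp: Sset_def)
    thus ?thesis by (rule weighted_arc.ct_ode[OF wg])
  qed
  hence "LS (synthetic_div (V2poly m \<alpha> x) z + pderiv (synthetic_div (Wpoly m x) z)) =
     (\<Sum>\<gamma>\<leftarrow>arcs. poly (V2poly m \<alpha> x) z * weighted_arc.ct1 \<gamma> w z + poly (Wpoly m x) z * weighted_arc.ct2 \<gamma> w z)"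
    unfolding LS_sum by (intro arg_cong[of _ _ sum_list] map_cong) auto
  thus ?thesis by (simp add: fS_def gS_def sum_list_addf sum_list_const_mult)
qed

text \<open>Covers Theta and Omega at once. After inserting eps = p f - q, the terms with f combine
  to p p1 (2V f - W f'), a polynomial by \<open>fS_ode\<close>; what remains involves only W, V and
  numerator polynomials. At x_k the terms with W drop out.\<close>

lemma bilinear_polynomial:
  obtains T where "\<forall>z. z \<notin> Sset arcs \<longrightarrow> poly T z =
       poly (Wpoly m x) z * (cauchy_tr arcs w (poly p1) z * poly (pderiv p) z - deriv (cauchy_tr arcs w (poly p)) z * poly p1 z)
       + poly (Vpoly m \<alpha> x) z * (cauchy_tr arcs w (poly p1) z * poly p z + cauchy_tr arcs w (poly p) z * poly p1 z)"
    "\<forall>k<m. poly T (x k) = poly p (x k) * poly p1 (x k) * ucoef m \<alpha> x LS k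
     - \<alpha> k * poly (Wdel m x k) (x k) / 2 *
        (LS (synthetic_div p1 (x k)) * poly p (x k) + LS (synthetic_div p (x k)) * poly p1 (x k))"
proof -
  obtain Q where Q: "\<And>z. poly Q z = LS (synthetic_div p z)" by (rule synthetic_functional_poly[OF plin_LS, of p]) blast
  obtain Q1 where Q1: "\<And>z. poly Q1 z = LS (synthetic_div p1 z)" by (rule synthetic_functional_poly[OF plin_LS, of p1]) blast
  obtain UV where UV: "\<And>z. poly UV z = LS (synthetic_div (V2poly m \<alpha> x) z)"
    by (rule synthetic_functional_poly[OF plin_LS, of "V2poly m \<alpha> x"]) blast
  have "plin (\<lambda>p. LS (pderiv p))" by (rule plinI) (simp_all add: pderiv_add pderiv_smult plin_simps[OF plin_LS])
  then obtain UW where UW: "\<And>z. poly UW z = LS (pderiv (synthetic_div (Wpoly m x) z))"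
    by (rule synthetic_functional_poly[where p = "Wpoly m x"]) blast
  define U where "U = UV + UW"
  have U: "poly U z = LS (synthetic_div (V2poly m \<alpha> x) z + pderiv (synthetic_div (Wpoly m x) z))" for z
    by (simp add: U_def UV UW plin_add[OF plin_LS])
  define T where "T = p * p1 * U + Wpoly m x * (pderiv Q * p1 - Q1 * pderiv p) - smult (1/2) (V2poly m \<alpha> x * (Q1 * p + Q * p1))"
  show thesis
  proof (rule that[of T]; intro allI impI)
    fix z assume z: "z \<notin> Sset arcs"
    have op: "open (- Sset arcs)" using compact_imp_closed[OF compact_Sset] by blast
    have tr: "cauchy_tr arcs w (poly q) z' = poly q z' * fS z' - LS (synthetic_div q z')" if "z' \<in> - Sset arcs" for q z'
      using cauchy_tr_poly that by simp
    have "((\<lambda>z. poly p z * fS z - poly Q z) has_field_derivative (poly (pderiv p) z * fS z + - gS z * poly p z - poly (pderiv Q) z)) (at z)"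
      by (intro DERIV_diff DERIV_mult poly_DERIV fS_has_derivative z)
    hence "(cauchy_tr arcs w (poly p) has_field_derivative (poly (pderiv p) z * fS z + - gS z * poly p z - poly (pderiv Q) z)) (at z)"
      by (rule has_field_derivative_transform_within_open[OF _ op]) (use z tr Q in auto)
    hence d: "deriv (cauchy_tr arcs w (poly p)) z = poly (pderiv p) z * fS z - gS z * poly p z - poly (pderiv Q) z"
      by (simp add: DERIV_imp_deriv)
    have e: "cauchy_tr arcs w (poly p) z = poly p z * fS z - poly Q z" "cauchy_tr arcs w (poly p1) z = poly p1 z * fS z - poly Q1 z"
      using tr[of z] z Q Q1 by auto
    have V: "poly (Vpoly m \<alpha> x) z = poly (V2poly m \<alpha> x) z / 2" using Vpoly_V2poly[of m \<alpha> x z] by (simp add: mult.commute)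
    have u: "poly U z = poly (V2poly m \<alpha> x) z * fS z + poly (Wpoly m x) z * gS z" unfolding U fS_ode[OF z] ..
    show "poly T z =
       poly (Wpoly m x) z * (cauchy_tr arcs w (poly p1) z * poly (pderiv p) z - deriv (cauchy_tr arcs w (poly p)) z * poly p1 z)
       + poly (Vpoly m \<alpha> x) z * (cauchy_tr arcs w (poly p1) z * poly p z + cauchy_tr arcs w (poly p) z * poly p1 z)"
      unfolding d e V T_def poly_add poly_diff poly_mult poly_smult u by (simp add: field_simps)
  next
    fix k assume k: "k < m"
    have "poly U (x k) = ucoef m \<alpha> x LS k"
      unfolding U ucoef_def by (simp only: Wpoly_Wdel[OF k] synthetic_div_linear_mult)
    thus "poly T (x k) = poly p (x k) * poly p1 (x k) * ucoef m \<alpha> x LS k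
     - \<alpha> k * poly (Wdel m x k) (x k) / 2 *
        (LS (synthetic_div p1 (x k)) * poly p (x k) + LS (synthetic_div p (x k)) * poly p1 (x k))"
      unfolding T_def poly_add poly_diff poly_mult poly_smult poly_Wpoly_root[OF k] poly_V2poly_at[OF k] Q Q1 by simp
  qed
qed

lemma Theta_at_point:
  assumes k: "k < m" shows "poly (Theta m \<alpha> x arcs w P n) (x k) = Theta_at m \<alpha> x LS P n k"
proof -
  obtain T where T: "\<forall>z. z \<notin> Sset arcs \<longrightarrow> poly T z =
       poly (Wpoly m x) z * (cauchy_tr arcs w (poly (P n)) z * poly (pderiv (P n)) z - deriv (cauchy_tr arcs w (poly (P n))) z * poly (P n) z)
       + poly (Vpoly m \<alpha> x) z * (cauchy_tr arcs w (poly (P n)) z * poly (P n) z + cauchy_tr arcs w (poly (P n)) z * poly (P n) z)"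
    and Tk: "\<forall>k<m. poly T (x k) = poly (P n) (x k) * poly (P n) (x k) * ucoef m \<alpha> x LS k
     - \<alpha> k * poly (Wdel m x k) (x k) / 2 *
        (LS (synthetic_div (P n) (x k)) * poly (P n) (x k) + LS (synthetic_div (P n) (x k)) * poly (P n) (x k))"
    by (rule bilinear_polynomial[of "P n" "P n"])
  have "Theta m \<alpha> x arcs w P n = T" unfolding Theta_def
    by (rule the_poly_off_compact[OF compact_Sset]) (simp add: T[rule_format] algebra_simps)
  thus ?thesis using Tk[rule_format, OF k] by (simp add: Theta_at_def qval_def power2_eq_square algebra_simps)
qed

lemma Omega_at_point:
  assumes k: "k < m" shows "poly (Omega m \<alpha> x arcs w P n) (x k) = Omega_at m \<alpha> x LS P n k"
proof -
  obtain T where T: "\<forall>z. z \<notin> Sset arcs \<longrightarrow> poly T z =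
       poly (Wpoly m x) z * (cauchy_tr arcs w (poly (P (n - 1))) z * poly (pderiv (P n)) z - deriv (cauchy_tr arcs w (poly (P n))) z * poly (P (n - 1)) z)
       + poly (Vpoly m \<alpha> x) z * (cauchy_tr arcs w (poly (P (n - 1))) z * poly (P n) z + cauchy_tr arcs w (poly (P n)) z * poly (P (n - 1)) z)"
    and Tk: "\<forall>k<m. poly T (x k) = poly (P n) (x k) * poly (P (n - 1)) (x k) * ucoef m \<alpha> x LS k
     - \<alpha> k * poly (Wdel m x k) (x k) / 2 *
        (LS (synthetic_div (P (n - 1)) (x k)) * poly (P n) (x k) + LS (synthetic_div (P n) (x k)) * poly (P (n - 1)) (x k))"
    by (rule bilinear_polynomial[of "P (n - 1)" "P n"])
  have "Omega m \<alpha> x arcs w P n = smult (acoef P n) T" unfolding Omega_def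
    by (rule the_poly_off_compact[OF compact_Sset]) (simp add: T[rule_format] distrib_left mult.assoc)
  thus ?thesis using Tk[rule_format, OF k] by (simp add: Omega_at_def qval_def)
qed

lemma ofam_LS: "orthonormal_family arcs w P \<Longrightarrow> ofam LS P"
  unfolding ofam_def orthonormal_family_def using plin_LS by (simp add: LS_def poly_mult[abs_def])

end

theorem theorem2:
  fixes m :: nat and I :: "real set"
    and x :: "nat \<Rightarrow> real \<Rightarrow> complex" and \<alpha> :: "nat \<Rightarrow> complex"
    and arcs :: "real \<Rightarrow> (real \<Rightarrow> complex) list"
    and w :: "real \<Rightarrow> complex \<Rightarrow> complex"
    and p :: "real \<Rightarrow> nat \<Rightarrow> complex poly"
  assumes m2: "m \<ge> 2"
    and I_open: "open I" and I_interval: "is_interval I" and I_ne: "I \<noteq> {}"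
    and x_diff: "\<And>k t. k < m \<Longrightarrow> t \<in> I \<Longrightarrow> (x k) differentiable (at t)"
    and x_distinct: "\<And>i j t. i < m \<Longrightarrow> j < m \<Longrightarrow> i \<noteq> j \<Longrightarrow> t \<in> I \<Longrightarrow> x i t \<noteq> x j t"
    and \<alpha>_nonint: "\<And>k. k < m \<Longrightarrow> \<alpha> k \<notin> \<int>"
    and arcs_ok: "\<And>t \<gamma>. t \<in> I \<Longrightarrow> \<gamma> \<in> set (arcs t) \<Longrightarrow>
        arc \<gamma> \<and> valid_path \<gamma> \<and> pathstart \<gamma> \<in> (\<lambda>k. x k t) ` {..<m}
        \<and> pathfinish \<gamma> \<in> (\<lambda>k. x k t) ` {..<m}"
    and weight_branch: "\<And>t \<gamma>. t \<in> I \<Longrightarrow> \<gamma> \<in> set (arcs t) \<Longrightarrow>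
        is_branch m \<alpha> (\<lambda>k. x k t) (\<gamma> ` {0<..<1}) (w t)"
    and moments_exist: "\<And>t \<gamma> j. t \<in> I \<Longrightarrow> \<gamma> \<in> set (arcs t) \<Longrightarrow>
        (\<lambda>z. z ^ j * w t z) contour_integrable_on \<gamma>"
    and hankel: "\<And>t n. t \<in> I \<Longrightarrow> n \<ge> 1 \<Longrightarrow> hankel_det (moment (arcs t) (w t)) n \<noteq> 0"
    and orth: "\<And>t. t \<in> I \<Longrightarrow> orthonormal_family (arcs t) (w t) (p t)"
    and a_diff: "\<And>n t. n \<ge> 1 \<Longrightarrow> t \<in> I \<Longrightarrow> (\<lambda>s. acoef (p s) n) differentiable (at t)"
    and b_diff: "\<And>n t. t \<in> I \<Longrightarrow> (\<lambda>s. bcoef (p s) n) differentiable (at t)"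
    and isomonodromic: "\<exists>C :: nat \<Rightarrow> complex. \<forall>t\<in>I. \<forall>j<m.
        \<exists>r>0. \<exists>\<theta> g h. g holomorphic_on ball (x j t) r
          \<and> is_branch m \<alpha> (\<lambda>k. x k t) (slit_nbhd (x j t) r \<theta> (Sset (arcs t))) h
          \<and> (\<forall>z\<in>slit_nbhd (x j t) r \<theta> (Sset (arcs t)).
                cauchy_tr (arcs t) (w t) (\<lambda>_. 1) z = g z + C j * h z)"
  shows "\<forall>t\<in>I. \<forall>n\<ge>1.
      vector_derivative (\<lambda>s. acoef (p s) n) (at t) / acoef (p t) n
        = 1/2 * (\<Sum>k<m. (poly (Theta m \<alpha> (\<lambda>i. x i t) (arcs t) (w t) (p t) n) (x k t)
                         - poly (Theta m \<alpha> (\<lambda>i. x i t) (arcs t) (w t) (p t) (n - 1)) (x k t))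
                        * vector_derivative (x k) (at t)
                        / poly (pderiv (Wpoly m (\<lambda>i. x i t))) (x k t))
    \<and> vector_derivative (\<lambda>s. bcoef (p s) n) (at t)
        = (\<Sum>k<m. (poly (Omega m \<alpha> (\<lambda>i. x i t) (arcs t) (w t) (p t) (Suc n)) (x k t)
                   - poly (Omega m \<alpha> (\<lambda>i. x i t) (arcs t) (w t) (p t) n) (x k t))
                  * vector_derivative (x k) (at t)
                  / poly (pderiv (Wpoly m (\<lambda>i. x i t))) (x k t))"
proof (intro ballI allI impI)
  fix t n assume t: "t \<in> I" and n: "(1::nat) \<le> n"
  define v where "v k s = vector_derivative (x k) (at s)" for k s
  have inj: "inj_on (\<lambda>k. x k s) {..<m}" if "s \<in> I" for s using x_distinct[OF _ _ _ that] by (auto simp: inj_on_def)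
  have wa: "weighted_arcs m (\<lambda>k. x k s) \<alpha> (arcs s) (w s)" if s: "s \<in> I" for s
  proof
    fix \<gamma> assume g: "\<gamma> \<in> set (arcs s)"
    show "\<exists>brk ell. weighted_arc m (\<lambda>k. x k s) \<alpha> \<gamma> (w s) brk ell"
      by (rule weighted_arc_of_branch[OF inj[OF s] \<alpha>_nonint arcs_ok[OF s g] weight_branch[OF s g] moments_exist[OF s g]]) blast+
  qed
  define L where "L s = weighted_arcs.LS (arcs s) (w s)" for s
  have P: "ofam (L s) (p s)" if "s \<in> I" for s
    unfolding L_def by (rule weighted_arcs.ofam_LS[OF wa[OF that] orth[OF that]])
  have pearson: "L s (Dstar m \<alpha> (\<lambda>k. x k s) \<phi>) = 0" if "s \<in> I" for s \<phi>
    unfolding L_def by (rule weighted_arcs.LS_Dstar[OF wa[OF that]])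
  have decomp: "\<exists>A. (\<forall>k. A k \<in> phase_group m (\<lambda>k. \<alpha> k + of_nat N)) \<and>
         (\<forall>q. L s (Wpoly m (\<lambda>k. x k s) ^ N * q) = omega m (\<lambda>k. x k s) b (\<lambda>k. \<alpha> k + of_nat N) *
            (\<Sum>k<m. A k * Ibase m (\<lambda>k. x k s) b (\<lambda>k. \<alpha> k + of_nat N) k q))"
    if "s \<in> I" "generic_base m (\<lambda>k. x k s) b" "N \<ge> 1" "\<forall>k<m. Re (\<alpha> k + of_nat N) > 0" for s b N
    unfolding L_def by (rule weighted_arcs.LS_decomposition[OF wa[OF that(1)] that(2-4)])
  have v: "(x k has_vector_derivative v k s) (at s)" if "k < m" "s \<in> I" for k s
    using x_diff[OF that] by (simp add: v_def vector_derivative_works)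
  obtain Ld lam where "plin Ld"
    and mom: "\<forall>j. ((\<lambda>s. normL (L s) (monom 1 j)) has_vector_derivative Ld (monom 1 j)) (at t)"
    and main: "\<forall>\<phi>. Ld \<phi> = lam * normL (L t) \<phi> - (\<Sum>k<m. \<alpha> k * v k t * normL (L t) (synthetic_div \<phi> (x k t)))
       + (\<Sum>k<m. poly \<phi> (x k t) * (v k t * ucoef m \<alpha> (\<lambda>k. x k t) (normL (L t)) k / poly (Wdel m (\<lambda>k. x k t) k) (x k t)))"
    by (rule deformation_formula[OF I_open t P a_diff b_diff inj v \<alpha>_nonint pearson decomp])
  \<comment> \<open>Neither \<open>Ld\<close> nor \<open>lam\<close> occurs in these equations any
    more; what is left is to identify the point values with those of Theta, Omega and W'.\<close>
  note toda = toda_equations[OF I_open t P a_diff[OF _ t] b_diff[OF t] inj[OF t] \<open>plin Ld\<close> mom[rule_format] main[rule_format] n]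
  have Th: "poly (Theta m \<alpha> (\<lambda>i. x i t) (arcs t) (w t) (p t) j) (x k t) = Theta_at m \<alpha> (\<lambda>k. x k t) (L t) (p t) j k" if "k < m" for j k
    unfolding L_def by (rule weighted_arcs.Theta_at_point[OF wa[OF t] that])
  have Om: "poly (Omega m \<alpha> (\<lambda>i. x i t) (arcs t) (w t) (p t) j) (x k t) = Omega_at m \<alpha> (\<lambda>k. x k t) (L t) (p t) j k" if "k < m" for j k
    unfolding L_def by (rule weighted_arcs.Omega_at_point[OF wa[OF t] that])
  have W: "poly (pderiv (Wpoly m (\<lambda>i. x i t))) (x k t) = poly (Wdel m (\<lambda>k. x k t) k) (x k t)" if "k < m" for k
    by (rule poly_pderiv_Wpoly_at[OF that])
  show "vector_derivative (\<lambda>s. acoef (p s) n) (at t) / acoef (p t) n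
        = 1/2 * (\<Sum>k<m. (poly (Theta m \<alpha> (\<lambda>i. x i t) (arcs t) (w t) (p t) n) (x k t)
                         - poly (Theta m \<alpha> (\<lambda>i. x i t) (arcs t) (w t) (p t) (n - 1)) (x k t))
                        * vector_derivative (x k) (at t)
                        / poly (pderiv (Wpoly m (\<lambda>i. x i t))) (x k t))
    \<and> vector_derivative (\<lambda>s. bcoef (p s) n) (at t)
        = (\<Sum>k<m. (poly (Omega m \<alpha> (\<lambda>i. x i t) (arcs t) (w t) (p t) (Suc n)) (x k t)
                   - poly (Omega m \<alpha> (\<lambda>i. x i t) (arcs t) (w t) (p t) n) (x k t))
                  * vector_derivative (x k) (at t)
                  / poly (pderiv (Wpoly m (\<lambda>i. x i t))) (x k t))"
  proof -
    have T: "(\<Sum>k<m. (poly (Theta m \<alpha> (\<lambda>i. x i t) (arcs t) (w t) (p t) n) (x k t)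
          - poly (Theta m \<alpha> (\<lambda>i. x i t) (arcs t) (w t) (p t) (n - 1)) (x k t))
          * vector_derivative (x k) (at t) / poly (pderiv (Wpoly m (\<lambda>i. x i t))) (x k t))
      = (\<Sum>k<m. (Theta_at m \<alpha> (\<lambda>k. x k t) (L t) (p t) n k - Theta_at m \<alpha> (\<lambda>k. x k t) (L t) (p t) (n - 1) k)
          * v k t / poly (Wdel m (\<lambda>k. x k t) k) (x k t))"
      by (intro sum.cong refl) (simp only: lessThan_iff Th W v_def)
    have O: "(\<Sum>k<m. (poly (Omega m \<alpha> (\<lambda>i. x i t) (arcs t) (w t) (p t) (Suc n)) (x k t)
          - poly (Omega m \<alpha> (\<lambda>i. x i t) (arcs t) (w t) (p t) n) (x k t))
          * vector_derivative (x k) (at t) / poly (pderiv (Wpoly m (\<lambda>i. x i t))) (x k t))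
      = (\<Sum>k<m. (Omega_at m \<alpha> (\<lambda>k. x k t) (L t) (p t) (Suc n) k - Omega_at m \<alpha> (\<lambda>k. x k t) (L t) (p t) n k)
          * v k t / poly (Wdel m (\<lambda>k. x k t) k) (x k t))"
      by (intro sum.cong refl) (simp only: lessThan_iff Om W v_def)
    show ?thesis unfolding T O by (intro conjI toda)
  qed
qed

end
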